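(* Assume $\gamma_0\neq\sqrt{\alpha/K}$ and $\gamma_k\neq\sqrt{\rho_k/E_k}$ for $k=1,3,\ldots,2m+1$. Then the semigroup $\{e^{\mathcal At}\}_{t\ge0}$ generated by $\mathcal A$ is strongly stable in $\mathcal H$, i.e. $\|e^{\mathcal At}Y_0\|_{\mathcal H}\to0$ as $t\to\infty$ for every $Y_0\in\mathcal H$.
   Context: Parameters: $m\ge1$ is an integer, $L>0$, $\Omega=(0,L)$; $\alpha,K>0$; $h_i>0$ ($1\le i\le 2m+1$), $\rho_i,E_i>0$ ($i$ odd), $G_i>0$ ($i$ even), and feedback gains $\gamma_0,\gamma_1,\gamma_3,\ldots,\gamma_{2m+1}>0$ are constants. Put $\mathbf h_{\mathcal O}=\mathrm{diag}(h_1,h_3,\ldots,h_{2m+1})$, $\mathbf p_{\mathcal O}=\mathrm{diag}(\rho_1,\rho_3,\ldots,\rho_{2m+1})$, $\mathbf E_{\mathcal O}=\mathrm{diag}(E_1,E_3,\ldots,E_{2m+1})$, $\mathbf h_E=\mathrm{diag}(h_2,\ldots,h_{2m})$, $\mathbf G_E=\mathrm{diag}(G_2,\ldots,G_{2m})$, $\Upsilon_{\mathcal O}=\mathrm{diag}(\gamma_1,\gamma_3,\ldots,\gamma_{2m+1})$. $\mathbf A=(a_{ij})$ and $\mathbf B=(b_{ij})$ are $m\times(m+1)$ matrices with $a_{ij}=1/2$, $b_{ij}=(-1)^{i+j+1}$ if $j\in\{i,i+1\}$ and $a_{ij}=b_{ij}=0$ otherwise; $N=\mathbf h_E^{-1}\mathbf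 A\mathbf h_{\mathcal O}\vec 1_{\mathcal O}+\vec 1_E\in\mathbb R^m$, where $\vec 1_{\mathcal O}\in\mathbb R^{m+1}$, $\vec 1_E\in\mathbb R^m$ are the all-ones vectors. Spaces (complex-valued): $H^2_\#(\Omega)=\{u\in H^2(\Omega)\cap H^1_0(\Omega):u'(0)=0\}$, $H^1_*(\Omega)=\{u\in H^1(\Omega):u(0)=0\}$, $X=H^2_\#(\Omega)\times(H^1_*(\Omega))^{m+1}$, $\mathcal Y=H^1_0(\Omega)\times(L^2(\Omega))^{m+1}$, $\mathcal H=X\times\mathcal Y$. With $\langle f,g\rangle_\Omega=\int_\Omega f\cdot\overline g\,dx$, define $c(z,v;\hat z,\hat v)=\langle z,\hat z\rangle_\Omega+\alpha\langle z',\hat z'\rangle_\Omega+\langle\mathbf h_{\mathcal O}\mathbf p_{\mathcal O}v,\hat v\rangle_\Omega$, $a(z,v;\hat z,\hat v)=K\langle z'',\hat z''\rangle_\Omega+\langle\mathbf h_{\mathcal O}\mathbf E_{\mathcal O}v',\hat v'\rangle_\Omega+\langle\mathbf G_E\mathbf h_E\phi,\hat\phi\rangle_\Omega$, where $\phi=\mathbf h_E^{-1}\mathbf Bv+Nz'$, $\hat\phi=\mathbf h_E^{-1}\mathbf B\hat v+N\hat z'$. The inner product on $\mathcal H$ is $\langle(U,V),(\hat U,\hat V)\rangle_{\mathcal H}=a(U;\hat U)+c(V;\hat V)$. Operator: $\mathcal L\varphi=\varphi-\alpha\varphi''$, an isomorphism $H^1_0(\Omega)\to H^{-1}(\Omega)$.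 For $U=(u,\mathbf u)$ put $A_1U=\big(\mathcal L^{-1}(-Ku''''+N^T\mathbf h_E\mathbf G_E(\mathbf h_E^{-1}\mathbf B\mathbf u'+Nu'')),\ \mathbf h_{\mathcal O}^{-1}\mathbf p_{\mathcal O}^{-1}(\mathbf h_{\mathcal O}\mathbf E_{\mathcal O}\mathbf u''-\mathbf B^T\mathbf G_E(\mathbf h_E^{-1}\mathbf B\mathbf u+Nu'))\big)$ (distributional derivatives). $\mathcal A(U,V)=(V,A_1U)$ with domain $\mathcal D(\mathcal A)$ the set of $(U,V)\in X\times X$, $V=(v,\mathbf v)$, such that $A_1U\in\mathcal Y$ and, for all $F=(f,\mathbf f)\in X$, $c(A_1U;F)+a(U;F)=-K\gamma_0v'(L)\overline{f'(L)}-\mathbf h_{\mathcal O}\mathbf E_{\mathcal O}\Upsilon_{\mathcal O}\mathbf v(L)\cdot\overline{\mathbf f(L)}$. $\mathcal A$ generates a $C_0$-semigroup of contractions on $\mathcal H$; it describes the multilayer Rao-Nakra beam $\ddot z-\alpha\ddot z''+Kz''''-N^T\mathbf h_E\mathbf G_E\phi_E'=0$, $\mathbf h_{\mathcal O}\mathbf p_{\mathcal O}\ddot v_{\mathcal O}-\mathbf h_{\mathcal O}\mathbf E_{\mathcal O}v_{\mathcal O}''+\mathbf B^T\mathbf G_E\phi_E=0$, $\phi_E=\mathbf h_E^{-1}\mathbf Bv_{\mathcal O}+Nz'$, with $z(0,t)=z'(0,t)=z(L,t)=0$, $z''(L,t)+\gamma_0\dot z'(L,t)=0$, $v_{\mathcal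 O}(0,t)=0$, $v_{\mathcal O}'(L,t)+\Upsilon_{\mathcal O}\dot v_{\mathcal O}(L,t)=0$. *)

theory Defs
  imports "HOL-Analysis.Analysis" "HOL-Library.Function_Algebras"
begin

section \<open>Function spaces on the interval (0,L)\<close>

text \<open>
  Elements of the Lebesgue and Sobolev spaces are represented by functions on the real line; no
  quotient is formed. All notions below depend only on the restriction to (0,L) up to null sets.
\<close>

definition l2 :: "real \<Rightarrow> (real \<Rightarrow> complex) set" where
  "l2 L = {f. f \<in> borel_measurable (lebesgue_on {0<..<L}) \<and>
              integrable (lebesgue_on {0<..<L}) (\<lambda>x. (cmod (f x))\<^sup>2)}"

definition l2_inner :: "real \<Rightarrow> (real \<Rightarrow> complex) \<Rightarrow> (real \<Rightarrow> complex) \<Rightarrow> complex" where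
  "l2_inner L f g = (LINT x|lebesgue_on {0<..<L}. f x * cnj (g x))"

definition vderiv :: "(real \<Rightarrow> complex) \<Rightarrow> real \<Rightarrow> complex" where
  "vderiv f = (\<lambda>x. vector_derivative f (at x))"

definition test_fun :: "real \<Rightarrow> (real \<Rightarrow> complex) set" where
  "test_fun L = {\<psi>. (\<forall>n x. (vderiv ^^ n) \<psi> differentiable at x) \<and>
                     (\<exists>C. compact C \<and> C \<subseteq> {0<..<L} \<and> (\<forall>x. x \<notin> C \<longrightarrow> \<psi> x = 0))}"

text \<open>
  Distributions on (0,L) are functionals of which only the values on test functions matter;
  hence they are compared by \<open>distr_eq\<close>. The pairing is bilinear (no conjugation).
\<close>

type_synonym distr = "(real \<Rightarrow> complex) \<Rightarrow> complex"

definition distr_of :: "real \<Rightarrow> (real \<Rightarrow> complex) \<Rightarrow> distr" where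
  "distr_of L f = (\<lambda>\<psi>. LINT x|lebesgue_on {0<..<L}. f x * \<psi> x)"

definition distr_deriv :: "distr \<Rightarrow> distr" where
  "distr_deriv S = (\<lambda>\<psi>. - S (vderiv \<psi>))"

definition distr_eq :: "real \<Rightarrow> distr \<Rightarrow> distr \<Rightarrow> bool" where
  "distr_eq L S R \<longleftrightarrow> (\<forall>\<psi>\<in>test_fun L. S \<psi> = R \<psi>)"

definition is_wderiv :: "real \<Rightarrow> (real \<Rightarrow> complex) \<Rightarrow> (real \<Rightarrow> complex) \<Rightarrow> bool" where
  "is_wderiv L u g \<longleftrightarrow> distr_eq L (distr_deriv (distr_of L u)) (distr_of L g)"

definition h1 :: "real \<Rightarrow> (real \<Rightarrow> complex) set" where
  "h1 L = {u \<in> l2 L. \<exists>g\<in>l2 L. is_wderiv L u g}"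

text \<open>The weak derivative of an element of \<open>h1 L\<close>, determined up to null sets.\<close>

definition wderiv :: "real \<Rightarrow> (real \<Rightarrow> complex) \<Rightarrow> real \<Rightarrow> complex" where
  "wderiv L u = (SOME g. g \<in> l2 L \<and> is_wderiv L u g)"

definition h2 :: "real \<Rightarrow> (real \<Rightarrow> complex) set" where
  "h2 L = {u \<in> h1 L. wderiv L u \<in> h1 L}"

definition h1_norm :: "real \<Rightarrow> (real \<Rightarrow> complex) \<Rightarrow> real" where
  "h1_norm L u = sqrt (Re (l2_inner L u u + l2_inner L (wderiv L u) (wderiv L u)))"

text \<open>The closure of the test functions in \<open>h1 L\<close>.\<close>

definition h1_0 :: "real \<Rightarrow> (real \<Rightarrow> complex) set" where
  "h1_0 L = {u \<in> h1 L. \<forall>\<epsilon>>0. \<exists>\<psi>\<in>test_fun L. h1_norm L (\<lambda>x. u x - \<psi> x) < \<epsilon>}"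

text \<open>
  Point values in [0,L] of an element of \<open>h1 L\<close> are those of its continuous representative,
  which is unique on [0,L].
\<close>

definition pt_val :: "real \<Rightarrow> (real \<Rightarrow> complex) \<Rightarrow> real \<Rightarrow> complex" where
  "pt_val L u = (SOME g. continuous_on {0..L} g \<and> (AE x in lebesgue_on {0<..<L}. u x = g x))"


section \<open>Strongly continuous semigroups\<close>

text \<open>
  A carrier \<open>S\<close> of representatives with a seminorm \<open>nrm\<close> stands for the normed space of classes
  modulo \<open>nrm (Y - Z) = 0\<close>; identities between operators are therefore required modulo \<open>nrm\<close>.
\<close>

definition C0_semigroup ::
  "'a::ab_group_add set \<Rightarrow> ('a \<Rightarrow> real) \<Rightarrow> (complex \<Rightarrow> 'a \<Rightarrow> 'a) \<Rightarrow> (real \<Rightarrow> 'a \<Rightarrow> 'a) \<Rightarrow> bool" where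
  "C0_semigroup S nrm scl T \<longleftrightarrow>
     (\<forall>t\<ge>0. \<forall>Y\<in>S. T t Y \<in> S) \<and>
     (\<forall>t\<ge>0. \<forall>Y\<in>S. \<forall>Z\<in>S. nrm (T t (Y + Z) - (T t Y + T t Z)) = 0) \<and>
     (\<forall>t\<ge>0. \<forall>Y\<in>S. \<forall>c. nrm (T t (scl c Y) - scl c (T t Y)) = 0) \<and>
     (\<forall>t\<ge>0. \<exists>M. \<forall>Y\<in>S. nrm (T t Y) \<le> M * nrm Y) \<and>
     (\<forall>Y\<in>S. nrm (T 0 Y - Y) = 0) \<and>
     (\<forall>s\<ge>0. \<forall>t\<ge>0. \<forall>Y\<in>S. nrm (T (s + t) Y - T s (T t Y)) = 0) \<and>
     (\<forall>Y\<in>S. ((\<lambda>t. nrm (T t Y - Y)) \<longlongrightarrow> 0) (at_right 0))"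

definition right_deriv_0 ::
  "('a::ab_group_add \<Rightarrow> real) \<Rightarrow> (complex \<Rightarrow> 'a \<Rightarrow> 'a) \<Rightarrow> (real \<Rightarrow> 'a \<Rightarrow> 'a) \<Rightarrow> 'a \<Rightarrow> 'a \<Rightarrow> bool" where
  "right_deriv_0 nrm scl T Y Z \<longleftrightarrow>
     ((\<lambda>t. nrm (scl (of_real (1 / t)) (T t Y - Y) - Z)) \<longlongrightarrow> 0) (at_right 0)"

text \<open>The operator \<open>A\<close> with domain \<open>D\<close> is the infinitesimal generator of the semigroup \<open>T\<close>.\<close>

definition is_generator ::
  "'a::ab_group_add set \<Rightarrow> ('a \<Rightarrow> real) \<Rightarrow> (complex \<Rightarrow> 'a \<Rightarrow> 'a) \<Rightarrow> (real \<Rightarrow> 'a \<Rightarrow> 'a)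
    \<Rightarrow> 'a set \<Rightarrow> ('a \<Rightarrow> 'a) \<Rightarrow> bool" where
  "is_generator S nrm scl T D A \<longleftrightarrow>
     D = {Y\<in>S. \<exists>Z\<in>S. right_deriv_0 nrm scl T Y Z} \<and>
     (\<forall>Y\<in>D. A Y \<in> S \<and> right_deriv_0 nrm scl T Y (A Y))"


section \<open>The multilayer Rao-Nakra beam\<close>

text \<open>
  The layers are numbered 1, ..., 2m+1. Thicknesses are used at all these indices, \<open>par_\<rho>\<close> and
  \<open>par_E\<close> at the odd ones, \<open>par_G\<close> at the even ones, and the gains \<open>par_\<gamma>\<close> at 0 and the odd ones.
\<close>

record beam =
  par_m :: nat
  par_L :: real
  par_\<alpha> :: real
  par_K :: real
  par_h :: "nat \<Rightarrow> real"
  par_\<rho> :: "nat \<Rightarrow> real"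
  par_E :: "nat \<Rightarrow> real"
  par_G :: "nat \<Rightarrow> real"
  par_\<gamma> :: "nat \<Rightarrow> real"

text \<open>
  Vectors indexed by stiff layers have components j = 1, ..., m+1 (layer 2j-1), vectors indexed by
  compliant layers have components i = 1, ..., m (layer 2i). Components outside these ranges are
  irrelevant. The following are the diagonal entries of the diagonal matrices.
\<close>

definition hO :: "beam \<Rightarrow> nat \<Rightarrow> real" where "hO P j = par_h P (2 * j - 1)"
definition pO :: "beam \<Rightarrow> nat \<Rightarrow> real" where "pO P j = par_\<rho> P (2 * j - 1)"
definition EO :: "beam \<Rightarrow> nat \<Rightarrow> real" where "EO P j = par_E P (2 * j - 1)"
definition gO :: "beam \<Rightarrow> nat \<Rightarrow> real" where "gO P j = par_\<gamma> P (2 * j - 1)"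
definition hE :: "beam \<Rightarrow> nat \<Rightarrow> real" where "hE P i = par_h P (2 * i)"
definition GE :: "beam \<Rightarrow> nat \<Rightarrow> real" where "GE P i = par_G P (2 * i)"

definition matA :: "nat \<Rightarrow> nat \<Rightarrow> real" where
  "matA i j = (if j = i \<or> j = i + 1 then 1 / 2 else 0)"

definition matB :: "nat \<Rightarrow> nat \<Rightarrow> real" where
  "matB i j = (if j = i \<or> j = i + 1 then (-1) ^ (i + j + 1) else 0)"

definition vecN :: "beam \<Rightarrow> nat \<Rightarrow> real" where
  "vecN P i = inverse (hE P i) * (\<Sum>j=1..par_m P + 1. matA i j * hO P j) + 1"

type_synonym disp = "(real \<Rightarrow> complex) \<times> (nat \<Rightarrow> real \<Rightarrow> complex)"
type_synonym state = "disp \<times> disp"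

definition spaceX :: "beam \<Rightarrow> disp set" where
  "spaceX P = {(u, v).
     u \<in> h2 (par_L P) \<inter> h1_0 (par_L P) \<and> pt_val (par_L P) (wderiv (par_L P) u) 0 = 0 \<and>
     (\<forall>j\<in>{1..par_m P + 1}. v j \<in> h1 (par_L P) \<and> pt_val (par_L P) (v j) 0 = 0)}"

definition spaceY :: "beam \<Rightarrow> disp set" where
  "spaceY P = {(u, v). u \<in> h1_0 (par_L P) \<and> (\<forall>j\<in>{1..par_m P + 1}. v j \<in> l2 (par_L P))}"

definition spaceH :: "beam \<Rightarrow> state set" where
  "spaceH P = spaceX P \<times> spaceY P"

fun phi :: "beam \<Rightarrow> disp \<Rightarrow> nat \<Rightarrow> real \<Rightarrow> complex" where
  "phi P (z, v) i = (\<lambda>x.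
     of_real (inverse (hE P i)) * (\<Sum>j=1..par_m P + 1. of_real (matB i j) * v j x)
     + of_real (vecN P i) * wderiv (par_L P) z x)"

fun c_form :: "beam \<Rightarrow> disp \<Rightarrow> disp \<Rightarrow> complex" where
  "c_form P (z, v) (z', v') =
     l2_inner (par_L P) z z'
     + of_real (par_\<alpha> P) * l2_inner (par_L P) (wderiv (par_L P) z) (wderiv (par_L P) z')
     + (\<Sum>j=1..par_m P + 1. of_real (hO P j * pO P j) * l2_inner (par_L P) (v j) (v' j))"

fun a_form :: "beam \<Rightarrow> disp \<Rightarrow> disp \<Rightarrow> complex" where
  "a_form P (z, v) (z', v') =
     of_real (par_K P) * l2_inner (par_L P) (wderiv (par_L P) (wderiv (par_L P) z))
                                            (wderiv (par_L P) (wderiv (par_L P) z'))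
     + (\<Sum>j=1..par_m P + 1. of_real (hO P j * EO P j) *
          l2_inner (par_L P) (wderiv (par_L P) (v j)) (wderiv (par_L P) (v' j)))
     + (\<Sum>i=1..par_m P. of_real (GE P i * hE P i) *
          l2_inner (par_L P) (phi P (z, v) i) (phi P (z', v') i))"

fun H_inner :: "beam \<Rightarrow> state \<Rightarrow> state \<Rightarrow> complex" where
  "H_inner P (U, V) (U', V') = a_form P U U' + c_form P V V'"

definition H_norm :: "beam \<Rightarrow> state \<Rightarrow> real" where
  "H_norm P Y = sqrt (Re (H_inner P Y Y))"

fun disp_scale :: "complex \<Rightarrow> disp \<Rightarrow> disp" where
  "disp_scale c (u, v) = ((\<lambda>x. c * u x), (\<lambda>j x. c * v j x))"

fun state_scale :: "complex \<Rightarrow> state \<Rightarrow> state" where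
  "state_scale c (U, V) = (disp_scale c U, disp_scale c V)"

definition distr_L :: "beam \<Rightarrow> distr \<Rightarrow> distr" where
  "distr_L P S = (\<lambda>\<psi>. S \<psi> - of_real (par_\<alpha> P) * distr_deriv (distr_deriv S) \<psi>)"

text \<open>
  \<open>is_A1 P (u, v) (w, y)\<close>: the equation \<open>A\<^sub>1 (u, v) = (w, y)\<close> in the sense of distributions.
  Since the operator \<open>distr_L P\<close> maps \<open>h1_0\<close> bijectively onto the dual of \<open>h1_0\<close>, the value of
  its inverse at a distribution is the element \<open>w\<close> of \<open>h1_0\<close> that it maps to that distribution.
\<close>

fun is_A1 :: "beam \<Rightarrow> disp \<Rightarrow> disp \<Rightarrow> bool" where
  "is_A1 P (u, v) (w, y) \<longleftrightarrow>
     (let L = par_L P; m = par_m P;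
          Du = distr_deriv (distr_of L u);
          D2u = distr_deriv Du;
          D4u = distr_deriv (distr_deriv D2u)
      in
      distr_eq L (distr_L P (distr_of L w))
        (\<lambda>\<psi>. - of_real (par_K P) * D4u \<psi>
             + (\<Sum>i=1..m. of_real (vecN P i * hE P i * GE P i) *
                  (of_real (inverse (hE P i)) *
                     (\<Sum>j=1..m + 1. of_real (matB i j) * distr_deriv (distr_of L (v j)) \<psi>)
                   + of_real (vecN P i) * D2u \<psi>))) \<and>
      (\<forall>j\<in>{1..m + 1}.
         distr_eq L (distr_of L (y j))
           (\<lambda>\<psi>. of_real (inverse (hO P j) * inverse (pO P j)) *
                 (of_real (hO P j * EO P j) * distr_deriv (distr_deriv (distr_of L (v j))) \<psi>
                  - (\<Sum>i=1..m. of_real (matB i j * GE P i) *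
                       (of_real (inverse (hE P i)) *
                          (\<Sum>k=1..m + 1. of_real (matB i k) * distr_of L (v k) \<psi>)
                        + of_real (vecN P i) * Du \<psi>))))))"

text \<open>
  \<open>A1_in_Y P U\<close> says that \<open>A\<^sub>1 U\<close> belongs to \<open>spaceY P\<close>; in that case \<open>A1 P U\<close> is (a
  representative of) its value.
\<close>

definition A1_in_Y :: "beam \<Rightarrow> disp \<Rightarrow> bool" where
  "A1_in_Y P U \<longleftrightarrow> (\<exists>W\<in>spaceY P. is_A1 P U W)"

definition A1 :: "beam \<Rightarrow> disp \<Rightarrow> disp" where
  "A1 P U = (SOME W. W \<in> spaceY P \<and> is_A1 P U W)"

fun bdry_form :: "beam \<Rightarrow> disp \<Rightarrow> disp \<Rightarrow> complex" where
  "bdry_form P (v, vv) (f, ff) =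
     - of_real (par_K P * par_\<gamma> P 0) * pt_val (par_L P) (wderiv (par_L P) v) (par_L P)
         * cnj (pt_val (par_L P) (wderiv (par_L P) f) (par_L P))
     - (\<Sum>j=1..par_m P + 1. of_real (hO P j * EO P j * gO P j) *
          pt_val (par_L P) (vv j) (par_L P) * cnj (pt_val (par_L P) (ff j) (par_L P)))"

definition dom_A :: "beam \<Rightarrow> state set" where
  "dom_A P = {(U, V). U \<in> spaceX P \<and> V \<in> spaceX P \<and> A1_in_Y P U \<and>
     (\<forall>F\<in>spaceX P. c_form P (A1 P U) F + a_form P U F = bdry_form P V F)}"

fun op_A :: "beam \<Rightarrow> state \<Rightarrow> state" where
  "op_A P (U, V) = (V, A1 P U)"

end

theory Submission
  imports Defs "HOL-Computational_Algebra.Polynomial"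
begin

text \<open>
  The beam is damped only at the end \<open>x = L\<close>: for a state \<open>Y\<close> in the domain, with time derivative
  \<open>\<A>Y\<close>, the energy changes at the rate \<open>Re \<langle>\<A>Y, Y\<rangle>\<close>, which is minus a positive definite quadratic form
  in the end velocities \<open>v'(L)\<close>, \<open>v\<^sub>j(L)\<close> (lemma \<open>dissipation\<close>). Stability follows because this loss
  controls the whole energy in the following sense. There is a bounded real bilinear form \<open>b\<close> on
  the energy space such that, for all \<open>Y\<close> in the domain,

  \<open>b(\<A>Y, Y) + b(Y, \<A>Y) \<le> - c \<parallel>Y\<parallel>\<^sup>2 - C Re \<langle>\<A>Y, Y\<rangle>\<close> with \<open>c > 0\<close>  (theorem \<open>Lyapunov_form\<close>).

  The left-hand side is the derivative of \<open>b(Y, Y)\<close> along orbits. Hence a sufficiently large multiple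
  of the energy plus \<open>b(Y, Y)\<close> is equivalent to the energy and decays exponentially along orbits
  that start in the domain; the domain is dense and the operators of the semigroup are bounded, so
  that all orbits tend to 0, in fact exponentially (theorem \<open>stable_of_Lyapunov_form\<close>).

  The form \<open>b\<close> has two parts. The first one is \<open>Re c(V; MU)\<close> for a state \<open>(U, V)\<close>, \<open>U = (u, v)\<close>, with the
  multiplier

  \<open>Mu = x u' - (1/2 + e) u - (x\<^sup>2/L) u'(L)\<close>,  \<open>Mv\<^sub>j = x v\<^sub>j' + (1/2 - e) v\<^sub>j\<close>.

  The term with \<open>u'(L)\<close> makes \<open>Mu\<close> vanish at both ends, so that \<open>MU\<close> is an admissible displacement
  and the variational identity that defines the domain can be tested with it. The zero order terms
  are chosen such that the shear \<open>\<phi>\<close> of \<open>MU\<close> is \<open>x \<phi>' + (1/2 - e) \<phi>\<close> up to a multiple of \<open>x u'(L)\<close>: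
  one multiplier fits all layers although \<open>\<phi>\<close> couples \<open>v\<^sub>j\<close> with the derivative of \<open>u\<close>. Rellich's
  identity \<open>2 Re \<langle>f, x f'\<rangle> = L |f(L)|\<^sup>2 - \<parallel>f\<parallel>\<^sup>2\<close> turns the real part of \<open>\<langle>f, x f' + k f\<rangle>\<close> into
  \<open>(k - 1/2) \<parallel>f\<parallel>\<^sup>2\<close> plus an end value. This gives a negative multiple of every part of the
  energy except the shear energy, which enters with the wrong sign and the small factor \<open>e\<close>; it is
  absorbed since Poincare's inequality bounds it by bending and stretching. The end values of
  \<open>u''\<close> and \<open>v\<^sub>j'\<close> come with the good sign and cancel those that the boundary form produces
  (lemmas \<open>kinetic_part\<close>, \<open>potential_part\<close>, \<open>boundary_part\<close>, together \<open>multiplier_form\<close>).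

  What remains is a multiple of \<open>|u'(L)| \<parallel>Y\<parallel>\<close> plus terms controlled by the damping. The end values
  of the displacement are not damped themselves, but they are continuous linear functionals of
  the state, and their Riesz representers are the solutions of static problems. The second part of
  \<open>b\<close>, built from these representers, has derivative minus the sum of the squares of the end
  values, up to damped terms (lemma \<open>trace_form\<close>). The inequality
  \<open>ab \<le> d a\<^sup>2 + b\<^sup>2/(4d)\<close> combines the two parts.

  Two analytic foundations are needed. First, the energy space is complete, so that Riesz'
  theorem and the uniform boundedness principle apply; completeness comes from that of the space
  of square integrable functions. Secondly, the functions defined by weak derivatives have
  representatives \<open>f(x) = f(0) + \<integral>\<^sub>0\<^sup>x g\<close>, for which integration by parts, point values and Rellich's
  identity are available (theorems \<open>h1_representative\<close> and \<open>h1_0_iff\<close>); elements of the domain have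
  one more derivative than the energy space requires because of the variational identity
  (lemmas \<open>dom_A_bending_regularity\<close>, \<open>dom_A_longitudinal_regularity\<close>).
\<close>

section \<open>Real Hilbert spaces of representatives\<close>

lemma nonneg_quadratic_discriminant:
  fixes a b c :: real
  assumes "\<And>r. 0 \<le> a - 2 * r * b + r\<^sup>2 * c"
  shows "b\<^sup>2 \<le> a * c"
proof (cases "c = 0")
  case True
  have "b = 0"
  proof (rule ccontr)
    assume "b \<noteq> 0"
    then show False using assms[of "(a + 1) / (2 * b)"] True by simp
  qed
  then show ?thesis using True by simp
next
  case False
  have "c > 0"
  proof (rule ccontr)
    assume "\<not> c > 0"
    with False have c: "c < 0" by simp
    define r where "r = (\<bar>a\<bar> + 2 * \<bar>b\<bar> + 1) / (-c) + 1"
    have "0 \<le> (\<bar>a\<bar> + 2 * \<bar>b\<bar> + 1) / (-c)" by (rule divide_nonneg_pos) (use c in auto)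
    then have r1: "r \<ge> 1" unfolding r_def by linarith
    have rc: "r * (-c) = \<bar>a\<bar> + 2 * \<bar>b\<bar> + 1 - c" using c by (simp add: r_def field_simps)
    have "a - 2 * r * b + r\<^sup>2 * c = a - 2 * r * b - r * (r * (-c))" by (simp add: power2_eq_square)
    also have "\<dots> = a - r * (2 * b + \<bar>a\<bar> + 2 * \<bar>b\<bar> + 1 - c)" unfolding rc by (simp add: algebra_simps)
    also have "\<dots> \<le> a - 1 * (\<bar>a\<bar> + 1)"
    proof -
      have "1 * (\<bar>a\<bar> + 1) \<le> r * (2 * b + \<bar>a\<bar> + 2 * \<bar>b\<bar> + 1 - c)"
        by (rule mult_mono) (use r1 c in auto)
      then show ?thesis by simp
    qed
    also have "\<dots> < 0" by simp
    finally show False using assms[of r] by simp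
  qed
  then show ?thesis using assms[of "b / c"] by (simp add: field_simps power2_eq_square)
qed

text \<open>
  Elements of \<open>S\<close> represent vectors, and \<open>ip\<close> is only semidefinite. The inner product is real and
  linear over real scalars only: it will be the real part of a complex inner product, and the
  quadratic forms of the stability argument are not sesquilinear. Completeness is required for
  sequences with \<open>\<parallel>x\<^sub>n\<^sub>+\<^sub>1 - x\<^sub>n\<parallel> \<le> 2\<^sup>-\<^sup>n\<close>, to which every Cauchy sequence can be reduced and
  which suffice for the constructions below.
\<close>

locale semi_hilbert =
  fixes S :: "'a::ab_group_add set" and scl :: "complex \<Rightarrow> 'a \<Rightarrow> 'a" and ip :: "'a \<Rightarrow> 'a \<Rightarrow> real"
  assumes zero_in: "0 \<in> S"
    and add_in: "x \<in> S \<Longrightarrow> y \<in> S \<Longrightarrow> x + y \<in> S"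
    and diff_in: "x \<in> S \<Longrightarrow> y \<in> S \<Longrightarrow> x - y \<in> S"
    and scl_in: "x \<in> S \<Longrightarrow> scl c x \<in> S"
    and ip_add: "x \<in> S \<Longrightarrow> y \<in> S \<Longrightarrow> z \<in> S \<Longrightarrow> ip (x + y) z = ip x z + ip y z"
    and ip_scl: "x \<in> S \<Longrightarrow> y \<in> S \<Longrightarrow> ip (scl (complex_of_real r) x) y = r * ip x y"
    and ip_sym: "x \<in> S \<Longrightarrow> y \<in> S \<Longrightarrow> ip x y = ip y x"
    and ip_nonneg: "x \<in> S \<Longrightarrow> 0 \<le> ip x x"
    and fast_Cauchy_convergent:
      "(\<And>n. X n \<in> S) \<Longrightarrow> (\<And>n. sqrt (ip (X (Suc n) - X n) (X (Suc n) - X n)) \<le> (1/2) ^ n) \<Longrightarrow>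
        \<exists>x\<in>S. (\<lambda>n. sqrt (ip (X n - x) (X n - x))) \<longlonglongrightarrow> 0"
begin

definition nrm :: "'a \<Rightarrow> real" where "nrm x = sqrt (ip x x)"

lemma nrm_nonneg: "x \<in> S \<Longrightarrow> 0 \<le> nrm x"
  by (simp add: nrm_def ip_nonneg)

lemma nrm_sq: "x \<in> S \<Longrightarrow> (nrm x)\<^sup>2 = ip x x"
  by (simp add: nrm_def ip_nonneg)

lemma ip_diff:
  assumes "x \<in> S" "y \<in> S" "z \<in> S"
  shows "ip (x - y) z = ip x z - ip y z"
  using ip_add[of "x - y" y z] assms diff_in by simp

lemma ip_add_right: "x \<in> S \<Longrightarrow> y \<in> S \<Longrightarrow> z \<in> S \<Longrightarrow> ip z (x + y) = ip z x + ip z y"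
  by (metis ip_add ip_sym add_in)

lemma ip_diff_right: "x \<in> S \<Longrightarrow> y \<in> S \<Longrightarrow> z \<in> S \<Longrightarrow> ip z (x - y) = ip z x - ip z y"
  by (metis ip_diff ip_sym diff_in)

lemma ip_scl_right: "x \<in> S \<Longrightarrow> y \<in> S \<Longrightarrow> ip y (scl (complex_of_real r) x) = r * ip y x"
  by (metis ip_scl ip_sym scl_in)

lemmas ip_simps = ip_add ip_diff ip_add_right ip_diff_right ip_scl ip_scl_right
lemmas closed = zero_in add_in diff_in scl_in

lemma Cauchy_Schwarz:
  assumes "x \<in> S" "y \<in> S"
  shows "\<bar>ip x y\<bar> \<le> nrm x * nrm y"
proof -
  have "0 \<le> ip x x - 2 * r * ip x y + r\<^sup>2 * ip y y" for r
  proof -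
    have "0 \<le> ip (x - scl (of_real r) y) (x - scl (of_real r) y)"
      by (intro ip_nonneg closed assms)
    then show ?thesis using assms ip_sym[of y x]
      by (simp add: ip_simps closed power2_eq_square algebra_simps)
  qed
  from nonneg_quadratic_discriminant[OF this]
  have "(ip x y)\<^sup>2 \<le> (nrm x * nrm y)\<^sup>2" using assms by (simp add: power_mult_distrib nrm_sq)
  then show ?thesis using assms by (simp add: abs_le_square_iff[symmetric] nrm_nonneg)
qed

lemma nrm_scl: "x \<in> S \<Longrightarrow> nrm (scl (complex_of_real r) x) = \<bar>r\<bar> * nrm x"
  by (simp add: nrm_def ip_simps closed real_sqrt_mult flip: power2_eq_square mult.assoc)

lemma nrm_triangle:
  assumes "x \<in> S" "y \<in> S"
  shows "nrm (x + y) \<le> nrm x + nrm y"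
proof (rule power2_le_imp_le)
  have "(nrm (x + y))\<^sup>2 = (nrm x)\<^sup>2 + 2 * ip x y + (nrm y)\<^sup>2"
    using assms ip_sym[of x y] by (simp add: nrm_sq closed ip_simps)
  also have "\<dots> \<le> (nrm x + nrm y)\<^sup>2"
    using Cauchy_Schwarz[OF assms] by (simp add: power2_sum)
  finally show "(nrm (x + y))\<^sup>2 \<le> (nrm x + nrm y)\<^sup>2" .
qed (simp add: nrm_nonneg assms)

lemma nrm_minus_commute:
  assumes "x \<in> S" "y \<in> S" shows "nrm (x - y) = nrm (y - x)"
  unfolding nrm_def using assms by (simp add: ip_simps closed)

lemma nrm_triangle3:
  assumes "x \<in> S" "y \<in> S" "z \<in> S"
  shows "nrm (x - z) \<le> nrm (x - y) + nrm (y - z)"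
  using nrm_triangle[of "x - y" "y - z"] assms by (simp add: closed)

lemma nrm_diff_ge:
  assumes "x \<in> S" "y \<in> S"
  shows "\<bar>nrm x - nrm y\<bar> \<le> nrm (x - y)"
  using nrm_triangle[of "x - y" y] nrm_triangle[of "y - x" x] nrm_minus_commute[of x y] assms
  by (auto simp: closed abs_le_iff)

lemma nrm0_ip:
  assumes "x \<in> S" "y \<in> S" "z \<in> S" "nrm (x - y) = 0"
  shows "ip x z = ip y z"
  using Cauchy_Schwarz[of "x - y" z] assms by (simp add: closed ip_simps)

lemma nrm0_nrm:
  assumes "x \<in> S" "y \<in> S" "nrm (x - y) = 0"
  shows "nrm x = nrm y"
  using nrm_diff_ge[of x y] assms by simp

text \<open>
  Norm estimates through inner products: several vectors below are known only through their inner
  products with all other vectors.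
\<close>

lemma nrm_le_dual:
  assumes "x \<in> S" "0 \<le> e" "\<And>w. w \<in> S \<Longrightarrow> ip x w \<le> e * nrm w"
  shows "nrm x \<le> e"
proof (cases "nrm x = 0")
  case False
  then have "nrm x > 0" using nrm_nonneg assms by (simp add: less_le)
  moreover have "nrm x * nrm x \<le> e * nrm x" using assms(3)[of x] assms(1)
    by (simp add: nrm_sq flip: power2_eq_square)
  ultimately show ?thesis by simp
qed (use assms in simp)

lemma fast_Cauchy:
  assumes "\<And>n. X n \<in> S" "\<And>n. nrm (X (Suc n) - X n) \<le> (1/2) ^ n"
  obtains x where "x \<in> S" "(\<lambda>n. nrm (X n - x)) \<longlonglongrightarrow> 0"
  using fast_Cauchy_convergent[of X] assms unfolding nrm_def by blast

text \<open>
  The representer minimizes \<open>\<parallel>x\<parallel>\<^sup>2 - 2 l(x)\<close>. By the parallelogram identity a sequence whose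
  values approach the infimum at the rate \<open>4\<^sup>-\<^sup>n\<close> moves by at most \<open>2\<^sup>-\<^sup>n\<close> in each step, hence
  converges.
\<close>

theorem riesz:
  assumes add: "\<And>x y. x \<in> S \<Longrightarrow> y \<in> S \<Longrightarrow> l (x + y) = l x + (l y :: real)"
    and hom: "\<And>x r. x \<in> S \<Longrightarrow> l (scl (complex_of_real r) x) = r * l x"
    and bnd: "\<And>x. x \<in> S \<Longrightarrow> \<bar>l x\<bar> \<le> C * nrm x"
  obtains y where "y \<in> S" "\<And>x. x \<in> S \<Longrightarrow> ip x y = l x"
proof -
  have ldiff: "l (x - y) = l x - l y" if "x \<in> S" "y \<in> S" for x y
    using add[of "x - y" y] that closed by simp
  define J where "J x = ip x x - 2 * l x" for x
  have J_ge: "J x \<ge> - C\<^sup>2" if "x \<in> S" for x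
  proof -
    have "2 * l x \<le> 2 * (C * nrm x)" using bnd[OF that] by simp
    also have "\<dots> \<le> C\<^sup>2 + (nrm x)\<^sup>2" using sum_squares_bound[of C "nrm x"] by simp
    finally show ?thesis using that by (simp add: J_def nrm_sq)
  qed
  define j where "j = Inf (J ` S)"
  have bdd: "bdd_below (J ` S)" using J_ge by (auto intro!: bdd_belowI)
  have j_le: "j \<le> J x" if "x \<in> S" for x
    unfolding j_def using that bdd by (auto intro: cInf_lower)
  have "\<exists>x\<in>S. J x < j + (1/4)^n / 4" for n :: nat
  proof -
    have "j < j + (1/4)^n / 4" by simp
    then show ?thesis unfolding j_def
      using cInf_less_iff[of "J ` S" "j + (1/4)^n / 4"] zero_in bdd unfolding j_def by fast
  qed
  then obtain X where X: "\<And>n. X n \<in> S" "\<And>n. J (X n) < j + (1/4)^n / 4" by metis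
  have par: "(nrm (x - y))\<^sup>2 \<le> 2 * (J x - j) + 2 * (J y - j)" if "x \<in> S" "y \<in> S" for x y
  proof -
    have m: "scl (complex_of_real (1/2)) (x + y) \<in> S" using that by (intro closed)
    have "ip (scl (complex_of_real (1/2)) (x + y)) (scl (complex_of_real (1/2)) (x + y)) =
          (1/2) * ((1/2) * ip (x + y) (x + y))"
      using that by (simp only: ip_scl ip_scl_right scl_in add_in)
    then have "4 * J (scl (complex_of_real (1/2)) (x + y)) = ip (x + y) (x + y) - 4 * (l x + l y)"
      unfolding J_def using that hom[of "x + y" "1/2"] add[of x y] by (simp add: closed)
    moreover have "(nrm (x - y))\<^sup>2 = 2 * ip x x + 2 * ip y y - ip (x + y) (x + y)"
      using that by (simp add: nrm_sq closed ip_simps)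
    ultimately show ?thesis using j_le[OF m] by (simp add: J_def)
  qed
  have step: "a \<le> 2 * p + 2 * q" if "a \<le> 2 * (u - j) + 2 * (v - j)" "u < j + p" "v < j + q" for a p q u v :: real
    using that by argo
  have "nrm (X (Suc n) - X n) \<le> (1/2)^n" for n
  proof (rule power2_le_imp_le)
    have "(nrm (X (Suc n) - X n))\<^sup>2 \<le> 2 * ((1/4)^Suc n / 4) + 2 * ((1/4)^n / 4)"
      by (rule step[OF par[OF X(1) X(1)] X(2) X(2)])
    also have "\<dots> \<le> (1/4)^n" by simp
    also have "\<dots> = ((1/2)^n)\<^sup>2" by (simp add: power2_eq_square flip: power_mult_distrib)
    finally show "(nrm (X (Suc n) - X n))\<^sup>2 \<le> ((1/2)^n)\<^sup>2" .
  qed simp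
  from fast_Cauchy[OF X(1) this] obtain y where y: "y \<in> S" and lim: "(\<lambda>n. nrm (X n - y)) \<longlonglongrightarrow> 0"
    by blast
  have "(\<lambda>n. \<bar>J (X n) - J y\<bar>) \<longlonglongrightarrow> 0"
  proof (rule tendsto_sandwich[where f = "\<lambda>_. 0"])
    have "\<bar>J (X n) - J y\<bar> \<le> nrm (X n - y) * (nrm (X n - y) + 2 * nrm y) + 2 * (C * nrm (X n - y))" for n
    proof -
      have e: "J (X n) - J y = ip (X n - y) (X n - y) + 2 * ip (X n - y) y - 2 * l (X n - y)"
        unfolding J_def using X(1) y ip_sym[OF y X(1)[of n]] by (simp add: ip_simps closed ldiff)
      show ?thesis using Cauchy_Schwarz[of "X n - y" y] Cauchy_Schwarz[of "X n - y" "X n - y"]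
          bnd[of "X n - y"] X(1) y closed unfolding e by (simp add: algebra_simps)
    qed
    then show "\<forall>\<^sub>F n in sequentially. \<bar>J (X n) - J y\<bar> \<le>
        nrm (X n - y) * (nrm (X n - y) + 2 * nrm y) + 2 * (C * nrm (X n - y))" by simp
    show "(\<lambda>n. nrm (X n - y) * (nrm (X n - y) + 2 * nrm y) + 2 * (C * nrm (X n - y))) \<longlonglongrightarrow> 0"
      by (rule tendsto_eq_intros lim refl | simp)+
  qed auto
  then have "(\<lambda>n. J (X n)) \<longlonglongrightarrow> J y"
    by (simp add: tendsto_rabs_zero_iff LIM_zero_iff)
  moreover have "(\<lambda>n. j + (1/4)^n / 4) \<longlonglongrightarrow> j + 0 / 4"
    by (intro tendsto_intros LIMSEQ_power_zero) auto
  ultimately have Jy: "J y \<le> j"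
    using X(2) LIMSEQ_le[of "\<lambda>n. J (X n)" "J y" "\<lambda>n. j + (1/4)^n / 4" "j + 0 / 4"] by (auto intro: less_imp_le)
  have "ip x y = l x" if x: "x \<in> S" for x
  proof -
    have "0 \<le> 0 - 2 * r * (l x - ip y x) + r\<^sup>2 * ip x x" for r
    proof -
      have "j \<le> J (y + scl (of_real r) x)" by (intro j_le closed x y)
      also have "\<dots> = J y + 2 * r * (ip y x - l x) + r\<^sup>2 * ip x x"
        unfolding J_def using x y ip_sym[OF x y]
        by (simp add: ip_simps closed add hom algebra_simps power2_eq_square)
      finally show ?thesis using Jy by (simp add: algebra_simps)
    qed
    from nonneg_quadratic_discriminant[OF this] show ?thesis using ip_sym[OF x y] by simp
  qed
  with y that show ?thesis by blast
qed

end

section \<open>Semigroups with a Lyapunov form\<close>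

text \<open>
  Generators are defined by right derivatives, so the derivative of a quadratic form along an
  orbit is one-sided too. If \<open>f b\<close> exceeded \<open>f 0\<close>, then the last point at which \<open>f\<close> is below the
  line of a small positive slope through \<open>(0, f 0)\<close> would contradict the sign of the derivative
  there.
\<close>

lemma nonincreasing_of_right_derivative_nonpos:
  fixes f :: "real \<Rightarrow> real"
  assumes cont: "continuous_on {0..} f"
    and der: "\<And>t. t \<ge> 0 \<Longrightarrow> \<exists>d\<le>0. ((\<lambda>h. (f (t + h) - f t) / h) \<longlongrightarrow> d) (at_right 0)"
    and b: "b \<ge> 0"
  shows "f b \<le> f 0"
proof (rule ccontr)
  assume "\<not> f b \<le> f 0"
  then have gt: "f b > f 0" and b0: "b > 0" using b by (auto simp: not_le less_le)
  define e where "e = (f b - f 0) / (2 * b)"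
  have e: "e > 0" using gt b0 by (simp add: e_def)
  \<comment> \<open>the times at which \<open>f\<close> is below the line of slope \<open>e\<close>; the slope is half of that of the chord, which excludes \<open>b\<close>\<close>
  define K where "K = {t \<in> {0..b}. f t - e * t \<le> f 0}"
  have "continuous_on {0..b} (\<lambda>t. f t - e * t)"
    by (intro continuous_intros continuous_on_subset[OF cont]) auto
  then have "closed K" unfolding K_def
    by (intro continuous_closed_preimage_constant continuous_on_closed_Collect_le) auto
  moreover have "bounded K" unfolding K_def by (rule bounded_subset[of "{0..b}"]) auto
  ultimately have "compact K" by (simp add: compact_eq_bounded_closed)
  moreover have "K \<noteq> {}" using b by (auto simp: K_def intro!: exI[of _ 0])
  ultimately obtain s where s: "s \<in> K" "\<And>t. t \<in> K \<Longrightarrow> t \<le> s"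
    using compact_attains_sup[of K] by blast
  have "b \<notin> K" using b0 gt by (simp add: K_def e_def field_simps)
  then have sb: "s < b" "s \<ge> 0" using s by (auto simp: K_def less_le)
  obtain d where d: "d \<le> 0" "((\<lambda>h. (f (s + h) - f s) / h) \<longlongrightarrow> d) (at_right 0)" using der sb by blast
  have "\<forall>\<^sub>F h in at_right 0. (f (s + h) - f s) / h < e"
    by (rule order_tendstoD[OF d(2)]) (use d e in simp)
  moreover have "\<forall>\<^sub>F h in at_right 0. h < b - s"
    using sb by (intro eventually_at_right_less[THEN eventually_mono] eventually_at_rightI[of 0 "b - s"]) auto
  moreover have "\<forall>\<^sub>F h::real in at_right 0. h > 0" by (rule eventually_at_right_less)
  ultimately have "\<forall>\<^sub>F h in at_right 0. h > 0 \<and> h < b - s \<and> (f (s + h) - f s) / h < e"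
    by eventually_elim auto
  then obtain h where h: "h > 0" "h < b - s" "(f (s + h) - f s) / h < e"
    using eventually_happens'[OF trivial_limit_at_right_real] by blast
  have "f (s + h) - f s < e * h" using h by (simp add: field_simps)
  then have "s + h \<in> K" using s(1) sb h by (simp add: K_def algebra_simps)
  with s(2)[of "s + h"] h show False by simp
qed

context semi_hilbert
begin

definition bounded_form :: "('a \<Rightarrow> 'a \<Rightarrow> real) \<Rightarrow> bool" where
  "bounded_form B \<longleftrightarrow>
    (\<forall>x\<in>S. \<forall>y\<in>S. \<forall>z\<in>S. B (x + y) z = B x z + B y z \<and> B z (x + y) = B z x + B z y) \<and>
    (\<forall>x\<in>S. \<forall>y\<in>S. \<forall>r. B (scl (complex_of_real r) x) y = r * B x y \<and> B x (scl (complex_of_real r) y) = r * B x y) \<and>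
    (\<exists>C. \<forall>x\<in>S. \<forall>y\<in>S. \<bar>B x y\<bar> \<le> C * nrm x * nrm y)"

lemma bounded_formD:
  assumes "bounded_form B"
  shows "x \<in> S \<Longrightarrow> y \<in> S \<Longrightarrow> z \<in> S \<Longrightarrow> B (x + y) z = B x z + B y z"
    and "x \<in> S \<Longrightarrow> y \<in> S \<Longrightarrow> z \<in> S \<Longrightarrow> B z (x + y) = B z x + B z y"
    and "x \<in> S \<Longrightarrow> y \<in> S \<Longrightarrow> B (scl (complex_of_real r) x) y = r * B x y"
    and "x \<in> S \<Longrightarrow> y \<in> S \<Longrightarrow> B x (scl (complex_of_real r) y) = r * B x y"
  using assms unfolding bounded_form_def by blast+

lemma bounded_form_bound:
  assumes "bounded_form B"
  obtains C where "C \<ge> 0" "\<And>x y. x \<in> S \<Longrightarrow> y \<in> S \<Longrightarrow> \<bar>B x y\<bar> \<le> C * nrm x * nrm y"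
proof -
  obtain C where C: "\<And>x y. x \<in> S \<Longrightarrow> y \<in> S \<Longrightarrow> \<bar>B x y\<bar> \<le> C * nrm x * nrm y"
    using assms unfolding bounded_form_def by blast
  show ?thesis
  proof (rule that[of "\<bar>C\<bar>"])
    fix x y assume xy: "x \<in> S" "y \<in> S"
    have "C * nrm x * nrm y \<le> \<bar>C\<bar> * nrm x * nrm y" using xy by (intro mult_right_mono nrm_nonneg) auto
    then show "\<bar>B x y\<bar> \<le> \<bar>C\<bar> * nrm x * nrm y" using C[OF xy] by simp
  qed simp
qed

lemma bounded_form_ip: "bounded_form ip"
  unfolding bounded_form_def by (auto simp: ip_simps Cauchy_Schwarz intro!: exI[of _ 1])

lemma bounded_form_lincomb:
  assumes "bounded_form B" "bounded_form B'"
  shows "bounded_form (\<lambda>x y. r * B x y + B' x y)"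
proof -
  obtain C where C: "\<And>x y. x \<in> S \<Longrightarrow> y \<in> S \<Longrightarrow> \<bar>B x y\<bar> \<le> C * nrm x * nrm y"
    using bounded_form_bound[OF assms(1)] by metis
  obtain C' where C': "\<And>x y. x \<in> S \<Longrightarrow> y \<in> S \<Longrightarrow> \<bar>B' x y\<bar> \<le> C' * nrm x * nrm y"
    using bounded_form_bound[OF assms(2)] by metis
  have "\<bar>r * B x y + B' x y\<bar> \<le> (\<bar>r\<bar> * C + C') * nrm x * nrm y" if "x \<in> S" "y \<in> S" for x y
  proof -
    have "\<bar>r * B x y + B' x y\<bar> \<le> \<bar>r\<bar> * \<bar>B x y\<bar> + \<bar>B' x y\<bar>" by (metis abs_mult abs_triangle_ineq)
    also have "\<dots> \<le> \<bar>r\<bar> * (C * nrm x * nrm y) + C' * nrm x * nrm y"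
      by (intro add_mono mult_left_mono C C' that) auto
    finally show ?thesis by (simp add: algebra_simps)
  qed
  then have "\<exists>C. \<forall>x\<in>S. \<forall>y\<in>S. \<bar>r * B x y + B' x y\<bar> \<le> C * nrm x * nrm y" by blast
  then show ?thesis unfolding bounded_form_def
    using bounded_formD[OF assms(1)] bounded_formD[OF assms(2)]
    by (intro conjI ballI allI) (simp_all add: algebra_simps)
qed

lemma bounded_form_diff:
  assumes "bounded_form B" "x \<in> S" "y \<in> S" "z \<in> S"
  shows "B (x - y) z = B x z - B y z" "B z (x - y) = B z x - B z y"
  using bounded_formD(1)[OF assms(1), of "x - y" y z] bounded_formD(2)[OF assms(1), of "x - y" y z] assms
  by (simp_all add: closed)

end

locale hilbert_semigroup = semi_hilbert +
  fixes T :: "real \<Rightarrow> 'a \<Rightarrow> 'a"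
  assumes C0: "C0_semigroup S nrm scl T"
begin

lemma T_in: "t \<ge> 0 \<Longrightarrow> x \<in> S \<Longrightarrow> T t x \<in> S"
  and T_add: "t \<ge> 0 \<Longrightarrow> x \<in> S \<Longrightarrow> y \<in> S \<Longrightarrow> nrm (T t (x + y) - (T t x + T t y)) = 0"
  and T_scl: "t \<ge> 0 \<Longrightarrow> x \<in> S \<Longrightarrow> nrm (T t (scl c x) - scl c (T t x)) = 0"
  and T_bounded: "t \<ge> 0 \<Longrightarrow> \<exists>M. \<forall>x\<in>S. nrm (T t x) \<le> M * nrm x"
  and T_0: "x \<in> S \<Longrightarrow> nrm (T 0 x - x) = 0"
  and T_plus: "s \<ge> 0 \<Longrightarrow> t \<ge> 0 \<Longrightarrow> x \<in> S \<Longrightarrow> nrm (T (s + t) x - T s (T t x)) = 0"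
  and T_right: "x \<in> S \<Longrightarrow> ((\<lambda>t. nrm (T t x - x)) \<longlongrightarrow> 0) (at_right 0)"
proof -
  note c0 = C0[unfolded C0_semigroup_def, THEN conjunct1]
  note c1 = C0[unfolded C0_semigroup_def, THEN conjunct2, THEN conjunct1]
  note c2 = C0[unfolded C0_semigroup_def, THEN conjunct2, THEN conjunct2, THEN conjunct1]
  note c3 = C0[unfolded C0_semigroup_def, THEN conjunct2, THEN conjunct2, THEN conjunct2, THEN conjunct1]
  note c4 = C0[unfolded C0_semigroup_def, THEN conjunct2, THEN conjunct2, THEN conjunct2, THEN conjunct2, THEN conjunct1]
  note c5 = C0[unfolded C0_semigroup_def, THEN conjunct2, THEN conjunct2, THEN conjunct2, THEN conjunct2, THEN conjunct2, THEN conjunct1]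
  note c6 = C0[unfolded C0_semigroup_def, THEN conjunct2, THEN conjunct2, THEN conjunct2, THEN conjunct2, THEN conjunct2, THEN conjunct2]
  show "t \<ge> 0 \<Longrightarrow> x \<in> S \<Longrightarrow> T t x \<in> S" using c0 by blast
  show "t \<ge> 0 \<Longrightarrow> x \<in> S \<Longrightarrow> y \<in> S \<Longrightarrow> nrm (T t (x + y) - (T t x + T t y)) = 0" using c1 by blast
  show "t \<ge> 0 \<Longrightarrow> x \<in> S \<Longrightarrow> nrm (T t (scl c x) - scl c (T t x)) = 0" using c2 by blast
  show "t \<ge> 0 \<Longrightarrow> \<exists>M. \<forall>x\<in>S. nrm (T t x) \<le> M * nrm x" using c3 by blast
  show "x \<in> S \<Longrightarrow> nrm (T 0 x - x) = 0" using c4 by blast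
  show "s \<ge> 0 \<Longrightarrow> t \<ge> 0 \<Longrightarrow> x \<in> S \<Longrightarrow> nrm (T (s + t) x - T s (T t x)) = 0" using c5 by blast
  show "x \<in> S \<Longrightarrow> ((\<lambda>t. nrm (T t x - x)) \<longlongrightarrow> 0) (at_right 0)" using c6 by blast
qed

lemma ip_T_add: "t \<ge> 0 \<Longrightarrow> x \<in> S \<Longrightarrow> y \<in> S \<Longrightarrow> w \<in> S \<Longrightarrow> ip (T t (x + y)) w = ip (T t x) w + ip (T t y) w"
  using nrm0_ip[OF _ _ _ T_add[of t x y], where z = w] by (simp add: closed T_in ip_add)

lemma ip_T_scl: "t \<ge> 0 \<Longrightarrow> x \<in> S \<Longrightarrow> w \<in> S \<Longrightarrow> ip (T t (scl (of_real r) x)) w = r * ip (T t x) w"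
  using nrm0_ip[OF _ _ _ T_scl[of t x "of_real r"], where z = w] by (simp add: closed T_in ip_scl)

lemma ip_T_plus: "s \<ge> 0 \<Longrightarrow> t \<ge> 0 \<Longrightarrow> x \<in> S \<Longrightarrow> w \<in> S \<Longrightarrow> ip (T (s + t) x) w = ip (T s (T t x)) w"
  using nrm0_ip[OF _ _ _ T_plus[of s t x], where z = w] by (simp add: closed T_in)

lemma ip_T_0: "x \<in> S \<Longrightarrow> w \<in> S \<Longrightarrow> ip (T 0 x) w = ip x w"
  using nrm0_ip[OF _ _ _ T_0[of x], where z = w] by (simp add: T_in)

lemma nrm_T_0: "x \<in> S \<Longrightarrow> nrm (T 0 x) = nrm x"
  using nrm0_nrm[OF _ _ T_0[of x]] by (simp add: T_in)

lemma nrm_T_scl: "t \<ge> 0 \<Longrightarrow> x \<in> S \<Longrightarrow> nrm (T t (scl (of_real r) x)) = \<bar>r\<bar> * nrm (T t x)"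
  using nrm0_nrm[OF _ _ T_scl[of t x "of_real r"]] by (simp add: closed T_in nrm_scl)

lemma ip_T_diff:
  assumes "t \<ge> 0" "x \<in> S" "y \<in> S" "w \<in> S"
  shows "ip (T t (x - y)) w = ip (T t x) w - ip (T t y) w"
  using ip_T_add[of t "x - y" y w] assms by (simp add: closed)

lemma nrm_T_diff:
  assumes "t \<ge> 0" "x \<in> S" "y \<in> S"
  shows "nrm (T t x - T t y) = nrm (T t (x - y))"
proof -
  have "ip (T t (x - y) - (T t x - T t y)) w = 0" if "w \<in> S" for w
    using assms that by (simp add: ip_T_diff ip_diff T_in closed)
  then have "nrm (T t (x - y) - (T t x - T t y)) = 0"
    using assms by (simp add: nrm_def closed T_in)
  then show ?thesis using assms nrm0_nrm by (metis T_in diff_in)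
qed

text \<open>
  The factor 2/3 only has to exceed 1/2: the remainder of the series in the gliding hump below has
  norm at most \<open>3\<^sup>-\<^sup>n/2\<close>, against \<open>3\<^sup>-\<^sup>n\<close> for the \<open>n\<close>-th term.
\<close>

lemma operator_norm_attained_up_to_factor:
  assumes t: "t \<ge> 0" and B: "B > 0" and x: "x \<in> S" "nrm (T t x) > B * nrm x"
  shows "\<exists>N z. N \<ge> B \<and> z \<in> S \<and> (\<forall>x\<in>S. nrm (T t x) \<le> N * nrm x) \<and> nrm z > 0 \<and> nrm (T t z) \<ge> 2/3 * N * nrm z"
proof -
  obtain M where M: "\<And>x. x \<in> S \<Longrightarrow> nrm (T t x) \<le> M * nrm x" using T_bounded[OF t] by blast
  define R where "R = (\<lambda>z. nrm (T t z) / nrm z) ` {z\<in>S. nrm z > 0}"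
  have pos: "nrm x > 0" using M[OF x(1)] x nrm_nonneg[OF x(1)] by (auto simp: less_le)
  have ne: "nrm (T t x) / nrm x \<in> R" using x pos by (auto simp: R_def)
  have bdd: "bdd_above R" unfolding R_def
    by (rule bdd_aboveI[of _ M]) (auto simp: divide_le_eq M)
  define N where "N = Sup R"
  have "B < nrm (T t x) / nrm x" using x pos by (simp add: field_simps)
  also have "\<dots> \<le> N" unfolding N_def by (rule cSup_upper[OF ne bdd])
  finally have N: "N > B" .
  have N_bound: "nrm (T t z) \<le> N * nrm z" if z: "z \<in> S" for z
  proof (cases "nrm z = 0")
    case True then show ?thesis using M[OF z] by simp
  next
    case False
    then have zp: "nrm z > 0" using nrm_nonneg[OF z] by simp
    then have "nrm (T t z) / nrm z \<le> N" unfolding N_def using z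
      by (intro cSup_upper[OF _ bdd]) (auto simp: R_def)
    then show ?thesis using zp by (simp add: field_simps)
  qed
  have "2/3 * N < N" using N B by simp
  then obtain r where "r \<in> R" "2/3 * N < r" unfolding N_def
    using less_cSup_iff[of R "2/3 * Sup R"] ne bdd by (auto simp: N_def)
  then obtain z where "z \<in> S" "nrm z > 0" "2/3 * N < nrm (T t z) / nrm z" by (auto simp: R_def)
  then show ?thesis using N N_bound by (intro exI[of _ N] exI[of _ z]) (auto simp: field_simps)
qed

text \<open>
  The uniform boundedness principle, by a gliding hump instead of Baire's theorem. If the bound
  failed, there would be times \<open>t\<^sub>n \<rightarrow> 0\<close> at which \<open>T\<close> has norm \<open>N\<^sub>n \<ge> 4\<^sup>n\<close>. Summing vectors \<open>\<plusminus>w\<^sub>n\<close>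
  of norm \<open>3\<^sup>-\<^sup>n\<close> that nearly attain these norms yields an \<open>x\<close> whose orbit is unbounded near time
  0, against the continuity of the orbit. The signs ensure that the image under \<open>T t\<^sub>n\<close> of the
  partial sum is at least as large as that of \<open>w\<^sub>n\<close>, and the rest of the series is too short to
  compensate.
\<close>

lemma locally_bounded_at_0: "\<exists>d>0. \<exists>M. \<forall>t\<in>{0..d}. \<forall>x\<in>S. nrm (T t x) \<le> M * nrm x"
proof (rule ccontr)
  assume neg: "\<not> ?thesis"
  have "\<exists>t N z. 0 < t \<and> t \<le> 1 / real (Suc n) \<and> N \<ge> 4^n \<and> z \<in> S \<and> (\<forall>x\<in>S. nrm (T t x) \<le> N * nrm x)
          \<and> nrm z > 0 \<and> nrm (T t z) \<ge> 2/3 * N * nrm z" for n :: nat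
  proof -
    from neg have "\<not> (\<forall>t\<in>{0..1 / real (Suc n)}. \<forall>x\<in>S. nrm (T t x) \<le> 4^n * nrm x)"
      by (metis of_nat_0_less_iff zero_less_Suc zero_less_divide_1_iff)
    then obtain t x where tx: "0 \<le> t" "t \<le> 1 / real (Suc n)" "x \<in> S" "nrm (T t x) > 4^n * nrm x"
      by (auto simp: not_le)
    have "t \<noteq> 0"
    proof
      assume "t = 0"
      moreover have "1 * nrm x \<le> 4^n * nrm x" using nrm_nonneg[OF tx(3)] by (intro mult_right_mono) auto
      ultimately show False using tx nrm_T_0[OF tx(3)] by simp
    qed
    then show ?thesis using operator_norm_attained_up_to_factor[OF tx(1) _ tx(3,4)] tx(1,2)
      by (metis less_le zero_less_numeral zero_less_power)
  qed
  then obtain t N z where t: "\<And>n. 0 < t n" "\<And>n. t n \<le> 1 / real (Suc n)" and N: "\<And>n. N n \<ge> 4^n"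
    and z: "\<And>n. z n \<in> S" "\<And>n. nrm (z n) > 0" "\<And>n. nrm (T (t n) (z n)) \<ge> 2/3 * N n * nrm (z n)"
    and NT: "\<And>n x. x \<in> S \<Longrightarrow> nrm (T (t n) x) \<le> N n * nrm x" by metis
  have t0: "0 \<le> t n" for n using t(1)[of n] by simp
  define w where "w n = scl (complex_of_real ((1/3)^n / nrm (z n))) (z n)" for n
  have w: "w n \<in> S" and nw: "nrm (w n) = (1/3)^n" for n
    using z(1,2)[of n] by (auto simp: w_def closed nrm_scl simp del: of_real_divide of_real_power)
  have Tw: "nrm (T (t n) (w n)) \<ge> 2/3 * N n * (1/3)^n" for n
  proof -
    have "nrm (T (t n) (w n)) = (1/3)^n / nrm (z n) * nrm (T (t n) (z n))"
      unfolding w_def using z(1,2)[of n] t0 by (simp add: nrm_T_scl del: of_real_divide of_real_power)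
    also have "\<dots> \<ge> (1/3)^n / nrm (z n) * (2/3 * N n * nrm (z n))"
      by (rule mult_left_mono[OF z(3)]) (use z(2)[of n] in simp)
    finally show ?thesis using z(2)[of n] by (simp add: field_simps)
  qed
  \<comment> \<open>each step moves by \<open>w n\<close> in the direction that makes the image under \<open>T (t n)\<close> large\<close>
  define X where "X = rec_nat 0 (\<lambda>n x. if nrm (T (t n) (x + w n)) \<ge> nrm (T (t n) (x - w n)) then x + w n else x - w n)"
  have X0: "X 0 = 0" and XS: "X (Suc n) = (if nrm (T (t n) (X n + w n)) \<ge> nrm (T (t n) (X n - w n))
      then X n + w n else X n - w n)" for n by (auto simp: X_def)
  have Xin: "X n \<in> S" for n by (induction n) (auto simp: X0 XS closed w)
  have Xstep: "nrm (X (Suc n) - X n) = (1/3)^n" for n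
    using nw[of n] nrm_minus_commute[OF zero_in w[of n]] by (auto simp: XS)
  have big: "nrm (T (t n) (X (Suc n))) \<ge> 2/3 * N n * (1/3)^n" for n
  proof -
    have "2 * nrm (T (t n) (w n)) = nrm (T (t n) (scl (complex_of_real 2) (w n)))"
      using nrm_T_scl[OF t0[of n] w[of n], of 2] by simp
    also have "\<dots> = nrm (T (t n) (X n + w n) - T (t n) (X n - w n))"
    proof -
      have "ip (T (t n) (scl (complex_of_real 2) (w n)) - (T (t n) (X n + w n) - T (t n) (X n - w n))) u = 0"
        if "u \<in> S" for u
        using that w t0 Xin by (simp only: ip_diff ip_T_scl ip_T_add ip_T_diff closed T_in)
      then have "nrm (T (t n) (scl (complex_of_real 2) (w n)) - (T (t n) (X n + w n) - T (t n) (X n - w n))) = 0"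
        unfolding nrm_def using w t0 Xin by (simp only: closed T_in) simp
      then show ?thesis by (intro nrm0_nrm) (auto intro!: closed T_in w t0 Xin)
    qed
    also have "\<dots> \<le> nrm (T (t n) (X n + w n)) + nrm (T (t n) (X n - w n))"
    proof -
      have i: "T (t n) (X n + w n) \<in> S" "T (t n) (X n - w n) \<in> S" by (auto intro!: closed T_in w t0 Xin)
      show ?thesis using nrm_triangle3[OF i(1) zero_in i(2)] nrm_minus_commute[OF zero_in i(2)] by simp
    qed
    also have "\<dots> \<le> 2 * nrm (T (t n) (X (Suc n)))" unfolding XS by simp
    finally show ?thesis using Tw[of n] by simp
  qed
  obtain x where x: "x \<in> S" and lim: "(\<lambda>n. nrm (X n - x)) \<longlonglongrightarrow> 0"
  proof (rule fast_Cauchy[of X])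
    show "nrm (X (Suc n) - X n) \<le> (1/2)^n" for n unfolding Xstep by (rule power_mono) auto
  qed (auto simp: Xin)
  have tail: "nrm (X (Suc n) - X (Suc n + k)) \<le> (1/3)^n / 2 - (1/3)^(n+k) / 2" for n k
  proof (induction k)
    case (Suc k)
    have "nrm (X (Suc n) - X (Suc n + Suc k)) \<le> nrm (X (Suc n) - X (Suc n + k)) + nrm (X (Suc n + k) - X (Suc (Suc n + k)))"
      using nrm_triangle3[OF Xin Xin Xin] by simp
    also have "nrm (X (Suc n + k) - X (Suc (Suc n + k))) = (1/3)^(Suc n + k)"
      using Xstep[of "Suc n + k"] nrm_minus_commute[OF Xin Xin] by metis
    finally show ?case using Suc by (simp add: power_add)
  qed (simp add: nrm_def ip_diff Xin closed, use nrm_def ip_diff[OF zero_in zero_in zero_in] in simp)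
  have dist: "nrm (X (Suc n) - x) \<le> (1/3)^n / 2" for n
  proof (rule LIMSEQ_le_const)
    have "(\<lambda>k. nrm (X (k + Suc n) - x)) \<longlonglongrightarrow> 0" using lim by (rule LIMSEQ_ignore_initial_segment)
    then show "(\<lambda>k. (1/3)^n / 2 + nrm (X (k + Suc n) - x)) \<longlonglongrightarrow> (1/3)^n / 2"
      using tendsto_add[OF tendsto_const, of _ 0 sequentially "(1/3)^n / 2 :: real"] by simp
    show "\<exists>K. \<forall>k\<ge>K. nrm (X (Suc n) - x) \<le> (1/3)^n / 2 + nrm (X (k + Suc n) - x)"
    proof (intro exI[of _ 0] allI impI)
      fix k
      have "nrm (X (Suc n) - x) \<le> nrm (X (Suc n) - X (Suc n + k)) + nrm (X (Suc n + k) - x)"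
        by (rule nrm_triangle3[OF Xin Xin x])
      moreover have "(0::real) \<le> (1/3)^(n+k) / 2" by simp
      ultimately show "nrm (X (Suc n) - x) \<le> (1/3)^n / 2 + nrm (X (k + Suc n) - x)"
        using tail[of n k] by (simp only: add.commute[of k "Suc n"])
    qed
  qed
  \<comment> \<open>the lower bound \<open>2/3\<close> for the partial sum minus \<open>1/2\<close> for the remainder leaves \<open>1/6\<close>\<close>
  have large: "(4/3)^n / 6 \<le> nrm (T (t n) x)" for n
  proof -
    have "nrm (T (t n) (X (Suc n)) - T (t n) x) \<le> N n * ((1/3)^n / 2)"
    proof -
      have "nrm (T (t n) (X (Suc n)) - T (t n) x) = nrm (T (t n) (X (Suc n) - x))"
        by (rule nrm_T_diff[OF t0 Xin x])
      also have "\<dots> \<le> N n * nrm (X (Suc n) - x)" by (intro NT closed Xin x)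
      also have "\<dots> \<le> N n * ((1/3)^n / 2)"
        by (rule mult_left_mono[OF dist]) (use order_trans[OF _ N[of n], of 0] in simp)
      finally show ?thesis .
    qed
    moreover have "\<bar>nrm (T (t n) (X (Suc n))) - nrm (T (t n) x)\<bar> \<le> nrm (T (t n) (X (Suc n)) - T (t n) x)"
      by (intro nrm_diff_ge T_in t0 Xin x)
    moreover have "nrm (T (t n) (X (Suc n))) \<ge> 2/3 * (N n * (1/3)^n)" using big[of n] by (simp only: mult.assoc)
    moreover have "N n * ((1/3)^n / 2) = (N n * (1/3)^n) / 2" by simp
    ultimately have "nrm (T (t n) x) \<ge> N n * (1/3)^n / 6" unfolding abs_le_iff by linarith
    moreover have "N n * (1/3)^n \<ge> 4^n * (1/3)^n" by (rule mult_right_mono[OF N]) simp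
    moreover have "(4::real)^n * (1/3)^n = (4/3)^n" by (simp add: power_mult_distrib[symmetric])
    ultimately show ?thesis by simp
  qed
  have "filterlim t (at_right 0) sequentially"
  proof -
    have "t \<longlonglongrightarrow> 0"
    proof (rule tendsto_sandwich[where f = "\<lambda>_. 0" and h = "\<lambda>n. 1 / real (Suc n)"])
      show "(\<lambda>n. 1 / real (Suc n)) \<longlonglongrightarrow> 0" by (rule LIMSEQ_Suc[OF lim_1_over_n])
    qed (use t t0 in auto)
    moreover have "t n \<noteq> 0" for n using t(1)[of n] by simp
    ultimately show ?thesis using t(1) by (auto simp: filterlim_at)
  qed
  then have to_0: "(\<lambda>n. nrm (T (t n) x - x)) \<longlonglongrightarrow> 0" by (rule filterlim_compose[OF T_right[OF x]])
  obtain n0 where n0: "\<And>n. n \<ge> n0 \<Longrightarrow> nrm (T (t n) x - x) < 1"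
    using order_tendstoD(2)[OF to_0, of 1] by (auto simp: eventually_sequentially)
  obtain n1 where n1: "6 * (nrm x + 1) < (4/3 :: real)^n1" using real_arch_pow[of "4/3"] by auto
  define n where "n = max n0 n1"
  have "(4/3::real)^n1 \<le> (4/3)^n" by (rule power_increasing) (auto simp: n_def)
  with n1 have "6 * (nrm x + 1) < (4/3)^n" by (rule less_le_trans)
  also have "(4/3)^n \<le> 6 * nrm (T (t n) x)" using large[of n] by simp
  finally have "nrm x + 1 < nrm (T (t n) x)" by simp
  moreover have "nrm (T (t n) x) - nrm x \<le> nrm (T (t n) x - x)"
    using nrm_diff_ge[OF T_in[OF t0 x] x] by (simp add: abs_le_iff)
  ultimately show False using n0[of n] by (simp add: n_def)
qed

lemma locally_bounded:
  "\<exists>M\<ge>0. \<forall>t\<in>{0..a}. \<forall>x\<in>S. nrm (T t x) \<le> M * nrm x"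
proof -
  obtain d M where d: "d > 0" and M: "\<And>t x. t \<in> {0..d} \<Longrightarrow> x \<in> S \<Longrightarrow> nrm (T t x) \<le> M * nrm x"
    using locally_bounded_at_0 by blast
  define N where "N = max M 1"
  have N: "nrm (T t x) \<le> N * nrm x" if "t \<in> {0..d}" "x \<in> S" for t x
    using M[OF that] mult_right_mono[of M N "nrm x"] nrm_nonneg[OF that(2)] by (simp add: N_def)
  have "\<exists>M\<ge>0. \<forall>t\<in>{0..real n * d}. \<forall>x\<in>S. nrm (T t x) \<le> M * nrm x" for n
  proof (induction n)
    case 0
    then show ?case by (intro exI[of _ 1]) (auto simp: nrm_T_0)
  next
    case (Suc n)
    then obtain K where K: "K \<ge> 0" "\<And>t x. t \<in> {0..real n * d} \<Longrightarrow> x \<in> S \<Longrightarrow> nrm (T t x) \<le> K * nrm x" by auto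
    have "nrm (T t x) \<le> (K * N + K) * nrm x" if t: "t \<in> {0..real (Suc n) * d}" and x: "x \<in> S" for t x
    proof (cases "t \<le> real n * d")
      case True
      have "K * nrm x \<le> (K * N + K) * nrm x"
        using nrm_nonneg[OF x] K(1) by (intro mult_right_mono) (auto simp: N_def)
      then show ?thesis using True K(2)[of t x] t x by simp
    next
      case False
      define s where "s = t - real n * d"
      have s: "s \<in> {0..d}" "t = real n * d + s" using False t by (auto simp: s_def algebra_simps)
      have "nrm (T t x) = nrm (T (real n * d) (T s x))"
        unfolding s(2) using s d x by (intro nrm0_nrm T_plus T_in) auto
      also have "\<dots> \<le> K * nrm (T s x)" using s d x by (intro K(2) T_in) auto
      also have "\<dots> \<le> K * (N * nrm x)" by (intro mult_left_mono N s x K)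
      also have "\<dots> \<le> (K * N + K) * nrm x" using nrm_nonneg[OF x] K(1) by (simp add: algebra_simps)
      finally show ?thesis .
    qed
    then show ?case using K(1) by (intro exI[of _ "K * N + K"]) (auto simp: N_def)
  qed
  moreover obtain n where "a \<le> real n * d" using reals_Archimedean3[OF d] by (metis less_imp_le)
  ultimately show ?thesis by (meson atLeastAtMost_iff order_trans)
qed

lemma orbit_modulus:
  obtains M where "M \<ge> 0" "\<And>s t x. s \<in> {0..a} \<Longrightarrow> t \<in> {0..a} \<Longrightarrow> x \<in> S \<Longrightarrow>
    nrm (T s x - T t x) \<le> M * nrm (T \<bar>s - t\<bar> x - x)"
proof -
  obtain M where M: "M \<ge> 0" "\<And>t x. t \<in> {0..a} \<Longrightarrow> x \<in> S \<Longrightarrow> nrm (T t x) \<le> M * nrm x"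
    using locally_bounded[of a] by blast
  have le: "nrm (T s x - T t x) \<le> M * nrm (T (s - t) x - x)" if "t \<le> s" "0 \<le> t" "s \<le> a" "x \<in> S" for s t x
  proof -
    have in': "T s x \<in> S" "T t x \<in> S" "T t (T (s - t) x) \<in> S" "T (s - t) x \<in> S" using that by (auto intro!: T_in)
    have "nrm (T s x - T t (T (s - t) x)) = 0" using T_plus[of t "s - t" x] that by simp
    then have "nrm (T s x - T t x) \<le> nrm (T t (T (s - t) x) - T t x)"
      using nrm_triangle3[OF in'(1,3,2)] by simp
    also have "\<dots> = nrm (T t (T (s - t) x - x))" using that in' by (intro nrm_T_diff) auto
    also have "\<dots> \<le> M * nrm (T (s - t) x - x)" using that in' by (intro M(2) closed) auto
    finally show ?thesis .
  qed
  show ?thesis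
  proof (rule that[OF M(1)])
    fix s t x assume st: "s \<in> {0..a}" "t \<in> {0..a}" "x \<in> S"
    show "nrm (T s x - T t x) \<le> M * nrm (T \<bar>s - t\<bar> x - x)"
    proof (cases "t \<le> s")
      case True then show ?thesis using le[of t s x] st by simp
    next
      case False
      then show ?thesis using le[of s t x] st nrm_minus_commute[of "T s x" "T t x"] by (simp add: T_in)
    qed
  qed
qed

lemma orbit_close:
  assumes "x \<in> S" "e > 0"
  obtains d where "d > 0" "\<And>s t. s \<in> {0..a} \<Longrightarrow> t \<in> {0..a} \<Longrightarrow> \<bar>s - t\<bar> < d \<Longrightarrow> nrm (T s x - T t x) < e"
proof -
  obtain M where M: "M \<ge> 0" "\<And>s t. s \<in> {0..a} \<Longrightarrow> t \<in> {0..a} \<Longrightarrow> nrm (T s x - T t x) \<le> M * nrm (T \<bar>s - t\<bar> x - x)"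
    using orbit_modulus[of a] assms(1) by metis
  have "\<forall>\<^sub>F h in at_right 0. nrm (T h x - x) < e / (M + 1)"
    by (rule order_tendstoD[OF T_right[OF assms(1)]]) (use M assms in simp)
  then obtain d where d: "d > 0" "\<And>h. 0 < h \<Longrightarrow> h < d \<Longrightarrow> nrm (T h x - x) < e / (M + 1)"
    unfolding eventually_at_right by (metis add_0 eventually_at_right_field)
  show ?thesis
  proof (rule that[OF d(1)])
    fix s t assume st: "s \<in> {0..a}" "t \<in> {0..a}" "\<bar>s - t\<bar> < d"
    have "nrm (T \<bar>s - t\<bar> x - x) < e / (M + 1)"
      using d(2)[of "\<bar>s - t\<bar>"] st(3) T_0[OF assms(1)] assms(2) M(1) by (cases "s = t") auto
    then have "M * nrm (T \<bar>s - t\<bar> x - x) \<le> M * (e / (M + 1))" using M(1) by (intro mult_left_mono) auto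
    also have "\<dots> < e" using M(1) assms(2) by (simp add: field_simps)
    finally show "nrm (T s x - T t x) < e" using M(2)[OF st(1,2)] by simp
  qed
qed

lemma orbit_continuous_ip:
  assumes "x \<in> S" "z \<in> S"
  shows "continuous_on {0..a} (\<lambda>t. ip (T t x) z)"
  unfolding continuous_on_iff
proof (intro ballI allI impI)
  fix t e :: real assume t: "t \<in> {0..a}" and e: "e > 0"
  have nz: "nrm z \<ge> 0" using assms nrm_nonneg by simp
  obtain d where d: "d > 0" "\<And>s t. s \<in> {0..a} \<Longrightarrow> t \<in> {0..a} \<Longrightarrow> \<bar>s - t\<bar> < d \<Longrightarrow> nrm (T s x - T t x) < e / (nrm z + 1)"
    using orbit_close[OF assms(1), of "e / (nrm z + 1)" a] e nz by auto
  show "\<exists>d>0. \<forall>s\<in>{0..a}. dist s t < d \<longrightarrow> dist (ip (T s x) z) (ip (T t x) z) < e"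
  proof (intro exI[of _ d] conjI ballI impI d(1))
    fix s assume s: "s \<in> {0..a}" "dist s t < d"
    have "dist (ip (T s x) z) (ip (T t x) z) = \<bar>ip (T s x - T t x) z\<bar>"
      using s t assms by (simp add: dist_real_def ip_diff T_in)
    also have "\<dots> \<le> nrm (T s x - T t x) * nrm z"
      using s t assms by (intro Cauchy_Schwarz closed T_in) auto
    also have "\<dots> \<le> e / (nrm z + 1) * nrm z"
      using d(2)[OF s(1) t] s(2) nz by (intro mult_right_mono) (auto simp: dist_real_def)
    also have "\<dots> < e" using nz e by (simp add: field_simps)
    finally show "dist (ip (T s x) z) (ip (T t x) z) < e" .
  qed
qed

lemma integrable_orbit_ip: "x \<in> S \<Longrightarrow> w \<in> S \<Longrightarrow> 0 \<le> a \<Longrightarrow> (\<lambda>s. ip (T s x) w) integrable_on {a..b}"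
  by (rule integrable_continuous_interval, rule continuous_on_subset[OF orbit_continuous_ip[where a = b]]) auto

text \<open>
  The mean value of an orbit over \<open>[0, t]\<close>. Representing the averaged inner products by Riesz'
  theorem replaces the integration of vector-valued functions.
\<close>

lemma orbit_average:
  assumes x: "x \<in> S" and t: "t > 0"
  obtains y where "y \<in> S" "\<And>w. w \<in> S \<Longrightarrow> ip y w = (1/t) * integral {0..t} (\<lambda>s. ip (T s x) w)"
proof -
  define l where "l w = (1/t) * integral {0..t} (\<lambda>s. ip (T s x) w)" for w
  obtain M where M: "M \<ge> 0" "\<And>s z. s \<in> {0..t} \<Longrightarrow> z \<in> S \<Longrightarrow> nrm (T s z) \<le> M * nrm z"
    using locally_bounded[of t] by blast
  have "\<bar>l w\<bar> \<le> (M * nrm x) * nrm w" if w: "w \<in> S" for w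
  proof -
    have "norm (integral {0..t} (\<lambda>s. ip (T s x) w)) \<le> (M * nrm x * nrm w) * (t - 0)"
    proof (rule integral_bound)
      show "norm (ip (T s x) w) \<le> M * nrm x * nrm w" if s: "s \<in> {0..t}" for s
      proof -
        have "norm (ip (T s x) w) \<le> nrm (T s x) * nrm w"
          using Cauchy_Schwarz[OF T_in[OF _ x] w, of s] s by simp
        also have "\<dots> \<le> M * nrm x * nrm w" by (intro mult_right_mono M s x nrm_nonneg w)
        finally show ?thesis .
      qed
    qed (use t orbit_continuous_ip x w in auto)
    then show ?thesis using t by (simp add: l_def abs_mult field_simps)
  qed
  moreover have "l (w + v) = l w + l v" if "w \<in> S" "v \<in> S" for w v
  proof -
    have "integral {0..t} (\<lambda>s. ip (T s x) (w + v)) = integral {0..t} (\<lambda>s. ip (T s x) w + ip (T s x) v)"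
      using that x by (intro integral_cong) (simp add: ip_add_right T_in)
    also have "\<dots> = integral {0..t} (\<lambda>s. ip (T s x) w) + integral {0..t} (\<lambda>s. ip (T s x) v)"
      using that x by (intro integral_add integrable_orbit_ip) auto
    finally show ?thesis by (simp add: l_def algebra_simps)
  qed
  moreover have "l (scl (complex_of_real r) w) = r * l w" if "w \<in> S" for w r
  proof -
    have "integral {0..t} (\<lambda>s. ip (T s x) (scl (complex_of_real r) w)) = integral {0..t} (\<lambda>s. r * ip (T s x) w)"
      using that x by (intro integral_cong) (simp add: ip_scl_right T_in)
    then show ?thesis by (simp add: l_def)
  qed
  ultimately obtain y where "y \<in> S" "\<And>w. w \<in> S \<Longrightarrow> ip w y = l w" using riesz[of l] by blast
  with that show ?thesis by (metis ip_sym l_def)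
qed

text \<open>
  Since orbit averages are characterized by inner products, an operator \<open>T h\<close> is applied to them
  by moving it to the other factor.
\<close>

lemma adjoint:
  assumes h: "h \<ge> 0" and w: "w \<in> S"
  obtains v where "v \<in> S" "\<And>x. x \<in> S \<Longrightarrow> ip (T h x) w = ip x v"
proof -
  obtain M where M: "\<And>x. x \<in> S \<Longrightarrow> nrm (T h x) \<le> M * nrm x" using T_bounded[OF h] by blast
  have "\<bar>ip (T h x) w\<bar> \<le> (M * nrm w) * nrm x" if x: "x \<in> S" for x
  proof -
    have "\<bar>ip (T h x) w\<bar> \<le> nrm (T h x) * nrm w" by (intro Cauchy_Schwarz T_in h x w)
    also have "\<dots> \<le> (M * nrm x) * nrm w" by (intro mult_right_mono M x nrm_nonneg w)
    finally show ?thesis by (simp add: mult.commute mult.left_commute)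
  qed
  then obtain v where "v \<in> S" "\<And>x. x \<in> S \<Longrightarrow> ip x v = ip (T h x) w"
    using riesz[of "\<lambda>x. ip (T h x) w"] h w by (auto simp: ip_T_add ip_T_scl)
  with that show ?thesis by metis
qed

lemma integral_near_start:
  assumes x: "x \<in> S" and w: "w \<in> S" and a: "a \<ge> 0" and h: "h \<ge> 0"
    and close: "\<And>s. s \<in> {a..a+h} \<Longrightarrow> nrm (T s x - T a x) \<le> e"
  shows "\<bar>integral {a..a+h} (\<lambda>s. ip (T s x) w) - h * ip (T a x) w\<bar> \<le> h * (e * nrm w)"
proof -
  have "integral {a..a+h} (\<lambda>s. ip (T s x) w) - h * ip (T a x) w =
        integral {a..a+h} (\<lambda>s. ip (T s x) w) - integral {a..a+h} (\<lambda>s. ip (T a x) w)"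
    using h by simp
  also have "\<dots> = integral {a..a+h} (\<lambda>s. ip (T s x) w - ip (T a x) w)"
    using a x w by (intro integral_diff[symmetric] integrable_orbit_ip) auto
  also have "norm \<dots> \<le> (e * nrm w) * (a + h - a)"
  proof (rule integral_bound)
    show "continuous_on {a..a+h} (\<lambda>s. ip (T s x) w - ip (T a x) w)"
      by (intro continuous_intros continuous_on_subset[OF orbit_continuous_ip[where a = "a+h"]] x w) (use a in auto)
    show "norm (ip (T s x) w - ip (T a x) w) \<le> e * nrm w" if s: "s \<in> {a..a+h}" for s
    proof -
      have i: "T s x \<in> S" "T a x \<in> S" using a s x by (auto intro: T_in)
      have "norm (ip (T s x) w - ip (T a x) w) \<le> nrm (T s x - T a x) * nrm w"
        using Cauchy_Schwarz[OF diff_in[OF i] w] by (simp add: ip_diff i w)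
      also have "\<dots> \<le> e * nrm w" by (intro mult_right_mono close s nrm_nonneg w)
      finally show ?thesis .
    qed
  qed (use h in simp)
  finally show ?thesis by (simp add: mult.commute)
qed

text \<open>
  The classical proof that the domain of a generator is dense: \<open>T h\<close> shifts the interval of
  integration, so the difference quotient of the average consists of averages over the two short
  intervals at the ends.
\<close>

lemma orbit_average_differentiable:
  assumes x: "x \<in> S" and t: "t > 0" and y: "y \<in> S"
    and ipy: "\<And>w. w \<in> S \<Longrightarrow> ip y w = (1/t) * integral {0..t} (\<lambda>s. ip (T s x) w)"
  shows "right_deriv_0 nrm scl T y (scl (complex_of_real (1/t)) (T t x - x))"
  unfolding right_deriv_0_def
proof (rule tendstoI)
  fix e :: real assume e: "e > 0"
  define Z where "Z = scl (complex_of_real (1/t)) (T t x - x)"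
  have Z: "Z \<in> S" unfolding Z_def using t x by (intro closed T_in) auto
  define e' where "e' = e * t / 4"
  have e': "e' > 0" using e t by (simp add: e'_def)
  obtain d where d: "d > 0" "\<And>s r. s \<in> {0..t+1} \<Longrightarrow> r \<in> {0..t+1} \<Longrightarrow> \<bar>s - r\<bar> < d \<Longrightarrow> nrm (T s x - T r x) < e'"
    using orbit_close[OF x e', of "t+1"] by metis
  have "nrm (scl (complex_of_real (1 / h)) (T h y - y) - Z) \<le> 2 * e' / t" if h: "0 < h" "h < min (min d 1) t" for h
  proof (rule nrm_le_dual)
    show "scl (complex_of_real (1 / h)) (T h y - y) - Z \<in> S" using h Z y by (intro closed T_in) auto
    show "0 \<le> 2 * e' / t" using e' t by simp
    fix w assume w: "w \<in> S"
    define g where "g s = ip (T s x) w" for s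
    have gi: "g integrable_on {a..b}" if "0 \<le> a" for a b
      unfolding g_def by (intro integrable_orbit_ip x w that)
    obtain v where v: "v \<in> S" "\<And>x. x \<in> S \<Longrightarrow> ip (T h x) w = ip x v" using adjoint[OF _ w] h by (metis less_imp_le)
    have "ip (T h y) w = ip y v" using v y by simp
    also have "\<dots> = (1/t) * integral {0..t} (\<lambda>s. ip (T s x) v)" by (rule ipy[OF v(1)])
    also have "integral {0..t} (\<lambda>s. ip (T s x) v) = integral {0..t} (\<lambda>s. g (s + h))"
    proof (rule integral_cong)
      fix s assume s: "s \<in> {0..t}"
      then show "ip (T s x) v = g (s + h)"
        using v(2)[of "T s x"] ip_T_plus[of h s x w] x h w by (simp add: T_in g_def add.commute)
    qed
    also have "integral {0..t} (\<lambda>s. g (s + h)) = integral {h..t+h} g"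
      using integral_shift_Icc_real[of 0 t g h] by (simp add: comp_def add.commute)
    also have "\<dots> = integral {0..t} g + integral {t..t+h} g - integral {0..h} g"
      using Henstock_Kurzweil_Integration.integral_combine[of 0 h "t+h" g]
        Henstock_Kurzweil_Integration.integral_combine[of 0 t "t+h" g] gi[of 0 "t+h"] h t by simp
    finally have 1: "ip (T h y - y) w = (1/t) * (integral {t..t+h} g - integral {0..h} g)"
      using y w h ipy[OF w] by (simp add: ip_diff T_in g_def[abs_def] algebra_simps)
    have "ip (scl (complex_of_real (1 / h)) (T h y - y) - Z) w
        = (1/h) * ip (T h y - y) w - (1/t) * (ip (T t x) w - ip x w)"
      unfolding Z_def using h t x y w
      by (simp add: ip_diff ip_scl closed T_in del: of_real_divide)
    also have "\<dots> = (1/(t*h)) * ((integral {t..t+h} g - h * ip (T t x) w) - (integral {0..0+h} g - h * ip (T 0 x) w))"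
      unfolding 1 using h t ip_T_0[OF x w] by (simp add: field_simps)
    also have "\<dots> \<le> (1/(t*h)) * (2 * (h * (e' * nrm w)))"
    proof (rule mult_left_mono)
      have "\<bar>integral {t..t+h} g - h * ip (T t x) w\<bar> \<le> h * (e' * nrm w)"
        unfolding g_def using h t by (intro integral_near_start x w less_imp_le[OF d(2)]) auto
      moreover have "\<bar>integral {0..0+h} g - h * ip (T 0 x) w\<bar> \<le> h * (e' * nrm w)"
        unfolding g_def using h t by (intro integral_near_start x w less_imp_le[OF d(2)]) auto
      ultimately show "(integral {t..t+h} g - h * ip (T t x) w) - (integral {0..0+h} g - h * ip (T 0 x) w)
          \<le> 2 * (h * (e' * nrm w))" unfolding abs_le_iff by linarith
    qed (use h t in simp)
    also have "\<dots> = 2 * e' / t * nrm w" using h t by (simp add: field_simps)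
    finally show "ip (scl (complex_of_real (1 / h)) (T h y - y) - Z) w \<le> 2 * e' / t * nrm w" .
  qed
  moreover have "2 * e' / t < e" using e t by (simp add: e'_def field_simps)
  moreover have "nrm (scl (complex_of_real (1 / h)) (T h y - y) - Z) \<ge> 0" if "h > 0" for h
    using that Z y by (intro nrm_nonneg closed T_in) auto
  ultimately have "dist (nrm (scl (complex_of_real (1 / h)) (T h y - y) - Z)) 0 < e" if "0 < h" "h < min (min d 1) t" for h
    using that by (fastforce simp: dist_real_def)
  then show "\<forall>\<^sub>F h in at_right 0. dist (nrm (scl (complex_of_real (1 / h)) (T h y - y)
      - scl (complex_of_real (1/t)) (T t x - x))) 0 < e"
    unfolding Z_def using d(1) t by (intro eventually_at_rightI[of 0 "min (min d 1) t"]) auto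
qed

lemma generator_dense:
  assumes gen: "is_generator S nrm scl T D A" and x: "x \<in> S" and e: "e > 0"
  obtains y where "y \<in> D" "nrm (x - y) < e"
proof -
  obtain d where d: "d > 0" "\<And>s r. s \<in> {0..1} \<Longrightarrow> r \<in> {0..1} \<Longrightarrow> \<bar>s - r\<bar> < d \<Longrightarrow> nrm (T s x - T r x) < e / 2"
    using orbit_close[OF x, of "e / 2" 1] e by (metis half_gt_zero)
  define t where "t = min (d / 2) 1"
  have t: "t > 0" "t < d" "t \<le> 1" using d(1) by (auto simp: t_def)
  obtain y where y: "y \<in> S" and ipy: "\<And>w. w \<in> S \<Longrightarrow> ip y w = (1/t) * integral {0..t} (\<lambda>s. ip (T s x) w)"
    using orbit_average[OF x t(1)] by blast
  have "right_deriv_0 nrm scl T y (scl (complex_of_real (1/t)) (T t x - x))"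
    by (rule orbit_average_differentiable[OF x t(1) y ipy])
  moreover have "scl (complex_of_real (1/t)) (T t x - x) \<in> S" using t x by (intro closed T_in) auto
  ultimately have "y \<in> D" using gen y unfolding is_generator_def by blast
  moreover have "nrm (y - x) \<le> e / 2"
  proof (rule nrm_le_dual)
    fix w assume w: "w \<in> S"
    have "\<bar>integral {0..0+t} (\<lambda>s. ip (T s x) w) - t * ip (T 0 x) w\<bar> \<le> t * (e / 2 * nrm w)"
      using t by (intro integral_near_start x w less_imp_le[OF d(2)]) auto
    then have "\<bar>ip y w - ip x w\<bar> \<le> e / 2 * nrm w"
      using t ip_T_0[OF x w] unfolding ipy[OF w] by (simp add: abs_le_iff field_simps)
    then have "ip y w - ip x w \<le> e / 2 * nrm w" by (simp only: abs_le_iff)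
    then show "ip (y - x) w \<le> e / 2 * nrm w" using x y w by (simp only: ip_diff)
  qed (use x y e closed in auto)
  ultimately show ?thesis using that nrm_minus_commute[OF x y] e by simp
qed

lemma orbit_right_derivative_form:
  assumes B: "bounded_form B" and y: "y \<in> S" and Z: "Z \<in> S"
    and d: "right_deriv_0 nrm scl T y Z"
  shows "((\<lambda>h. (B (T h y) (T h y) - B y y) / h) \<longlongrightarrow> B Z y + B y Z) (at_right 0)"
proof -
  obtain C where C: "C \<ge> 0" "\<And>x y. x \<in> S \<Longrightarrow> y \<in> S \<Longrightarrow> \<bar>B x y\<bar> \<le> C * nrm x * nrm y"
    using bounded_form_bound[OF B] by metis
  define q where "q h = scl (complex_of_real (1 / h)) (T h y - y)" for h
  have q0: "((\<lambda>h. nrm (q h - Z)) \<longlongrightarrow> 0) (at_right 0)" using d unfolding right_deriv_0_def q_def .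
  have T0: "((\<lambda>h. nrm (T h y - y)) \<longlongrightarrow> 0) (at_right 0)" by (rule T_right[OF y])
  have "((\<lambda>h. (B (T h y) (T h y) - B y y) / h - (B Z y + B y Z)) \<longlongrightarrow> 0) (at_right 0)"
  proof (rule Lim_null_comparison)
    show "((\<lambda>h. C * nrm (q h - Z) * (nrm (T h y - y) + nrm y) + C * nrm Z * nrm (T h y - y)
        + C * nrm y * nrm (q h - Z)) \<longlongrightarrow> 0) (at_right 0)"
      by (rule tendsto_eq_intros q0 T0 refl | simp)+
    have "norm ((B (T h y) (T h y) - B y y) / h - (B Z y + B y Z)) \<le>
        C * nrm (q h - Z) * (nrm (T h y - y) + nrm y) + C * nrm Z * nrm (T h y - y) + C * nrm y * nrm (q h - Z)"
      if h: "h > 0" for h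
    proof -
      have Th: "T h y \<in> S" using h y by (intro T_in) auto
      have qh: "q h \<in> S" unfolding q_def using Th y by (intro closed)
      note i = Th qh y Z closed
      have 1: "B (q h) u = (B (T h y) u - B y u) / h" "B u (q h) = (B u (T h y) - B u y) / h" if "u \<in> S" for u
        unfolding q_def using that i by (simp_all only: bounded_formD(3,4)[OF B] bounded_form_diff[OF B]) simp_all
      have "(B (T h y) (T h y) - B y y) / h = B (q h) (T h y) + B y (q h)"
        unfolding 1[OF Th] 1[OF y] by (simp add: diff_divide_distrib)
      then have "(B (T h y) (T h y) - B y y) / h - (B Z y + B y Z) =
          B (q h - Z) (T h y) + B Z (T h y - y) + B y (q h - Z)"
        using i by (simp add: bounded_form_diff[OF B] closed)
      also have "norm \<dots> \<le> C * nrm (q h - Z) * nrm (T h y) + C * nrm Z * nrm (T h y - y) + C * nrm y * nrm (q h - Z)"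
        using C(2)[of "q h - Z" "T h y"] C(2)[of Z "T h y - y"] C(2)[of y "q h - Z"] i by simp
      also have "\<dots> \<le> C * nrm (q h - Z) * (nrm (T h y - y) + nrm y) + C * nrm Z * nrm (T h y - y) + C * nrm y * nrm (q h - Z)"
        using nrm_triangle[of "T h y - y" y] i C(1) by (intro add_right_mono mult_left_mono) (auto simp: nrm_nonneg)
      finally show ?thesis .
    qed
    then show "\<forall>\<^sub>F h in at_right 0. norm ((B (T h y) (T h y) - B y y) / h - (B Z y + B y Z)) \<le>
        C * nrm (q h - Z) * (nrm (T h y - y) + nrm y) + C * nrm Z * nrm (T h y - y) + C * nrm y * nrm (q h - Z)"
      by (intro eventually_mono[OF eventually_at_right_less]) auto
  qed
  then show ?thesis by (simp add: LIM_zero_iff)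
qed

lemma orbit_form_continuous:
  assumes B: "bounded_form B" and x: "x \<in> S"
  shows "continuous_on {0..} (\<lambda>t. B (T t x) (T t x))"
  unfolding continuous_on_iff
proof (intro ballI allI impI)
  fix t e :: real assume t: "t \<in> {0..}" and e: "e > 0"
  obtain C where C: "C \<ge> 0" "\<And>x y. x \<in> S \<Longrightarrow> y \<in> S \<Longrightarrow> \<bar>B x y\<bar> \<le> C * nrm x * nrm y"
    using bounded_form_bound[OF B] by metis
  have Tt: "T t x \<in> S" using t x by (intro T_in) auto
  define e' where "e' = min 1 (e / (C * (2 * nrm (T t x) + 1) + 1))"
  have p: "C * (2 * nrm (T t x) + 1) \<ge> 0" using C(1) nrm_nonneg[OF Tt] by simp
  then have e': "e' > 0" "e' \<le> 1" using e by (auto simp: e'_def)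
  obtain d where d: "d > 0" "\<And>s r. s \<in> {0..t+1} \<Longrightarrow> r \<in> {0..t+1} \<Longrightarrow> \<bar>s - r\<bar> < d \<Longrightarrow> nrm (T s x - T r x) < e'"
    using orbit_close[OF x e'(1), of "t+1"] by metis
  show "\<exists>d>0. \<forall>s\<in>{0..}. dist s t < d \<longrightarrow> dist (B (T s x) (T s x)) (B (T t x) (T t x)) < e"
  proof (intro exI[of _ "min d 1"] conjI ballI impI)
    fix s assume s: "s \<in> {0..}" "dist s t < min d 1"
    have Ts: "T s x \<in> S" using s x by (intro T_in) auto
    have n: "nrm (T s x - T t x) < e'" using s t by (intro d(2)) (auto simp: dist_real_def)
    have n': "nrm (T s x) \<le> nrm (T t x) + 1"
      using nrm_diff_ge[OF Ts Tt] n e' by (simp add: abs_le_iff)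
    have "B (T s x) (T s x) - B (T t x) (T t x) = B (T s x - T t x) (T s x) + B (T t x) (T s x - T t x)"
      using Ts Tt by (simp add: bounded_form_diff[OF B] closed)
    also have "norm \<dots> \<le> C * nrm (T s x - T t x) * nrm (T s x) + C * nrm (T t x) * nrm (T s x - T t x)"
      using C(2)[of "T s x - T t x" "T s x"] C(2)[of "T t x" "T s x - T t x"] Ts Tt closed by simp
    also have "\<dots> = (C * (nrm (T s x) + nrm (T t x))) * nrm (T s x - T t x)" by (simp add: algebra_simps)
    also have "\<dots> \<le> (C * (2 * nrm (T t x) + 1)) * nrm (T s x - T t x)"
      using n' C(1) by (intro mult_right_mono mult_left_mono nrm_nonneg closed Ts Tt) auto
    also have "\<dots> \<le> (C * (2 * nrm (T t x) + 1)) * e'" using p n by (intro mult_left_mono) auto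
    also have "\<dots> \<le> (C * (2 * nrm (T t x) + 1)) * (e / (C * (2 * nrm (T t x) + 1) + 1))"
      using p by (intro mult_left_mono) (auto simp: e'_def)
    also have "\<dots> < e" using p e by (simp add: field_simps)
    finally show "dist (B (T s x) (T s x)) (B (T t x) (T t x)) < e" by (simp add: dist_norm)
  qed (use d in auto)
qed

text \<open>
  For large \<open>K\<close> the form \<open>Q = K ip + b\<close> is equivalent to the energy, and the multiple of
  \<open>ip (A y) y\<close> in the hypothesis is dominated by the derivative of \<open>K ip\<close>. Then \<open>Q\<close> decays
  exponentially on orbits in the domain \<open>D\<close>, and so does the energy; the bound extends to \<open>S\<close> by
  density.
\<close>

theorem stable_of_Lyapunov_form:
  assumes gen: "is_generator S nrm scl T D A"
    and b: "bounded_form b" and c: "c > 0" and C: "C \<ge> 0"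
    and dissipative: "\<And>y. y \<in> D \<Longrightarrow> ip (A y) y \<le> 0"
    and Lyapunov: "\<And>y. y \<in> D \<Longrightarrow> b (A y) y + b y (A y) \<le> - c * ip y y - C * ip (A y) y"
    and x: "x \<in> S"
  shows "((\<lambda>t. nrm (T t x)) \<longlongrightarrow> 0) at_top"
proof -
  have DS: "D \<subseteq> S" and AS: "\<And>y. y \<in> D \<Longrightarrow> A y \<in> S"
    and Ad: "\<And>y. y \<in> D \<Longrightarrow> right_deriv_0 nrm scl T y (A y)"
    and DI: "\<And>y Z. y \<in> S \<Longrightarrow> Z \<in> S \<Longrightarrow> right_deriv_0 nrm scl T y Z \<Longrightarrow> y \<in> D"
    using gen unfolding is_generator_def by blast+
  obtain Cb where Cb: "Cb \<ge> 0" "\<And>x y. x \<in> S \<Longrightarrow> y \<in> S \<Longrightarrow> \<bar>b x y\<bar> \<le> Cb * nrm x * nrm y"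
    using bounded_form_bound[OF b] by metis
  \<comment> \<open>\<open>Cb + 1\<close> makes \<open>Q\<close> dominate \<open>ip\<close>; \<open>C\<close> lets \<open>2 K ip (A y) y\<close> absorb the dissipation term\<close>
  define K where "K = Cb + 1 + C"
  define Q where "Q x y = K * ip x y + b x y" for x y
  have Q: "bounded_form Q" unfolding Q_def by (rule bounded_form_lincomb[OF bounded_form_ip b])
  have bxx: "\<bar>b z z\<bar> \<le> Cb * ip z z" if "z \<in> S" for z
    using Cb(2)[OF that that] nrm_sq[OF that] by (simp add: power2_eq_square mult.assoc)
  have Q_ge: "ip z z \<le> Q z z" if "z \<in> S" for z
  proof -
    have "0 \<le> C * ip z z" using C ip_nonneg[OF that] by simp
    then show ?thesis using bxx[OF that] by (simp add: Q_def K_def algebra_simps abs_le_iff)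
  qed
  have Q_le: "Q z z \<le> (K + Cb) * ip z z" if "z \<in> S" for z
    using bxx[OF that] by (simp add: Q_def algebra_simps abs_le_iff)
  define k where "k = c / (K + Cb)"
  have KC: "K + Cb > 0" using Cb(1) C by (simp add: K_def)
  have k: "k > 0" using c KC by (simp add: k_def)
  have Q_decay: "Q (A y) y + Q y (A y) \<le> - k * Q y y" if y: "y \<in> D" for y
  proof -
    have yS: "y \<in> S" "A y \<in> S" using y DS AS by auto
    have "Q (A y) y + Q y (A y) = 2 * K * ip (A y) y + (b (A y) y + b y (A y))"
      using ip_sym[of y "A y"] yS by (simp add: Q_def)
    also have "\<dots> \<le> 2 * K * ip (A y) y + (- c * ip y y - C * ip (A y) y)" using Lyapunov[OF y] by simp
    also have "\<dots> = (2 * K - C) * ip (A y) y - c * ip y y" by (simp add: algebra_simps)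
    also have "\<dots> \<le> - c * ip y y"
      using dissipative[OF y] Cb(1) C mult_nonneg_nonpos[of "2 * K - C" "ip (A y) y"] by (simp add: K_def)
    also have "\<dots> \<le> - k * Q y y"
    proof -
      have "k * Q y y \<le> k * ((K + Cb) * ip y y)" using Q_le[OF yS(1)] k by (intro mult_left_mono) auto
      also have "\<dots> = c * ip y y" using KC by (simp add: k_def)
      finally show ?thesis by simp
    qed
    finally show ?thesis .
  qed
  have decay_D: "ip (T t y) (T t y) \<le> (K + Cb) * exp (- k * t) * ip y y" if y: "y \<in> D" and t: "t \<ge> 0" for y t
  proof -
    have yS: "y \<in> S" using y DS by auto
    define f where "f t = exp (k * t) * Q (T t y) (T t y)" for t
    \<comment> \<open>the domain is invariant, since \<open>T s\<close> commutes with difference quotients\<close>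
    have TD: "T s y \<in> D" if s: "s \<ge> 0" for s
    proof (rule DI)
      show Ts: "T s y \<in> S" using s yS by (rule T_in)
      show TA: "T s (A y) \<in> S" using s y by (intro T_in AS)
      obtain M where M: "\<And>x. x \<in> S \<Longrightarrow> nrm (T s x) \<le> M * nrm x" using T_bounded[OF s] by blast
      show "right_deriv_0 nrm scl T (T s y) (T s (A y))" unfolding right_deriv_0_def
      proof (rule tendsto_sandwich[where f = "\<lambda>_. 0"])
        have "((\<lambda>h. M * nrm (scl (complex_of_real (1 / h)) (T h y - y) - A y)) \<longlongrightarrow> M * 0) (at_right 0)"
          using Ad[OF y] unfolding right_deriv_0_def by (intro tendsto_intros)
        then show "((\<lambda>h. M * nrm (scl (complex_of_real (1 / h)) (T h y - y) - A y)) \<longlongrightarrow> 0) (at_right 0)" by simp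
        have eq: "nrm (scl (complex_of_real (1 / h)) (T h (T s y) - T s y) - T s (A y)) =
            nrm (T s (scl (complex_of_real (1 / h)) (T h y - y) - A y))" if h: "h > 0" for h
        proof -
          have h0: "h \<ge> 0" using h by simp
          have i: "T h y \<in> S" "T h (T s y) \<in> S" "T s (T h y) \<in> S" using h0 s yS by (auto intro: T_in)
          have i2: "scl (complex_of_real (1 / h)) (T h y - y) \<in> S" using i yS by (intro closed)
          have "ip (T h (T s y)) w = ip (T s (T h y)) w" if w: "w \<in> S" for w
            using ip_T_plus[OF s h0 yS w] ip_T_plus[OF h0 s yS w] by (simp add: add.commute)
          then have "ip ((scl (complex_of_real (1 / h)) (T h (T s y) - T s y) - T s (A y)) -
            T s (scl (complex_of_real (1 / h)) (T h y - y) - A y)) w = 0" if w: "w \<in> S" for w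
            using w i i2 Ts TA yS AS[OF y] s
            by (simp add: ip_diff ip_T_diff ip_scl ip_T_scl closed T_in del: of_real_divide)
          then have "nrm ((scl (complex_of_real (1 / h)) (T h (T s y) - T s y) - T s (A y)) -
            T s (scl (complex_of_real (1 / h)) (T h y - y) - A y)) = 0"
            unfolding nrm_def using i i2 Ts TA yS AS[OF y] s by (simp add: closed T_in)
          then show ?thesis using i i2 Ts TA yS AS[OF y] s h0 by (intro nrm0_nrm closed T_in)
        qed
        show "\<forall>\<^sub>F h in at_right 0. nrm (scl (complex_of_real (1 / h)) (T h (T s y) - T s y) - T s (A y))
            \<le> M * nrm (scl (complex_of_real (1 / h)) (T h y - y) - A y)"
        proof (rule eventually_mono[OF eventually_at_right_less])
          fix h :: real assume h: "0 < h"
          have "nrm (T s (scl (complex_of_real (1 / h)) (T h y - y) - A y)) \<le> M * nrm (scl (complex_of_real (1 / h)) (T h y - y) - A y)"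
            using h yS AS[OF y] by (intro M closed T_in) auto
          then show "nrm (scl (complex_of_real (1 / h)) (T h (T s y) - T s y) - T s (A y))
            \<le> M * nrm (scl (complex_of_real (1 / h)) (T h y - y) - A y)" using eq[OF h] by simp
        qed
        show "\<forall>\<^sub>F h in at_right 0. 0 \<le> nrm (scl (complex_of_real (1 / h)) (T h (T s y) - T s y) - T s (A y))"
          by (rule eventually_mono[OF eventually_at_right_less]) (auto intro!: nrm_nonneg closed T_in Ts TA)
      qed auto
    qed
    have "f t \<le> f 0"
    proof (rule nonincreasing_of_right_derivative_nonpos[OF _ _ t])
      show "continuous_on {0..} f" unfolding f_def
        by (intro continuous_intros orbit_form_continuous[OF Q yS])
      fix s :: real assume s: "s \<ge> 0"
      define y' where "y' = T s y"
      have y': "y' \<in> D" "y' \<in> S" using TD[OF s] DS by (auto simp: y'_def)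
      define q where "q = Q (A y') y' + Q y' (A y')"
      have l1: "((\<lambda>h. (Q (T h y') (T h y') - Q y' y') / h) \<longlongrightarrow> q) (at_right 0)"
        unfolding q_def by (rule orbit_right_derivative_form[OF Q y'(2) AS[OF y'(1)] Ad[OF y'(1)]])
      have "((\<lambda>h. (exp (k * h) - 1) / h) \<longlongrightarrow> k) (at 0)"
      proof -
        have "((\<lambda>h. exp (k * h)) has_real_derivative k) (at 0)"
          by (auto intro!: derivative_eq_intros)
        then show ?thesis by (simp add: DERIV_def)
      qed
      then have l2: "((\<lambda>h. (exp (k * h) - 1) / h) \<longlongrightarrow> k) (at_right 0)"
        by (rule filterlim_mono) (auto simp: at_le)
      have l3: "((\<lambda>h. exp (k * h)) \<longlongrightarrow> exp (k * 0)) (at_right 0)" by (intro tendsto_intros)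
      have "((\<lambda>h. exp (k * s) * (exp (k * h) * ((Q (T h y') (T h y') - Q y' y') / h) + (exp (k * h) - 1) / h * Q y' y'))
          \<longlongrightarrow> exp (k * s) * (exp (k * 0) * q + k * Q y' y')) (at_right 0)"
        by (intro tendsto_intros l1 l2 l3)
      then have "((\<lambda>h. (f (s + h) - f s) / h) \<longlongrightarrow> exp (k * s) * (exp (k * 0) * q + k * Q y' y')) (at_right 0)"
      proof (rule Lim_transform_eventually)
        show "\<forall>\<^sub>F h in at_right 0. exp (k * s) * (exp (k * h) * ((Q (T h y') (T h y') - Q y' y') / h) + (exp (k * h) - 1) / h * Q y' y')
          = (f (s + h) - f s) / h"
      proof (rule eventually_mono[OF eventually_at_right_less])
        fix h :: real assume h: "0 < h"
        have i: "T (s + h) y \<in> S" "T h y' \<in> S" using s h yS y' by (auto intro!: T_in)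
        have n0: "nrm (T (s + h) y - T h y') = 0" unfolding y'_def using T_plus[of h s y] s h yS by (simp add: add.commute)
        obtain CQ where CQ: "\<And>x y. x \<in> S \<Longrightarrow> y \<in> S \<Longrightarrow> \<bar>Q x y\<bar> \<le> CQ * nrm x * nrm y"
          using bounded_form_bound[OF Q] by metis
        have "Q (T (s + h) y - T h y') (T (s + h) y) = 0" "Q (T h y') (T (s + h) y - T h y') = 0"
          using CQ[of "T (s + h) y - T h y'" "T (s + h) y"] CQ[of "T h y'" "T (s + h) y - T h y'"] n0 i closed by auto
        then have "Q (T (s + h) y) (T (s + h) y) = Q (T h y') (T h y')"
          using i by (simp add: bounded_form_diff[OF Q] closed)
        then show "exp (k * s) * (exp (k * h) * ((Q (T h y') (T h y') - Q y' y') / h) + (exp (k * h) - 1) / h * Q y' y')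
          = (f (s + h) - f s) / h"
          unfolding f_def using h by (simp add: y'_def[symmetric] field_simps exp_add)
      qed
      qed
      then have "((\<lambda>h. (f (s + h) - f s) / h) \<longlongrightarrow> exp (k * s) * (q + k * Q y' y')) (at_right 0)" by simp
      moreover have "exp (k * s) * (q + k * Q y' y') \<le> 0"
        using Q_decay[OF y'(1)] by (intro mult_nonneg_nonpos) (auto simp: q_def)
      ultimately show "\<exists>d\<le>0. ((\<lambda>h. (f (s + h) - f s) / h) \<longlongrightarrow> d) (at_right 0)" by blast
    qed
    moreover have "f 0 \<le> (K + Cb) * ip y y"
      using Q_le[OF T_in[OF order_refl yS]] nrm_T_0[OF yS] nrm_sq[OF yS] nrm_sq[OF T_in[OF order_refl yS]]
      by (simp add: f_def)
    moreover have "exp (k * t) * ip (T t y) (T t y) \<le> f t"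
      unfolding f_def by (intro mult_left_mono Q_ge T_in t yS) simp
    ultimately have "exp (k * t) * ip (T t y) (T t y) \<le> (K + Cb) * ip y y" by linarith
    then show ?thesis by (simp add: exp_minus field_simps)
  qed
  \<comment> \<open>the decay on \<open>D\<close> in terms of the norm, in a form that extends to limits\<close>
  define c2 where "c2 = sqrt (K + Cb)"
  have decay_D': "nrm (T t y) \<le> c2 * exp (- k * t / 2) * nrm y" if y: "y \<in> D" and t: "t \<ge> 0" for y t
  proof (rule power2_le_imp_le)
    have yS: "y \<in> S" "T t y \<in> S" using y DS t by (auto intro: T_in)
    have "(exp (- k * t / 2))\<^sup>2 = exp (- k * t)" by (simp add: power2_eq_square flip: exp_add)
    then show "(nrm (T t y))\<^sup>2 \<le> (c2 * exp (- k * t / 2) * nrm y)\<^sup>2"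
      using decay_D[OF y t] KC by (simp add: power_mult_distrib nrm_sq yS c2_def)
    show "0 \<le> c2 * exp (- k * t / 2) * nrm y" using KC by (simp add: c2_def nrm_nonneg yS)
  qed
  have c2: "c2 \<ge> 0" using KC by (simp add: c2_def)
  have decay: "nrm (T t x) \<le> c2 * exp (- k * t / 2) * nrm x" if t: "t \<ge> 0" for t
  proof (rule field_le_epsilon)
    fix e :: real assume e: "e > 0"
    obtain M where M: "M \<ge> 0" "\<And>x. x \<in> S \<Longrightarrow> nrm (T t x) \<le> M * nrm x"
      using locally_bounded[of t] t by (metis atLeastAtMost_iff order_refl)
    define L where "L = c2 * exp (- k * t / 2)"
    have L: "L \<ge> 0" using c2 by (simp add: L_def)
    obtain y where y: "y \<in> D" "nrm (x - y) < e / (M + L + 1)"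
      using generator_dense[OF gen x, of "e / (M + L + 1)"] e M(1) L by auto
    have yS: "y \<in> S" using y DS by auto
    have "nrm (T t x) \<le> nrm (T t x - T t y) + nrm (T t y)"
      using nrm_triangle[of "T t x - T t y" "T t y"] t x yS by (simp add: closed T_in)
    also have "nrm (T t x - T t y) \<le> M * nrm (x - y)"
      using nrm_T_diff[OF t x yS] M(2)[OF diff_in[OF x yS]] by simp
    also have "nrm (T t y) \<le> L * nrm y" using decay_D'[OF y(1) t] by (simp add: L_def)
    also have "L * nrm y \<le> L * (nrm x + nrm (x - y))"
      using nrm_diff_ge[OF x yS] L by (intro mult_left_mono) (auto simp: abs_le_iff)
    finally have "nrm (T t x) \<le> L * nrm x + (M + L) * nrm (x - y)" by (simp add: algebra_simps)
    also have "(M + L) * nrm (x - y) \<le> (M + L) * (e / (M + L + 1))" using y M(1) L by (intro mult_left_mono) auto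
    also have "\<dots> \<le> e" using e M(1) L by (simp add: field_simps)
    finally show "nrm (T t x) \<le> c2 * exp (- k * t / 2) * nrm x + e" by (simp add: L_def)
  qed
  show ?thesis
  proof (rule tendsto_sandwich[where f = "\<lambda>_. 0"])
    have "((\<lambda>t. exp (- (k / 2) * t)) \<longlongrightarrow> 0) at_top"
    proof -
      have "filterlim (\<lambda>t. (k / 2) * t) at_top at_top"
        using k by (intro filterlim_tendsto_pos_mult_at_top[OF tendsto_const]) (auto intro: filterlim_ident)
      then have "filterlim (\<lambda>t. - (k / 2) * t) at_bot at_top" by (simp add: filterlim_uminus_at_bot)
      then show ?thesis by (rule filterlim_compose[OF exp_at_bot])
    qed
    then have "((\<lambda>t. c2 * exp (- (k / 2) * t) * nrm x) \<longlongrightarrow> c2 * 0 * nrm x) at_top" by (intro tendsto_intros)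
    then show "((\<lambda>t. c2 * exp (- k * t / 2) * nrm x) \<longlongrightarrow> 0) at_top" by simp
    show "\<forall>\<^sub>F t in at_top. nrm (T t x) \<le> c2 * exp (- k * t / 2) * nrm x"
      using eventually_ge_at_top[of 0] by eventually_elim (rule decay)
    show "\<forall>\<^sub>F t in at_top. 0 \<le> nrm (T t x)"
      using eventually_ge_at_top[of 0] by eventually_elim (intro nrm_nonneg T_in x)
  qed auto
qed

end

section \<open>Square integrable functions\<close>

abbreviation lebI :: "real \<Rightarrow> real measure" where "lebI L \<equiv> lebesgue_on {0<..<L}"

definition l2_norm :: "real \<Rightarrow> (real \<Rightarrow> complex) \<Rightarrow> real" where
  "l2_norm L f = sqrt (LINT x|lebI L. (cmod (f x))\<^sup>2)"

lemma finite_measure_lebI: "finite_measure (lebI L)"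
  by (rule finite_measure_lebesgue_on) simp

lemma l2_I: "f \<in> borel_measurable (lebI L) \<Longrightarrow> integrable (lebI L) (\<lambda>x. (cmod (f x))\<^sup>2) \<Longrightarrow> f \<in> l2 L"
  by (simp add: l2_def)

lemma l2_measurable: "f \<in> l2 L \<Longrightarrow> f \<in> borel_measurable (lebI L)"
  by (simp add: l2_def)

lemma l2_integrable_sq: "f \<in> l2 L \<Longrightarrow> integrable (lebI L) (\<lambda>x. (cmod (f x))\<^sup>2)"
  by (simp add: l2_def)

lemma l2_scale: "f \<in> l2 L \<Longrightarrow> (\<lambda>x. c * f x) \<in> l2 L"
  by (auto simp: l2_def norm_mult power_mult_distrib)

lemma l2_bounded_mult:
  assumes f: "f \<in> l2 L" and k: "k \<in> borel_measurable (lebI L)" and B: "\<And>x. x \<in> {0<..<L} \<Longrightarrow> cmod (k x) \<le> B"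
  shows "(\<lambda>x. k x * f x) \<in> l2 L"
proof (rule l2_I)
  show m: "(\<lambda>x. k x * f x) \<in> borel_measurable (lebI L)" using f k by (auto simp: l2_def)
  show "integrable (lebI L) (\<lambda>x. (cmod (k x * f x))\<^sup>2)"
  proof (rule Bochner_Integration.integrable_bound)
    show "integrable (lebI L) (\<lambda>x. B\<^sup>2 * (cmod (f x))\<^sup>2)" using f by (auto simp: l2_def)
    show "(\<lambda>x. (cmod (k x * f x))\<^sup>2) \<in> borel_measurable (lebI L)" using m by measurable
    show "AE x in lebI L. norm ((cmod (k x * f x))\<^sup>2) \<le> norm (B\<^sup>2 * (cmod (f x))\<^sup>2)"
    proof (rule AE_I2)
      fix x assume "x \<in> space (lebI L)"
      then have "cmod (k x) \<le> B" using B by (auto simp: space_restrict_space)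
      then show "norm ((cmod (k x * f x))\<^sup>2) \<le> norm (B\<^sup>2 * (cmod (f x))\<^sup>2)"
        by (auto simp: norm_mult power_mult_distrib intro!: mult_right_mono power_mono)
    qed
  qed
qed

lemma l2_add:
  assumes "f \<in> l2 L" "g \<in> l2 L"
  shows "(\<lambda>x. f x + g x) \<in> l2 L"
proof (rule l2_I)
  show m: "(\<lambda>x. f x + g x) \<in> borel_measurable (lebI L)" using assms by (auto simp: l2_def)
  show "integrable (lebI L) (\<lambda>x. (cmod (f x + g x))\<^sup>2)"
  proof (rule Bochner_Integration.integrable_bound)
    show "integrable (lebI L) (\<lambda>x. 2 * (cmod (f x))\<^sup>2 + 2 * (cmod (g x))\<^sup>2)" using assms by (auto simp: l2_def)
    show "(\<lambda>x. (cmod (f x + g x))\<^sup>2) \<in> borel_measurable (lebI L)" using m by measurable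
    have "(cmod (f x + g x))\<^sup>2 \<le> 2 * (cmod (f x))\<^sup>2 + 2 * (cmod (g x))\<^sup>2" for x
    proof -
      have "(cmod (f x + g x))\<^sup>2 \<le> (cmod (f x) + cmod (g x))\<^sup>2" by (intro power_mono norm_triangle_ineq) auto
      also have "\<dots> \<le> 2 * (cmod (f x))\<^sup>2 + 2 * (cmod (g x))\<^sup>2"
        using sum_squares_bound[of "cmod (f x)" "cmod (g x)"] by (simp add: power2_sum)
      finally show ?thesis .
    qed
    then show "AE x in lebI L. norm ((cmod (f x + g x))\<^sup>2) \<le> norm (2 * (cmod (f x))\<^sup>2 + 2 * (cmod (g x))\<^sup>2)"
      by (intro AE_I2) simp
  qed
qed

lemma l2_minus: "f \<in> l2 L \<Longrightarrow> (\<lambda>x. - f x) \<in> l2 L"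
  using l2_scale[of f L "-1"] by simp

lemma l2_diff: "f \<in> l2 L \<Longrightarrow> g \<in> l2 L \<Longrightarrow> (\<lambda>x. f x - g x) \<in> l2 L"
  using l2_add[of f L "\<lambda>x. - g x"] l2_minus[of g L] by simp

lemma l2_sum: "(\<And>i. i \<in> I \<Longrightarrow> f i \<in> l2 L) \<Longrightarrow> (\<lambda>x. \<Sum>i\<in>I. f i x) \<in> l2 L"
proof (induction I rule: infinite_finite_induct)
  case (insert i I)
  then show ?case using l2_add[of "f i" L "\<lambda>x. \<Sum>i\<in>I. f i x"] by simp
qed (auto simp: l2_def)

lemma l2_const: "(\<lambda>x. c) \<in> l2 L"
  using finite_measure_lebI[of L] by (auto simp: l2_def finite_measure.emeasure_finite finite_measure.integrable_const)

lemma l2_bounded: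
  assumes "f \<in> borel_measurable (lebI L)" "\<And>x. x \<in> {0<..<L} \<Longrightarrow> cmod (f x) \<le> B"
  shows "f \<in> l2 L"
  using l2_bounded_mult[OF l2_const[of 1] assms] by simp

lemma continuous_measurable_lebI:
  fixes f :: "real \<Rightarrow> complex"
  shows "continuous_on {0..L} f \<Longrightarrow> f \<in> borel_measurable (lebI L)"
  by (rule continuous_imp_measurable_on_sets_lebesgue) (auto intro: continuous_on_subset)

lemma l2_continuous:
  assumes "continuous_on {0..L} f"
  shows "f \<in> l2 L"
proof -
  have "bounded (f ` {0..L})" using assms by (intro compact_imp_bounded compact_continuous_image) auto
  then obtain B where "\<And>x. x \<in> {0..L} \<Longrightarrow> cmod (f x) \<le> B" unfolding bounded_iff by blast
  then show ?thesis using continuous_measurable_lebI[OF assms] by (intro l2_bounded[where B = B]) auto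
qed

lemma l2_continuous_mult:
  assumes "f \<in> l2 L" "continuous_on {0..L} k"
  shows "(\<lambda>x. k x * f x) \<in> l2 L"
proof -
  have "bounded (k ` {0..L})" using assms by (intro compact_imp_bounded compact_continuous_image) auto
  then obtain B where "\<And>x. x \<in> {0..L} \<Longrightarrow> cmod (k x) \<le> B" unfolding bounded_iff by blast
  then show ?thesis using continuous_measurable_lebI[OF assms(2)] assms(1) by (intro l2_bounded_mult[where B = B]) auto
qed

lemma l2_prod_integrable:
  assumes "f \<in> l2 L" "g \<in> l2 L"
  shows "integrable (lebI L) (\<lambda>x. f x * g x)"
proof (rule Bochner_Integration.integrable_bound)
  show "integrable (lebI L) (\<lambda>x. (cmod (f x))\<^sup>2 + (cmod (g x))\<^sup>2)" using assms by (auto simp: l2_def)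
  show "(\<lambda>x. f x * g x) \<in> borel_measurable (lebI L)" using assms by (auto simp: l2_def)
  have "cmod (f x) * cmod (g x) \<le> (cmod (f x))\<^sup>2 + (cmod (g x))\<^sup>2" for x
  proof -
    have "0 \<le> cmod (f x) * cmod (g x)" by simp
    then show ?thesis using sum_squares_bound[of "cmod (f x)" "cmod (g x)"] unfolding mult.assoc by linarith
  qed
  then show "AE x in lebI L. norm (f x * g x) \<le> norm ((cmod (f x))\<^sup>2 + (cmod (g x))\<^sup>2)"
    by (intro AE_I2) (simp add: norm_mult)
qed

lemma l2_cnj: "f \<in> l2 L \<Longrightarrow> (\<lambda>x. cnj (f x)) \<in> l2 L"
proof -
  assume f: "f \<in> l2 L"
  have "(\<lambda>x. cnj (f x)) \<in> borel_measurable (lebI L)"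
    using l2_measurable[OF f] by (rule borel_measurable_continuous_on[where f = cnj, rotated]) (intro continuous_intros)
  then show ?thesis using f by (simp add: l2_def)
qed

lemma l2_inner_integrable: "f \<in> l2 L \<Longrightarrow> g \<in> l2 L \<Longrightarrow> integrable (lebI L) (\<lambda>x. f x * cnj (g x))"
  by (intro l2_prod_integrable l2_cnj)

lemma l2_integrable: "f \<in> l2 L \<Longrightarrow> integrable (lebI L) f"
  using l2_prod_integrable[OF _ l2_const[of 1]] by simp

lemma l2_inner_add: "f \<in> l2 L \<Longrightarrow> g \<in> l2 L \<Longrightarrow> h \<in> l2 L \<Longrightarrow> l2_inner L (\<lambda>x. f x + g x) h = l2_inner L f h + l2_inner L g h"
  by (simp add: l2_inner_def distrib_right l2_inner_integrable)

lemma l2_inner_add_right: "f \<in> l2 L \<Longrightarrow> g \<in> l2 L \<Longrightarrow> h \<in> l2 L \<Longrightarrow> l2_inner L h (\<lambda>x. f x + g x) = l2_inner L h f + l2_inner L h g"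
  by (simp add: l2_inner_def distrib_left l2_inner_integrable)

lemma l2_inner_diff: "f \<in> l2 L \<Longrightarrow> g \<in> l2 L \<Longrightarrow> h \<in> l2 L \<Longrightarrow> l2_inner L (\<lambda>x. f x - g x) h = l2_inner L f h - l2_inner L g h"
  by (simp add: l2_inner_def left_diff_distrib l2_inner_integrable)

lemma l2_inner_scale: "l2_inner L (\<lambda>x. c * f x) h = c * l2_inner L f h"
  by (simp add: l2_inner_def mult.assoc)

lemma l2_inner_scale_right: "l2_inner L h (\<lambda>x. c * f x) = cnj c * l2_inner L h f"
  by (simp add: l2_inner_def mult.left_commute[of _ "cnj c"])

lemma l2_inner_commute:
  assumes "f \<in> l2 L" "g \<in> l2 L"
  shows "l2_inner L g f = cnj (l2_inner L f g)"
proof -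
  have "cnj (l2_inner L f g) = (LINT x|lebI L. cnj (f x * cnj (g x)))"
    unfolding l2_inner_def using Bochner_Integration.integral_bounded_linear[OF bounded_linear_cnj l2_inner_integrable[OF assms]] by simp
  then show ?thesis by (simp add: l2_inner_def mult.commute)
qed

lemma l2_inner_sum: "(\<And>i. i \<in> I \<Longrightarrow> f i \<in> l2 L) \<Longrightarrow> h \<in> l2 L \<Longrightarrow>
    l2_inner L (\<lambda>x. \<Sum>i\<in>I. f i x) h = (\<Sum>i\<in>I. l2_inner L (f i) h)"
  by (simp add: l2_inner_def sum_distrib_right l2_inner_integrable)

lemma l2_inner_cong_AE:
  assumes "AE x in lebI L. f x = f' x" "AE x in lebI L. g x = g' x"
    "f \<in> l2 L" "f' \<in> l2 L" "g \<in> l2 L" "g' \<in> l2 L"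
  shows "l2_inner L f g = l2_inner L f' g'"
  unfolding l2_inner_def
proof (rule integral_cong_AE)
  show "AE x in lebI L. f x * cnj (g x) = f' x * cnj (g' x)" using assms(1,2) by eventually_elim simp
qed (use assms l2_inner_integrable in auto)

lemma l2_inner_self: "f \<in> l2 L \<Longrightarrow> l2_inner L f f = of_real ((l2_norm L f)\<^sup>2)"
proof -
  assume f: "f \<in> l2 L"
  have "l2_inner L f f = (LINT x|lebI L. complex_of_real ((cmod (f x))\<^sup>2))"
    unfolding l2_inner_def by (simp only: complex_norm_square)
  also have "\<dots> = of_real (LINT x|lebI L. (cmod (f x))\<^sup>2)" by (rule integral_complex_of_real)
  finally show ?thesis by (simp add: l2_norm_def)
qed

lemma l2_norm_nonneg: "0 \<le> l2_norm L f"
  by (simp add: l2_norm_def)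

lemma l2_norm_cong_AE:
  assumes "AE x in lebI L. f x = g x" "f \<in> l2 L" "g \<in> l2 L"
  shows "l2_norm L f = l2_norm L g"
  unfolding l2_norm_def
  by (rule arg_cong[where f = sqrt], rule integral_cong_AE)
    (use assms in \<open>auto simp: l2_def elim: eventually_mono\<close>)

lemma l2_norm_minus_commute: "l2_norm L (\<lambda>x. f x - g x) = l2_norm L (\<lambda>x. g x - f x)"
  by (simp add: l2_norm_def norm_minus_commute)

lemma l2_Cauchy_Schwarz:
  assumes f: "f \<in> l2 L" and g: "g \<in> l2 L"
  shows "(LINT x|lebI L. cmod (f x) * cmod (g x)) \<le> l2_norm L f * l2_norm L g"
proof -
  let ?I = "LINT x|lebI L. cmod (f x) * cmod (g x)"
  have i: "integrable (lebI L) (\<lambda>x. cmod (f x) * cmod (g x))"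
    using integrable_norm[OF l2_prod_integrable[OF f g]] by (simp add: norm_mult)
  have nn: "?I \<ge> 0" by (intro integral_nonneg_AE) simp
  have "0 \<le> (l2_norm L f)\<^sup>2 - 2 * r * ?I + r\<^sup>2 * (l2_norm L g)\<^sup>2" for r
  proof -
    have "0 \<le> (LINT x|lebI L. (cmod (f x) - r * cmod (g x))\<^sup>2)" by (intro integral_nonneg_AE) simp
    also have "\<dots> = (LINT x|lebI L. (cmod (f x))\<^sup>2 - 2 * r * (cmod (f x) * cmod (g x)) + r\<^sup>2 * (cmod (g x))\<^sup>2)"
      by (intro Bochner_Integration.integral_cong) (auto simp: power2_eq_square algebra_simps)
    also have "\<dots> = (l2_norm L f)\<^sup>2 - 2 * r * ?I + r\<^sup>2 * (l2_norm L g)\<^sup>2"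
      using i l2_integrable_sq[OF f] l2_integrable_sq[OF g] by (simp add: l2_norm_def)
    finally show ?thesis .
  qed
  from nonneg_quadratic_discriminant[OF this]
  have "?I\<^sup>2 \<le> (l2_norm L f * l2_norm L g)\<^sup>2" by (simp add: power_mult_distrib)
  then show ?thesis by (rule power2_le_imp_le) (simp add: l2_norm_nonneg)
qed

lemma l2_inner_bound:
  assumes "f \<in> l2 L" "g \<in> l2 L"
  shows "cmod (l2_inner L f g) \<le> l2_norm L f * l2_norm L g"
proof -
  have "cmod (l2_inner L f g) \<le> (LINT x|lebI L. cmod (f x * cnj (g x)))"
    unfolding l2_inner_def by (rule integral_norm_bound)
  then show ?thesis using l2_Cauchy_Schwarz[OF assms] by (simp add: norm_mult)
qed

lemma l2_norm_triangle:
  assumes f: "f \<in> l2 L" and g: "g \<in> l2 L"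
  shows "l2_norm L (\<lambda>x. f x + g x) \<le> l2_norm L f + l2_norm L g"
proof (rule power2_le_imp_le)
  have i: "integrable (lebI L) (\<lambda>x. cmod (f x) * cmod (g x))"
    using integrable_norm[OF l2_prod_integrable[OF f g]] by (simp add: norm_mult)
  have "(l2_norm L (\<lambda>x. f x + g x))\<^sup>2 = (LINT x|lebI L. (cmod (f x + g x))\<^sup>2)" by (simp add: l2_norm_def)
  also have "\<dots> \<le> (LINT x|lebI L. (cmod (f x))\<^sup>2 + 2 * (cmod (f x) * cmod (g x)) + (cmod (g x))\<^sup>2)"
  proof (rule integral_mono)
    show "(cmod (f x + g x))\<^sup>2 \<le> (cmod (f x))\<^sup>2 + 2 * (cmod (f x) * cmod (g x)) + (cmod (g x))\<^sup>2" for x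
      using power_mono[OF norm_triangle_ineq[of "f x" "g x"], of 2] by (simp add: power2_sum algebra_simps)
  qed (use i l2_integrable_sq[OF f] l2_integrable_sq[OF g] l2_integrable_sq[OF l2_add[OF f g]] in auto)
  also have "\<dots> = (l2_norm L f)\<^sup>2 + 2 * (LINT x|lebI L. cmod (f x) * cmod (g x)) + (l2_norm L g)\<^sup>2"
    using i l2_integrable_sq[OF f] l2_integrable_sq[OF g] by (simp add: l2_norm_def)
  also have "\<dots> \<le> (l2_norm L f + l2_norm L g)\<^sup>2"
    using l2_Cauchy_Schwarz[OF f g] by (simp add: power2_sum)
  finally show "(l2_norm L (\<lambda>x. f x + g x))\<^sup>2 \<le> (l2_norm L f + l2_norm L g)\<^sup>2" .
qed (simp add: l2_norm_nonneg)

lemma l2_norm_triangle_diff: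
  assumes "f \<in> l2 L" "g \<in> l2 L" "h \<in> l2 L"
  shows "l2_norm L (\<lambda>x. f x - h x) \<le> l2_norm L (\<lambda>x. f x - g x) + l2_norm L (\<lambda>x. g x - h x)"
  using l2_norm_triangle[OF l2_diff[OF assms(1,2)] l2_diff[OF assms(2,3)]] by simp

lemma l2_norm_sum: "(\<And>i. i \<in> I \<Longrightarrow> f i \<in> l2 L) \<Longrightarrow> l2_norm L (\<lambda>x. \<Sum>i\<in>I. f i x) \<le> (\<Sum>i\<in>I. l2_norm L (f i))"
proof (induction I rule: infinite_finite_induct)
  case (insert i I)
  then show ?case using l2_norm_triangle[of "f i" L "\<lambda>x. \<Sum>i\<in>I. f i x"] l2_sum[of I f L] by simp
qed (auto simp: l2_norm_def)

lemma l2_norm_bounded_mult: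
  assumes f: "f \<in> l2 L" and k: "k \<in> borel_measurable (lebI L)" and B: "\<And>x. x \<in> {0<..<L} \<Longrightarrow> cmod (k x) \<le> B" "B \<ge> 0"
  shows "l2_norm L (\<lambda>x. k x * f x) \<le> B * l2_norm L f"
proof -
  have "(LINT x|lebI L. (cmod (k x * f x))\<^sup>2) \<le> (LINT x|lebI L. B\<^sup>2 * (cmod (f x))\<^sup>2)"
  proof (rule integral_mono)
    show "integrable (lebI L) (\<lambda>x. (cmod (k x * f x))\<^sup>2)" by (rule l2_integrable_sq[OF l2_bounded_mult[OF f k B(1)]])
    show "integrable (lebI L) (\<lambda>x. B\<^sup>2 * (cmod (f x))\<^sup>2)" using l2_integrable_sq[OF f] by auto
    fix x assume "x \<in> space (lebI L)"
    then show "(cmod (k x * f x))\<^sup>2 \<le> B\<^sup>2 * (cmod (f x))\<^sup>2" using B(1)[of x]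
      by (auto simp: norm_mult power_mult_distrib space_restrict_space intro!: mult_right_mono power_mono)
  qed
  also have "\<dots> = B\<^sup>2 * (LINT x|lebI L. (cmod (f x))\<^sup>2)" by simp
  finally have "l2_norm L (\<lambda>x. k x * f x) \<le> sqrt (B\<^sup>2 * (LINT x|lebI L. (cmod (f x))\<^sup>2))"
    unfolding l2_norm_def by (rule real_sqrt_le_mono)
  then show ?thesis using B(2) by (simp add: l2_norm_def real_sqrt_mult)
qed

lemma l2_norm_const: "L > 0 \<Longrightarrow> l2_norm L (\<lambda>x. c) = sqrt L * cmod c"
  by (simp add: l2_norm_def measure_restrict_space real_sqrt_mult)

lemma l2_norm_le_sup:
  assumes "f \<in> l2 L" "L > 0" "\<And>x. x \<in> {0<..<L} \<Longrightarrow> cmod (f x) \<le> B" "B \<ge> 0"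
  shows "l2_norm L f \<le> sqrt L * B"
  using l2_norm_bounded_mult[OF l2_const[of 1 L] l2_measurable[OF assms(1)] assms(3,4)]
  by (simp add: l2_norm_const[OF assms(2)] mult.commute)

lemma l2_norm_zero_iff:
  assumes "f \<in> l2 L"
  shows "l2_norm L f = 0 \<longleftrightarrow> (AE x in lebI L. f x = 0)"
  using integral_nonneg_eq_0_iff_AE[OF l2_integrable_sq[OF assms]] by (simp add: l2_norm_def)

lemma l2_dominated_convergence:
  assumes f: "f \<in> l2 L" and fn: "\<And>n. fn n \<in> l2 L" and w: "w \<in> l2 L"
    and lim: "AE x in lebI L. (\<lambda>n. fn n x) \<longlonglongrightarrow> f x"
    and bound: "\<And>n. AE x in lebI L. cmod (fn n x) \<le> cmod (w x)"
  shows "(\<lambda>n. l2_norm L (\<lambda>x. fn n x - f x)) \<longlonglongrightarrow> 0"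
proof -
  have "(\<lambda>n. LINT x|lebI L. (cmod (fn n x - f x))\<^sup>2) \<longlonglongrightarrow> (LINT x|lebI L. 0)"
  proof (rule integral_dominated_convergence[where w = "\<lambda>x. 4 * (cmod (w x))\<^sup>2"])
    show "integrable (lebI L) (\<lambda>x. 4 * (cmod (w x))\<^sup>2)" using l2_integrable_sq[OF w] by simp
    show "(\<lambda>x. (cmod (fn n x - f x))\<^sup>2) \<in> borel_measurable (lebI L)" for n
      using l2_integrable_sq[OF l2_diff[OF fn[of n] f]] by auto
    show "AE x in lebI L. (\<lambda>n. (cmod (fn n x - f x))\<^sup>2) \<longlonglongrightarrow> 0"
      using lim
    proof eventually_elim
      fix x assume "(\<lambda>n. fn n x) \<longlonglongrightarrow> f x"
      then have "(\<lambda>n. (cmod (fn n x - f x))\<^sup>2) \<longlonglongrightarrow> (cmod (f x - f x))\<^sup>2" by (intro tendsto_intros)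
      then show "(\<lambda>n. (cmod (fn n x - f x))\<^sup>2) \<longlonglongrightarrow> 0" by simp
    qed
    have "AE x in lebI L. \<forall>n. cmod (fn n x) \<le> cmod (w x)" using bound by (simp add: AE_all_countable)
    with lim have ae: "AE x in lebI L. \<forall>n. cmod (fn n x - f x) \<le> 2 * cmod (w x)"
    proof eventually_elim
      fix x assume l: "(\<lambda>n. fn n x) \<longlonglongrightarrow> f x" and b: "\<forall>n. cmod (fn n x) \<le> cmod (w x)"
      have "cmod (f x) \<le> cmod (w x)" by (rule LIMSEQ_le_const2[OF tendsto_norm[OF l]]) (use b in auto)
      then show "\<forall>n. cmod (fn n x - f x) \<le> 2 * cmod (w x)" using b norm_triangle_ineq4 by (smt (verit))
    qed
    show "AE x in lebI L. norm ((cmod (fn n x - f x))\<^sup>2) \<le> 4 * (cmod (w x))\<^sup>2" for n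
      using ae
    proof eventually_elim
      fix x assume "\<forall>n. cmod (fn n x - f x) \<le> 2 * cmod (w x)"
      then have "(cmod (fn n x - f x))\<^sup>2 \<le> (2 * cmod (w x))\<^sup>2" by (intro power_mono) auto
      then show "norm ((cmod (fn n x - f x))\<^sup>2) \<le> 4 * (cmod (w x))\<^sup>2" by (simp add: power_mult_distrib)
    qed
  qed auto
  then show ?thesis unfolding l2_norm_def using tendsto_real_sqrt[of _ 0] by simp
qed

text \<open>
  The Riesz-Fischer argument: the sum of the moduli of the increments is square integrable by
  monotone convergence, hence finite almost everywhere. It gives the pointwise limit and a
  dominating function.
\<close>

theorem l2_complete:
  assumes L: "L > 0" and f: "\<And>n. f n \<in> l2 L"
    and fast: "\<And>n. l2_norm L (\<lambda>x. f (Suc n) x - f n x) \<le> C * (1/2)^n"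
  obtains g where "g \<in> l2 L" "(\<lambda>n. l2_norm L (\<lambda>x. f n x - g x)) \<longlonglongrightarrow> 0"
proof -
  define d where "d n x = f (Suc n) x - f n x" for n x
  have d: "d n \<in> l2 L" for n unfolding d_def by (intro l2_diff f)
  have nd: "l2_norm L (d n) \<le> C * (1/2)^n" for n using fast[of n] by (simp add: d_def[abs_def])
  define h where "h x = (\<Sum>n. cmod (d n x))" for x
  have i1: "(LINT x|lebI L. cmod (d n x)) \<le> sqrt L * (C * (1/2)^n)" for n
  proof -
    have "(LINT x|lebI L. cmod (d n x)) \<le> l2_norm L (d n) * l2_norm L (\<lambda>x. 1)"
      using l2_Cauchy_Schwarz[OF d[of n] l2_const[of 1]] by simp
    also have "\<dots> \<le> sqrt L * (C * (1/2)^n)" using nd[of n] L by (simp add: l2_norm_const mult.commute mult_left_mono)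
    finally show ?thesis .
  qed
  have summ: "summable (\<lambda>n. C * (1/2::real)^n)" by (intro summable_mult summable_geometric) auto
  \<comment> \<open>partial sums of the moduli of the increments, bounded in \<open>L\<^sup>2\<close> uniformly in the number of terms\<close>
  define s where "s N x = (\<Sum>n<N. cmod (d n x))" for N x
  have smeas: "s N \<in> borel_measurable (lebI L)" for N unfolding s_def[abs_def] using l2_measurable[OF d] by measurable
  have s_l2: "(\<lambda>x. complex_of_real (s N x)) \<in> l2 L" for N
    unfolding s_def of_real_sum
  proof (rule l2_sum)
    fix n show "(\<lambda>x. complex_of_real (cmod (d n x))) \<in> l2 L" using d[of n] by (auto simp: l2_def)
  qed
  define B where "B = (\<Sum>n. C * (1/2::real)^n)"
  have C0: "C \<ge> 0" using order_trans[OF l2_norm_nonneg fast[of 0]] by simp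
  have s_norm: "l2_norm L (\<lambda>x. complex_of_real (s N x)) \<le> B" for N
  proof -
    have dn: "(\<lambda>x. complex_of_real (cmod (d n x))) \<in> l2 L" for n using d[of n] by (auto simp: l2_def)
    have "l2_norm L (\<lambda>x. complex_of_real (s N x)) \<le> (\<Sum>n<N. l2_norm L (\<lambda>x. complex_of_real (cmod (d n x))))"
      unfolding s_def of_real_sum by (rule l2_norm_sum[OF dn])
    also have "\<dots> \<le> (\<Sum>n<N. C * (1/2)^n)" using nd by (intro sum_mono) (simp add: l2_norm_def)
    also have "\<dots> \<le> B" unfolding B_def using C0 by (intro sum_le_suminf summ) auto
    finally show ?thesis .
  qed
  have s_sq: "(\<integral>\<^sup>+x. ennreal ((s N x)\<^sup>2) \<partial>lebI L) \<le> ennreal (B\<^sup>2)" for N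
  proof -
    have i: "integrable (lebI L) (\<lambda>x. (s N x)\<^sup>2)" using l2_integrable_sq[OF s_l2[of N]] by simp
    have "(\<integral>\<^sup>+x. ennreal ((s N x)\<^sup>2) \<partial>lebI L) = ennreal (LINT x|lebI L. (s N x)\<^sup>2)"
      by (rule nn_integral_eq_integral[OF i]) simp
    also have "(LINT x|lebI L. (s N x)\<^sup>2) = (l2_norm L (\<lambda>x. complex_of_real (s N x)))\<^sup>2" by (simp add: l2_norm_def)
    also have "ennreal \<dots> \<le> ennreal (B\<^sup>2)" by (intro ennreal_leI power_mono s_norm l2_norm_nonneg)
    finally show ?thesis .
  qed
  have mono: "incseq (\<lambda>N x. ennreal ((s N x)\<^sup>2))"
    by (auto simp: incseq_def le_fun_def s_def intro!: ennreal_leI power_mono sum_mono2 sum_nonneg)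
  have "(\<integral>\<^sup>+x. (SUP N. ennreal ((s N x)\<^sup>2)) \<partial>lebI L) = (SUP N. \<integral>\<^sup>+x. ennreal ((s N x)\<^sup>2) \<partial>lebI L)"
    by (rule nn_integral_monotone_convergence_SUP[OF mono]) (use smeas in measurable)
  also have "\<dots> \<le> ennreal (B\<^sup>2)" by (rule SUP_least) (rule s_sq)
  finally have fin: "(\<integral>\<^sup>+x. (SUP N. ennreal ((s N x)\<^sup>2)) \<partial>lebI L) \<le> ennreal (B\<^sup>2)" .
  have "AE x in lebI L. (SUP N. ennreal ((s N x)\<^sup>2)) \<noteq> \<infinity>"
    by (rule nn_integral_PInf_AE) (use fin smeas in \<open>auto simp: top_unique\<close>)
  then have ae: "AE x in lebI L. summable (\<lambda>n. cmod (d n x))"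
  proof eventually_elim
    fix x assume "(SUP N. ennreal ((s N x)\<^sup>2)) \<noteq> \<infinity>"
    then obtain b where b: "b \<ge> 0" "(SUP N. ennreal ((s N x)\<^sup>2)) = ennreal b" by (cases "SUP N. ennreal ((s N x)\<^sup>2)") auto
    have "s N x \<le> sqrt b" for N
    proof -
      have "ennreal ((s N x)\<^sup>2) \<le> ennreal b" unfolding b(2)[symmetric] by (rule SUP_upper) simp
      then show ?thesis using b(1) by (intro real_le_rsqrt) simp
    qed
    then show "summable (\<lambda>n. cmod (d n x))" unfolding s_def
      by (intro summableI_nonneg_bounded[where x = "sqrt b"]) auto
  qed
  define w where "w x = cmod (f 0 x) + h x" for x
  have "(\<lambda>x. cmod (d n x)) \<in> borel_measurable (lebI L)" for n using l2_measurable[OF d[of n]] by measurable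
  then have hmeas: "h \<in> borel_measurable (lebI L)" unfolding h_def[abs_def] by (intro borel_measurable_suminf)
  have "(\<integral>\<^sup>+x. ennreal ((h x)\<^sup>2) \<partial>lebI L) \<le> (\<integral>\<^sup>+x. (SUP N. ennreal ((s N x)\<^sup>2)) \<partial>lebI L)"
  proof (rule nn_integral_mono_AE)
    show "AE x in lebI L. ennreal ((h x)\<^sup>2) \<le> (SUP N. ennreal ((s N x)\<^sup>2))"
      using ae
    proof eventually_elim
      fix x assume "summable (\<lambda>n. cmod (d n x))"
      then have "(\<lambda>N. s N x) \<longlonglongrightarrow> h x" unfolding s_def h_def by (rule summable_LIMSEQ)
      then have "(\<lambda>N. ennreal ((s N x)\<^sup>2)) \<longlonglongrightarrow> ennreal ((h x)\<^sup>2)" by (intro tendsto_intros)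
      then show "ennreal ((h x)\<^sup>2) \<le> (SUP N. ennreal ((s N x)\<^sup>2))"
        by (rule LIMSEQ_le_const2) (intro exI[of _ 0] allI impI SUP_upper UNIV_I)
    qed
  qed
  from order_trans[OF this fin] have "(\<integral>\<^sup>+x. ennreal ((h x)\<^sup>2) \<partial>lebI L) < \<infinity>"
    by (rule order_le_less_trans) simp
  then have "integrable (lebI L) (\<lambda>x. (h x)\<^sup>2)"
    by (intro integrableI_bounded) (use hmeas in \<open>auto simp: abs_power2\<close>)
  then have h_l2: "(\<lambda>x. complex_of_real (h x)) \<in> l2 L"
    by (intro l2_I) (use hmeas in \<open>auto simp: abs_power2\<close>)
  have w_l2: "(\<lambda>x. complex_of_real (w x)) \<in> l2 L"
    unfolding w_def of_real_add by (intro l2_add h_l2) (use f[of 0] in \<open>auto simp: l2_def\<close>)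
  define g where "g x = lim (\<lambda>n. f n x)" for x
  have f_sum: "f n x = f 0 x + (\<Sum>k<n. d k x)" for n x
    by (induction n) (auto simp: d_def)
  have ae2: "AE x in lebI L. (\<lambda>n. f n x) \<longlonglongrightarrow> g x \<and> (\<forall>n. cmod (f n x) \<le> w x)"
    using ae
  proof eventually_elim
    fix x assume s: "summable (\<lambda>n. cmod (d n x))"
    have "(\<lambda>n. f 0 x + (\<Sum>k<n. d k x)) \<longlonglongrightarrow> f 0 x + (\<Sum>k. d k x)"
      by (intro tendsto_intros summable_LIMSEQ summable_norm_cancel[OF s])
    then have "(\<lambda>n. f n x) \<longlonglongrightarrow> f 0 x + (\<Sum>k. d k x)" by (simp add: f_sum[symmetric])
    moreover from this have "g x = f 0 x + (\<Sum>k. d k x)" unfolding g_def by (rule limI)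
    moreover have "cmod (f n x) \<le> w x" for n
    proof -
      have "cmod (f n x) \<le> cmod (f 0 x) + (\<Sum>k<n. cmod (d k x))" unfolding f_sum[of n]
        by (rule order_trans[OF norm_triangle_ineq add_left_mono[OF norm_sum]])
      also have "(\<Sum>k<n. cmod (d k x)) \<le> h x" unfolding h_def by (intro sum_le_suminf s) auto
      finally show ?thesis by (simp add: w_def)
    qed
    ultimately show "(\<lambda>n. f n x) \<longlonglongrightarrow> g x \<and> (\<forall>n. cmod (f n x) \<le> w x)" by simp
  qed
  have gmeas: "g \<in> borel_measurable (lebI L)" unfolding g_def[abs_def]
    by (rule borel_measurable_lim_metric) (use f in \<open>auto simp: l2_def\<close>)
  have g_l2: "g \<in> l2 L"
  proof (rule l2_I[OF gmeas], rule Bochner_Integration.integrable_bound)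
    show "integrable (lebI L) (\<lambda>x. (cmod (complex_of_real (w x)))\<^sup>2)" by (rule l2_integrable_sq[OF w_l2])
    show "AE x in lebI L. norm ((cmod (g x))\<^sup>2) \<le> norm ((cmod (complex_of_real (w x)))\<^sup>2)"
      using ae2
    proof eventually_elim
      fix x assume a: "(\<lambda>n. f n x) \<longlonglongrightarrow> g x \<and> (\<forall>n. cmod (f n x) \<le> w x)"
      have "cmod (g x) \<le> w x" by (rule LIMSEQ_le_const2[OF tendsto_norm]) (use a in auto)
      then have "cmod (g x) \<le> cmod (complex_of_real (w x))" by simp
      then show "norm ((cmod (g x))\<^sup>2) \<le> norm ((cmod (complex_of_real (w x)))\<^sup>2)"
        by (simp add: power_mono del: norm_of_real)
    qed
  qed (use gmeas in measurable)
  have "(\<lambda>n. l2_norm L (\<lambda>x. f n x - g x)) \<longlonglongrightarrow> 0"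
  proof (rule l2_dominated_convergence[OF g_l2 f w_l2])
    show "AE x in lebI L. (\<lambda>n. f n x) \<longlonglongrightarrow> g x" using ae2 by eventually_elim simp
    show "AE x in lebI L. cmod (f n x) \<le> cmod (complex_of_real (w x))" for n
      using ae2 by eventually_elim (auto intro: order_trans[OF _ abs_ge_self])
  qed
  with g_l2 that show ?thesis by blast
qed

lemma AE_lebI_not_negligible: "negligible N \<Longrightarrow> AE x in lebI L. x \<notin> N"
  by (subst AE_restrict_space_iff) (auto simp: negligible_iff_null_sets intro: eventually_mono[OF AE_not_in])

lemma polynomial_uniform_approx:
  fixes f :: "real \<Rightarrow> complex"
  assumes "continuous_on {a..b} f" "e > 0"
  obtains p :: "complex poly" where "\<And>x. x \<in> {a..b} \<Longrightarrow> cmod (f x - poly p (of_real x)) < e"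
proof -
  have *: "\<exists>p::complex poly. \<forall>x\<in>{a..b}. cmod (of_real (h x) - poly p (of_real x)) < e / 2"
    if h: "continuous_on {a..b} h" for h :: "real \<Rightarrow> real"
  proof -
    obtain g where g: "real_polynomial_function g" "\<And>x. x \<in> {a..b} \<Longrightarrow> \<bar>h x - g x\<bar> < e / 2"
      using Stone_Weierstrass_real_polynomial_function[OF compact_Icc h, of "e / 2"] assms(2) by auto
    then obtain c n where c: "g = (\<lambda>x. \<Sum>i\<le>n. c i * x ^ i)" using real_polynomial_function_iff_sum by blast
    have "poly (\<Sum>i\<le>n. monom (of_real (c i)) i) (of_real x) = complex_of_real (g x)" for x
      by (simp add: c poly_sum poly_monom)
    then show ?thesis using g(2)
      by (intro exI[of _ "\<Sum>i\<le>n. monom (of_real (c i)) i"]) (metis norm_of_real of_real_diff)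
  qed
  obtain p where p: "\<forall>x\<in>{a..b}. cmod (of_real (Re (f x)) - poly p (of_real x)) < e / 2"
    using *[of "\<lambda>x. Re (f x)"] assms(1) by (auto intro: continuous_intros)
  obtain q where q: "\<forall>x\<in>{a..b}. cmod (of_real (Im (f x)) - poly q (of_real x)) < e / 2"
    using *[of "\<lambda>x. Im (f x)"] assms(1) by (auto intro: continuous_intros)
  show ?thesis
  proof (rule that[of "p + smult \<i> q"])
    fix x assume x: "x \<in> {a..b}"
    have "f x - poly (p + smult \<i> q) (of_real x) =
        (of_real (Re (f x)) - poly p (of_real x)) + \<i> * (of_real (Im (f x)) - poly q (of_real x))"
      using complex_eq[of "f x"] by (simp add: algebra_simps)
    also have "cmod \<dots> \<le> cmod (of_real (Re (f x)) - poly p (of_real x)) + cmod (of_real (Im (f x)) - poly q (of_real x))"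
      by (rule order_trans[OF norm_triangle_ineq]) (simp add: norm_mult)
    also have "\<dots> < e" using p q x by (metis add_strict_mono field_sum_of_halves)
    finally show "cmod (f x - poly (p + smult \<i> q) (of_real x)) < e" .
  qed
qed

text \<open>
  A square integrable \<open>g\<close> is cut off at modulus \<open>n\<close>, then approximated by the cut off members of a
  sequence of continuous functions that converges to \<open>g\<close> almost everywhere, and these uniformly by
  polynomials. The cut off is a continuous map of the complex plane, so that it preserves
  continuity and makes dominated convergence applicable.
\<close>

theorem l2_poly_dense:
  assumes L: "L > 0" and g: "g \<in> l2 L" and e: "e > 0"
  obtains p :: "complex poly" where "l2_norm L (\<lambda>x. g x - poly p (of_real x)) < e"
proof -
  \<comment> \<open>the radial projection onto the disc of radius \<open>n + 1\<close>\<close>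
  define cl where "cl n z = z / complex_of_real (max 1 (cmod z / real (Suc n)))" for n :: nat and z :: complex
  have cl_cont: "continuous_on UNIV (cl n)" for n
  proof -
    have "max 1 (cmod z / real (Suc n)) \<noteq> 0" for z by linarith
    then show ?thesis unfolding cl_def
      by (intro continuous_intros) (simp_all only: of_real_eq_0_iff not_False_eq_True ball_UNIV simp_thms)
  qed
  have cl_le: "cmod (cl n z) \<le> cmod z" for n z
    unfolding cl_def by (simp add: norm_divide divide_le_eq mult_le_cancel_left1 del: of_nat_Suc)
  have cl_bd: "cmod (cl n z) \<le> real (Suc n)" for n z
  proof -
    have "cmod z \<le> real (Suc n) * max 1 (cmod z / real (Suc n))"
      by (cases "cmod z / real (Suc n) \<le> 1") (auto simp: max_def field_simps simp del: of_nat_Suc)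
    then show ?thesis unfolding cl_def by (simp add: norm_divide divide_le_eq del: of_nat_Suc)
  qed
  have cl_lim: "(\<lambda>n. cl n z) \<longlonglongrightarrow> z" for z
  proof -
    obtain n0 where n0: "cmod z \<le> real n0" using real_arch_simple by blast
    have "cl n z = z" if "n \<ge> n0" for n
    proof -
      have "cmod z / real (Suc n) \<le> 1" using n0 that by (simp add: field_simps)
      then show ?thesis by (simp add: cl_def max_def)
    qed
    then show ?thesis by (intro tendsto_eventually) (auto simp: eventually_sequentially)
  qed
  have gm: "(\<lambda>x. cl n (g x)) \<in> borel_measurable (lebI L)" for n
    by (rule borel_measurable_continuous_on[OF cl_cont l2_measurable[OF g]])
  have g1: "(\<lambda>x. cl n (g x)) \<in> l2 L" for n
    by (rule l2_bounded[OF gm cl_bd])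
  have "(\<lambda>n. l2_norm L (\<lambda>x. cl n (g x) - g x)) \<longlonglongrightarrow> 0"
    by (rule l2_dominated_convergence[OF g g1 g]) (auto intro: cl_lim cl_le)
  then obtain n where n: "l2_norm L (\<lambda>x. cl n (g x) - g x) < e / 3"
    using order_tendstoD(2)[of _ 0 sequentially "e / 3"] e by (auto simp: eventually_sequentially)
  have "g measurable_on {0<..<L}"
    using l2_measurable[OF g] by (simp add: measurable_on_iff_borel_measurable)
  then obtain N h where N: "negligible N" and h: "\<And>k. continuous_on UNIV (h k)"
    and lim: "\<And>x. x \<notin> N \<Longrightarrow> (\<lambda>k. h k x) \<longlonglongrightarrow> (if x \<in> {0<..<L} then g x else 0)"
    unfolding measurable_on_def by blast
  have hc: "continuous_on A (\<lambda>x. cl n (h k x))" for k A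
    by (rule continuous_on_compose2[OF cl_cont continuous_on_subset[OF h]]) auto
  have h1: "(\<lambda>x. cl n (h k x)) \<in> l2 L" for k by (rule l2_continuous[OF hc])
  have "(\<lambda>k. l2_norm L (\<lambda>x. cl n (h k x) - cl n (g x))) \<longlonglongrightarrow> 0"
  proof (rule l2_dominated_convergence[OF g1 h1 l2_const[of "of_real (real (Suc n))"]])
    have "AE x in lebI L. x \<in> {0<..<L} \<and> x \<notin> N"
      using AE_lebI_not_negligible[OF N, of L] AE_space[of "lebI L"]
      by eventually_elim (auto simp: space_restrict_space)
    then show "AE x in lebI L. (\<lambda>k. cl n (h k x)) \<longlonglongrightarrow> cl n (g x)"
    proof eventually_elim
      fix x assume x: "x \<in> {0<..<L} \<and> x \<notin> N"
      then have "(\<lambda>k. h k x) \<longlonglongrightarrow> g x" using lim[of x] by simp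
      then show "(\<lambda>k. cl n (h k x)) \<longlonglongrightarrow> cl n (g x)"
        by (rule continuous_on_tendsto_compose[OF cl_cont]) auto
    qed
    show "AE x in lebI L. cmod (cl n (h k x)) \<le> cmod (complex_of_real (real (Suc n)))" for k
      using cl_bd[of n] by (simp del: of_nat_Suc)
  qed
  then obtain k where k: "l2_norm L (\<lambda>x. cl n (h k x) - cl n (g x)) < e / 3"
    using order_tendstoD(2)[of _ 0 sequentially "e / 3"] e by (auto simp: eventually_sequentially)
  have e': "e / (3 * (sqrt L + 1)) > 0" using e L by (intro divide_pos_pos mult_pos_pos add_nonneg_pos) auto
  obtain p where p: "\<And>x. x \<in> {0..L} \<Longrightarrow> cmod (cl n (h k x) - poly p (of_real x)) < e / (3 * (sqrt L + 1))"
    using polynomial_uniform_approx[OF hc e'] by blast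
  have p2: "(\<lambda>x. poly p (complex_of_real x)) \<in> l2 L" by (intro l2_continuous continuous_intros)
  have "l2_norm L (\<lambda>x. cl n (h k x) - poly p (of_real x)) \<le> sqrt L * (e / (3 * (sqrt L + 1)))"
    by (rule l2_norm_le_sup[OF l2_diff[OF h1 p2] L]) (use p e' in \<open>auto intro: less_imp_le\<close>)
  also have "\<dots> < e / 3"
  proof -
    have "sqrt L / (sqrt L + 1) < 1" using L by (simp add: divide_less_eq add_pos_pos)
    then have "sqrt L / (sqrt L + 1) * (e / 3) < 1 * (e / 3)" using e by (intro mult_strict_right_mono) auto
    then show ?thesis by (simp add: mult.commute)
  qed
  finally have "l2_norm L (\<lambda>x. cl n (h k x) - poly p (of_real x)) < e / 3" .
  moreover have "l2_norm L (\<lambda>x. g x - poly p (of_real x)) \<le>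
      l2_norm L (\<lambda>x. g x - cl n (g x)) + l2_norm L (\<lambda>x. cl n (g x) - poly p (of_real x))"
    by (rule l2_norm_triangle_diff[OF g g1 p2])
  moreover have "l2_norm L (\<lambda>x. cl n (g x) - poly p (of_real x)) \<le>
      l2_norm L (\<lambda>x. cl n (g x) - cl n (h k x)) + l2_norm L (\<lambda>x. cl n (h k x) - poly p (of_real x))"
    by (rule l2_norm_triangle_diff[OF g1 h1 p2])
  ultimately have "l2_norm L (\<lambda>x. g x - poly p (of_real x)) < e"
    using n k l2_norm_minus_commute[of L g "\<lambda>x. cl n (g x)"]
      l2_norm_minus_commute[of L "\<lambda>x. cl n (g x)" "\<lambda>x. cl n (h k x)"] by linarith
  then show ?thesis by (rule that)
qed

lemma AE_zero_of_orthogonal_to_polys: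
  assumes L: "L > 0" and w: "w \<in> l2 L"
    and orth: "\<And>p :: complex poly. (LINT x|lebI L. w x * poly p (of_real x)) = 0"
  shows "AE x in lebI L. w x = 0"
proof -
  have "(l2_norm L w)\<^sup>2 \<le> 0"
  proof (rule field_le_epsilon)
    fix e :: real assume e: "e > 0"
    have w': "(\<lambda>x. cnj (w x)) \<in> l2 L" by (rule l2_cnj[OF w])
    define e' where "e' = e / (l2_norm L w + 1)"
    have e': "e' > 0" using e l2_norm_nonneg[of L w] by (simp add: e'_def add_nonneg_pos)
    obtain p where p: "l2_norm L (\<lambda>x. cnj (w x) - poly p (of_real x)) < e'"
      using l2_poly_dense[OF L w' e'] by blast
    have p2: "(\<lambda>x. poly p (complex_of_real x)) \<in> l2 L" by (intro l2_continuous continuous_intros)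
    have "complex_of_real ((l2_norm L w)\<^sup>2) = (LINT x|lebI L. w x * cnj (w x))"
      using l2_inner_self[OF w] by (simp add: l2_inner_def)
    also have "\<dots> = (LINT x|lebI L. w x * cnj (w x)) - (LINT x|lebI L. w x * poly p (of_real x))"
      by (simp add: orth)
    also have "\<dots> = (LINT x|lebI L. w x * (cnj (w x) - poly p (of_real x)))"
      using l2_prod_integrable[OF w w'] l2_prod_integrable[OF w p2] by (simp add: right_diff_distrib)
    finally have "(l2_norm L w)\<^sup>2 = cmod (LINT x|lebI L. w x * (cnj (w x) - poly p (of_real x)))"
      by (metis abs_power2 norm_of_real)
    also have "\<dots> \<le> (LINT x|lebI L. cmod (w x * (cnj (w x) - poly p (of_real x))))"
      by (rule integral_norm_bound)
    also have "\<dots> \<le> l2_norm L w * l2_norm L (\<lambda>x. cnj (w x) - poly p (of_real x))"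
      using l2_Cauchy_Schwarz[OF w l2_diff[OF w' p2]] by (simp add: norm_mult)
    also have "\<dots> \<le> l2_norm L w * e'" using p l2_norm_nonneg by (intro mult_left_mono) auto
    also have "\<dots> \<le> e" using e l2_norm_nonneg[of L w] by (simp add: e'_def divide_simps add_nonneg_eq_0_iff)
    finally show "(l2_norm L w)\<^sup>2 \<le> 0 + e" by simp
  qed
  then show ?thesis using l2_norm_zero_iff[OF w] by simp
qed

lemma l2_absolutely_integrable:
  assumes "g \<in> l2 L" "0 \<le> a" "b \<le> L"
  shows "g absolutely_integrable_on {a..b}"
proof -
  have "integrable (lebI L) g" by (rule l2_integrable[OF assms(1)])
  then have "g absolutely_integrable_on {0<..<L}"
    by (simp add: integrable_restrict_space set_integrable_def)
  then have "g absolutely_integrable_on {0..L}"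
    using absolutely_integrable_on_open_interval[where f = g and a = 0 and b = L] by simp
  then show ?thesis by (rule absolutely_integrable_on_subinterval) (use assms in auto)
qed

lemma l2_integrable_on: "g \<in> l2 L \<Longrightarrow> 0 \<le> a \<Longrightarrow> b \<le> L \<Longrightarrow> g integrable_on {a..b}"
  by (rule set_lebesgue_integral_eq_integral(1)[OF l2_absolutely_integrable])

lemma LINT_eq_integral:
  fixes g :: "real \<Rightarrow> complex"
  shows "integrable (lebI L) g \<Longrightarrow> (LINT x|lebI L. g x) = integral {0..L} g"
  by (simp add: lebesgue_integral_eq_integral integral_open_interval_real)

lemma l2_integral_bound:
  assumes g: "g \<in> l2 L" and L: "L > 0" and ab: "0 \<le> a" "b \<le> L"
  shows "cmod (integral {a..b} g) \<le> sqrt L * l2_norm L g"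
proof -
  have n: "(\<lambda>x. complex_of_real (cmod (g x))) \<in> l2 L" using g by (auto simp: l2_def)
  have ni: "(\<lambda>x. cmod (g x)) integrable_on {c..d}" if "0 \<le> c" "d \<le> L" for c d
    using l2_absolutely_integrable[OF g that] by (simp add: absolutely_integrable_on_def)
  have "cmod (integral {a..b} g) \<le> integral {a..b} (\<lambda>x. cmod (g x))"
    by (rule integral_norm_bound_integral) (use l2_integrable_on[OF g ab] ni[OF ab] in auto)
  also have "\<dots> \<le> integral {0..L} (\<lambda>x. cmod (g x))"
    by (rule integral_subset_le) (use ab ni in auto)
  also have "\<dots> = (LINT x|lebI L. cmod (g x))"
    using l2_integrable[OF g] by (simp add: lebesgue_integral_eq_integral integral_open_interval_real)
  also have "\<dots> \<le> sqrt L * l2_norm L g"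
    using l2_Cauchy_Schwarz[OF g l2_const[of 1 L]] by (simp add: l2_norm_const[OF L] mult.commute)
  finally show ?thesis .
qed

lemma negligible_of_AE_lebI:
  assumes "AE x in lebI L. P x"
  obtains N where "negligible N" "\<And>x. x \<in> {0..L} \<Longrightarrow> x \<notin> N \<Longrightarrow> P x"
proof -
  have "AE x in lebesgue. x \<in> {0<..<L} \<longrightarrow> P x"
    using assms by (subst (asm) AE_restrict_space_iff) auto
  then obtain N where N: "N \<in> null_sets lebesgue" "{x \<in> space lebesgue. \<not> (x \<in> {0<..<L} \<longrightarrow> P x)} \<subseteq> N"
    unfolding eventually_ae_filter by blast
  show ?thesis
  proof (rule that[of "N \<union> {0, L}"])
    show "negligible (N \<union> {0, L})" using N(1) by (simp add: negligible_iff_null_sets negligible_Un)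
    fix x assume "x \<in> {0..L}" "x \<notin> N \<union> {0, L}"
    then have "x \<in> {0<..<L}" by auto
    then show "P x" using N(2) \<open>x \<notin> N \<union> {0, L}\<close> by auto
  qed
qed

lemma AE_lebI_I: "(\<And>x. x \<in> {0<..<L} \<Longrightarrow> P x) \<Longrightarrow> AE x in lebI L. P x"
  by (rule AE_I2) (auto simp: space_restrict_space)

text \<open>
  Continuous representatives are unique on the closed interval, in particular at its ends; this is
  what makes point values of Sobolev functions meaningful.
\<close>

lemma continuous_eq_of_AE:
  fixes f g :: "real \<Rightarrow> complex"
  assumes L: "L > 0" and c: "continuous_on {0..L} f" "continuous_on {0..L} g"
    and ae: "AE x in lebI L. f x = g x" and x: "x \<in> {0..L}"
  shows "f x = g x"
proof -
  obtain N where N: "negligible N" "\<And>x. x \<in> {0..L} \<Longrightarrow> x \<notin> N \<Longrightarrow> f x = g x"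
    using negligible_of_AE_lebI[OF ae] by blast
  define U where "U = {y \<in> {0<..<L}. f y - g y \<in> - {0}}"
  have "U = {0<..<L} \<inter> (\<lambda>y. f y - g y) -` (- {0})" by (auto simp: U_def)
  moreover have "continuous_on {0<..<L} (\<lambda>y. f y - g y)"
    by (intro continuous_on_diff continuous_on_subset[OF c(1)] continuous_on_subset[OF c(2)]) auto
  then have "open ({0<..<L} \<inter> (\<lambda>y. f y - g y) -` (- {0}))" by (intro continuous_open_preimage) auto
  ultimately have "open U" by simp
  moreover have "U \<subseteq> N"
  proof
    fix y assume "y \<in> U"
    then have "y \<in> {0..L}" "f y \<noteq> g y" by (auto simp: U_def)
    then show "y \<in> N" using N(2) by blast
  qed
  then have "negligible U" by (rule negligible_subset[OF N(1)])
  ultimately have "U = {}" using open_not_negligible by blast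
  then have "f y - g y = 0" if "y \<in> {0<..<L}" for y using that by (auto simp: U_def)
  moreover have "closure {0<..<L} = {0..L}" using L by simp
  ultimately have "f x - g x = 0"
    using continuous_constant_on_closure[of "{0<..<L}" "\<lambda>x. f x - g x" 0 x] c x
    by (auto intro: continuous_intros)
  then show ?thesis by simp
qed

section \<open>Absolutely continuous functions\<close>

text \<open>
  \<open>f\<close> is a primitive of the square integrable function \<open>g\<close> on \<open>[0, L]\<close>. All calculus with Sobolev
  functions is carried out for such pairs, in which derivatives are chosen explicitly.
\<close>

definition ac :: "real \<Rightarrow> (real \<Rightarrow> complex) \<Rightarrow> (real \<Rightarrow> complex) \<Rightarrow> bool" where
  "ac L f g \<longleftrightarrow> g \<in> l2 L \<and> (\<forall>x\<in>{0..L}. f x = f 0 + integral {0..x} g)"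

lemma l2_subinterval:
  assumes g: "g \<in> l2 L" and x: "x \<le> L"
  shows "g \<in> l2 x"
proof (rule l2_I)
  show "g \<in> borel_measurable (lebI x)"
    by (rule measurable_restrict_mono[OF l2_measurable[OF g]]) (use x in auto)
  have "set_integrable lebesgue {0<..<L} (\<lambda>y. (cmod (g y))\<^sup>2)"
    using l2_integrable_sq[OF g] by (simp add: integrable_restrict_space set_integrable_def)
  then have "set_integrable lebesgue {0<..<x} (\<lambda>y. (cmod (g y))\<^sup>2)"
    by (rule set_integrable_subset) (use x in auto)
  then show "integrable (lebI x) (\<lambda>y. (cmod (g y))\<^sup>2)"
    by (simp add: integrable_restrict_space set_integrable_def)
qed

lemma ac_deriv_l2: "ac L f g \<Longrightarrow> g \<in> l2 L"
  by (drule iffD1[OF ac_def]) (erule conjunct1)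

lemma ac_eq: "ac L f g \<Longrightarrow> 0 \<le> x \<Longrightarrow> x \<le> L \<Longrightarrow> f x = f 0 + integral {0..x} g"
  by (drule iffD1[OF ac_def], drule conjunct2, erule bspec) simp

lemma ac_I:
  assumes "g \<in> l2 L" "\<And>x. 0 \<le> x \<Longrightarrow> x \<le> L \<Longrightarrow> f x = f 0 + integral {0..x} g"
  shows "ac L f g"
  unfolding ac_def
proof (intro conjI ballI)
  fix x assume x: "x \<in> {0..L}"
  show "f x = f 0 + integral {0..x} g" by (rule assms(2)) (use x in auto)
qed (rule assms(1))

lemma ac_subinterval: "ac L f g \<Longrightarrow> x \<le> L \<Longrightarrow> ac x f g"
  by (rule ac_I[OF l2_subinterval[OF ac_deriv_l2]]) (auto intro: ac_eq)

lemma ac_integral: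
  assumes "g \<in> l2 L" shows "ac L (\<lambda>x. c + integral {0..x} g) g"
  using assms by (simp add: ac_def)

lemma ac_continuous:
  assumes "ac L f g" shows "continuous_on {0..L} f"
proof -
  have "continuous_on {0..L} (\<lambda>x. f 0 + integral {0..x} g)"
    by (intro continuous_on_add continuous_on_const indefinite_integral_continuous_1 l2_integrable_on[OF ac_deriv_l2[OF assms]]) auto
  then show ?thesis
    by (rule continuous_on_eq) (simp add: ac_eq[OF assms, symmetric])
qed

lemma ac_l2: "ac L f g \<Longrightarrow> f \<in> l2 L" by (intro l2_continuous ac_continuous)

lemma ac_add:
  assumes "ac L f f'" "ac L g g'"
  shows "ac L (\<lambda>x. f x + g x) (\<lambda>x. f' x + g' x)"
  unfolding ac_def
proof (intro conjI ballI)
  fix x assume x: "x \<in> {0..L}"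
  have "integral {0..x} (\<lambda>x. f' x + g' x) = integral {0..x} f' + integral {0..x} g'"
    using x assms by (intro integral_add l2_integrable_on) (auto dest: ac_deriv_l2)
  then show "f x + g x = f 0 + g 0 + integral {0..x} (\<lambda>x. f' x + g' x)"
    using ac_eq[OF assms(1), of x] ac_eq[OF assms(2), of x] x by simp
qed (use assms in \<open>auto intro: l2_add dest: ac_deriv_l2\<close>)

lemma ac_scale: "ac L f f' \<Longrightarrow> ac L (\<lambda>x. c * f x) (\<lambda>x. c * f' x)"
proof (rule ac_I)
  assume f: "ac L f f'"
  show "(\<lambda>x. c * f' x) \<in> l2 L" by (rule l2_scale[OF ac_deriv_l2[OF f]])
  fix x assume x: "0 \<le> x" "x \<le> L"
  show "c * f x = c * f 0 + integral {0..x} (\<lambda>x. c * f' x)" using ac_eq[OF f x] by (simp add: distrib_left)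
qed

lemma ac_diff: "ac L f f' \<Longrightarrow> ac L g g' \<Longrightarrow> ac L (\<lambda>x. f x - g x) (\<lambda>x. f' x - g' x)"
  using ac_add[of L f f' "\<lambda>x. (-1) * g x" "\<lambda>x. (-1) * g' x"] ac_scale[of L g g' "-1"] by simp

lemma ac_const: "ac L (\<lambda>x. c) (\<lambda>x. 0)"
  using l2_const by (simp add: ac_def)

lemma ac_sum: "(\<And>i. i \<in> I \<Longrightarrow> ac L (f i) (g i)) \<Longrightarrow> ac L (\<lambda>x. \<Sum>i\<in>I. f i x) (\<lambda>x. \<Sum>i\<in>I. g i x)"
  by (induction I rule: infinite_finite_induct) (auto intro: ac_const ac_add)

lemma ac_C1:
  assumes "\<And>x. x \<in> {0..L} \<Longrightarrow> (f has_vector_derivative g x) (at x within {0..L})" "continuous_on {0..L} g"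
  shows "ac L f g"
  unfolding ac_def
proof (intro conjI ballI)
  fix x assume x: "x \<in> {0..L}"
  have "(g has_integral (f x - f 0)) {0..x}"
  proof (rule fundamental_theorem_of_calculus)
    fix y assume "y \<in> {0..x}"
    then show "(f has_vector_derivative g y) (at y within {0..x})"
      using x by (intro has_vector_derivative_within_subset[OF assms(1)]) auto
  qed (use x in simp)
  then show "f x = f 0 + integral {0..x} g" by (simp add: integral_unique)
qed (rule l2_continuous[OF assms(2)])

lemma poly_has_vector_derivative:
  "((\<lambda>x. poly p (complex_of_real x)) has_vector_derivative poly (pderiv p) (of_real x)) (at x within S)"
proof -
  have "((poly p \<circ> complex_of_real) has_vector_derivative (1 * poly (pderiv p) (of_real x))) (at x within S)"
    by (rule field_vector_diff_chain_within)
      (auto intro!: has_vector_derivative_of_real DERIV_subset[OF poly_DERIV] derivative_eq_intros)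
  then show ?thesis by (simp add: o_def)
qed

lemma ac_poly: "ac L (\<lambda>x. poly p (of_real x)) (\<lambda>x. poly (pderiv p) (of_real x))"
  by (intro ac_C1 poly_has_vector_derivative continuous_intros)

lemma ac_cnj:
  assumes "ac L f g" shows "ac L (\<lambda>x. cnj (f x)) (\<lambda>x. cnj (g x))"
  unfolding ac_def
proof (intro conjI ballI)
  fix x assume x: "x \<in> {0..L}"
  have "(g has_integral integral {0..x} g) {0..x}"
    using l2_integrable_on[OF ac_deriv_l2[OF assms]] x by (intro integrable_integral) auto
  from has_integral_linear[OF this bounded_linear_cnj]
  have "integral {0..x} (\<lambda>x. cnj (g x)) = cnj (integral {0..x} g)" by (simp add: o_def integral_unique)
  then show "cnj (f x) = cnj (f 0) + integral {0..x} (\<lambda>x. cnj (g x))" using ac_eq[OF assms, of x] x by simp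
qed (use assms in \<open>auto intro: l2_cnj dest: ac_deriv_l2\<close>)

lemma ac_sup_bound:
  assumes "ac L f g" "L > 0" "x \<in> {0..L}"
  shows "cmod (f x - f 0) \<le> sqrt L * l2_norm L g"
  using ac_eq[OF assms(1), of x] l2_integral_bound[OF ac_deriv_l2[OF assms(1)] assms(2), of 0 x] assms(3) by simp

text \<open>
  The Sobolev embedding: \<open>|f|\<close> cannot fall below \<open>|f x|\<close> by more than the norm of \<open>g\<close> allows, so
  its mean value bounds \<open>|f x|\<close>.
\<close>

lemma ac_sup_bound_norms:
  assumes "ac L f g" and L: "L > 0" and x: "x \<in> {0..L}"
  shows "cmod (f x) \<le> l2_norm L f / sqrt L + 2 * sqrt L * l2_norm L g"
proof -
  have f: "f \<in> l2 L" by (rule ac_l2[OF assms(1)])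
  have "cmod (f x) - cmod (f y) \<le> 2 * sqrt L * l2_norm L g" if y: "y \<in> {0..L}" for y
  proof -
    have "cmod (f x) - cmod (f y) \<le> cmod (f x - f y)" by (rule norm_triangle_ineq2)
    also have "\<dots> = cmod ((f x - f 0) - (f y - f 0))" by simp
    also have "\<dots> \<le> cmod (f x - f 0) + cmod (f y - f 0)" by (rule norm_triangle_ineq4)
    finally show ?thesis using ac_sup_bound[OF assms] ac_sup_bound[OF assms(1,2) y] by simp
  qed
  then have lower: "cmod (f x) - 2 * sqrt L * l2_norm L g \<le> cmod (f y)" if "y \<in> {0..L}" for y
    using that by (simp add: algebra_simps)
  have "(cmod (f x) - 2 * sqrt L * l2_norm L g) * L = (LINT y|lebI L. cmod (f x) - 2 * sqrt L * l2_norm L g)"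
    using L by (simp add: measure_restrict_space)
  also have "\<dots> \<le> (LINT y|lebI L. cmod (f y))"
  proof (rule integral_mono)
    show "integrable (lebI L) (\<lambda>y. cmod (f x) - 2 * sqrt L * l2_norm L g)"
      by (rule finite_measure.integrable_const[OF finite_measure_lebI])
    show "integrable (lebI L) (\<lambda>y. cmod (f y))" using l2_integrable[OF f] by simp
  qed (use lower in \<open>auto simp: space_restrict_space\<close>)
  also have "\<dots> \<le> l2_norm L f * sqrt L"
    using l2_Cauchy_Schwarz[OF f l2_const[of 1 L]] by (simp add: l2_norm_const[OF L])
  finally have "cmod (f x) - 2 * sqrt L * l2_norm L g \<le> l2_norm L f * sqrt L / L"
    using L by (simp add: le_divide_eq)
  also have "\<dots> = l2_norm L f / sqrt L" using L by (simp add: field_simps)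
  finally show ?thesis by simp
qed

lemma pderiv_sum: "pderiv (\<Sum>i\<in>I. p i) = (\<Sum>i\<in>I. pderiv (p i))"
  by (induction I rule: infinite_finite_induct) (auto simp: pderiv_add)

lemma poly_antiderivative:
  obtains P :: "complex poly" where "pderiv P = p" "poly P 0 = c"
proof -
  have "\<exists>P. pderiv P = p" for p :: "complex poly"
  proof -
    define Q where "Q = (\<Sum>i\<le>degree p. monom (coeff p i / of_nat (Suc i)) (Suc i))"
    have "pderiv Q = (\<Sum>i\<le>degree p. monom (coeff p i) i)"
      unfolding Q_def pderiv_sum by (intro sum.cong) (auto simp: pderiv_monom simp del: of_nat_Suc)
    then show ?thesis using poly_as_sum_of_monoms[of p] by auto
  qed
  then obtain P where "pderiv P = p" by blast
  then have "pderiv (P + [:c - poly P 0:]) = p" "poly (P + [:c - poly P 0:]) 0 = c"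
    by (simp_all add: pderiv_add pderiv_pCons)
  with that show ?thesis by blast
qed

text \<open>
  The difference of the two sides of the formula of integration by parts. It is bilinear and
  continuous with respect to the norm of the derivatives, so that it vanishes once it vanishes for
  polynomials; this avoids an argument with double integrals.
\<close>

definition ibp_defect :: "real \<Rightarrow> (real \<Rightarrow> complex) \<Rightarrow> (real \<Rightarrow> complex) \<Rightarrow> (real \<Rightarrow> complex) \<Rightarrow> (real \<Rightarrow> complex) \<Rightarrow> complex" where
  "ibp_defect L f f' g g' = (LINT x|lebI L. f' x * g x + f x * g' x) - (f L * g L - f 0 * g 0)"

lemma ibp_defect_commute: "ibp_defect L f f' g g' = ibp_defect L g g' f f'"
  by (simp add: ibp_defect_def mult.commute add.commute)

lemma ibp_defect_diff:
  assumes "ac L f f'" "ac L h h'" "ac L g g'"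
  shows "ibp_defect L (\<lambda>x. f x - h x) (\<lambda>x. f' x - h' x) g g' = ibp_defect L f f' g g' - ibp_defect L h h' g g'"
proof -
  have i: "integrable (lebI L) (\<lambda>x. f' x * g x + f x * g' x)" if "ac L f f'" for f f'
    using that assms(3) by (intro Bochner_Integration.integrable_add l2_prod_integrable) (auto intro: ac_l2 ac_deriv_l2)
  have "(LINT x|lebI L. (f' x - h' x) * g x + (f x - h x) * g' x) =
      (LINT x|lebI L. (f' x * g x + f x * g' x) - (h' x * g x + h x * g' x))"
    by (intro Bochner_Integration.integral_cong) (auto simp: algebra_simps)
  also have "\<dots> = (LINT x|lebI L. f' x * g x + f x * g' x) - (LINT x|lebI L. h' x * g x + h x * g' x)"
    by (intro Bochner_Integration.integral_diff i assms)
  finally show ?thesis by (simp add: ibp_defect_def algebra_simps)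
qed

lemma ibp_defect_poly:
  assumes L: "L > 0"
  shows "ibp_defect L (\<lambda>x. poly p (of_real x)) (\<lambda>x. poly (pderiv p) (of_real x)) (\<lambda>x. poly q (of_real x)) (\<lambda>x. poly (pderiv q) (of_real x)) = 0"
proof -
  have a: "ac L (\<lambda>x. poly (p * q) (of_real x)) (\<lambda>x. poly (pderiv (p * q)) (of_real x))" by (rule ac_poly)
  have "(LINT x|lebI L. poly (pderiv (p * q)) (of_real x)) = integral {0..L} (\<lambda>x. poly (pderiv (p * q)) (of_real x))"
    by (intro LINT_eq_integral l2_integrable ac_deriv_l2[OF a])
  also have "\<dots> = poly (p * q) (of_real L) - poly (p * q) (of_real 0)" using ac_eq[OF a, of L] L by simp
  finally show ?thesis by (simp add: ibp_defect_def pderiv_mult add.commute mult.commute)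
qed

lemma ibp_defect_bound:
  assumes "ac L f f'" "f 0 = 0" "ac L g g'" and L: "L > 0"
  shows "cmod (ibp_defect L f f' g g') \<le> l2_norm L f' * (l2_norm L g + L * l2_norm L g' + sqrt L * cmod (g L))"
proof -
  have l: "f \<in> l2 L" "f' \<in> l2 L" "g \<in> l2 L" "g' \<in> l2 L" using assms by (auto intro: ac_l2 ac_deriv_l2)
  have b: "cmod (LINT x|lebI L. a x * b x) \<le> l2_norm L a * l2_norm L b" if "a \<in> l2 L" "b \<in> l2 L" for a b
    using integral_norm_bound[of "lebI L" "\<lambda>x. a x * b x"] l2_Cauchy_Schwarz[OF that] by (simp add: norm_mult)
  have fs: "cmod (f x) \<le> sqrt L * l2_norm L f'" if "x \<in> {0..L}" for x
    using ac_sup_bound[OF assms(1) L that] assms(2) by simp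
  have "l2_norm L f \<le> sqrt L * (sqrt L * l2_norm L f')"
    by (rule l2_norm_le_sup[OF l(1) L]) (use fs L in \<open>auto simp: l2_norm_nonneg\<close>)
  then have f: "l2_norm L f \<le> L * l2_norm L f'" using L by (simp add: mult.assoc[symmetric])
  have "cmod (ibp_defect L f f' g g') \<le> cmod (LINT x|lebI L. f' x * g x + f x * g' x) + cmod (f L * g L - f 0 * g 0)"
    unfolding ibp_defect_def by (rule norm_triangle_ineq4)
  also have "(LINT x|lebI L. f' x * g x + f x * g' x) = (LINT x|lebI L. f' x * g x) + (LINT x|lebI L. f x * g' x)"
    by (intro Bochner_Integration.integral_add l2_prod_integrable l)
  also have "cmod \<dots> \<le> l2_norm L f' * l2_norm L g + l2_norm L f * l2_norm L g'"
    by (rule order_trans[OF norm_triangle_ineq add_mono[OF b b]]) (auto simp: l)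
  also have "l2_norm L f * l2_norm L g' \<le> (L * l2_norm L f') * l2_norm L g'"
    by (rule mult_right_mono[OF f l2_norm_nonneg])
  also have "cmod (f L * g L - f 0 * g 0) \<le> (sqrt L * l2_norm L f') * cmod (g L)"
    using fs[of L] L assms(2) by (simp add: norm_mult mult_right_mono)
  finally show ?thesis by (simp add: algebra_simps)
qed

lemma ibp_defect_zero_of_poly:
  assumes f: "ac L f f'" and g: "ac L g g'" and L: "L > 0"
    and z: "\<And>p. ibp_defect L (\<lambda>x. poly p (of_real x)) (\<lambda>x. poly (pderiv p) (of_real x)) g g' = 0"
  shows "ibp_defect L f f' g g' = 0"
proof -
  define C where "C = l2_norm L g + L * l2_norm L g' + sqrt L * cmod (g L)"
  have C: "C \<ge> 0" using L by (simp add: C_def l2_norm_nonneg)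
  have "cmod (ibp_defect L f f' g g') \<le> 0 + e" if e: "e > 0" for e
  proof -
    obtain p where p: "l2_norm L (\<lambda>x. f' x - poly p (of_real x)) < e / (C + 1)"
      using l2_poly_dense[OF L ac_deriv_l2[OF f], of "e / (C + 1)"] e C by auto
    obtain P where P: "pderiv P = p" "poly P 0 = f 0" by (rule poly_antiderivative)
    have "ibp_defect L f f' g g' = ibp_defect L (\<lambda>x. f x - poly P (of_real x)) (\<lambda>x. f' x - poly (pderiv P) (of_real x)) g g'"
      using ibp_defect_diff[OF f ac_poly g] z[of P] by simp
    also have "cmod \<dots> \<le> l2_norm L (\<lambda>x. f' x - poly (pderiv P) (of_real x)) * C"
      unfolding C_def by (rule ibp_defect_bound[OF ac_diff[OF f ac_poly] _ g L]) (use P in simp)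
    also have "\<dots> \<le> e / (C + 1) * C" using p C unfolding P(1) by (intro mult_right_mono) auto
    also have "\<dots> \<le> e" using C e by (simp add: field_simps)
    finally show ?thesis by simp
  qed
  from field_le_epsilon[OF this] show ?thesis by simp
qed

theorem ac_integration_by_parts:
  assumes "ac L f f'" "ac L g g'" "L > 0"
  shows "(LINT x|lebI L. f' x * g x + f x * g' x) = f L * g L - f 0 * g 0"
proof -
  have "ibp_defect L f f' (\<lambda>x. poly p (of_real x)) (\<lambda>x. poly (pderiv p) (of_real x)) = 0" for p
    by (rule ibp_defect_zero_of_poly[OF assms(1) ac_poly assms(3)]) (rule ibp_defect_poly[OF assms(3)])
  then have "ibp_defect L (\<lambda>x. poly p (of_real x)) (\<lambda>x. poly (pderiv p) (of_real x)) f f' = 0" for p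
    by (subst ibp_defect_commute)
  then have "ibp_defect L g g' f f' = 0" by (rule ibp_defect_zero_of_poly[OF assms(2,1,3)])
  then show ?thesis by (subst (asm) ibp_defect_commute) (simp add: ibp_defect_def)
qed

text \<open>
  The product rule is integration by parts on all subintervals \<open>[0, x]\<close>.
\<close>

theorem ac_mult:
  assumes f: "ac L f f'" and g: "ac L g g'" and L: "L > 0"
  shows "ac L (\<lambda>x. f x * g x) (\<lambda>x. f' x * g x + f x * g' x)"
  unfolding ac_def
proof (intro conjI ballI)
  show l: "(\<lambda>x. f' x * g x + f x * g' x) \<in> l2 L"
    using l2_continuous_mult[OF ac_deriv_l2[OF f] ac_continuous[OF g]]
      l2_continuous_mult[OF ac_deriv_l2[OF g] ac_continuous[OF f]]
    by (intro l2_add) (simp_all add: mult.commute)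
  fix x assume x: "x \<in> {0..L}"
  show "f x * g x = f 0 * g 0 + integral {0..x} (\<lambda>x. f' x * g x + f x * g' x)"
  proof (cases "x = 0")
    case False
    then have x0: "x > 0" "x \<le> L" using x by auto
    have "integral {0..x} (\<lambda>x. f' x * g x + f x * g' x) = (LINT y|lebI x. f' y * g y + f y * g' y)"
      by (rule LINT_eq_integral[symmetric], rule l2_integrable, rule l2_subinterval[OF l]) (use x0 in auto)
    also have "\<dots> = f x * g x - f 0 * g 0"
      by (intro ac_integration_by_parts ac_subinterval[OF f] ac_subinterval[OF g] x0)
    finally show ?thesis by simp
  qed simp
qed

section \<open>Test functions\<close>

text \<open>
  The flat function \<open>exp (- s/y)\<close>, continued by 0 to \<open>y \<le> 0\<close>, and its products with powers of
  \<open>1/y\<close>. Up to polynomial factors this family is closed under differentiation, which proves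
  smoothness.
\<close>

definition flat :: "real \<Rightarrow> nat \<Rightarrow> real \<Rightarrow> real" where
  "flat s k y = (if y > 0 then inverse y ^ k * exp (- s * inverse y) else 0)"

lemma flat_shift: "flat s k y = y ^ j * flat s (k + j) y"
  by (simp add: flat_def power_add power_inverse)

lemma flat_little_o:
  assumes s: "s > 0"
  shows "((\<lambda>h. flat s k h / h) \<longlongrightarrow> 0) (at 0)"
proof -
  have "filterlim (\<lambda>h::real. s * inverse h) at_top (at_right 0)"
    using s by (intro filterlim_tendsto_pos_mult_at_top[OF tendsto_const]) (auto intro: filterlim_inverse_at_top_right)
  from filterlim_compose[OF tendsto_power_div_exp_0[of "Suc k"] this]
  have "((\<lambda>h. (1 / s) ^ Suc k * ((s * inverse h) ^ Suc k / exp (s * inverse h))) \<longlongrightarrow> (1 / s) ^ Suc k * 0) (at_right 0)"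
    by (intro tendsto_intros)
  moreover have "\<forall>\<^sub>F h in at_right 0. (1 / s) ^ Suc k * ((s * inverse h) ^ Suc k / exp (s * inverse h)) = flat s k h / h"
    by (rule eventually_mono[OF eventually_at_right_less])
      (use s in \<open>simp add: flat_def power_mult_distrib exp_minus field_simps\<close>)
  ultimately have r: "((\<lambda>h. flat s k h / h) \<longlongrightarrow> 0) (at_right 0)"
    by (simp add: tendsto_cong)
  have "\<forall>\<^sub>F h in at_left 0. flat s k h / h = 0"
    by (rule eventually_at_leftI[of "-1"]) (auto simp: flat_def)
  then have "((\<lambda>h. flat s k h / h) \<longlongrightarrow> 0) (at_left 0)" by (rule tendsto_eventually)
  with r show ?thesis by (simp add: filterlim_split_at)
qed

lemma flat_has_derivative:
  assumes s: "s > 0"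
  shows "(flat s k has_real_derivative (s * flat s (k + 2) y - real k * flat s (k + 1) y)) (at y)"
proof -
  consider "y > 0" | "y < 0" | "y = 0" by linarith
  then show ?thesis
  proof cases
    case 1
    have d: "((\<lambda>y. inverse y ^ k * exp (- s * inverse y)) has_real_derivative
        (s * flat s (k + 2) y - real k * flat s (k + 1) y)) (at y)"
      using 1 by (auto intro!: derivative_eq_intros simp: flat_def power_add power2_eq_square field_simps)
        (cases k; simp add: field_simps)
    have ev: "\<forall>\<^sub>F z in nhds y. inverse z ^ k * exp (- s * inverse z) = flat s k z"
      by (rule eventually_mono[OF eventually_nhds_in_open[of "{0<..}"]]) (use 1 in \<open>auto simp: flat_def\<close>)
    show ?thesis using d DERIV_cong_ev[OF refl ev refl] by simp
  next
    case 2
    have ev: "\<forall>\<^sub>F z in nhds y. 0 = flat s k z"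
      by (rule eventually_mono[OF eventually_nhds_in_open[of "{..<0}"]]) (use 2 in \<open>auto simp: flat_def\<close>)
    have "(flat s k has_real_derivative 0) (at y)"
      by (rule iffD1[OF DERIV_cong_ev[OF refl ev refl] DERIV_const])
    moreover have "s * flat s (k + 2) y - real k * flat s (k + 1) y = 0" using 2 by (simp add: flat_def)
    ultimately show ?thesis by (simp only:)
  next
    case 3
    then show ?thesis using flat_little_o[OF s, of k] by (simp add: DERIV_def flat_def)
  qed
qed

definition cut_poly :: "real \<Rightarrow> real \<Rightarrow> complex poly" where
  "cut_poly L d = [:- of_real d, 1:] * [:of_real (L - d), -1:]"

text \<open>
  The quadratic polynomial that is positive exactly between \<open>d\<close> and \<open>L - d\<close> if \<open>d < L/2\<close>.
\<close>

definition cut :: "real \<Rightarrow> real \<Rightarrow> real \<Rightarrow> real" where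
  "cut L d x = (x - d) * (L - d - x)"

lemma poly_cut_poly: "poly (cut_poly L d) (of_real x) = of_real (cut L d x)"
  by (simp add: cut_poly_def cut_def algebra_simps)

lemma poly_pderiv_cut_poly: "poly (pderiv (cut_poly L d)) (of_real x) = of_real (L - 2 * x)"
  by (simp add: cut_poly_def pderiv_pCons pderiv_mult algebra_simps)

definition bump :: "real \<Rightarrow> real \<Rightarrow> real \<Rightarrow> complex poly \<Rightarrow> nat \<Rightarrow> real \<Rightarrow> complex" where
  "bump L d s p k x = poly p (of_real x) * of_real (flat s k (cut L d x))"

lemma bump_has_vector_derivative:
  assumes s: "s > 0"
  shows "(bump L d s p k has_vector_derivative
    poly (pderiv p) (of_real x) * of_real (flat s k (cut L d x)) +
    poly p (of_real x) * of_real ((s * flat s (k + 2) (cut L d x) - real k * flat s (k + 1) (cut L d x)) * (L - 2 * x))) (at x)"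
proof -
  have "((\<lambda>x. flat s k (cut L d x)) has_real_derivative
     (s * flat s (k + 2) (cut L d x) - real k * flat s (k + 1) (cut L d x)) * (L - 2 * x)) (at x)"
    by (rule DERIV_chain2[OF flat_has_derivative[OF s]])
      (auto simp: cut_def intro!: derivative_eq_intros)
  then have "((\<lambda>x. complex_of_real (flat s k (cut L d x))) has_vector_derivative
     of_real ((s * flat s (k + 2) (cut L d x) - real k * flat s (k + 1) (cut L d x)) * (L - 2 * x))) (at x)"
    by (rule has_vector_derivative_of_real[unfolded has_real_derivative_iff_has_vector_derivative[symmetric]])
  from has_vector_derivative_mult[OF poly_has_vector_derivative this, of p]
  show ?thesis unfolding bump_def[abs_def] by (simp add: add.commute)
qed

lemma vderiv_bump:
  assumes s: "s > 0"
  shows "vderiv (bump L d s p k) = bump L d s (pderiv p * (cut_poly L d)^2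
    + p * pderiv (cut_poly L d) * ([:of_real s:] - smult (of_nat k) (cut_poly L d))) (k + 2)"
proof
  fix x
  have "flat s k (cut L d x) = (cut L d x)\<^sup>2 * flat s (k + 2) (cut L d x)" by (rule flat_shift)
  moreover have "flat s (k + 1) (cut L d x) = cut L d x * flat s (k + 2) (cut L d x)"
    using flat_shift[of s "k + 1" "cut L d x" 1] by simp
  ultimately show "vderiv (bump L d s p k) x = bump L d s (pderiv p * (cut_poly L d)^2
    + p * pderiv (cut_poly L d) * ([:of_real s:] - smult (of_nat k) (cut_poly L d))) (k + 2) x"
    unfolding vderiv_def vector_derivative_at[OF bump_has_vector_derivative[OF s]]
    by (simp add: bump_def poly_cut_poly poly_pderiv_cut_poly algebra_simps)
qed

lemma vderiv_funpow_bump: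
  assumes s: "s > 0"
  shows "\<exists>p' k'. (vderiv ^^ n) (bump L d s p k) = bump L d s p' k'"
proof (induction n arbitrary: p k)
  case (Suc n)
  show ?case unfolding funpow_Suc_right o_apply vderiv_bump[OF s] by (rule Suc)
qed auto

lemma bump_test_fun:
  assumes s: "s > 0" and d: "0 < d" "d < L / 2"
  shows "bump L d s p k \<in> test_fun L"
  unfolding test_fun_def
proof (intro CollectI conjI allI exI[of _ "{d..L-d}"])
  fix n x
  obtain p' k' where "(vderiv ^^ n) (bump L d s p k) = bump L d s p' k'" using vderiv_funpow_bump[OF s] by blast
  then show "(vderiv ^^ n) (bump L d s p k) differentiable at x"
    using differentiableI_vector[OF bump_has_vector_derivative[OF s]] by simp
next
  fix x show "x \<notin> {d..L-d} \<longrightarrow> bump L d s p k x = 0"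
  proof
    assume x: "x \<notin> {d..L-d}"
    have "cut L d x \<le> 0"
    proof (cases "x < d")
      case True
      then show ?thesis unfolding cut_def using d by (intro mult_nonpos_nonneg) auto
    next
      case False
      then show ?thesis unfolding cut_def using d x by (intro mult_nonneg_nonpos) auto
    qed
    then show "bump L d s p k x = 0" by (simp add: bump_def flat_def)
  qed
qed (use d in auto)

lemma test_fun_has_vector_derivative:
  assumes "\<psi> \<in> test_fun L"
  shows "(\<psi> has_vector_derivative vderiv \<psi> x) (at x)"
proof -
  have "(vderiv ^^ 0) \<psi> differentiable at x" using assms unfolding test_fun_def by blast
  then show ?thesis by (simp add: vector_derivative_works vderiv_def)
qed

lemma test_fun_ac:
  assumes "\<psi> \<in> test_fun L"
  shows "ac L \<psi> (vderiv \<psi>)" "\<psi> 0 = 0" "\<psi> L = 0"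
proof -
  have "(vderiv ^^ 1) \<psi> differentiable at x" for x using assms unfolding test_fun_def by blast
  then have "isCont (vderiv \<psi>) x" for x by (simp add: differentiable_imp_continuous_within)
  then show "ac L \<psi> (vderiv \<psi>)"
    by (intro ac_C1 has_vector_derivative_at_within[OF test_fun_has_vector_derivative[OF assms]]
        continuous_at_imp_continuous_on) auto
  show "\<psi> 0 = 0" "\<psi> L = 0" using assms unfolding test_fun_def by (auto simp: subset_iff)
qed

lemma poly_vanishing_at_ends:
  fixes F :: "complex poly"
  assumes "poly F 0 = 0" "poly F (of_real L) = 0" "L > 0"
  obtains r where "F = cut_poly L 0 * r"
proof -
  obtain r1 where r1: "F = [:0, 1:] * r1" using assms(1) unfolding poly_eq_0_iff_dvd by auto
  then have "poly r1 (of_real L) = 0" using assms by simp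
  then obtain r2 where r2: "r1 = [:- of_real L, 1:] * r2" unfolding poly_eq_0_iff_dvd by auto
  have "F = cut_poly L 0 * (- r2)"
    unfolding r1 r2 cut_poly_def by (simp add: algebra_simps)
  with that show ?thesis by blast
qed

lemma mult_exp_minus_le_1: "z \<ge> 0 \<Longrightarrow> z * exp (- z) \<le> (1::real)"
proof -
  assume "z \<ge> 0"
  have "z \<le> exp z" using exp_ge_add_one_self[of z] by linarith
  then have "z * exp (- z) \<le> exp z * exp (- z)" by (intro mult_right_mono) auto
  then show ?thesis by (simp flip: exp_add)
qed

lemma flat_limits:
  assumes s: "s \<longlonglongrightarrow> 0" and y: "y \<longlonglongrightarrow> (y0::real)" and y0: "y0 > 0"
  shows "(\<lambda>n. flat (s n) 0 (y n)) \<longlonglongrightarrow> 1" "(\<lambda>n. s n * flat (s n) 1 (y n)) \<longlonglongrightarrow> 0"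
proof -
  have ev: "\<forall>\<^sub>F n in sequentially. y n > 0" using order_tendstoD(1)[OF y y0] .
  have l: "(\<lambda>n. - s n * inverse (y n)) \<longlonglongrightarrow> - 0 * inverse y0"
    by (intro tendsto_intros s y) (use y0 in auto)
  then have e: "(\<lambda>n. exp (- s n * inverse (y n))) \<longlonglongrightarrow> exp (- 0 * inverse y0)" by (rule tendsto_exp)
  have "\<forall>\<^sub>F n in sequentially. exp (- s n * inverse (y n)) = flat (s n) 0 (y n)"
    using ev by eventually_elim (simp add: flat_def)
  with e show "(\<lambda>n. flat (s n) 0 (y n)) \<longlonglongrightarrow> 1" by (simp add: tendsto_cong)
  have e1: "(\<lambda>n. - (- s n * inverse (y n)) * exp (- s n * inverse (y n))) \<longlonglongrightarrow> - (- 0 * inverse y0) * exp (- 0 * inverse y0)"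
    by (rule tendsto_mult[OF tendsto_minus[OF l] e])
  have "\<forall>\<^sub>F n in sequentially. - (- s n * inverse (y n)) * exp (- s n * inverse (y n)) = s n * flat (s n) 1 (y n)"
    using ev by eventually_elim (simp add: flat_def)
  from Lim_transform_eventually[OF e1 this] show "(\<lambda>n. s n * flat (s n) 1 (y n)) \<longlonglongrightarrow> 0" by simp
qed

lemma flat_bounds:
  assumes s: "s > 0"
  shows "0 \<le> flat s 0 y" "flat s 0 y \<le> 1" "0 \<le> s * flat s 1 y" "s * flat s 1 y \<le> 1"
proof -
  show "0 \<le> flat s 0 y" "flat s 0 y \<le> 1" "0 \<le> s * flat s 1 y" using s by (auto simp: flat_def)
  show "s * flat s 1 y \<le> 1"
    using mult_exp_minus_le_1[of "s * inverse y"] s by (auto simp: flat_def mult.assoc)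
qed

text \<open>
  A polynomial that vanishes at both ends is \<open>x (L - x) r(x)\<close>. It is approximated by
  \<open>q r exp (- d/q)\<close>, where \<open>q = (x - d)(L - d - x)\<close> and \<open>d \<rightarrow> 0\<close>. The factor \<open>q\<close> is what keeps the
  derivative bounded: it compensates the derivative of the exponential up to the factor
  \<open>(d/q) exp (- d/q)\<close>, which is at most 1 and tends to 0 pointwise. So both the functions and
  their derivatives converge boundedly.
\<close>

theorem test_fun_approximates_poly:
  fixes F :: "complex poly"
  assumes L: "L > 0" and F0: "poly F 0 = 0" and FL: "poly F (of_real L) = 0"
  obtains \<psi> where "\<And>n. \<psi> n \<in> test_fun L"
    "(\<lambda>n. l2_norm L (\<lambda>x. \<psi> n x - poly F (of_real x))) \<longlonglongrightarrow> 0"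
    "(\<lambda>n. l2_norm L (\<lambda>x. vderiv (\<psi> n) x - poly (pderiv F) (of_real x))) \<longlonglongrightarrow> 0"
proof -
  obtain r where r: "F = cut_poly L 0 * r" by (rule poly_vanishing_at_ends[OF F0 FL L])
  define d where "d n = L / real (n + 3)" for n
  have d: "0 < d n" "d n < L / 2" for n
  proof -
    show "0 < d n" unfolding d_def using L by (intro divide_pos_pos) auto
    show "d n < L / 2" unfolding d_def by (rule divide_strict_left_mono) (use L in auto)
  qed
  have dlim: "d \<longlonglongrightarrow> 0"
  proof -
    have "(\<lambda>n. L / real (n + 3)) \<longlonglongrightarrow> 0"
      by (rule LIMSEQ_ignore_initial_segment[OF lim_const_over_n])
    then show ?thesis by (simp add: d_def[abs_def])
  qed
  define \<psi> where "\<psi> n = bump L (d n) (d n) (cut_poly L (d n) * r) 0" for n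
  have test: "\<psi> n \<in> test_fun L" for n unfolding \<psi>_def by (rule bump_test_fun[OF d(1) d])
  let ?c = "\<lambda>n x. cut L (d n) x"
  have psi: "\<psi> n x = of_real (?c n x) * poly r (of_real x) * of_real (flat (d n) 0 (?c n x))" for n x
    by (simp add: \<psi>_def bump_def poly_cut_poly)
  have dpsi: "vderiv (\<psi> n) x = (of_real (L - 2 * x) * poly r (of_real x) + of_real (?c n x) * poly (pderiv r) (of_real x)) * of_real (flat (d n) 0 (?c n x))
      + poly r (of_real x) * of_real (L - 2 * x) * of_real (d n * flat (d n) 1 (?c n x))" for n x
  proof -
    have "flat (d n) 1 (?c n x) = ?c n x * flat (d n) 2 (?c n x)"
      using flat_shift[of "d n" 1 "?c n x" 1] by (simp add: numeral_2_eq_2)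
    then show ?thesis unfolding \<psi>_def vderiv_def vector_derivative_at[OF bump_has_vector_derivative[OF d(1)]]
      by (simp add: pderiv_mult poly_cut_poly poly_pderiv_cut_poly algebra_simps numeral_2_eq_2)
  qed
  have F: "poly F (of_real x) = of_real (cut L 0 x) * poly r (of_real x)" for x by (simp add: r poly_cut_poly)
  have dF: "poly (pderiv F) (of_real x) = of_real (L - 2 * x) * poly r (of_real x) + of_real (cut L 0 x) * poly (pderiv r) (of_real x)" for x
    by (simp add: r pderiv_mult poly_cut_poly poly_pderiv_cut_poly algebra_simps)
  have clim: "(\<lambda>n. ?c n x) \<longlonglongrightarrow> cut L 0 x" for x
  proof -
    have "(\<lambda>n. (x - d n) * (L - d n - x)) \<longlonglongrightarrow> (x - 0) * (L - 0 - x)" by (intro tendsto_intros dlim)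
    then show ?thesis by (simp add: cut_def)
  qed
  have cpos: "cut L 0 x > 0" if "x \<in> {0<..<L}" for x using that by (simp add: cut_def)
  have cbound: "\<bar>?c n x\<bar> \<le> L * L" if x: "x \<in> {0<..<L}" for n x
    unfolding cut_def abs_mult by (rule mult_mono) (use x d[of n] L in \<open>auto simp: abs_le_iff\<close>)
  have "bounded ((\<lambda>x. poly r (complex_of_real x)) ` {0..L})"
    by (intro compact_imp_bounded compact_continuous_image continuous_intros) auto
  then obtain R where R: "\<And>x. x \<in> {0..L} \<Longrightarrow> cmod (poly r (of_real x)) \<le> R" unfolding bounded_iff by blast
  have "bounded ((\<lambda>x. poly (pderiv r) (complex_of_real x)) ` {0..L})"
    by (intro compact_imp_bounded compact_continuous_image continuous_intros) auto
  then obtain R' where R': "\<And>x. x \<in> {0..L} \<Longrightarrow> cmod (poly (pderiv r) (of_real x)) \<le> R'" unfolding bounded_iff by blast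
  have R0: "R \<ge> 0" using order_trans[OF norm_ge_zero R[of 0]] L by simp
  have R0': "R' \<ge> 0" using order_trans[OF norm_ge_zero R'[of 0]] L by simp
  define B where "B = L * L * R + ((L * R + L * L * R') + R * L)"
  have B0: "B \<ge> 0" using L R0 R0' by (simp add: B_def)
  have psi_bound: "cmod (\<psi> n x) \<le> B" if x: "x \<in> {0<..<L}" for n x
  proof -
    have "cmod (\<psi> n x) = \<bar>?c n x\<bar> * cmod (poly r (of_real x)) * flat (d n) 0 (?c n x)"
      using flat_bounds[OF d(1)] by (simp add: psi norm_mult)
    also have "\<dots> \<le> L * L * R * 1"
      using x L R0 by (intro mult_mono cbound R flat_bounds[OF d(1)]) auto
    also have "\<dots> \<le> B" using L R0 R0' by (simp add: B_def)
    finally show ?thesis .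
  qed
  have dpsi_bound: "cmod (vderiv (\<psi> n) x) \<le> B" if x: "x \<in> {0<..<L}" for n x
  proof -
    have a: "cmod (of_real (L - 2 * x)) \<le> L" unfolding norm_of_real using x by (simp add: abs_le_iff)
    have "cmod (vderiv (\<psi> n) x) \<le> (cmod (of_real (L - 2 * x)) * cmod (poly r (of_real x)) + \<bar>?c n x\<bar> * cmod (poly (pderiv r) (of_real x))) * flat (d n) 0 (?c n x)
      + cmod (poly r (of_real x)) * cmod (of_real (L - 2 * x)) * (d n * flat (d n) 1 (?c n x))"
    proof -
      have "cmod (vderiv (\<psi> n) x) \<le> cmod ((of_real (L - 2 * x) * poly r (of_real x) + of_real (?c n x) * poly (pderiv r) (of_real x)) * of_real (flat (d n) 0 (?c n x)))
        + cmod (poly r (of_real x) * of_real (L - 2 * x) * of_real (d n * flat (d n) 1 (?c n x)))"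
        unfolding dpsi by (rule norm_triangle_ineq)
      also have "cmod ((of_real (L - 2 * x) * poly r (of_real x) + of_real (?c n x) * poly (pderiv r) (of_real x)) * of_real (flat (d n) 0 (?c n x)))
        \<le> (cmod (of_real (L - 2 * x)) * cmod (poly r (of_real x)) + \<bar>?c n x\<bar> * cmod (poly (pderiv r) (of_real x))) * flat (d n) 0 (?c n x)"
        unfolding norm_mult norm_of_real abs_of_nonneg[OF flat_bounds(1)[OF d(1)]]
        by (intro mult_right_mono flat_bounds[OF d(1)] order_trans[OF norm_triangle_ineq])
          (simp only: norm_mult norm_of_real order_refl)
      also have "cmod (poly r (of_real x) * of_real (L - 2 * x) * of_real (d n * flat (d n) 1 (?c n x)))
        = cmod (poly r (of_real x)) * cmod (of_real (L - 2 * x)) * (d n * flat (d n) 1 (?c n x))"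
        unfolding norm_mult[of _ "of_real (d n * flat (d n) 1 (?c n x))"] norm_of_real[of "d n * flat (d n) 1 (?c n x)"]
          abs_of_nonneg[OF flat_bounds(3)[OF d(1)]] by (simp only: norm_mult)
      finally show ?thesis by simp
    qed
    also have "\<dots> \<le> (L * R + L * L * R') * 1 + R * L * 1"
      using x L R0 R0' by (intro add_mono mult_mono a cbound R R' flat_bounds[OF d(1)]) (auto intro!: add_nonneg_nonneg mult_nonneg_nonneg flat_bounds[OF d(1)])
    also have "\<dots> \<le> B" using L R0 R0' by (simp add: B_def)
    finally show ?thesis .
  qed
  have l2psi: "\<psi> n \<in> l2 L" "vderiv (\<psi> n) \<in> l2 L" for n
    using ac_l2[OF test_fun_ac(1)[OF test]] ac_deriv_l2[OF test_fun_ac(1)[OF test]] by auto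
  have l2F: "(\<lambda>x. poly F (of_real x)) \<in> l2 L" "(\<lambda>x. poly (pderiv F) (of_real x)) \<in> l2 L"
    using ac_l2[OF ac_poly] ac_deriv_l2[OF ac_poly] by auto
  show ?thesis
  proof (rule that[OF test])
    show "(\<lambda>n. l2_norm L (\<lambda>x. \<psi> n x - poly F (of_real x))) \<longlonglongrightarrow> 0"
    proof (rule l2_dominated_convergence[OF l2F(1) l2psi(1) l2_const[of "of_real B"]])
      show "AE x in lebI L. (\<lambda>n. \<psi> n x) \<longlonglongrightarrow> poly F (of_real x)"
      proof (rule AE_lebI_I)
        fix x assume x: "x \<in> {0<..<L}"
        have "(\<lambda>n. of_real (?c n x) * poly r (of_real x) * of_real (flat (d n) 0 (?c n x))) \<longlonglongrightarrow>
          of_real (cut L 0 x) * poly r (of_real x) * of_real 1"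
          by (intro tendsto_intros clim flat_limits[OF dlim clim cpos[OF x]])
        then show "(\<lambda>n. \<psi> n x) \<longlonglongrightarrow> poly F (of_real x)" by (simp add: psi F)
      qed
      show "AE x in lebI L. cmod (\<psi> n x) \<le> cmod (complex_of_real B)" for n
        by (rule AE_lebI_I) (use psi_bound B0 in auto)
    qed
    show "(\<lambda>n. l2_norm L (\<lambda>x. vderiv (\<psi> n) x - poly (pderiv F) (of_real x))) \<longlonglongrightarrow> 0"
    proof (rule l2_dominated_convergence[OF l2F(2) l2psi(2) l2_const[of "of_real B"]])
      show "AE x in lebI L. (\<lambda>n. vderiv (\<psi> n) x) \<longlonglongrightarrow> poly (pderiv F) (of_real x)"
      proof (rule AE_lebI_I)
        fix x assume x: "x \<in> {0<..<L}"
        have "(\<lambda>n. vderiv (\<psi> n) x) \<longlonglongrightarrow> (of_real (L - 2 * x) * poly r (of_real x) + of_real (cut L 0 x) * poly (pderiv r) (of_real x)) * of_real 1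
          + poly r (of_real x) * of_real (L - 2 * x) * of_real 0"
          unfolding dpsi by (intro tendsto_intros clim flat_limits[OF dlim clim cpos[OF x]])
        then show "(\<lambda>n. vderiv (\<psi> n) x) \<longlonglongrightarrow> poly (pderiv F) (of_real x)" unfolding dF by simp
      qed
      show "AE x in lebI L. cmod (vderiv (\<psi> n) x) \<le> cmod (complex_of_real B)" for n
        by (rule AE_lebI_I) (use dpsi_bound B0 in auto)
    qed
  qed
qed

section \<open>Weak derivatives\<close>

lemma is_wderiv_iff:
  "is_wderiv L u g \<longleftrightarrow> (\<forall>\<psi>\<in>test_fun L. - (LINT x|lebI L. u x * vderiv \<psi> x) = (LINT x|lebI L. g x * \<psi> x))"
  by (simp add: is_wderiv_def distr_eq_def distr_deriv_def distr_of_def)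

lemma is_wderiv_ac:
  assumes L: "L > 0" and f: "ac L f g"
  shows "is_wderiv L f g"
  unfolding is_wderiv_iff
proof
  fix \<psi> assume t: "\<psi> \<in> test_fun L"
  note a = test_fun_ac[OF t]
  have "(LINT x|lebI L. g x * \<psi> x) + (LINT x|lebI L. f x * vderiv \<psi> x) = (LINT x|lebI L. g x * \<psi> x + f x * vderiv \<psi> x)"
    by (intro Bochner_Integration.integral_add[symmetric] l2_prod_integrable ac_deriv_l2[OF f] ac_l2[OF f] ac_l2[OF a(1)] ac_deriv_l2[OF a(1)])
  also have "\<dots> = 0" using ac_integration_by_parts[OF f a(1) L] a(2,3) by simp
  finally show "- (LINT x|lebI L. f x * vderiv \<psi> x) = (LINT x|lebI L. g x * \<psi> x)"
    by (metis add.inverse_unique add.commute)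
qed

lemma LINT_prod_cong_AE:
  assumes "AE x in lebI L. u x = f x" "u \<in> l2 L" "f \<in> l2 L" "v \<in> l2 L"
  shows "(LINT x|lebI L. u x * v x) = (LINT x|lebI L. f x * (v x :: complex))"
proof (rule integral_cong_AE)
  show "AE x in lebI L. u x * v x = f x * v x" using assms(1) by eventually_elim simp
qed (use assms in \<open>auto simp: l2_def\<close>)

lemma is_wderiv_cong_AE:
  assumes ae: "AE x in lebI L. u x = f x" and l: "u \<in> l2 L" "f \<in> l2 L" and w: "is_wderiv L f g"
  shows "is_wderiv L u g"
  unfolding is_wderiv_iff
proof
  fix \<psi> assume t: "\<psi> \<in> test_fun L"
  show "- (LINT x|lebI L. u x * vderiv \<psi> x) = (LINT x|lebI L. g x * \<psi> x)"
    using w t LINT_prod_cong_AE[OF ae l ac_deriv_l2[OF test_fun_ac(1)[OF t]]] by (simp add: is_wderiv_iff)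
qed

lemma LINT_prod_tendsto:
  assumes w: "w \<in> l2 L" and f: "\<And>n. f n \<in> l2 L" and g: "g \<in> l2 L"
    and lim: "(\<lambda>n. l2_norm L (\<lambda>x. f n x - g x)) \<longlonglongrightarrow> 0"
  shows "(\<lambda>n. LINT x|lebI L. w x * f n x) \<longlonglongrightarrow> (LINT x|lebI L. w x * g x)"
proof -
  have "(\<lambda>n. (LINT x|lebI L. w x * f n x) - (LINT x|lebI L. w x * g x)) \<longlonglongrightarrow> 0"
  proof (rule Lim_null_comparison)
    show "(\<lambda>n. l2_norm L w * l2_norm L (\<lambda>x. f n x - g x)) \<longlonglongrightarrow> 0"
      using tendsto_mult_right_zero[OF lim] by simp
    have "norm ((LINT x|lebI L. w x * f n x) - (LINT x|lebI L. w x * g x)) \<le> l2_norm L w * l2_norm L (\<lambda>x. f n x - g x)" for n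
    proof -
      have "(LINT x|lebI L. w x * f n x) - (LINT x|lebI L. w x * g x) = (LINT x|lebI L. w x * (f n x - g x))"
        using l2_prod_integrable[OF w f[of n]] l2_prod_integrable[OF w g] by (simp add: right_diff_distrib)
      also have "norm \<dots> \<le> (LINT x|lebI L. cmod (w x * (f n x - g x)))" by (rule integral_norm_bound)
      also have "\<dots> \<le> l2_norm L w * l2_norm L (\<lambda>x. f n x - g x)"
        using l2_Cauchy_Schwarz[OF w l2_diff[OF f g]] by (simp add: norm_mult)
      finally show ?thesis .
    qed
    then show "\<forall>\<^sub>F n in sequentially. norm ((LINT x|lebI L. w x * f n x) - (LINT x|lebI L. w x * g x))
      \<le> l2_norm L w * l2_norm L (\<lambda>x. f n x - g x)" by simp
  qed
  then show ?thesis by (simp add: LIM_zero_iff)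
qed

text \<open>
  By approximation, \<open>w\<close> is orthogonal to the derivatives of all polynomials that vanish at the
  ends. Every polynomial \<open>p\<close> minus its mean value is such a derivative, so \<open>w\<close> minus its mean
  value is orthogonal to all polynomials.
\<close>

lemma du_Bois_Reymond:
  assumes L: "L > 0" and w: "w \<in> l2 L" and orth: "\<And>\<psi>. \<psi> \<in> test_fun L \<Longrightarrow> (LINT x|lebI L. w x * vderiv \<psi> x) = 0"
  obtains c where "AE x in lebI L. w x = c"
proof -
  define c where "c = (LINT x|lebI L. w x) / of_real L"
  \<comment> \<open>the hypothesis passes from test functions to polynomials that vanish at the ends\<close>
  have F0: "(LINT x|lebI L. w x * poly (pderiv F) (of_real x)) = 0"
    if ends: "poly F 0 = 0" "poly F (of_real L) = 0" for F :: "complex poly"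
  proof -
    obtain \<psi> where t: "\<And>n. \<psi> n \<in> test_fun L"
      and lim: "(\<lambda>n. l2_norm L (\<lambda>x. vderiv (\<psi> n) x - poly (pderiv F) (of_real x))) \<longlonglongrightarrow> 0"
      using test_fun_approximates_poly[OF L ends] by blast
    have "(\<lambda>n. LINT x|lebI L. w x * vderiv (\<psi> n) x) \<longlonglongrightarrow> (LINT x|lebI L. w x * poly (pderiv F) (of_real x))"
      by (rule LINT_prod_tendsto[OF w ac_deriv_l2[OF test_fun_ac(1)[OF t]] ac_deriv_l2[OF ac_poly] lim])
    then have "(\<lambda>n. 0) \<longlonglongrightarrow> (LINT x|lebI L. w x * poly (pderiv F) (of_real x))" by (simp add: orth[OF t])
    then show ?thesis by (simp add: LIMSEQ_const_iff)
  qed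
  have wc: "(\<lambda>x. w x - c) \<in> l2 L" by (intro l2_diff w l2_const)
  have "AE x in lebI L. w x - c = 0"
  proof (rule AE_zero_of_orthogonal_to_polys[OF L wc])
    fix p :: "complex poly"
    obtain P where P: "pderiv P = p" "poly P 0 = 0" by (rule poly_antiderivative)
    define m where "m = poly P (of_real L) / of_real L"
    have ip: "(LINT x|lebI L. poly p (of_real x)) = of_real L * m"
    proof -
      have "(LINT x|lebI L. poly (pderiv P) (of_real x)) = integral {0..L} (\<lambda>x. poly (pderiv P) (of_real x))"
        by (intro LINT_eq_integral l2_integrable ac_deriv_l2[OF ac_poly])
      also have "\<dots> = poly P (of_real L)" using ac_eq[OF ac_poly[of L P], of L] L P(2) by simp
      finally show ?thesis using L P(1) by (simp add: m_def)
    qed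
    have "(LINT x|lebI L. w x * poly (pderiv (P - [:0, m:])) (of_real x)) = 0"
      by (rule F0) (use L P(2) in \<open>auto simp: m_def\<close>)
    then have 0: "(LINT x|lebI L. w x * (poly p (of_real x) - m)) = 0" by (simp add: pderiv_diff pderiv_pCons P(1))
    have pl: "(\<lambda>x. poly p (complex_of_real x)) \<in> l2 L" by (rule ac_l2[OF ac_poly])
    have i: "integrable (lebI L) (\<lambda>x. w x * poly p (of_real x))" "integrable (lebI L) w"
      "integrable (lebI L) (\<lambda>x. poly p (complex_of_real x))"
      using l2_prod_integrable[OF w pl] l2_integrable[OF w] l2_integrable[OF pl] by auto
    have "(LINT x|lebI L. w x * (poly p (of_real x) - m)) = (LINT x|lebI L. w x * poly p (of_real x)) - (LINT x|lebI L. w x) * m"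
      using i by (simp add: right_diff_distrib)
    moreover have "(LINT x|lebI L. (w x - c) * poly p (of_real x)) = (LINT x|lebI L. w x * poly p (of_real x)) - c * (LINT x|lebI L. poly p (of_real x))"
      using i by (simp add: left_diff_distrib)
    ultimately show "(LINT x|lebI L. (w x - c) * poly p (of_real x)) = 0"
      using 0 ip L by (simp add: c_def)
  qed
  then have "AE x in lebI L. w x = c" by eventually_elim simp
  with that show ?thesis by blast
qed

lemma is_wderiv_representative:
  assumes L: "L > 0" and u: "u \<in> l2 L" and g: "g \<in> l2 L" and w: "is_wderiv L u g"
  obtains f where "ac L f g" "AE x in lebI L. u x = f x"
proof -
  define f0 where "f0 x = 0 + integral {0..x} g" for x
  have a0: "ac L f0 g" unfolding f0_def by (rule ac_integral[OF g])
  have "(LINT x|lebI L. (u x - f0 x) * vderiv \<psi> x) = 0" if t: "\<psi> \<in> test_fun L" for \<psi>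
  proof -
    have d: "vderiv \<psi> \<in> l2 L" by (rule ac_deriv_l2[OF test_fun_ac(1)[OF t]])
    have "(LINT x|lebI L. (u x - f0 x) * vderiv \<psi> x) = (LINT x|lebI L. u x * vderiv \<psi> x) - (LINT x|lebI L. f0 x * vderiv \<psi> x)"
      using l2_prod_integrable[OF u d] l2_prod_integrable[OF ac_l2[OF a0] d] by (simp add: left_diff_distrib)
    also have "\<dots> = 0" using w is_wderiv_ac[OF L a0] t unfolding is_wderiv_iff
      by (metis add.inverse_inverse right_minus_eq)
    finally show ?thesis .
  qed
  then obtain c where c: "AE x in lebI L. u x - f0 x = c"
    using du_Bois_Reymond[OF L l2_diff[OF u ac_l2[OF a0]]] by blast
  have "ac L (\<lambda>x. f0 x + c) g" using ac_add[OF a0 ac_const[of L c]] by simp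
  moreover have "AE x in lebI L. u x = f0 x + c" using c by eventually_elim (simp add: algebra_simps)
  ultimately show ?thesis by (rule that)
qed

text \<open>
  The difference of two weak derivatives of \<open>u\<close> is a weak derivative of 0. The primitive that
  represents 0 vanishes identically, and integrating it by parts against polynomials shows that
  the difference is orthogonal to all polynomials.
\<close>

lemma wderiv_unique:
  assumes L: "L > 0" and g: "g \<in> l2 L" "g' \<in> l2 L" and w: "is_wderiv L u g" "is_wderiv L u g'"
  shows "AE x in lebI L. g x = g' x"
proof -
  have d: "(\<lambda>x. g x - g' x) \<in> l2 L" by (intro l2_diff g)
  \<comment> \<open>the representation theorem applies to the function 0 with this weak derivative\<close>
  have w0: "is_wderiv L (\<lambda>x. 0) (\<lambda>x. g x - g' x)"
    unfolding is_wderiv_iff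
  proof
    fix \<psi> assume t: "\<psi> \<in> test_fun L"
    have p: "\<psi> \<in> l2 L" by (rule ac_l2[OF test_fun_ac(1)[OF t]])
    show "- (LINT x|lebI L. 0 * vderiv \<psi> x) = (LINT x|lebI L. (g x - g' x) * \<psi> x)"
      using w t l2_prod_integrable[OF g(1) p] l2_prod_integrable[OF g(2) p]
      by (simp add: is_wderiv_iff left_diff_distrib)
  qed
  obtain f where f: "ac L f (\<lambda>x. g x - g' x)" "AE x in lebI L. 0 = f x"
    using is_wderiv_representative[OF L l2_const d w0] by blast
  have fz: "f x = 0" if "x \<in> {0..L}" for x
  proof -
    have "AE x in lebI L. f x = 0" using f(2) by eventually_elim simp
    from continuous_eq_of_AE[OF L ac_continuous[OF f(1)] continuous_on_const this that] show ?thesis .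
  qed
  have "(LINT x|lebI L. (g x - g' x) * poly p (of_real x)) = 0" for p
  proof -
    have pl: "(\<lambda>x. poly p (complex_of_real x)) \<in> l2 L" "(\<lambda>x. poly (pderiv p) (complex_of_real x)) \<in> l2 L"
      by (rule ac_l2[OF ac_poly], rule ac_deriv_l2[OF ac_poly])
    have "(LINT x|lebI L. (g x - g' x) * poly p (of_real x)) = (LINT x|lebI L. (g x - g' x) * poly p (of_real x) + f x * poly (pderiv p) (of_real x))"
      by (rule Bochner_Integration.integral_cong) (auto simp: space_restrict_space fz)
    also have "\<dots> = 0" using ac_integration_by_parts[OF f(1) ac_poly L, of p] fz[of 0] fz[of L] L by simp
    finally show ?thesis .
  qed
  then have "AE x in lebI L. g x - g' x = 0" by (rule AE_zero_of_orthogonal_to_polys[OF L d])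
  then show ?thesis by eventually_elim simp
qed

lemma wderiv_l2: "u \<in> h1 L \<Longrightarrow> wderiv L u \<in> l2 L"
  and is_wderiv_wderiv: "u \<in> h1 L \<Longrightarrow> is_wderiv L u (wderiv L u)"
proof -
  assume "u \<in> h1 L"
  then have "\<exists>g. g \<in> l2 L \<and> is_wderiv L u g" by (auto simp: h1_def)
  then have "wderiv L u \<in> l2 L \<and> is_wderiv L u (wderiv L u)" unfolding wderiv_def by (rule someI_ex)
  then show "wderiv L u \<in> l2 L" "is_wderiv L u (wderiv L u)" by auto
qed

lemma h1_l2: "u \<in> h1 L \<Longrightarrow> u \<in> l2 L" by (simp add: h1_def)

theorem h1I_representative:
  assumes L: "L > 0" and u: "u \<in> l2 L" and f: "ac L f g" and ae: "AE x in lebI L. u x = f x"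
  shows "u \<in> h1 L" "AE x in lebI L. wderiv L u x = g x" "\<And>x. x \<in> {0..L} \<Longrightarrow> pt_val L u x = f x"
proof -
  have w: "is_wderiv L u g" by (rule is_wderiv_cong_AE[OF ae u ac_l2[OF f] is_wderiv_ac[OF L f]])
  show h: "u \<in> h1 L" using u w ac_deriv_l2[OF f] by (auto simp: h1_def)
  show "AE x in lebI L. wderiv L u x = g x"
    by (rule wderiv_unique[OF L wderiv_l2[OF h] ac_deriv_l2[OF f] is_wderiv_wderiv[OF h] w])
  have "\<exists>g. continuous_on {0..L} g \<and> (AE x in lebI L. u x = g x)" using ac_continuous[OF f] ae by blast
  then have p: "continuous_on {0..L} (pt_val L u)" "AE x in lebI L. u x = pt_val L u x"
    unfolding pt_val_def by (rule someI2_ex, blast)+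
  have "AE x in lebI L. pt_val L u x = f x" using p(2) ae by eventually_elim simp
  then show "pt_val L u x = f x" if "x \<in> {0..L}" for x
    using continuous_eq_of_AE[OF L p(1) ac_continuous[OF f] _ that] by blast
qed

lemma h1I:
  assumes "L > 0" "ac L f g"
  shows "f \<in> h1 L" "AE x in lebI L. wderiv L f x = g x" "\<And>x. x \<in> {0..L} \<Longrightarrow> pt_val L f x = f x"
  using h1I_representative[OF assms(1) ac_l2[OF assms(2)] assms(2)] by auto

theorem h1_representative:
  assumes L: "L > 0" and u: "u \<in> h1 L"
  shows "ac L (pt_val L u) (wderiv L u)" "AE x in lebI L. u x = pt_val L u x"
proof -
  obtain f where f: "ac L f (wderiv L u)" "AE x in lebI L. u x = f x"
    using is_wderiv_representative[OF L h1_l2[OF u] wderiv_l2[OF u] is_wderiv_wderiv[OF u]] by blast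
  have p: "pt_val L u x = f x" if "x \<in> {0..L}" for x
    by (rule h1I_representative(3)[OF L h1_l2[OF u] f that])
  show "ac L (pt_val L u) (wderiv L u)"
  proof (rule ac_I[OF wderiv_l2[OF u]])
    fix x assume x: "0 \<le> x" "x \<le> L"
    show "pt_val L u x = pt_val L u 0 + integral {0..x} (wderiv L u)"
      using ac_eq[OF f(1) x] p[of x] p[of 0] x L by simp
  qed
  have "AE x in lebI L. x \<in> {0..L}" by (rule AE_lebI_I) auto
  with f(2) show "AE x in lebI L. u x = pt_val L u x" by eventually_elim (simp add: p)
qed

lemma h1_add:
  assumes L: "L > 0" and u: "u \<in> h1 L" and v: "v \<in> h1 L"
  shows "(\<lambda>x. u x + v x) \<in> h1 L" "AE x in lebI L. wderiv L (\<lambda>x. u x + v x) x = wderiv L u x + wderiv L v x"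
    "\<And>x. x \<in> {0..L} \<Longrightarrow> pt_val L (\<lambda>x. u x + v x) x = pt_val L u x + pt_val L v x"
proof -
  have ae: "AE x in lebI L. u x + v x = pt_val L u x + pt_val L v x"
    using h1_representative(2)[OF L u] h1_representative(2)[OF L v] by eventually_elim simp
  note r = h1I_representative[OF L l2_add[OF h1_l2[OF u] h1_l2[OF v]]
      ac_add[OF h1_representative(1)[OF L u] h1_representative(1)[OF L v]] ae]
  show "(\<lambda>x. u x + v x) \<in> h1 L" "AE x in lebI L. wderiv L (\<lambda>x. u x + v x) x = wderiv L u x + wderiv L v x"
    "\<And>x. x \<in> {0..L} \<Longrightarrow> pt_val L (\<lambda>x. u x + v x) x = pt_val L u x + pt_val L v x"
    by (rule r, assumption?)+
qed

lemma h1_scale: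
  assumes L: "L > 0" and u: "u \<in> h1 L"
  shows "(\<lambda>x. c * u x) \<in> h1 L" "AE x in lebI L. wderiv L (\<lambda>x. c * u x) x = c * wderiv L u x"
    "\<And>x. x \<in> {0..L} \<Longrightarrow> pt_val L (\<lambda>x. c * u x) x = c * pt_val L u x"
proof -
  have ae: "AE x in lebI L. c * u x = c * pt_val L u x"
    using h1_representative(2)[OF L u] by eventually_elim simp
  note r = h1I_representative[OF L l2_scale[OF h1_l2[OF u]] ac_scale[OF h1_representative(1)[OF L u]] ae]
  show "(\<lambda>x. c * u x) \<in> h1 L" "AE x in lebI L. wderiv L (\<lambda>x. c * u x) x = c * wderiv L u x"
    "\<And>x. x \<in> {0..L} \<Longrightarrow> pt_val L (\<lambda>x. c * u x) x = c * pt_val L u x"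
    by (rule r, assumption?)+
qed

lemma h1_norm_eq:
  assumes "u \<in> h1 L"
  shows "h1_norm L u = sqrt ((l2_norm L u)\<^sup>2 + (l2_norm L (wderiv L u))\<^sup>2)"
  using l2_inner_self[OF h1_l2[OF assms]] l2_inner_self[OF wderiv_l2[OF assms]] by (simp add: h1_norm_def)

text \<open>
  End values are continuous with respect to the norm by the Sobolev embedding and vanish for test
  functions. Conversely, if the end values vanish, then the derivative is approximated by a
  polynomial, the primitive of the latter is corrected by a small linear function such that it
  vanishes at both ends, and polynomials of this kind are limits of test functions.
\<close>

theorem h1_0_iff:
  assumes L: "L > 0"
  shows "u \<in> h1_0 L \<longleftrightarrow> u \<in> h1 L \<and> pt_val L u 0 = 0 \<and> pt_val L u L = 0"
proof (intro iffI conjI)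
  assume u0: "u \<in> h1_0 L"
  then show u: "u \<in> h1 L" by (simp add: h1_0_def)
  have z: "pt_val L u x = 0" if x: "x = 0 \<or> x = L" for x
  proof -
    have xi: "x \<in> {0..L}" using x L by auto
    define C where "C = 1 / sqrt L + 2 * sqrt L"
    have C: "C > 0" using L by (simp add: C_def add_pos_pos)
    have "cmod (pt_val L u x) \<le> 0 + e" if e: "e > 0" for e
    proof -
      obtain \<psi> where t: "\<psi> \<in> test_fun L" and n: "h1_norm L (\<lambda>x. u x - \<psi> x) < e / C"
        using u0 e C unfolding h1_0_def by (auto dest!: spec[of _ "e / C"])
      note a = test_fun_ac[OF t]
      have ae: "AE x in lebI L. u x - \<psi> x = pt_val L u x - \<psi> x"
        using h1_representative(2)[OF L u] by eventually_elim simp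
      note r = h1I_representative[OF L l2_diff[OF h1_l2[OF u] ac_l2[OF a(1)]]
          ac_diff[OF h1_representative(1)[OF L u] a(1)] ae]
      have rr: "ac L (pt_val L (\<lambda>x. u x - \<psi> x)) (wderiv L (\<lambda>x. u x - \<psi> x))"
        "AE y in lebI L. u y - \<psi> y = pt_val L (\<lambda>x. u x - \<psi> x) y"
        by (rule h1_representative[OF L r(1)])+
      have N: "l2_norm L (\<lambda>x. u x - \<psi> x) \<le> e / C" "l2_norm L (wderiv L (\<lambda>x. u x - \<psi> x)) \<le> e / C"
        using n unfolding h1_norm_eq[OF r(1)]
        by (smt (verit) l2_norm_nonneg real_sqrt_sum_squares_ge1 real_sqrt_sum_squares_ge2)+
      have "l2_norm L (pt_val L (\<lambda>x. u x - \<psi> x)) = l2_norm L (\<lambda>x. u x - \<psi> x)"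
        by (rule l2_norm_cong_AE[symmetric, OF rr(2) h1_l2[OF r(1)] ac_l2[OF rr(1)]])
      then have "cmod (pt_val L (\<lambda>x. u x - \<psi> x) x) \<le> l2_norm L (\<lambda>x. u x - \<psi> x) / sqrt L + 2 * sqrt L * l2_norm L (wderiv L (\<lambda>x. u x - \<psi> x))"
        using ac_sup_bound_norms[OF rr(1) L xi] by simp
      also have "\<dots> \<le> (e / C) / sqrt L + 2 * sqrt L * (e / C)"
        using N L by (intro add_mono divide_right_mono mult_left_mono) auto
      also have "\<dots> = e / C * (1 / sqrt L + 2 * sqrt L)" by (simp only: distrib_left) (simp add: mult.commute)
      also have "\<dots> = e / C * C" by (simp only: C_def)
      also have "\<dots> = e" using C by simp
      finally have "cmod (pt_val L (\<lambda>x. u x - \<psi> x) x) \<le> e" .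
      moreover have "\<psi> x = 0" using x a(2,3) by auto
      ultimately show ?thesis using r(3)[OF xi] by simp
    qed
    from field_le_epsilon[OF this] show ?thesis by simp
  qed
  show "pt_val L u 0 = 0" "pt_val L u L = 0" by (rule z, simp)+
next
  assume asm: "u \<in> h1 L \<and> pt_val L u 0 = 0 \<and> pt_val L u L = 0"
  define f where "f = pt_val L u"
  define f' where "f' = wderiv L u"
  have u: "u \<in> h1 L" and f0: "f 0 = 0" "f L = 0" using asm by (auto simp: f_def)
  have f: "ac L f f'" and uf: "AE x in lebI L. u x = f x"
    using h1_representative[OF L u] by (auto simp: f_def f'_def)
  have "\<exists>\<psi>\<in>test_fun L. h1_norm L (\<lambda>x. u x - \<psi> x) < e" if e: "e > 0" for e
  proof -
    \<comment> \<open>the errors of the polynomial are at most \<open>2 \<eta>\<close> in the derivative and \<open>2 L \<eta>\<close> in the function, together \<open>e/2\<close>\<close>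
    define \<eta> where "\<eta> = e / (4 * (L + 1))"
    have eta: "\<eta> > 0" using e L by (simp add: \<eta>_def)
    obtain p where p: "l2_norm L (\<lambda>x. f' x - poly p (of_real x)) < \<eta>"
      using l2_poly_dense[OF L ac_deriv_l2[OF f] eta] by blast
    obtain P where P: "pderiv P = p" "poly P 0 = 0" by (rule poly_antiderivative)
    define m where "m = poly P (of_real L) / of_real L"
    define F where "F = P - [:0, m:]"
    have F0: "poly F 0 = 0" "poly F (of_real L) = 0" and dF: "pderiv F = p - [:m:]"
      using P L by (auto simp: F_def m_def pderiv_diff pderiv_pCons)
    have a1: "ac L (\<lambda>x. f x - poly P (of_real x)) (\<lambda>x. f' x - poly p (of_real x))"
      using ac_diff[OF f ac_poly[of L P]] by (simp add: P(1))
    have "cmod (poly P (of_real L)) \<le> sqrt L * \<eta>"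
    proof -
      have "cmod ((f L - poly P (of_real L)) - (f 0 - poly P (of_real 0))) \<le> sqrt L * l2_norm L (\<lambda>x. f' x - poly p (of_real x))"
        by (rule ac_sup_bound[OF a1 L]) (use L in auto)
      also have "\<dots> \<le> sqrt L * \<eta>" using p L by (intro mult_left_mono) auto
      finally show ?thesis using f0 P(2) by simp
    qed
    then have "cmod m \<le> (sqrt L * \<eta>) / L"
      using L by (simp add: m_def norm_divide divide_right_mono)
    also have "\<dots> = \<eta> / sqrt L" using L by (simp add: field_simps)
    finally have m: "cmod m \<le> \<eta> / sqrt L" .
    have pl: "(\<lambda>x. poly p (complex_of_real x)) \<in> l2 L" by (rule ac_l2[OF ac_poly])
    have a2: "ac L (\<lambda>x. f x - poly F (of_real x)) (\<lambda>x. f' x - poly (pderiv F) (of_real x))"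
      by (rule ac_diff[OF f ac_poly])
    have d2: "l2_norm L (\<lambda>x. f' x - poly (pderiv F) (of_real x)) \<le> 2 * \<eta>"
    proof -
      have "l2_norm L (\<lambda>x. (f' x - poly p (of_real x)) + m) \<le> l2_norm L (\<lambda>x. f' x - poly p (of_real x)) + l2_norm L (\<lambda>x. m)"
        by (intro l2_norm_triangle l2_diff ac_deriv_l2[OF f] pl l2_const)
      also have "\<dots> \<le> \<eta> + sqrt L * (\<eta> / sqrt L)"
        using p mult_left_mono[OF m, of "sqrt L"] L unfolding l2_norm_const[OF L] by (intro add_mono) auto
      also have "\<dots> = 2 * \<eta>" using L by simp
      finally show ?thesis by (simp add: dF algebra_simps)
    qed
    have d1: "l2_norm L (\<lambda>x. f x - poly F (of_real x)) \<le> L * (2 * \<eta>)"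
    proof -
      have "l2_norm L (\<lambda>x. f x - poly F (of_real x)) \<le> sqrt L * (sqrt L * (2 * \<eta>))"
      proof (rule l2_norm_le_sup[OF ac_l2[OF a2] L])
        fix x assume x: "x \<in> {0<..<L}"
        have "cmod ((f x - poly F (of_real x)) - (f 0 - poly F (of_real 0))) \<le> sqrt L * l2_norm L (\<lambda>x. f' x - poly (pderiv F) (of_real x))"
          by (rule ac_sup_bound[OF a2 L]) (use x in auto)
        also have "\<dots> \<le> sqrt L * (2 * \<eta>)" using d2 L by (intro mult_left_mono) auto
        finally show "cmod (f x - poly F (of_real x)) \<le> sqrt L * (2 * \<eta>)" using f0 F0 by simp
      qed (use L eta in auto)
      then show ?thesis using L by (simp add: mult.assoc[symmetric])
    qed
    obtain \<psi> where t: "\<And>n. \<psi> n \<in> test_fun L"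
      and lim: "(\<lambda>n. l2_norm L (\<lambda>x. \<psi> n x - poly F (of_real x))) \<longlonglongrightarrow> 0"
        "(\<lambda>n. l2_norm L (\<lambda>x. vderiv (\<psi> n) x - poly (pderiv F) (of_real x))) \<longlonglongrightarrow> 0"
      using test_fun_approximates_poly[OF L F0] by blast
    have "\<forall>\<^sub>F n in sequentially. l2_norm L (\<lambda>x. \<psi> n x - poly F (of_real x)) < e / 4 \<and>
        l2_norm L (\<lambda>x. vderiv (\<psi> n) x - poly (pderiv F) (of_real x)) < e / 4"
      using order_tendstoD(2)[OF lim(1), of "e / 4"] order_tendstoD(2)[OF lim(2), of "e / 4"] e
      by (simp add: eventually_conj)
    then obtain n where n: "l2_norm L (\<lambda>x. \<psi> n x - poly F (of_real x)) < e / 4"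
        "l2_norm L (\<lambda>x. vderiv (\<psi> n) x - poly (pderiv F) (of_real x)) < e / 4"
      by (auto simp: eventually_sequentially)
    note a = test_fun_ac[OF t[of n]]
    have eta_L: "2 * \<eta> < e / 2 " "L * (2 * \<eta>) \<le> e / 2 - 2 * \<eta>"
      using e L by (auto simp: \<eta>_def field_simps)
    have Fl: "(\<lambda>x. poly F (complex_of_real x)) \<in> l2 L" "(\<lambda>x. poly (pderiv F) (complex_of_real x)) \<in> l2 L"
      by (rule ac_l2[OF ac_poly], rule ac_deriv_l2[OF ac_poly])
    have ae: "AE x in lebI L. u x - \<psi> n x = f x - \<psi> n x" using uf by eventually_elim simp
    note r = h1I_representative[OF L l2_diff[OF h1_l2[OF u] ac_l2[OF a(1)]] ac_diff[OF f a(1)] ae]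
    have e1: "l2_norm L (\<lambda>x. u x - \<psi> n x) = l2_norm L (\<lambda>x. f x - \<psi> n x)"
      by (intro l2_norm_cong_AE ae l2_diff h1_l2 u ac_l2[OF a(1)] ac_l2[OF f])
    have e2: "l2_norm L (wderiv L (\<lambda>x. u x - \<psi> n x)) = l2_norm L (\<lambda>x. f' x - vderiv (\<psi> n) x)"
      by (intro l2_norm_cong_AE r(2) l2_diff wderiv_l2[OF r(1)] ac_deriv_l2[OF a(1)] ac_deriv_l2[OF f])
    have "l2_norm L (\<lambda>x. f x - \<psi> n x) \<le> l2_norm L (\<lambda>x. f x - poly F (of_real x)) + l2_norm L (\<lambda>x. poly F (of_real x) - \<psi> n x)"
      by (intro l2_norm_triangle_diff ac_l2[OF f] Fl ac_l2[OF a(1)])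
    moreover have "l2_norm L (\<lambda>x. f' x - vderiv (\<psi> n) x) \<le> l2_norm L (\<lambda>x. f' x - poly (pderiv F) (of_real x)) + l2_norm L (\<lambda>x. poly (pderiv F) (of_real x) - vderiv (\<psi> n) x)"
      by (intro l2_norm_triangle_diff ac_deriv_l2[OF f] Fl ac_deriv_l2[OF a(1)])
    ultimately have s: "l2_norm L (\<lambda>x. u x - \<psi> n x) + l2_norm L (wderiv L (\<lambda>x. u x - \<psi> n x)) < e"
      using d1 d2 n eta_L unfolding e1 e2
        l2_norm_minus_commute[of L "\<psi> n"] l2_norm_minus_commute[of L "vderiv (\<psi> n)"] by linarith
    have "h1_norm L (\<lambda>x. u x - \<psi> n x) \<le> l2_norm L (\<lambda>x. u x - \<psi> n x) + l2_norm L (wderiv L (\<lambda>x. u x - \<psi> n x))"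
      unfolding h1_norm_eq[OF r(1)] by (intro sqrt_sum_squares_le_sum l2_norm_nonneg)
    with s t show ?thesis by (intro bexI[of _ "\<psi> n"]) auto
  qed
  then show "u \<in> h1_0 L" using u by (auto simp: h1_0_def)
qed

lemma h1_cong_AE:
  assumes L: "L > 0" and g: "g \<in> h1 L" and g': "g' \<in> l2 L" and ae: "AE x in lebI L. g' x = g x"
  shows "g' \<in> h1 L" "AE x in lebI L. wderiv L g' x = wderiv L g x"
    "\<And>x. x \<in> {0..L} \<Longrightarrow> pt_val L g' x = pt_val L g x"
proof -
  have ae': "AE x in lebI L. g' x = pt_val L g x"
    using ae h1_representative(2)[OF L g] by eventually_elim simp
  note r = h1I_representative[OF L g' h1_representative(1)[OF L g] ae']
  show "g' \<in> h1 L" "AE x in lebI L. wderiv L g' x = wderiv L g x"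
    "\<And>x. x \<in> {0..L} \<Longrightarrow> pt_val L g' x = pt_val L g x"
    by (rule r, assumption?)+
qed

lemma h1_zero:
  assumes L: "L > 0"
  shows "(\<lambda>x. 0) \<in> h1 L" "AE x in lebI L. wderiv L (\<lambda>x. 0) x = 0" "x \<in> {0..L} \<Longrightarrow> pt_val L (\<lambda>x. 0) x = 0"
  using h1I[OF L ac_const[of L 0]] by auto

lemma h2_add:
  assumes L: "L > 0" and u: "u \<in> h1 L" "wderiv L u \<in> h1 L" and v: "v \<in> h1 L" "wderiv L v \<in> h1 L"
  shows "wderiv L (\<lambda>x. u x + v x) \<in> h1 L"
    "AE x in lebI L. wderiv L (wderiv L (\<lambda>x. u x + v x)) x = wderiv L (wderiv L u) x + wderiv L (wderiv L v) x"
    "\<And>x. x \<in> {0..L} \<Longrightarrow> pt_val L (wderiv L (\<lambda>x. u x + v x)) x = pt_val L (wderiv L u) x + pt_val L (wderiv L v) x"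
proof -
  note a = h1_add[OF L u(1) v(1)] and b = h1_add[OF L u(2) v(2)]
  note c = h1_cong_AE[OF L b(1) wderiv_l2[OF a(1)] a(2)]
  show "wderiv L (\<lambda>x. u x + v x) \<in> h1 L" by (rule c)
  show "AE x in lebI L. wderiv L (wderiv L (\<lambda>x. u x + v x)) x = wderiv L (wderiv L u) x + wderiv L (wderiv L v) x"
    using c(2) b(2) by eventually_elim simp
  show "pt_val L (wderiv L (\<lambda>x. u x + v x)) x = pt_val L (wderiv L u) x + pt_val L (wderiv L v) x"
    if "x \<in> {0..L}" for x using c(3)[OF that] b(3)[OF that] by simp
qed

lemma h2_scale:
  assumes L: "L > 0" and u: "u \<in> h1 L" "wderiv L u \<in> h1 L"
  shows "wderiv L (\<lambda>x. c * u x) \<in> h1 L"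
    "AE x in lebI L. wderiv L (wderiv L (\<lambda>x. c * u x)) x = c * wderiv L (wderiv L u) x"
    "\<And>x. x \<in> {0..L} \<Longrightarrow> pt_val L (wderiv L (\<lambda>x. c * u x)) x = c * pt_val L (wderiv L u) x"
proof -
  note a = h1_scale[OF L u(1), where c = c] and b = h1_scale[OF L u(2), where c = c]
  note d = h1_cong_AE[OF L b(1) wderiv_l2[OF a(1)] a(2)]
  show "wderiv L (\<lambda>x. c * u x) \<in> h1 L" by (rule d)
  show "AE x in lebI L. wderiv L (wderiv L (\<lambda>x. c * u x)) x = c * wderiv L (wderiv L u) x"
    using d(2) b(2) by eventually_elim simp
  show "pt_val L (wderiv L (\<lambda>x. c * u x)) x = c * pt_val L (wderiv L u) x"
    if "x \<in> {0..L}" for x using d(3)[OF that] b(3)[OF that] by simp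
qed

lemma h1_Poincare:
  assumes L: "L > 0" and u: "u \<in> h1 L" and u0: "pt_val L u 0 = 0"
  shows "x \<in> {0..L} \<Longrightarrow> cmod (pt_val L u x) \<le> sqrt L * l2_norm L (wderiv L u)"
    and "l2_norm L u \<le> L * l2_norm L (wderiv L u)"
proof -
  note r = h1_representative[OF L u]
  show b: "cmod (pt_val L u x) \<le> sqrt L * l2_norm L (wderiv L u)" if "x \<in> {0..L}" for x
    using ac_sup_bound[OF r(1) L that] u0 by simp
  have "l2_norm L u = l2_norm L (pt_val L u)" by (rule l2_norm_cong_AE[OF r(2) h1_l2[OF u] ac_l2[OF r(1)]])
  also have "\<dots> \<le> sqrt L * (sqrt L * l2_norm L (wderiv L u))"
    by (rule l2_norm_le_sup[OF ac_l2[OF r(1)] L]) (use b L in \<open>auto simp: l2_norm_nonneg\<close>)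
  finally show "l2_norm L u \<le> L * l2_norm L (wderiv L u)" using L by (simp add: mult.assoc[symmetric])
qed

lemma l2_inner_zero: "AE x in lebI L. g x = 0 \<Longrightarrow> f \<in> l2 L \<Longrightarrow> g \<in> l2 L \<Longrightarrow> l2_inner L f g = 0 \<and> l2_inner L g f = 0"
  using l2_inner_cong_AE[where f = f and f' = f and g = g and g' = "\<lambda>x. 0" and L = L]
    l2_inner_cong_AE[where g = f and g' = f and f = g and f' = "\<lambda>x. 0" and L = L] l2_const[of 0 L]
  by (simp add: l2_inner_def)

section \<open>The energy space of the beam\<close>

locale rao_nakra_beam =
  fixes P :: beam
  assumes L_pos: "par_L P > 0" and alpha_pos: "par_\<alpha> P > 0" and K_pos: "par_K P > 0"
    and hO_pos: "\<And>j. j \<in> {1..par_m P + 1} \<Longrightarrow> hO P j > 0"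
    and pO_pos: "\<And>j. j \<in> {1..par_m P + 1} \<Longrightarrow> pO P j > 0"
    and EO_pos: "\<And>j. j \<in> {1..par_m P + 1} \<Longrightarrow> EO P j > 0"
    and gO_pos: "\<And>j. j \<in> {1..par_m P + 1} \<Longrightarrow> gO P j > 0"
    and hE_pos: "\<And>i. i \<in> {1..par_m P} \<Longrightarrow> hE P i > 0"
    and GE_pos: "\<And>i. i \<in> {1..par_m P} \<Longrightarrow> GE P i > 0"
    and gamma_pos: "par_\<gamma> P 0 > 0"
begin

abbreviation "L \<equiv> par_L P"
abbreviation "K \<equiv> par_K P"
abbreviation "stiff \<equiv> {1..par_m P + 1}"
abbreviation "soft \<equiv> {1..par_m P}"
abbreviation "dampers \<equiv> {0..par_m P + 1}"

lemma in_X_iff: "(u, v) \<in> spaceX P \<longleftrightarrow> u \<in> h1 L \<and> wderiv L u \<in> h1 L \<and> pt_val L u 0 = 0 \<and> pt_val L u L = 0 \<and>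
    pt_val L (wderiv L u) 0 = 0 \<and> (\<forall>j\<in>stiff. v j \<in> h1 L \<and> pt_val L (v j) 0 = 0)"
  by (auto simp: spaceX_def h2_def h1_0_iff[OF L_pos])

lemma in_Y_iff: "(p, y) \<in> spaceY P \<longleftrightarrow> p \<in> h1 L \<and> pt_val L p 0 = 0 \<and> pt_val L p L = 0 \<and> (\<forall>j\<in>stiff. y j \<in> l2 L)"
  by (auto simp: spaceY_def h1_0_iff[OF L_pos])

lemma X_subset_Y: "spaceX P \<subseteq> spaceY P"
  using in_X_iff in_Y_iff h1_l2 by auto

lemma in_H_iff: "(U, V) \<in> spaceH P \<longleftrightarrow> U \<in> spaceX P \<and> V \<in> spaceY P"
  by (simp add: spaceH_def)

text \<open>
  A state is \<open>((u, v), (p, y))\<close> with displacements \<open>u\<close>, \<open>v\<^sub>j\<close> and velocities \<open>p\<close>, \<open>y\<^sub>j\<close>; a digit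
  in a name counts derivatives. The components are maps on states in order to be treated uniformly
  as linear operators. The end values \<open>tr k\<close> belong to the displacement, with the slope \<open>u'(L)\<close> at
  index 0; applied to \<open>\<A>Y\<close>, whose displacement is the velocity of \<open>Y\<close>, they are the damped end
  velocities of \<open>Y\<close>.
\<close>

definition "c_u Y = fst (fst Y)" for Y :: state
definition "c_u1 Y = wderiv L (fst (fst Y))" for Y :: state
definition "c_u2 Y = wderiv L (wderiv L (fst (fst Y)))" for Y :: state
definition "c_v j Y = snd (fst Y) j" for Y :: state and j
definition "c_v1 j Y = wderiv L (snd (fst Y) j)" for Y :: state and j
definition "c_p Y = fst (snd Y)" for Y :: state
definition "c_p1 Y = wderiv L (fst (snd Y))" for Y :: state
definition "c_y j Y = snd (snd Y) j" for Y :: state and j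
definition "c_phi i Y = phi P (fst Y) i" for Y :: state and i
definition "tr k Y = (if k = 0 then pt_val L (wderiv L (fst (fst Y))) L else pt_val L (snd (fst Y) k) L)" for Y :: state and k :: nat

lemmas c_defs = c_u_def c_u1_def c_u2_def c_v_def c_v1_def c_p_def c_p1_def c_y_def c_phi_def

lemma c_phi_eq: "c_phi i Y = (\<lambda>x. of_real (inverse (hE P i)) * (\<Sum>j=1..par_m P + 1. of_real (matB i j) * c_v j Y x)
     + of_real (vecN P i) * c_u1 Y x)"
  by (cases Y; cases "fst Y") (simp add: c_defs)

lemma H_inner_eq: "H_inner P Y Z = of_real K * l2_inner L (c_u2 Y) (c_u2 Z)
    + (\<Sum>j\<in>stiff. of_real (hO P j * EO P j) * l2_inner L (c_v1 j Y) (c_v1 j Z))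
    + (\<Sum>i\<in>soft. of_real (GE P i * hE P i) * l2_inner L (c_phi i Y) (c_phi i Z))
    + (l2_inner L (c_p Y) (c_p Z) + of_real (par_\<alpha> P) * l2_inner L (c_p1 Y) (c_p1 Z)
      + (\<Sum>j\<in>stiff. of_real (hO P j * pO P j) * l2_inner L (c_y j Y) (c_y j Z)))"
proof -
  obtain u v p y u' v' p' y' where "Y = ((u, v), (p, y))" "Z = ((u', v'), (p', y'))"
    by (metis prod.exhaust)
  then show ?thesis by (simp add: c_defs)
qed

text \<open>
  Weak derivatives are arbitrary representatives, so the components of a state depend on it
  linearly only up to null sets.
\<close>

definition linear_AE :: "(state \<Rightarrow> real \<Rightarrow> complex) \<Rightarrow> bool" where
  "linear_AE A \<longleftrightarrow> (\<forall>Y\<in>spaceH P. A Y \<in> l2 L) \<and>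
    (\<forall>Y\<in>spaceH P. \<forall>Z\<in>spaceH P. AE x in lebI L. A (Y + Z) x = A Y x + A Z x) \<and>
    (\<forall>Y\<in>spaceH P. \<forall>c. AE x in lebI L. A (state_scale c Y) x = c * A Y x)"

lemma linear_AE_l2: "linear_AE A \<Longrightarrow> Y \<in> spaceH P \<Longrightarrow> A Y \<in> l2 L"
  and linear_AE_plus: "linear_AE A \<Longrightarrow> Y \<in> spaceH P \<Longrightarrow> Z \<in> spaceH P \<Longrightarrow> AE x in lebI L. A (Y + Z) x = A Y x + A Z x"
  and linear_AE_scl: "linear_AE A \<Longrightarrow> Y \<in> spaceH P \<Longrightarrow> AE x in lebI L. A (state_scale c Y) x = c * A Y x"
  unfolding linear_AE_def by blast+

lemma linear_AE_add:
  assumes A: "linear_AE A" and B: "linear_AE B"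
  shows "linear_AE (\<lambda>Y x. A Y x + B Y x)"
  unfolding linear_AE_def
proof (intro conjI ballI allI)
  fix Y Z c assume Y: "Y \<in> spaceH P"
  show "(\<lambda>x. A Y x + B Y x) \<in> l2 L" by (intro l2_add linear_AE_l2 assms Y)
  show "AE x in lebI L. A (state_scale c Y) x + B (state_scale c Y) x = c * (A Y x + B Y x)"
    using linear_AE_scl[OF A Y, where c = c] linear_AE_scl[OF B Y, where c = c] by eventually_elim (simp add: distrib_left)
  assume Z: "Z \<in> spaceH P"
  show "AE x in lebI L. A (Y + Z) x + B (Y + Z) x = A Y x + B Y x + (A Z x + B Z x)"
    using linear_AE_plus[OF A Y Z] linear_AE_plus[OF B Y Z] by eventually_elim simp
qed

lemma linear_AE_cmult:
  assumes A: "linear_AE A" and k: "continuous_on {0..L} k"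
  shows "linear_AE (\<lambda>Y x. k x * A Y x)"
  unfolding linear_AE_def
proof (intro conjI ballI allI)
  fix Y Z c assume Y: "Y \<in> spaceH P"
  show "(\<lambda>x. k x * A Y x) \<in> l2 L" by (rule l2_continuous_mult[OF linear_AE_l2[OF A Y] k])
  show "AE x in lebI L. k x * A (state_scale c Y) x = c * (k x * A Y x)"
    using linear_AE_scl[OF A Y, where c = c] by eventually_elim simp
  assume Z: "Z \<in> spaceH P"
  show "AE x in lebI L. k x * A (Y + Z) x = k x * A Y x + k x * A Z x"
    using linear_AE_plus[OF A Y Z] by eventually_elim (simp add: distrib_left)
qed

lemma linear_AE_zero: "linear_AE (\<lambda>Y x. 0)"
  by (simp add: linear_AE_def l2_const)

lemma linear_AE_sum: "(\<And>i. i \<in> I \<Longrightarrow> linear_AE (A i)) \<Longrightarrow> linear_AE (\<lambda>Y x. \<Sum>i\<in>I. A i Y x)"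
  by (induction I rule: infinite_finite_induct) (auto intro: linear_AE_zero linear_AE_add)

lemma X_add:
  assumes "U \<in> spaceX P" "U' \<in> spaceX P"
  shows "U + U' \<in> spaceX P"
proof -
  obtain u v u' v' where e: "U = (u, v)" "U' = (u', v')" by (metis prod.exhaust)
  have z: "0 \<in> {0..L}" "L \<in> {0..L}" using L_pos by auto
  show ?thesis using assms unfolding e
    by (simp add: in_X_iff plus_fun_def h1_add[OF L_pos] h2_add[OF L_pos] L_pos less_imp_le)
qed

lemma Y_add:
  assumes "U \<in> spaceY P" "U' \<in> spaceY P"
  shows "U + U' \<in> spaceY P"
proof -
  obtain u v u' v' where e: "U = (u, v)" "U' = (u', v')" by (metis prod.exhaust)
  show ?thesis using assms unfolding e
    by (simp add: in_Y_iff plus_fun_def h1_add[OF L_pos] l2_add L_pos less_imp_le)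
qed

lemma X_scale: "U \<in> spaceX P \<Longrightarrow> disp_scale c U \<in> spaceX P"
  by (cases U) (simp add: in_X_iff h1_scale[OF L_pos] h2_scale[OF L_pos] L_pos less_imp_le)

lemma Y_scale: "U \<in> spaceY P \<Longrightarrow> disp_scale c U \<in> spaceY P"
  by (cases U) (simp add: in_Y_iff h1_scale[OF L_pos] l2_scale L_pos less_imp_le)

lemma X_zero: "0 \<in> spaceX P"
proof -
  have "wderiv L (\<lambda>x. 0) \<in> h1 L" "pt_val L (wderiv L (\<lambda>x. 0)) 0 = 0"
    using h1_cong_AE[OF L_pos h1_zero(1)[OF L_pos] wderiv_l2[OF h1_zero(1)[OF L_pos]] h1_zero(2)[OF L_pos]]
      h1_zero[OF L_pos] L_pos by auto
  then show ?thesis unfolding zero_prod_def zero_fun_def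
    by (simp add: in_X_iff h1_zero[OF L_pos] L_pos less_imp_le)
qed

lemma H_zero: "0 \<in> spaceH P" using X_zero X_subset_Y by (auto simp: zero_prod_def in_H_iff)

lemma H_add: "Y \<in> spaceH P \<Longrightarrow> Z \<in> spaceH P \<Longrightarrow> Y + Z \<in> spaceH P"
proof -
  obtain U V U' V' where e: "Y = (U, V)" "Z = (U', V')" by (metis prod.exhaust)
  show "Y \<in> spaceH P \<Longrightarrow> Z \<in> spaceH P \<Longrightarrow> Y + Z \<in> spaceH P"
    unfolding e by (simp add: in_H_iff X_add Y_add)
qed

lemma H_scale: "Y \<in> spaceH P \<Longrightarrow> state_scale c Y \<in> spaceH P"
  unfolding spaceH_def by (auto simp del: disp_scale.simps intro: X_scale Y_scale)

lemma state_diff: "Y - Z = Y + state_scale (-1) Z" for Y Z :: state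
proof -
  obtain u v p y u' v' p' y' where "Y = ((u, v), (p, y))" "Z = ((u', v'), (p', y'))"
    by (metis prod.exhaust)
  then show ?thesis by (simp add: fun_eq_iff)
qed

lemma H_diff: "Y \<in> spaceH P \<Longrightarrow> Z \<in> spaceH P \<Longrightarrow> Y - Z \<in> spaceH P"
  unfolding state_diff by (intro H_add H_scale)

lemma linear_AE_diff:
  assumes A: "linear_AE A" and Y: "Y \<in> spaceH P" and Z: "Z \<in> spaceH P"
  shows "AE x in lebI L. A (Y - Z) x = A Y x - A Z x"
  unfolding state_diff using linear_AE_plus[OF A Y H_scale[OF Z, where c = "-1"]] linear_AE_scl[OF A Z, where c = "-1"]
  by eventually_elim simp

lemma H_memD:
  assumes "Y \<in> spaceH P"
  shows "c_u Y \<in> h1 L" "c_u1 Y \<in> h1 L" "pt_val L (c_u Y) 0 = 0" "pt_val L (c_u Y) L = 0" "pt_val L (c_u1 Y) 0 = 0"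
    "j \<in> stiff \<Longrightarrow> c_v j Y \<in> h1 L" "j \<in> stiff \<Longrightarrow> pt_val L (c_v j Y) 0 = 0"
    "c_p Y \<in> h1 L" "pt_val L (c_p Y) 0 = 0" "pt_val L (c_p Y) L = 0" "j \<in> stiff \<Longrightarrow> c_y j Y \<in> l2 L"
proof -
  obtain u v p y where "Y = ((u, v), (p, y))" by (metis prod.exhaust)
  then show "c_u Y \<in> h1 L" "c_u1 Y \<in> h1 L" "pt_val L (c_u Y) 0 = 0" "pt_val L (c_u Y) L = 0" "pt_val L (c_u1 Y) 0 = 0"
    "j \<in> stiff \<Longrightarrow> c_v j Y \<in> h1 L" "j \<in> stiff \<Longrightarrow> pt_val L (c_v j Y) 0 = 0"
    "c_p Y \<in> h1 L" "pt_val L (c_p Y) 0 = 0" "pt_val L (c_p Y) L = 0" "j \<in> stiff \<Longrightarrow> c_y j Y \<in> l2 L"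
    using assms by (simp_all add: in_H_iff in_X_iff in_Y_iff c_defs del: atLeastAtMost_iff)
qed

lemma c_plus: "c_u (Y + Z) = (\<lambda>x. c_u Y x + c_u Z x)" "c_v j (Y + Z) = (\<lambda>x. c_v j Y x + c_v j Z x)"
    "c_p (Y + Z) = (\<lambda>x. c_p Y x + c_p Z x)" "c_y j (Y + Z) = (\<lambda>x. c_y j Y x + c_y j Z x)"
  by (simp_all add: c_defs plus_fun_def)

lemma c_scale: "c_u (state_scale c Y) = (\<lambda>x. c * c_u Y x)" "c_v j (state_scale c Y) = (\<lambda>x. c * c_v j Y x)"
    "c_p (state_scale c Y) = (\<lambda>x. c * c_p Y x)" "c_y j (state_scale c Y) = (\<lambda>x. c * c_y j Y x)"
proof -
  obtain u v p y where "Y = ((u, v), (p, y))" by (metis prod.exhaust)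
  then show "c_u (state_scale c Y) = (\<lambda>x. c * c_u Y x)" "c_v j (state_scale c Y) = (\<lambda>x. c * c_v j Y x)"
    "c_p (state_scale c Y) = (\<lambda>x. c * c_p Y x)" "c_y j (state_scale c Y) = (\<lambda>x. c * c_y j Y x)"
    by (simp_all add: c_defs)
qed

lemma c_derivs: "c_u1 Y = wderiv L (c_u Y)" "c_u2 Y = wderiv L (wderiv L (c_u Y))" "c_v1 j Y = wderiv L (c_v j Y)" "c_p1 Y = wderiv L (c_p Y)"
  by (simp_all add: c_defs)

lemma linear_AE_c_u: "linear_AE c_u" and linear_AE_c_u1: "linear_AE c_u1" and linear_AE_c_u2: "linear_AE c_u2" and linear_AE_c_p: "linear_AE c_p" and linear_AE_c_p1: "linear_AE c_p1"
  using H_memD(1,2,8) unfolding linear_AE_def c_derivs c_plus c_scale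
  by (auto intro: h1_l2 wderiv_l2 h1_add(2)[OF L_pos] h1_scale(2)[OF L_pos] h2_add(2)[OF L_pos] h2_scale(2)[OF L_pos])

lemma linear_AE_c_v: "j \<in> stiff \<Longrightarrow> linear_AE (c_v j)" and linear_AE_c_v1: "j \<in> stiff \<Longrightarrow> linear_AE (c_v1 j)" and linear_AE_c_y: "j \<in> stiff \<Longrightarrow> linear_AE (c_y j)"
proof -
  assume j: "j \<in> stiff"
  note m = H_memD(6)[OF _ j] H_memD(11)[OF _ j]
  show "linear_AE (c_v j)" "linear_AE (c_v1 j)" "linear_AE (c_y j)"
    unfolding linear_AE_def c_derivs c_plus c_scale
    by (auto intro: m h1_l2[OF m(1)] wderiv_l2[OF m(1)] h1_add(2)[OF L_pos m(1) m(1)] h1_scale(2)[OF L_pos m(1)])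
qed

lemma linear_AE_c_phi: "linear_AE (c_phi i)"
  unfolding c_phi_eq
  by (intro linear_AE_add linear_AE_cmult linear_AE_sum linear_AE_c_u1 linear_AE_c_v continuous_intros)

lemma tr_plus: "Y \<in> spaceH P \<Longrightarrow> Z \<in> spaceH P \<Longrightarrow> k \<in> dampers \<Longrightarrow> tr k (Y + Z) = tr k Y + tr k Z"
proof -
  assume a: "Y \<in> spaceH P" "Z \<in> spaceH P" "k \<in> dampers"
  have l: "L \<in> {0..L}" using L_pos by simp
  show ?thesis
  proof (cases "k = 0")
    case True
    then show ?thesis
      using h2_add(3)[OF L_pos H_memD(1)[OF a(1)] _ H_memD(1)[OF a(2)] _ l] H_memD(2)[OF a(1)] H_memD(2)[OF a(2)]
      by (simp add: tr_def c_defs plus_fun_def)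
  next
    case False
    then have k: "k \<in> stiff" using a(3) by auto
    then show ?thesis using False h1_add(3)[OF L_pos H_memD(6)[OF a(1) k] H_memD(6)[OF a(2) k] l]
      by (simp add: tr_def c_defs plus_fun_def)
  qed
qed

lemma tr_scale: "Y \<in> spaceH P \<Longrightarrow> k \<in> dampers \<Longrightarrow> tr k (state_scale c Y) = c * tr k Y"
proof -
  assume a: "Y \<in> spaceH P" "k \<in> dampers"
  have l: "L \<in> {0..L}" using L_pos by simp
  obtain u v p y where Y: "Y = ((u, v), (p, y))" by (metis prod.exhaust)
  show ?thesis
  proof (cases "k = 0")
    case True
    then show ?thesis
      using h2_scale(3)[OF L_pos H_memD(1)[OF a(1)] _ l] H_memD(2)[OF a(1)] by (simp add: tr_def c_defs Y)
  next
    case False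
    then have k: "k \<in> stiff" using a(2) by auto
    then show ?thesis using False h1_scale(3)[OF L_pos H_memD(6)[OF a(1) k] l] by (simp add: tr_def c_defs Y)
  qed
qed

lemma linear_AE_tr: "k \<in> dampers \<Longrightarrow> linear_AE (\<lambda>Y x. tr k Y)"
  unfolding linear_AE_def by (simp add: l2_const tr_plus tr_scale del: atLeastAtMost_iff)

text \<open>
  The boundary damping enters through the real part of the inner product only, and the quadratic
  forms used for stability are real.
\<close>

definition "ip Y Z = Re (H_inner P Y Z)" for Y Z :: state

definition real_bilinear :: "(state \<Rightarrow> state \<Rightarrow> real) \<Rightarrow> bool" where
  "real_bilinear B \<longleftrightarrow>
    (\<forall>Y\<in>spaceH P. \<forall>Z\<in>spaceH P. \<forall>W\<in>spaceH P. B (Y + Z) W = B Y W + B Z W \<and> B W (Y + Z) = B W Y + B W Z) \<and>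
    (\<forall>Y\<in>spaceH P. \<forall>W\<in>spaceH P. \<forall>r. B (state_scale (complex_of_real r) Y) W = r * B Y W \<and>
       B W (state_scale (complex_of_real r) Y) = r * B W Y)"

lemma real_bilinear_l2_inner:
  assumes A: "linear_AE A" and B: "linear_AE B"
  shows "real_bilinear (\<lambda>Y Z. Re (l2_inner L (A Y) (B Z)))"
  unfolding real_bilinear_def
proof (intro conjI ballI allI)
  fix Y W r assume Y: "Y \<in> spaceH P" and W: "W \<in> spaceH P"
  have s: "state_scale c Y \<in> spaceH P" for c using Y by (rule H_scale)
  have "l2_inner L (A (state_scale (complex_of_real r) Y)) (B W) = l2_inner L (\<lambda>x. complex_of_real r * A Y x) (B W)"
    by (rule l2_inner_cong_AE[OF linear_AE_scl[OF A Y]]) (auto intro: linear_AE_l2[OF A] linear_AE_l2[OF B] l2_scale s Y W)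
  then show "Re (l2_inner L (A (state_scale (complex_of_real r) Y)) (B W)) = r * Re (l2_inner L (A Y) (B W))"
    by (simp add: l2_inner_scale)
  have "l2_inner L (A W) (B (state_scale (complex_of_real r) Y)) = l2_inner L (A W) (\<lambda>x. complex_of_real r * B Y x)"
    by (rule l2_inner_cong_AE[OF _ linear_AE_scl[OF B Y]]) (auto intro: linear_AE_l2[OF A] linear_AE_l2[OF B] l2_scale s Y W)
  then show "Re (l2_inner L (A W) (B (state_scale (complex_of_real r) Y))) = r * Re (l2_inner L (A W) (B Y))"
    by (simp add: l2_inner_scale_right)
next
  fix Y Z W assume Y: "Y \<in> spaceH P" and Z: "Z \<in> spaceH P" and W: "W \<in> spaceH P"
  have s: "Y + Z \<in> spaceH P" using Y Z by (rule H_add)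
  have "l2_inner L (A (Y + Z)) (B W) = l2_inner L (\<lambda>x. A Y x + A Z x) (B W)"
    by (rule l2_inner_cong_AE[OF linear_AE_plus[OF A Y Z]]) (auto intro: linear_AE_l2[OF A] linear_AE_l2[OF B] l2_add s Y Z W)
  then show "Re (l2_inner L (A (Y + Z)) (B W)) = Re (l2_inner L (A Y) (B W)) + Re (l2_inner L (A Z) (B W))"
    by (simp add: l2_inner_add linear_AE_l2[OF A] linear_AE_l2[OF B] Y Z W)
  have "l2_inner L (A W) (B (Y + Z)) = l2_inner L (A W) (\<lambda>x. B Y x + B Z x)"
    by (rule l2_inner_cong_AE[OF _ linear_AE_plus[OF B Y Z]]) (auto intro: linear_AE_l2[OF A] linear_AE_l2[OF B] l2_add s Y Z W)
  then show "Re (l2_inner L (A W) (B (Y + Z))) = Re (l2_inner L (A W) (B Y)) + Re (l2_inner L (A W) (B Z))"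
    by (simp add: l2_inner_add_right linear_AE_l2[OF A] linear_AE_l2[OF B] Y Z W)
qed

lemma real_bilinear_add: "real_bilinear A \<Longrightarrow> real_bilinear B \<Longrightarrow> real_bilinear (\<lambda>Y Z. A Y Z + B Y Z)"
  unfolding real_bilinear_def by (simp add: algebra_simps)

lemma real_bilinear_cmult: "real_bilinear A \<Longrightarrow> real_bilinear (\<lambda>Y Z. c * A Y Z)"
  unfolding real_bilinear_def by (simp add: algebra_simps)

lemma real_bilinear_sum: "(\<And>i. i \<in> I \<Longrightarrow> real_bilinear (A i)) \<Longrightarrow> real_bilinear (\<lambda>Y Z. \<Sum>i\<in>I. A i Y Z)"
proof (induction I rule: infinite_finite_induct)
  case (insert i I)
  then show ?case using real_bilinear_add[of "A i" "\<lambda>Y Z. \<Sum>i\<in>I. A i Y Z"] by simp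
qed (simp_all add: real_bilinear_def)

lemma ip_eq: "ip Y Z = K * Re (l2_inner L (c_u2 Y) (c_u2 Z))
    + (\<Sum>j\<in>stiff. (hO P j * EO P j) * Re (l2_inner L (c_v1 j Y) (c_v1 j Z)))
    + (\<Sum>i\<in>soft. (GE P i * hE P i) * Re (l2_inner L (c_phi i Y) (c_phi i Z)))
    + (Re (l2_inner L (c_p Y) (c_p Z)) + par_\<alpha> P * Re (l2_inner L (c_p1 Y) (c_p1 Z))
      + (\<Sum>j\<in>stiff. (hO P j * pO P j) * Re (l2_inner L (c_y j Y) (c_y j Z))))"
  by (simp add: ip_def H_inner_eq Re_sum)

lemma real_bilinear_ip: "real_bilinear ip"
  unfolding ip_eq
  by (intro real_bilinear_add real_bilinear_cmult real_bilinear_sum real_bilinear_l2_inner linear_AE_c_u2 linear_AE_c_v1 linear_AE_c_phi linear_AE_c_p linear_AE_c_p1 linear_AE_c_y)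

lemma Re_l2_inner_self: "f \<in> l2 L \<Longrightarrow> Re (l2_inner L f f) = (l2_norm L f)\<^sup>2"
  by (simp add: l2_inner_self)

text \<open>
  Twice the stretching and shear energies and the kinetic energy of the longitudinal motions.
\<close>

abbreviation "stretching Y \<equiv> \<Sum>j\<in>stiff. (hO P j * EO P j) * (l2_norm L (c_v1 j Y))\<^sup>2"
abbreviation "shearing Y \<equiv> \<Sum>i\<in>soft. (GE P i * hE P i) * (l2_norm L (c_phi i Y))\<^sup>2"
abbreviation "sliding Y \<equiv> \<Sum>j\<in>stiff. (hO P j * pO P j) * (l2_norm L (c_y j Y))\<^sup>2"

lemma ip_self:
  assumes Y: "Y \<in> spaceH P"
  shows "ip Y Y = K * (l2_norm L (c_u2 Y))\<^sup>2
    + stretching Y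
    + shearing Y
    + ((l2_norm L (c_p Y))\<^sup>2 + par_\<alpha> P * (l2_norm L (c_p1 Y))\<^sup>2
      + sliding Y)"
  unfolding ip_eq
  by (simp add: Re_l2_inner_self linear_AE_l2[OF linear_AE_c_u2 Y] linear_AE_l2[OF linear_AE_c_v1 Y] linear_AE_l2[OF linear_AE_c_phi Y]
      linear_AE_l2[OF linear_AE_c_p Y] linear_AE_l2[OF linear_AE_c_p1 Y] linear_AE_l2[OF linear_AE_c_y Y] del: atLeastAtMost_iff cong: sum.cong)

lemma ip_parts_nonneg:
  "0 \<le> K * (l2_norm L (c_u2 Y))\<^sup>2"
  "0 \<le> stretching Y"
  "0 \<le> shearing Y"
  "0 \<le> (l2_norm L (c_p Y))\<^sup>2" "0 \<le> par_\<alpha> P * (l2_norm L (c_p1 Y))\<^sup>2"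
  "0 \<le> sliding Y"
proof -
  show "0 \<le> stretching Y"
    by (intro sum_nonneg mult_nonneg_nonneg zero_le_power2; blast intro: less_imp_le hO_pos EO_pos)
  show "0 \<le> shearing Y"
    by (intro sum_nonneg mult_nonneg_nonneg zero_le_power2; blast intro: less_imp_le GE_pos hE_pos)
  show "0 \<le> sliding Y"
    by (intro sum_nonneg mult_nonneg_nonneg zero_le_power2; blast intro: less_imp_le hO_pos pO_pos)
qed (use K_pos alpha_pos in auto)

lemma ip_nonneg: "Y \<in> spaceH P \<Longrightarrow> 0 \<le> ip Y Y"
  unfolding ip_self by (intro add_nonneg_nonneg ip_parts_nonneg)

lemma ip_commute:
  assumes "Y \<in> spaceH P" "Z \<in> spaceH P"
  shows "ip Y Z = ip Z Y"
proof -
  have c: "Re (l2_inner L (A Y) (A Z)) = Re (l2_inner L (A Z) (A Y))" if "linear_AE A" for A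
    using l2_inner_commute[OF linear_AE_l2[OF that assms(1)] linear_AE_l2[OF that assms(2)]] by simp
  show ?thesis unfolding ip_eq
    by (simp add: c linear_AE_c_u2 linear_AE_c_v1 linear_AE_c_phi linear_AE_c_p linear_AE_c_p1 linear_AE_c_y del: atLeastAtMost_iff cong: sum.cong)
qed

end

section \<open>Completeness of the energy space\<close>

lemma ac_diff_bounds:
  assumes L: "L > 0" and f: "ac L f f'" and g: "ac L g g'" and 0: "f 0 = g 0"
  shows "x \<in> {0..L} \<Longrightarrow> cmod (f x - g x) \<le> sqrt L * l2_norm L (\<lambda>x. f' x - g' x)"
    and "l2_norm L (\<lambda>x. f x - g x) \<le> L * l2_norm L (\<lambda>x. f' x - g' x)"
proof -
  note a = ac_diff[OF f g]
  show b: "cmod (f x - g x) \<le> sqrt L * l2_norm L (\<lambda>x. f' x - g' x)" if "x \<in> {0..L}" for x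
    using ac_sup_bound[OF a L that] 0 by simp
  have "l2_norm L (\<lambda>x. f x - g x) \<le> sqrt L * (sqrt L * l2_norm L (\<lambda>x. f' x - g' x))"
    by (rule l2_norm_le_sup[OF ac_l2[OF a] L]) (use b L in \<open>auto simp: l2_norm_nonneg\<close>)
  then show "l2_norm L (\<lambda>x. f x - g x) \<le> L * l2_norm L (\<lambda>x. f' x - g' x)" using L by (simp add: mult.assoc[symmetric])
qed

lemma le_of_weighted_square_le:
  fixes a c h :: real
  assumes "c * a\<^sup>2 \<le> h\<^sup>2" "c > 0" "0 \<le> h"
  shows "a \<le> (1 / sqrt c) * h"
proof (rule power2_le_imp_le)
  show "a\<^sup>2 \<le> ((1 / sqrt c) * h)\<^sup>2" using assms by (simp add: power_mult_distrib power_divide field_simps)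
  show "0 \<le> 1 / sqrt c * h" using assms by simp
qed

context rao_nakra_beam
begin

lemma L_nonneg: "0 \<le> L" using L_pos by (rule less_imp_le)

lemma H_norm_eq: "H_norm P Y = sqrt (ip Y Y)"
  by (simp add: H_norm_def ip_def)

lemma H_norm_nonneg: "Y \<in> spaceH P \<Longrightarrow> 0 \<le> H_norm P Y"
  by (simp add: H_norm_eq ip_nonneg)

lemma H_norm_sq: "Y \<in> spaceH P \<Longrightarrow> (H_norm P Y)\<^sup>2 = ip Y Y"
  by (simp add: H_norm_eq ip_nonneg)

text \<open>
  The size \<open>n\<close> is a parameter because the same bounds for the dependent components \<open>u\<close>, \<open>u'\<close>,
  \<open>v\<^sub>j\<close>, \<open>p\<close>, the shears and the end values are used relative to the energy norm, to the sum of
  the norms of the independent components, and to the square root of the bending and stretching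
  energy.
\<close>

definition bounded_by :: "(state \<Rightarrow> real) \<Rightarrow> (state \<Rightarrow> real \<Rightarrow> complex) \<Rightarrow> bool" where
  "bounded_by n A \<longleftrightarrow> linear_AE A \<and> (\<exists>C\<ge>0. \<forall>Y\<in>spaceH P. l2_norm L (A Y) \<le> C * n Y)"

lemma bounded_by_lin: "bounded_by n A \<Longrightarrow> linear_AE A" by (simp add: bounded_by_def)

lemma bounded_byE:
  assumes "bounded_by n A"
  obtains C where "C \<ge> 0" "\<And>Y. Y \<in> spaceH P \<Longrightarrow> l2_norm L (A Y) \<le> C * n Y"
  using assms unfolding bounded_by_def by blast

lemma bounded_byI: "linear_AE A \<Longrightarrow> C \<ge> 0 \<Longrightarrow> (\<And>Y. Y \<in> spaceH P \<Longrightarrow> l2_norm L (A Y) \<le> C * n Y) \<Longrightarrow> bounded_by n A"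
  unfolding bounded_by_def by blast

lemma bounded_by_dominated:
  assumes B: "bounded_by n B" and A: "linear_AE A" and le: "\<And>Y. Y \<in> spaceH P \<Longrightarrow> l2_norm L (A Y) \<le> c * l2_norm L (B Y)" and c: "c \<ge> 0"
  shows "bounded_by n A"
proof -
  obtain C where C: "C \<ge> 0" "\<And>Y. Y \<in> spaceH P \<Longrightarrow> l2_norm L (B Y) \<le> C * n Y" using bounded_byE[OF B] by blast
  show ?thesis
  proof (rule bounded_byI[OF A, of "c * C"])
    fix Y assume Y: "Y \<in> spaceH P"
    have "l2_norm L (A Y) \<le> c * l2_norm L (B Y)" by (rule le[OF Y])
    also have "\<dots> \<le> c * (C * n Y)" by (intro mult_left_mono C Y c)
    finally show "l2_norm L (A Y) \<le> c * C * n Y" by (simp add: mult.assoc)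
  qed (use C c in simp)
qed

lemma bounded_by_add:
  assumes A: "bounded_by n A" and B: "bounded_by n B"
  shows "bounded_by n (\<lambda>Y x. A Y x + B Y x)"
proof -
  obtain C where C: "C \<ge> 0" "\<And>Y. Y \<in> spaceH P \<Longrightarrow> l2_norm L (A Y) \<le> C * n Y" using bounded_byE[OF A] by blast
  obtain D where D: "D \<ge> 0" "\<And>Y. Y \<in> spaceH P \<Longrightarrow> l2_norm L (B Y) \<le> D * n Y" using bounded_byE[OF B] by blast
  show ?thesis
  proof (rule bounded_byI[OF linear_AE_add[OF bounded_by_lin[OF A] bounded_by_lin[OF B]], of "C + D"])
    fix Y assume Y: "Y \<in> spaceH P"
    have "l2_norm L (\<lambda>x. A Y x + B Y x) \<le> l2_norm L (A Y) + l2_norm L (B Y)"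
      by (intro l2_norm_triangle linear_AE_l2[OF bounded_by_lin[OF A] Y] linear_AE_l2[OF bounded_by_lin[OF B] Y])
    then show "l2_norm L (\<lambda>x. A Y x + B Y x) \<le> (C + D) * n Y" using C(2)[OF Y] D(2)[OF Y] by (simp add: distrib_right)
  qed (use C D in simp)
qed

lemma bounded_by_cmult:
  assumes A: "bounded_by n A" and k: "continuous_on {0..L} k"
  shows "bounded_by n (\<lambda>Y x. k x * A Y x)"
proof -
  have "bounded (k ` {0..L})" using k by (intro compact_imp_bounded compact_continuous_image) auto
  then obtain B where B: "\<And>x. x \<in> {0..L} \<Longrightarrow> cmod (k x) \<le> B" unfolding bounded_iff by blast
  have B0: "B \<ge> 0" using order_trans[OF norm_ge_zero B[of 0]] L_pos by simp
  show ?thesis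
    by (rule bounded_by_dominated[OF A linear_AE_cmult[OF bounded_by_lin[OF A] k] _ B0],
        rule l2_norm_bounded_mult[OF linear_AE_l2[OF bounded_by_lin[OF A]] continuous_measurable_lebI[OF k] _ B0]) (use B in auto)
qed

lemma bounded_by_zero: "bounded_by n (\<lambda>Y x. 0)"
  by (rule bounded_byI[OF linear_AE_zero, of 0]) (auto simp: l2_norm_def)

lemma bounded_by_sum: "(\<And>i. i \<in> I \<Longrightarrow> bounded_by n (A i)) \<Longrightarrow> bounded_by n (\<lambda>Y x. \<Sum>i\<in>I. A i Y x)"
  by (induction I rule: infinite_finite_induct) (auto intro: bounded_by_zero bounded_by_add)

lemma bounded_by_c_u1: "bounded_by n c_u2 \<Longrightarrow> bounded_by n c_u1"
proof (rule bounded_by_dominated[OF _ linear_AE_c_u1])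
  fix Y assume Y: "Y \<in> spaceH P"
  show "l2_norm L (c_u1 Y) \<le> L * l2_norm L (c_u2 Y)"
    using h1_Poincare(2)[OF L_pos H_memD(2)[OF Y] H_memD(5)[OF Y]] by (simp add: c_defs)
qed (auto intro: L_nonneg)

lemma bounded_by_c_u: "bounded_by n c_u2 \<Longrightarrow> bounded_by n c_u"
proof (rule bounded_by_dominated[OF bounded_by_c_u1 linear_AE_c_u])
  fix Y assume Y: "Y \<in> spaceH P"
  show "l2_norm L (c_u Y) \<le> L * l2_norm L (c_u1 Y)"
    using h1_Poincare(2)[OF L_pos H_memD(1)[OF Y] H_memD(3)[OF Y]] by (simp add: c_defs)
qed (auto intro: L_nonneg)

lemma bounded_by_c_v: "bounded_by n (c_v1 j) \<Longrightarrow> j \<in> stiff \<Longrightarrow> bounded_by n (c_v j)"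
proof (rule bounded_by_dominated[OF _ linear_AE_c_v])
  fix Y assume Y: "Y \<in> spaceH P" and j: "j \<in> stiff"
  show "l2_norm L (c_v j Y) \<le> L * l2_norm L (c_v1 j Y)"
    using h1_Poincare(2)[OF L_pos H_memD(6)[OF Y j] H_memD(7)[OF Y j]] by (simp add: c_defs)
qed (auto intro: L_nonneg)

lemma bounded_by_c_p: "bounded_by n c_p1 \<Longrightarrow> bounded_by n c_p"
proof (rule bounded_by_dominated[OF _ linear_AE_c_p])
  fix Y assume Y: "Y \<in> spaceH P"
  show "l2_norm L (c_p Y) \<le> L * l2_norm L (c_p1 Y)"
    using h1_Poincare(2)[OF L_pos H_memD(8)[OF Y] H_memD(9)[OF Y]] by (simp add: c_defs)
qed (auto intro: L_nonneg)

lemma bounded_by_c_phi: "bounded_by n c_u2 \<Longrightarrow> (\<And>j. j \<in> stiff \<Longrightarrow> bounded_by n (c_v1 j)) \<Longrightarrow> bounded_by n (c_phi i)"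
  unfolding c_phi_eq
  by (intro bounded_by_add bounded_by_cmult bounded_by_sum bounded_by_c_u1 bounded_by_c_v continuous_intros)

lemma bounded_by_tr:
  assumes "bounded_by n c_u2" "\<And>j. j \<in> stiff \<Longrightarrow> bounded_by n (c_v1 j)" "k \<in> dampers"
  shows "bounded_by n (\<lambda>Y x. tr k Y)"
proof (cases "k = 0")
  case True
  show ?thesis
  proof (rule bounded_by_dominated[OF assms(1) linear_AE_tr[OF assms(3)]])
    fix Y assume Y: "Y \<in> spaceH P"
    have "cmod (tr k Y) \<le> sqrt L * l2_norm L (c_u2 Y)"
      using h1_Poincare(1)[OF L_pos H_memD(2)[OF Y] H_memD(5)[OF Y], of L] True L_pos by (simp add: c_defs tr_def)
    then have "sqrt L * cmod (tr k Y) \<le> sqrt L * (sqrt L * l2_norm L (c_u2 Y))" by (intro mult_left_mono) (auto intro: L_nonneg)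
    then show "l2_norm L (\<lambda>x. tr k Y) \<le> L * l2_norm L (c_u2 Y)"
      using L_nonneg by (simp add: l2_norm_const[OF L_pos] mult.assoc[symmetric])
  qed (auto intro: L_nonneg)
next
  case False
  then have k: "k \<in> stiff" using assms(3) by auto
  show ?thesis
  proof (rule bounded_by_dominated[OF assms(2)[OF k] linear_AE_tr[OF assms(3)]])
    fix Y assume Y: "Y \<in> spaceH P"
    have "cmod (tr k Y) \<le> sqrt L * l2_norm L (c_v1 k Y)"
      using h1_Poincare(1)[OF L_pos H_memD(6)[OF Y k] H_memD(7)[OF Y k], of L] False L_pos by (simp add: c_defs tr_def)
    then have "sqrt L * cmod (tr k Y) \<le> sqrt L * (sqrt L * l2_norm L (c_v1 k Y))" by (intro mult_left_mono) (auto intro: L_nonneg)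
    then show "l2_norm L (\<lambda>x. tr k Y) \<le> L * l2_norm L (c_v1 k Y)"
      using L_nonneg by (simp add: l2_norm_const[OF L_pos] mult.assoc[symmetric])
  qed (auto intro: L_nonneg)
qed

lemma single_le_sum_sq:
  assumes "j \<in> I" "finite I" "\<And>j. j \<in> I \<Longrightarrow> c j > (0::real)"
  shows "c j * (a j)\<^sup>2 \<le> (\<Sum>j\<in>I. c j * (a j)\<^sup>2)"
proof (rule member_le_sum[of j I "\<lambda>j. c j * (a j)\<^sup>2"])
  fix k assume "k \<in> I - {j}"
  then have "0 \<le> c k" using assms(3)[of k] by simp
  then show "0 \<le> c k * (a k)\<^sup>2" by simp
qed (use assms in auto)

lemma bounded_by_H: "bounded_by (H_norm P) c_u2" "j \<in> stiff \<Longrightarrow> bounded_by (H_norm P) (c_v1 j)" "bounded_by (H_norm P) c_p1" "j \<in> stiff \<Longrightarrow> bounded_by (H_norm P) (c_y j)"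
proof -
  have *: "bounded_by (H_norm P) A" if "linear_AE A" "c > 0" "\<And>Y. Y \<in> spaceH P \<Longrightarrow> c * (l2_norm L (A Y))\<^sup>2 \<le> ip Y Y" for A c
    by (rule bounded_byI[OF that(1), of "1 / sqrt c"])
      (use that le_of_weighted_square_le[of c "l2_norm L (A Y)" "H_norm P Y" for Y] H_norm_sq H_norm_nonneg in auto)
  show "bounded_by (H_norm P) c_u2"
    by (rule *[OF linear_AE_c_u2 K_pos]) (use ip_self ip_parts_nonneg in \<open>smt (verit)\<close>)
  show "bounded_by (H_norm P) c_p1"
    by (rule *[OF linear_AE_c_p1 alpha_pos]) (use ip_self ip_parts_nonneg in \<open>smt (verit)\<close>)
  show "bounded_by (H_norm P) (c_v1 j)" if j: "j \<in> stiff"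
  proof (rule *[OF linear_AE_c_v1[OF j], of "hO P j * EO P j"])
    show "hO P j * EO P j > 0" by (intro mult_pos_pos hO_pos EO_pos j)
    fix Y assume Y: "Y \<in> spaceH P"
    have "hO P j * EO P j * (l2_norm L (c_v1 j Y))\<^sup>2 \<le> stretching Y"
      by (rule single_le_sum_sq[OF j finite_atLeastAtMost mult_pos_pos[OF hO_pos EO_pos]])
    then show "hO P j * EO P j * (l2_norm L (c_v1 j Y))\<^sup>2 \<le> ip Y Y"
      unfolding ip_self[OF Y] using ip_parts_nonneg[of Y] by linarith
  qed
  show "bounded_by (H_norm P) (c_y j)" if j: "j \<in> stiff"
  proof (rule *[OF linear_AE_c_y[OF j], of "hO P j * pO P j"])
    show "hO P j * pO P j > 0" by (intro mult_pos_pos hO_pos pO_pos j)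
    fix Y assume Y: "Y \<in> spaceH P"
    have "hO P j * pO P j * (l2_norm L (c_y j Y))\<^sup>2 \<le> sliding Y"
      by (rule single_le_sum_sq[OF j finite_atLeastAtMost mult_pos_pos[OF hO_pos pO_pos]])
    then show "hO P j * pO P j * (l2_norm L (c_y j Y))\<^sup>2 \<le> ip Y Y"
      unfolding ip_self[OF Y] using ip_parts_nonneg[of Y] by linarith
  qed
qed

text \<open>
  The components that determine a state, measured separately. They converge separately in a Cauchy
  sequence, and convergence in this norm implies convergence in energy.
\<close>

definition "coarse_norm Y = l2_norm L (c_u2 Y) + (\<Sum>j\<in>stiff. l2_norm L (c_v1 j Y)) + l2_norm L (c_p1 Y) + (\<Sum>j\<in>stiff. l2_norm L (c_y j Y))"
  for Y :: state

lemma coarse_norm_ge: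
  "l2_norm L (c_u2 Y) \<le> coarse_norm Y" "j \<in> stiff \<Longrightarrow> l2_norm L (c_v1 j Y) \<le> coarse_norm Y"
  "l2_norm L (c_p1 Y) \<le> coarse_norm Y" "j \<in> stiff \<Longrightarrow> l2_norm L (c_y j Y) \<le> coarse_norm Y" "0 \<le> coarse_norm Y"
proof -
  have n: "0 \<le> (\<Sum>j\<in>stiff. l2_norm L (c_v1 j Y))" "0 \<le> (\<Sum>j\<in>stiff. l2_norm L (c_y j Y))"
    by (intro sum_nonneg l2_norm_nonneg)+
  have m: "j \<in> stiff \<Longrightarrow> l2_norm L (c_v1 j Y) \<le> (\<Sum>j\<in>stiff. l2_norm L (c_v1 j Y))"
    "j \<in> stiff \<Longrightarrow> l2_norm L (c_y j Y) \<le> (\<Sum>j\<in>stiff. l2_norm L (c_y j Y))"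
    by (rule member_le_sum; simp add: l2_norm_nonneg)+
  note p = l2_norm_nonneg[of L "c_u2 Y"] l2_norm_nonneg[of L "c_p1 Y"]
  show "l2_norm L (c_u2 Y) \<le> coarse_norm Y" "l2_norm L (c_p1 Y) \<le> coarse_norm Y" "0 \<le> coarse_norm Y"
    unfolding coarse_norm_def using n p by linarith+
  show "j \<in> stiff \<Longrightarrow> l2_norm L (c_v1 j Y) \<le> coarse_norm Y" "j \<in> stiff \<Longrightarrow> l2_norm L (c_y j Y) \<le> coarse_norm Y"
    unfolding coarse_norm_def using n p m by linarith+
qed

lemma H_norm_le_coarse: obtains C where "\<And>Y. Y \<in> spaceH P \<Longrightarrow> H_norm P Y \<le> C * coarse_norm Y"
proof -
  have b: "bounded_by coarse_norm c_u2" "\<And>j. j \<in> stiff \<Longrightarrow> bounded_by coarse_norm (c_v1 j)" "bounded_by coarse_norm c_p1"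
    "\<And>j. j \<in> stiff \<Longrightarrow> bounded_by coarse_norm (c_y j)"
    by (rule bounded_byI[of _ 1], (simp_all only: linear_AE_c_u2 linear_AE_c_v1 linear_AE_c_p1 linear_AE_c_y coarse_norm_ge mult_1 zero_le_one))+
  have sq: "\<exists>D. \<forall>Y\<in>spaceH P. (l2_norm L (A Y))\<^sup>2 \<le> D * (coarse_norm Y)\<^sup>2" if A: "bounded_by coarse_norm A" for A
  proof -
    obtain C where C: "C \<ge> 0" "\<And>Y. Y \<in> spaceH P \<Longrightarrow> l2_norm L (A Y) \<le> C * coarse_norm Y" using bounded_byE[OF A] by blast
    have "(l2_norm L (A Y))\<^sup>2 \<le> C\<^sup>2 * (coarse_norm Y)\<^sup>2" if "Y \<in> spaceH P" for Y
      using power_mono[OF C(2)[OF that] l2_norm_nonneg, of 2] by (simp add: power_mult_distrib)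
    then show ?thesis by blast
  qed
  obtain D1 where D1: "\<And>Y. Y \<in> spaceH P \<Longrightarrow> (l2_norm L (c_u2 Y))\<^sup>2 \<le> D1 * (coarse_norm Y)\<^sup>2" using sq[OF b(1)] by blast
  have "\<forall>j\<in>stiff. \<exists>D. \<forall>Y\<in>spaceH P. (l2_norm L (c_v1 j Y))\<^sup>2 \<le> D * (coarse_norm Y)\<^sup>2" using sq[OF b(2)] by blast
  then obtain D2 where D2: "\<And>j Y. j \<in> stiff \<Longrightarrow> Y \<in> spaceH P \<Longrightarrow> (l2_norm L (c_v1 j Y))\<^sup>2 \<le> D2 j * (coarse_norm Y)\<^sup>2" by metis
  have "\<forall>i\<in>soft. \<exists>D. \<forall>Y\<in>spaceH P. (l2_norm L (c_phi i Y))\<^sup>2 \<le> D * (coarse_norm Y)\<^sup>2" using sq[OF bounded_by_c_phi[OF b(1,2)]] by blast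
  then obtain D3 where D3: "\<And>i Y. i \<in> soft \<Longrightarrow> Y \<in> spaceH P \<Longrightarrow> (l2_norm L (c_phi i Y))\<^sup>2 \<le> D3 i * (coarse_norm Y)\<^sup>2" by metis
  obtain D4 where D4: "\<And>Y. Y \<in> spaceH P \<Longrightarrow> (l2_norm L (c_p Y))\<^sup>2 \<le> D4 * (coarse_norm Y)\<^sup>2" using sq[OF bounded_by_c_p[OF b(3)]] by blast
  obtain D5 where D5: "\<And>Y. Y \<in> spaceH P \<Longrightarrow> (l2_norm L (c_p1 Y))\<^sup>2 \<le> D5 * (coarse_norm Y)\<^sup>2" using sq[OF b(3)] by blast
  have "\<forall>j\<in>stiff. \<exists>D. \<forall>Y\<in>spaceH P. (l2_norm L (c_y j Y))\<^sup>2 \<le> D * (coarse_norm Y)\<^sup>2" using sq[OF b(4)] by blast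
  then obtain D6 where D6: "\<And>j Y. j \<in> stiff \<Longrightarrow> Y \<in> spaceH P \<Longrightarrow> (l2_norm L (c_y j Y))\<^sup>2 \<le> D6 j * (coarse_norm Y)\<^sup>2" by metis
  define D where "D = K * D1 + (\<Sum>j\<in>stiff. (hO P j * EO P j) * D2 j) + (\<Sum>i\<in>soft. (GE P i * hE P i) * D3 i)
     + (D4 + par_\<alpha> P * D5 + (\<Sum>j\<in>stiff. (hO P j * pO P j) * D6 j))"
  show ?thesis
  proof (rule that[of "sqrt D"])
    fix Y assume Y: "Y \<in> spaceH P"
    have "ip Y Y \<le> K * (D1 * (coarse_norm Y)\<^sup>2)
      + (\<Sum>j\<in>stiff. (hO P j * EO P j) * (D2 j * (coarse_norm Y)\<^sup>2))
      + (\<Sum>i\<in>soft. (GE P i * hE P i) * (D3 i * (coarse_norm Y)\<^sup>2))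
      + (D4 * (coarse_norm Y)\<^sup>2 + par_\<alpha> P * (D5 * (coarse_norm Y)\<^sup>2)
        + (\<Sum>j\<in>stiff. (hO P j * pO P j) * (D6 j * (coarse_norm Y)\<^sup>2)))"
      unfolding ip_self[OF Y]
      by (intro add_mono sum_mono mult_left_mono D1 D2 D3 D4 D5 D6 Y less_imp_le K_pos alpha_pos
          mult_pos_pos hO_pos pO_pos EO_pos GE_pos hE_pos)
    also have "\<dots> = D * (coarse_norm Y)\<^sup>2"
      by (simp add: D_def distrib_right sum_distrib_right mult.assoc)
    finally have "H_norm P Y \<le> sqrt (D * (coarse_norm Y)\<^sup>2)" unfolding H_norm_eq by (rule real_sqrt_le_mono)
    then show "H_norm P Y \<le> sqrt D * coarse_norm Y"
      using coarse_norm_ge(5)[of Y] by (simp add: real_sqrt_mult)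
  qed
qed

lemma fast_Cauchy_component:
  assumes A: "bounded_by (H_norm P) A" and X: "\<And>n. X n \<in> spaceH P" and fast: "\<And>n. H_norm P (X (Suc n) - X n) \<le> (1/2)^n"
  shows "\<exists>g\<in>l2 L. (\<lambda>n. l2_norm L (\<lambda>x. A (X n) x - g x)) \<longlonglongrightarrow> 0"
proof -
  obtain C where C: "C \<ge> 0" "\<And>Y. Y \<in> spaceH P \<Longrightarrow> l2_norm L (A Y) \<le> C * H_norm P Y" using bounded_byE[OF A] by blast
  note lA = bounded_by_lin[OF A]
  have "l2_norm L (\<lambda>x. A (X (Suc n)) x - A (X n) x) \<le> C * (1/2)^n" for n
  proof -
    have "l2_norm L (\<lambda>x. A (X (Suc n)) x - A (X n) x) = l2_norm L (A (X (Suc n) - X n))"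
      by (rule l2_norm_cong_AE[symmetric, OF linear_AE_diff[OF lA X X] linear_AE_l2[OF lA H_diff[OF X X]] l2_diff[OF linear_AE_l2[OF lA X] linear_AE_l2[OF lA X]]])
    also have "\<dots> \<le> C * H_norm P (X (Suc n) - X n)" by (intro C H_diff X)
    also have "\<dots> \<le> C * (1/2)^n" by (intro mult_left_mono fast C)
    finally show ?thesis .
  qed
  from l2_complete[OF L_pos linear_AE_l2[OF lA X] this] show ?thesis by blast
qed

text \<open>
  The top derivatives converge by completeness of the space of square integrable functions, and
  the limit state is obtained by integrating from the end \<open>x = 0\<close>, where the boundary values are
  built in. The boundary values at \<open>x = L\<close> pass to the limit by uniform convergence.
\<close>

lemma fast_Cauchy_convergent:
  assumes X: "\<And>n. X n \<in> spaceH P" and fast: "\<And>n. H_norm P (X (Suc n) - X n) \<le> (1/2)^n"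
  shows "\<exists>x\<in>spaceH P. (\<lambda>n. H_norm P (X n - x)) \<longlonglongrightarrow> 0"
proof -
  note lim = fast_Cauchy_component[OF _ X fast]
  obtain g2 where g2: "g2 \<in> l2 L" "(\<lambda>n. l2_norm L (\<lambda>x. c_u2 (X n) x - g2 x)) \<longlonglongrightarrow> 0" using lim[OF bounded_by_H(1)] by blast
  have "\<forall>j\<in>stiff. \<exists>g. g \<in> l2 L \<and> (\<lambda>n. l2_norm L (\<lambda>x. c_v1 j (X n) x - g x)) \<longlonglongrightarrow> 0"
    using lim[OF bounded_by_H(2)] by blast
  from bchoice[OF this] obtain gv where gv: "\<And>j. j \<in> stiff \<Longrightarrow> gv j \<in> l2 L"
    "\<And>j. j \<in> stiff \<Longrightarrow> (\<lambda>n. l2_norm L (\<lambda>x. c_v1 j (X n) x - gv j x)) \<longlonglongrightarrow> 0" by blast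
  obtain gp where gp: "gp \<in> l2 L" "(\<lambda>n. l2_norm L (\<lambda>x. c_p1 (X n) x - gp x)) \<longlonglongrightarrow> 0" using lim[OF bounded_by_H(3)] by blast
  have "\<forall>j\<in>stiff. \<exists>g. g \<in> l2 L \<and> (\<lambda>n. l2_norm L (\<lambda>x. c_y j (X n) x - g x)) \<longlonglongrightarrow> 0"
    using lim[OF bounded_by_H(4)] by blast
  from bchoice[OF this] obtain y where y: "\<And>j. j \<in> stiff \<Longrightarrow> y j \<in> l2 L"
    "\<And>j. j \<in> stiff \<Longrightarrow> (\<lambda>n. l2_norm L (\<lambda>x. c_y j (X n) x - y j x)) \<longlonglongrightarrow> 0" by blast
  define u1 where "u1 x = 0 + integral {0..x} g2" for x
  have u1: "ac L u1 g2" "u1 0 = 0" unfolding u1_def[abs_def] by (rule ac_integral[OF g2(1)], simp)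
  define u where "u x = 0 + integral {0..x} u1" for x
  have u: "ac L u u1" "u 0 = 0" unfolding u_def[abs_def] by (rule ac_integral[OF ac_l2[OF u1(1)]], simp)
  define v where "v j x = 0 + integral {0..x} (gv j)" for j x
  have v: "j \<in> stiff \<Longrightarrow> ac L (v j) (gv j)" "v j 0 = 0" for j unfolding v_def[abs_def] by (rule ac_integral[OF gv(1)], assumption, simp)
  define p where "p x = 0 + integral {0..x} gp" for x
  have p: "ac L p gp" "p 0 = 0" unfolding p_def[abs_def] by (rule ac_integral[OF gp(1)], simp)
  have ends: "0 \<in> {0..L}" "L \<in> {0..L}" using L_pos by auto
  have pL: "p L = 0"
  proof -
    have "(\<lambda>n. - p L) \<longlonglongrightarrow> 0"
    proof (rule Lim_null_comparison)
      show "(\<lambda>n. sqrt L * l2_norm L (\<lambda>x. c_p1 (X n) x - gp x)) \<longlonglongrightarrow> 0" using tendsto_mult_right_zero[OF gp(2)] by simp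
      have "norm (- p L) \<le> sqrt L * l2_norm L (\<lambda>x. c_p1 (X n) x - gp x)" for n
        using ac_diff_bounds(1)[OF L_pos h1_representative(1)[OF L_pos H_memD(8)[OF X[of n]]] p(1) _ ends(2)] H_memD(9,10)[OF X[of n]] p(2)
        by (simp add: c_derivs)
      then show "\<forall>\<^sub>F n in sequentially. norm (- p L) \<le> sqrt L * l2_norm L (\<lambda>x. c_p1 (X n) x - gp x)" by simp
    qed
    then show ?thesis by (simp add: LIMSEQ_const_iff)
  qed
  \<comment> \<open>two integrations from 0 pass from the bound for \<open>u''\<close> to one for \<open>u(L)\<close>\<close>
  have uL: "u L = 0"
  proof -
    have "(\<lambda>n. - u L) \<longlonglongrightarrow> 0"
    proof (rule Lim_null_comparison)
      show "(\<lambda>n. sqrt L * (L * l2_norm L (\<lambda>x. c_u2 (X n) x - g2 x))) \<longlonglongrightarrow> 0"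
        using tendsto_mult_right_zero[OF tendsto_mult_right_zero[OF g2(2)]] by simp
      have "norm (- u L) \<le> sqrt L * (L * l2_norm L (\<lambda>x. c_u2 (X n) x - g2 x))" for n
      proof -
        note r = h1_representative[OF L_pos H_memD(2)[OF X[of n]]]
        have "norm (- u L) \<le> sqrt L * l2_norm L (\<lambda>x. c_u1 (X n) x - u1 x)"
          using ac_diff_bounds(1)[OF L_pos h1_representative(1)[OF L_pos H_memD(1)[OF X[of n]]] u(1) _ ends(2)] H_memD(3,4)[OF X[of n]] u(2)
          by (simp add: c_derivs)
        also have "l2_norm L (\<lambda>x. c_u1 (X n) x - u1 x) = l2_norm L (\<lambda>x. pt_val L (c_u1 (X n)) x - u1 x)"
          by (rule l2_norm_cong_AE[OF _ l2_diff[OF h1_l2[OF H_memD(2)[OF X]] ac_l2[OF u1(1)]] l2_diff[OF ac_l2[OF r(1)] ac_l2[OF u1(1)]]])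
            (use r(2) in \<open>auto elim: eventually_mono\<close>)
        also have "\<dots> \<le> L * l2_norm L (\<lambda>x. c_u2 (X n) x - g2 x)"
          using ac_diff_bounds(2)[OF L_pos r(1) u1(1)] H_memD(5)[OF X[of n]] u1(2) by (simp add: c_derivs)
        finally show ?thesis using L_pos by (simp add: mult_left_mono)
      qed
      then show "\<forall>\<^sub>F n in sequentially. norm (- u L) \<le> sqrt L * (L * l2_norm L (\<lambda>x. c_u2 (X n) x - g2 x))" by simp
    qed
    then show ?thesis by (simp add: LIMSEQ_const_iff)
  qed
  define x where "x = ((u, v), (p, y))"
  note hu = h1I[OF L_pos u(1)] and hu1 = h1I[OF L_pos u1(1)] and hv = h1I[OF L_pos v(1)] and hp = h1I[OF L_pos p(1)]
  note hu' = h1_cong_AE[OF L_pos hu1(1) wderiv_l2[OF hu(1)] hu(2)]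
  have x: "x \<in> spaceH P" unfolding x_def
    using hu(1,3) hu'(1,3) hu1(3) hv hp(1,3) y(1) ends u(2) u1(2) v(2) p(2) uL pL
    by (simp add: in_H_iff in_X_iff in_Y_iff del: atLeastAtMost_iff)
  have c: "AE z in lebI L. c_u2 x z = g2 z" "\<And>j. j \<in> stiff \<Longrightarrow> AE z in lebI L. c_v1 j x z = gv j z" "AE z in lebI L. c_p1 x z = gp z"
    "\<And>j. j \<in> stiff \<Longrightarrow> AE z in lebI L. c_y j x z = y j z"
  proof -
    show "AE z in lebI L. c_u2 x z = g2 z" using hu'(2) hu1(2) by eventually_elim (simp add: x_def c_defs)
    show "AE z in lebI L. c_v1 j x z = gv j z" if "j \<in> stiff" for j using hv(2)[OF that] by (simp add: x_def c_defs)
    show "AE z in lebI L. c_p1 x z = gp z" using hp(2) by (simp add: x_def c_defs)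
    show "AE z in lebI L. c_y j x z = y j z" if "j \<in> stiff" for j by (simp add: x_def c_defs)
  qed
  have lim0: "(\<lambda>n. l2_norm L (A (X n - x))) \<longlonglongrightarrow> 0"
    if A: "linear_AE A" and g: "g \<in> l2 L" and ae: "AE z in lebI L. A x z = g z" and l: "(\<lambda>n. l2_norm L (\<lambda>z. A (X n) z - g z)) \<longlonglongrightarrow> 0" for A g
  proof -
    have "l2_norm L (A (X n - x)) = l2_norm L (\<lambda>z. A (X n) z - g z)" for n
    proof (rule l2_norm_cong_AE[OF _ linear_AE_l2[OF A H_diff[OF X x]] l2_diff[OF linear_AE_l2[OF A X] g]])
      show "AE z in lebI L. A (X n - x) z = A (X n) z - g z"
        using linear_AE_diff[OF A X x] ae by eventually_elim simp
    qed
    then show ?thesis using l by simp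
  qed
  have "(\<lambda>n. coarse_norm (X n - x)) \<longlonglongrightarrow> 0 + (\<Sum>j\<in>stiff. 0) + 0 + (\<Sum>j\<in>stiff. 0)"
    unfolding coarse_norm_def
    by (intro tendsto_add tendsto_sum lim0[OF linear_AE_c_u2 g2(1) c(1) g2(2)] lim0[OF linear_AE_c_v1 gv(1) c(2) gv(2)]
        lim0[OF linear_AE_c_p1 gp(1) c(3) gp(2)] lim0[OF linear_AE_c_y y(1) c(4) y(2)])
  then have N0: "(\<lambda>n. coarse_norm (X n - x)) \<longlonglongrightarrow> 0" by simp
  obtain C where C: "\<And>Y. Y \<in> spaceH P \<Longrightarrow> H_norm P Y \<le> C * coarse_norm Y" using H_norm_le_coarse by blast
  have "(\<lambda>n. H_norm P (X n - x)) \<longlonglongrightarrow> 0"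
  proof (rule tendsto_sandwich[where f = "\<lambda>_. 0" and h = "\<lambda>n. C * coarse_norm (X n - x)"])
    show "(\<lambda>n. C * coarse_norm (X n - x)) \<longlonglongrightarrow> 0" using tendsto_mult_right_zero[OF N0] by simp
  qed (use C H_norm_nonneg H_diff X x in auto)
  with x show ?thesis by blast
qed

sublocale H: semi_hilbert "spaceH P" state_scale ip
proof
  show "ip (x + y) z = ip x z + ip y z" if "x \<in> spaceH P" "y \<in> spaceH P" "z \<in> spaceH P" for x y z
    using real_bilinear_ip that unfolding real_bilinear_def by blast
  show "ip (state_scale (complex_of_real r) x) y = r * ip x y" if "x \<in> spaceH P" "y \<in> spaceH P" for x y r
    using real_bilinear_ip that unfolding real_bilinear_def by blast
  show "\<exists>x\<in>spaceH P. (\<lambda>n. sqrt (ip (X n - x) (X n - x))) \<longlonglongrightarrow> 0"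
    if "\<And>n. X n \<in> spaceH P" "\<And>n. sqrt (ip (X (Suc n) - X n) (X (Suc n) - X n)) \<le> (1/2) ^ n" for X
    using fast_Cauchy_convergent[OF that(1)] that(2) by (simp add: H_norm_eq)
qed (fact H_zero H_add H_diff H_scale ip_commute ip_nonneg)+

lemma H_nrm: "H.nrm = H_norm P"
  by (rule ext) (simp add: H.nrm_def H_norm_eq)

lemma bounded_form_l2_inner:
  assumes A: "bounded_by (H_norm P) A" and B: "bounded_by (H_norm P) B"
  shows "H.bounded_form (\<lambda>Y Z. Re (l2_inner L (A Y) (B Z)))"
proof -
  obtain C where C: "C \<ge> 0" "\<And>Y. Y \<in> spaceH P \<Longrightarrow> l2_norm L (A Y) \<le> C * H_norm P Y" using bounded_byE[OF A] by blast
  obtain D where D: "D \<ge> 0" "\<And>Y. Y \<in> spaceH P \<Longrightarrow> l2_norm L (B Y) \<le> D * H_norm P Y" using bounded_byE[OF B] by blast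
  have "\<bar>Re (l2_inner L (A Y) (B Z))\<bar> \<le> C * D * H_norm P Y * H_norm P Z" if Y: "Y \<in> spaceH P" and Z: "Z \<in> spaceH P" for Y Z
  proof -
    have "\<bar>Re (l2_inner L (A Y) (B Z))\<bar> \<le> cmod (l2_inner L (A Y) (B Z))" by (rule abs_Re_le_cmod)
    also have "\<dots> \<le> l2_norm L (A Y) * l2_norm L (B Z)"
      by (intro l2_inner_bound linear_AE_l2[OF bounded_by_lin[OF A] Y] linear_AE_l2[OF bounded_by_lin[OF B] Z])
    also have "\<dots> \<le> (C * H_norm P Y) * (D * H_norm P Z)"
      using C(1) H_norm_nonneg[OF Y] by (intro mult_mono C D Y Z l2_norm_nonneg mult_nonneg_nonneg)
    finally show ?thesis by (simp add: mult_ac)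
  qed
  then have "\<exists>C. \<forall>x\<in>spaceH P. \<forall>y\<in>spaceH P. \<bar>Re (l2_inner L (A x) (B y))\<bar> \<le> C * H_norm P x * H_norm P y" by blast
  then show ?thesis using real_bilinear_l2_inner[OF bounded_by_lin[OF A] bounded_by_lin[OF B]]
    unfolding H.bounded_form_def real_bilinear_def H_nrm by blast
qed

end

section \<open>Rellich's identity\<close>

lemma l2_inner_cong_right:
  "AE x in lebI L. g x = g' x \<Longrightarrow> f \<in> l2 L \<Longrightarrow> g \<in> l2 L \<Longrightarrow> g' \<in> l2 L \<Longrightarrow> l2_inner L f g = l2_inner L f g'"
  by (rule l2_inner_cong_AE) auto

lemma l2_inner_cong_left:
  "AE x in lebI L. f x = f' x \<Longrightarrow> f \<in> l2 L \<Longrightarrow> f' \<in> l2 L \<Longrightarrow> g \<in> l2 L \<Longrightarrow> l2_inner L f g = l2_inner L f' g"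
  by (rule l2_inner_cong_AE) auto

lemma ac_ident: "ac L (\<lambda>x. complex_of_real x) (\<lambda>x. 1)"
  using ac_poly[of L "[:0, 1:]"] by (simp add: pderiv_pCons)

text \<open>
  Integration of the derivative of \<open>x |f|\<^sup>2\<close>.
\<close>

lemma Rellich_identity:
  assumes L: "L > 0" and f: "ac L f f'"
  shows "Re (l2_inner L f (\<lambda>x. of_real x * f' x)) = (L * (cmod (f L))\<^sup>2 - (l2_norm L f)\<^sup>2) / 2"
proof -
  have xf: "ac L (\<lambda>x. of_real x * cnj (f x)) (\<lambda>x. 1 * cnj (f x) + of_real x * cnj (f' x))"
    by (rule ac_mult[OF ac_ident ac_cnj[OF f] L])
  have l: "f \<in> l2 L" "f' \<in> l2 L" by (rule ac_l2[OF f], rule ac_deriv_l2[OF f])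
  have lx: "(\<lambda>x. of_real x * f x) \<in> l2 L" "(\<lambda>x. of_real x * f' x) \<in> l2 L"
    by (intro l2_continuous_mult l continuous_intros)+
  have "(LINT x|lebI L. f' x * (of_real x * cnj (f x)) + f x * (1 * cnj (f x) + of_real x * cnj (f' x))) = f L * (of_real L * cnj (f L))"
    using ac_integration_by_parts[OF f xf L] by simp
  also have "(LINT x|lebI L. f' x * (of_real x * cnj (f x)) + f x * (1 * cnj (f x) + of_real x * cnj (f' x))) =
     (LINT x|lebI L. (f' x * cnj (of_real x * f x) + f x * cnj (f x)) + f x * cnj (of_real x * f' x))"
    by (intro Bochner_Integration.integral_cong) (auto simp: algebra_simps)
  also have "\<dots> = l2_inner L f' (\<lambda>x. of_real x * f x) + l2_inner L f f + l2_inner L f (\<lambda>x. of_real x * f' x)"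
    unfolding l2_inner_def using l2_inner_integrable[OF l(2) lx(1)] l2_inner_integrable[OF l(1) l(1)] l2_inner_integrable[OF l(1) lx(2)]
    by (simp add: Bochner_Integration.integral_add)
  also have "l2_inner L f' (\<lambda>x. of_real x * f x) = cnj (l2_inner L (\<lambda>x. of_real x * f x) f')" by (rule l2_inner_commute[OF lx(1) l(2)])
  also have "l2_inner L (\<lambda>x. of_real x * f x) f' = l2_inner L f (\<lambda>x. of_real x * f' x)"
    by (simp add: l2_inner_def mult_ac)
  finally have e: "cnj (l2_inner L f (\<lambda>x. of_real x * f' x)) + l2_inner L f f + l2_inner L f (\<lambda>x. of_real x * f' x) = of_real L * (f L * cnj (f L))"
    by (simp add: mult_ac)
  have "Re (cnj (l2_inner L f (\<lambda>x. of_real x * f' x)) + l2_inner L f f + l2_inner L f (\<lambda>x. of_real x * f' x)) = L * (cmod (f L))\<^sup>2"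
    unfolding e complex_norm_square[symmetric] by (simp flip: of_real_power)
  then show ?thesis using l by (simp add: l2_inner_self flip: of_real_power)
qed

text \<open>
  The common shape of all products with the multiplier: \<open>c\<close> is the coefficient of the zero order
  term, and \<open>k x * t\<close> is the correction by a multiple \<open>t\<close> of \<open>u'(L)\<close>, which is only estimated.
\<close>

lemma Rellich_multiplier:
  assumes L: "L > 0" and f: "ac L f f'" and a: "a \<in> l2 L" "AE x in lebI L. a x = f x"
    and k: "continuous_on {0..L} k" "\<And>x. x \<in> {0..L} \<Longrightarrow> cmod (k x) \<le> B"
  shows "\<bar>Re (l2_inner L a (\<lambda>x. of_real c * a x + of_real x * f' x + k x * t)) - ((c - 1/2) * (l2_norm L a)\<^sup>2 + L / 2 * (cmod (f L))\<^sup>2)\<bar>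
    \<le> sqrt L * B * (cmod t * l2_norm L a)"
proof -
  have B: "B \<ge> 0" using order_trans[OF norm_ge_zero k(2)[of 0]] L by simp
  have l: "f' \<in> l2 L" "f \<in> l2 L" by (rule ac_deriv_l2[OF f], rule ac_l2[OF f])
  have l2: "(\<lambda>x. of_real c * a x) \<in> l2 L" "(\<lambda>x. of_real x * f' x) \<in> l2 L" "(\<lambda>x. k x * t) \<in> l2 L"
    by (intro l2_scale a l2_continuous_mult l k continuous_intros l2_const)+
  have "l2_inner L a (\<lambda>x. of_real c * a x + of_real x * f' x + k x * t) =
      l2_inner L a (\<lambda>x. of_real c * a x) + l2_inner L a (\<lambda>x. of_real x * f' x) + l2_inner L a (\<lambda>x. k x * t)"
    by (simp add: l2_inner_add_right l2_add l2 a)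
  moreover have "Re (l2_inner L a (\<lambda>x. of_real c * a x)) = c * (l2_norm L a)\<^sup>2"
    using a by (simp add: l2_inner_scale_right l2_inner_self flip: of_real_power)
  moreover have "Re (l2_inner L a (\<lambda>x. of_real x * f' x)) = (L * (cmod (f L))\<^sup>2 - (l2_norm L a)\<^sup>2) / 2"
    using Rellich_identity[OF L f] l2_inner_cong_left[OF a(2) a(1) l(2) l2(2)] l2_norm_cong_AE[OF a(2) a(1) l(2)] by simp
  moreover have "\<bar>Re (l2_inner L a (\<lambda>x. k x * t))\<bar> \<le> sqrt L * B * (cmod t * l2_norm L a)"
  proof -
    have "\<bar>Re (l2_inner L a (\<lambda>x. k x * t))\<bar> \<le> l2_norm L a * l2_norm L (\<lambda>x. k x * t)"
      by (rule order_trans[OF abs_Re_le_cmod l2_inner_bound[OF a(1) l2(3)]])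
    also have "l2_norm L (\<lambda>x. k x * t) \<le> sqrt L * (B * cmod t)"
      by (rule l2_norm_le_sup[OF l2(3) L]) (use k B in \<open>auto simp: norm_mult intro!: mult_right_mono\<close>)
    finally have "\<bar>Re (l2_inner L a (\<lambda>x. k x * t))\<bar> \<le> l2_norm L a * (sqrt L * (B * cmod t))"
      by (simp add: l2_norm_nonneg mult_left_mono)
    then show ?thesis by (simp only: mult_ac)
  qed
  ultimately show ?thesis by (simp add: field_simps)
qed

section \<open>Regularity of the domain\<close>

text \<open>
  With \<open>g = f'\<close>, \<open>f(0) = 0\<close>, the hypothesis reads \<open>\<langle>a, f'\<rangle> + \<langle>r, f\<rangle> = b conj (f(L))\<close> for all \<open>f\<close>
  whose derivative is orthogonal to \<open>l\<close>. Integrating \<open>\<langle>r, f\<rangle>\<close> by parts shows that \<open>a + R - b\<close> is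
  orthogonal to the complement of \<open>l\<close>, where \<open>R\<close> is a primitive of \<open>- r\<close>. So it is a multiple of
  \<open>l\<close>, and \<open>a\<close> is a primitive. The constraint is needed because test displacements \<open>u\<close> must vanish
  at \<open>L\<close>, too.
\<close>

lemma h1_of_weak_identity:
  assumes L: "L > 0" and a: "a \<in> l2 L" and r: "r \<in> l2 L" and l: "ac L l l'"
    and weak: "\<And>g. g \<in> l2 L \<Longrightarrow> l2_inner L g l = 0 \<Longrightarrow>
      l2_inner L a g + l2_inner L r (\<lambda>x. 0 + integral {0..x} g) = b * cnj (0 + integral {0..L} g)"
  shows "a \<in> h1 L"
proof -
  \<comment> \<open>the primitive of \<open>- r\<close> that vanishes at \<open>L\<close>, so that only the end value with factor \<open>b\<close> remains\<close>
  define R where "R x = integral {0..L} r - integral {0..x} r" for x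
  have R: "ac L R (\<lambda>x. - r x)" "R L = 0"
    using ac_diff[OF ac_const[of L "integral {0..L} r"] ac_integral[OF r, of 0]] by (auto simp: R_def[abs_def])
  define q where "q x = a x + R x - b" for x
  have q: "q \<in> l2 L" unfolding q_def by (intro l2_diff l2_add a ac_l2[OF R(1)] l2_const)
  have ll: "l \<in> l2 L" by (rule ac_l2[OF l])
  have orth: "l2_inner L q g = 0" if g: "g \<in> l2 L" "l2_inner L g l = 0" for g
  proof -
    define f where "f x = 0 + integral {0..x} g" for x
    have f: "ac L f g" "f 0 = 0" unfolding f_def[abs_def] by (rule ac_integral[OF g(1)], simp)
    have i: "(\<lambda>x. - r x) \<in> l2 L" "R \<in> l2 L" "f \<in> l2 L" by (rule ac_deriv_l2[OF R(1)], rule ac_l2[OF R(1)], rule ac_l2[OF f(1)])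
    have "(LINT x|lebI L. - r x * cnj (f x) + R x * cnj (g x)) = 0"
      using ac_integration_by_parts[OF R(1) ac_cnj[OF f(1)] L] R(2) f(2) by simp
    then have "l2_inner L (\<lambda>x. - r x) f + l2_inner L R g = 0"
      unfolding l2_inner_def using l2_inner_integrable[OF i(1,3)] l2_inner_integrable[OF i(2) g(1)] by simp
    moreover have "l2_inner L (\<lambda>x. - r x) f = - l2_inner L r f" using l2_inner_scale[of L "-1" r f] by simp
    ultimately have 1: "l2_inner L r f = l2_inner L R g" by (metis add.inverse_inverse neg_eq_iff_add_eq_0)
    have "l2_inner L (\<lambda>x. b) g = b * cnj (LINT x|lebI L. g x)"
    proof -
      have "(LINT x|lebI L. cnj (g x)) = cnj (LINT x|lebI L. g x)"
        using Bochner_Integration.integral_bounded_linear[OF bounded_linear_cnj l2_integrable[OF g(1)]] .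
      then show ?thesis by (simp add: l2_inner_def)
    qed
    then have 2: "l2_inner L (\<lambda>x. b) g = b * cnj (0 + integral {0..L} g)"
      using LINT_eq_integral[OF l2_integrable[OF g(1)]] by simp
    have "l2_inner L q g = l2_inner L a g + l2_inner L R g - l2_inner L (\<lambda>x. b) g"
      unfolding q_def using a i(2) g(1) by (simp add: l2_inner_diff l2_inner_add l2_add l2_const)
    then show ?thesis using weak[OF g] 1 2 by (simp add: f_def[abs_def])
  qed
  \<comment> \<open>the component of \<open>q\<close> along \<open>l\<close>; the division yields 0 if \<open>l = 0\<close>, as it should\<close>
  define k where "k = l2_inner L q l / l2_inner L l l"
  define g where "g x = q x - k * l x" for x
  have g: "g \<in> l2 L" unfolding g_def by (intro l2_diff q l2_scale ll)
  have "k * l2_inner L l l = l2_inner L q l"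
  proof (cases "l2_inner L l l = 0")
    case True
    then have "l2_norm L l = 0" using l2_inner_self[OF ll] by simp
    then show ?thesis using l2_inner_bound[OF q ll] True by simp
  qed (simp add: k_def)
  then have gl: "l2_inner L g l = 0" unfolding g_def using q ll by (simp add: l2_inner_diff l2_scale l2_inner_scale)
  have "l2_inner L g g = l2_inner L q g - k * l2_inner L l g"
    unfolding g_def[of "x" for x] using q ll g by (simp add: l2_inner_diff l2_scale l2_inner_scale g_def[abs_def])
  also have "\<dots> = 0" using orth[OF g gl] l2_inner_commute[OF g ll] gl by simp
  finally have "l2_norm L g = 0" using l2_inner_self[OF g] by simp
  then have "AE x in lebI L. g x = 0" using l2_norm_zero_iff[OF g] by simp
  then have ae: "AE x in lebI L. a x = (b - R x) + k * l x" by eventually_elim (simp add: g_def q_def algebra_simps)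
  show ?thesis
    by (rule h1I_representative(1)[OF L a ac_add[OF ac_diff[OF ac_const R(1)] ac_scale[OF l]] ae])
qed

context rao_nakra_beam
begin

lemma wderiv_zero: "wderiv L (\<lambda>x. 0) \<in> l2 L" "AE x in lebI L. wderiv L (\<lambda>x. 0) x = 0"
   "wderiv L (wderiv L (\<lambda>x. 0)) \<in> l2 L" "AE x in lebI L. wderiv L (wderiv L (\<lambda>x. 0)) x = 0"
   "pt_val L (wderiv L (\<lambda>x. 0)) L = 0" "pt_val L (\<lambda>x. 0) L = 0" "wderiv L (\<lambda>x. 0) \<in> h1 L"
   "pt_val L (wderiv L (\<lambda>x. 0)) 0 = 0" "pt_val L (\<lambda>x. 0) 0 = 0"
proof -
  note z = h1_zero[OF L_pos]
  show l: "wderiv L (\<lambda>x. 0) \<in> l2 L" by (rule wderiv_l2[OF z(1)])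
  show a: "AE x in lebI L. wderiv L (\<lambda>x. 0) x = 0" by (rule z)
  note c = h1_cong_AE[OF L_pos z(1) l a]
  show "wderiv L (wderiv L (\<lambda>x. 0)) \<in> l2 L" by (rule wderiv_l2[OF c(1)])
  show "AE x in lebI L. wderiv L (wderiv L (\<lambda>x. 0)) x = 0" using c(2) a by eventually_elim simp
  show "pt_val L (wderiv L (\<lambda>x. 0)) L = 0" "pt_val L (\<lambda>x. 0) L = 0" "wderiv L (\<lambda>x. 0) \<in> h1 L"
   "pt_val L (wderiv L (\<lambda>x. 0)) 0 = 0" "pt_val L (\<lambda>x. 0) 0 = 0"
    using c(1) c(3)[of L] z(3)[of L] c(3)[of 0] z(3)[of 0] L_pos by (auto simp: less_imp_le)
qed

lemma l2_inner_wderiv_zero: "f \<in> l2 L \<Longrightarrow> l2_inner L f (wderiv L (\<lambda>x. 0)) = 0"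
  "f \<in> l2 L \<Longrightarrow> l2_inner L f (wderiv L (wderiv L (\<lambda>x. 0))) = 0" "l2_inner L f (\<lambda>x. 0) = 0" "l2_inner L (\<lambda>x. 0) f = 0"
  "f \<in> l2 L \<Longrightarrow> l2_inner L (wderiv L (\<lambda>x. 0)) f = 0"
  using l2_inner_zero[OF wderiv_zero(2) _ wderiv_zero(1)] l2_inner_zero[OF wderiv_zero(4) _ wderiv_zero(3)]
  by (auto simp: l2_inner_def)

lemma dom_A_components:
  assumes "((u, v), (p, y)) \<in> dom_A P"
  obtains w z where "A1 P (u, v) = (w, z)" "(u, v) \<in> spaceX P" "(p, y) \<in> spaceX P" "(w, z) \<in> spaceY P"
    "\<And>F. F \<in> spaceX P \<Longrightarrow> c_form P (w, z) F + a_form P (u, v) F = bdry_form P (p, y) F"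
    "((u, v), (p, y)) \<in> spaceH P" "((p, y), (w, z)) \<in> spaceH P"
proof -
  obtain w z where wz: "A1 P (u, v) = (w, z)" by (metis prod.exhaust)
  have d: "(u, v) \<in> spaceX P" "(p, y) \<in> spaceX P" "A1_in_Y P (u, v)"
    "\<And>F. F \<in> spaceX P \<Longrightarrow> c_form P (w, z) F + a_form P (u, v) F = bdry_form P (p, y) F"
    using assms wz by (auto simp: dom_A_def)
  have "\<exists>W. W \<in> spaceY P \<and> is_A1 P (u, v) W" using d(3) unfolding A1_in_Y_def by blast
  then have "A1 P (u, v) \<in> spaceY P \<and> is_A1 P (u, v) (A1 P (u, v))" unfolding A1_def by (rule someI_ex)
  then have w: "(w, z) \<in> spaceY P" using wz by simp
  show ?thesis using that[OF wz d(1,2) w d(4)] d(1,2) w X_subset_Y by (auto simp: in_H_iff)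
qed

text \<open>
  Test displacements that move the \<open>j\<close>-th stiff layer only; they are unconstrained at \<open>L\<close>, so that
  the hyperplane is the whole space (\<open>l = 0\<close>).
\<close>

lemma dom_A_longitudinal_regularity:
  assumes Y: "Y \<in> dom_A P" and j: "j \<in> stiff"
  shows "c_v1 j Y \<in> h1 L"
proof -
  obtain u v p y where Ye: "Y = ((u, v), (p, y))" by (metis prod.exhaust)
  obtain w z where wz: "(u, v) \<in> spaceX P" "(p, y) \<in> spaceX P" "(w, z) \<in> spaceY P"
    and var: "\<And>F. F \<in> spaceX P \<Longrightarrow> c_form P (w, z) F + a_form P (u, v) F = bdry_form P (p, y) F"
    and S: "Y \<in> spaceH P" "((p, y), (w, z)) \<in> spaceH P"
    using dom_A_components[OF Y[unfolded Ye]] Ye by metis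
  have zl: "z k \<in> l2 L" if "k \<in> stiff" for k using wz(3) that by (auto simp: in_Y_iff)
  have wl: "w \<in> l2 L" "wderiv L w \<in> l2 L" using wz(3) by (auto simp: in_Y_iff h1_l2 wderiv_l2)
  have vl: "wderiv L (v k) \<in> l2 L" if "k \<in> stiff" for k using wz(1) that by (auto simp: in_X_iff wderiv_l2)
  have ul: "wderiv L (wderiv L u) \<in> l2 L" using wz(1) by (auto simp: in_X_iff wderiv_l2)
  have phil: "phi P (u, v) i \<in> l2 L" for i using linear_AE_l2[OF linear_AE_c_phi S(1), of i] by (simp add: c_phi_def Ye)
  define cc where "cc = hO P j * EO P j"
  define co where "co i = GE P i * hE P i * (inverse (hE P i) * matB i j)" for i
  define a where "a x = of_real cc * c_v1 j Y x" for x
  define r where "r x = of_real (hO P j * pO P j) * z j x + (\<Sum>i\<in>soft. of_real (co i) * phi P (u, v) i x)" for x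
  have al: "a \<in> l2 L" unfolding a_def by (intro l2_scale linear_AE_l2[OF linear_AE_c_v1[OF j] S(1)])
  have rl: "r \<in> l2 L" unfolding r_def by (intro l2_add l2_scale l2_sum zl j phil)
  have "a \<in> h1 L"
  proof (rule h1_of_weak_identity[OF L_pos al rl ac_const[of L 0]])
    fix g assume g: "g \<in> l2 L"
    define f where "f x = 0 + integral {0..x} g" for x
    have f: "ac L f g" "f 0 = 0" unfolding f_def[abs_def] by (rule ac_integral[OF g], simp)
    note hf = h1I[OF L_pos f(1)]
    have fl: "f \<in> l2 L" by (rule ac_l2[OF f(1)])
    define F where "F = ((\<lambda>x. 0) :: real \<Rightarrow> complex, \<lambda>k. if k = j then f else (\<lambda>x. 0))"
    have FX: "F \<in> spaceX P" unfolding F_def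
      using hf f(2) wderiv_zero h1_zero(1)[OF L_pos] L_nonneg by (auto simp: in_X_iff)
    have c: "c_form P (w, z) F = of_real (hO P j * pO P j) * l2_inner L (z j) f"
    proof -
      have "(\<Sum>k\<in>stiff. of_real (hO P k * pO P k) * l2_inner L (z k) (if k = j then f else (\<lambda>x. 0)))
          = (\<Sum>k\<in>stiff. if k = j then of_real (hO P j * pO P j) * l2_inner L (z j) f else 0)"
        by (rule sum.cong) (auto simp: l2_inner_wderiv_zero)
      also have "\<dots> = of_real (hO P j * pO P j) * l2_inner L (z j) f" using j by (simp only: sum.delta finite_atLeastAtMost if_True)
      finally show ?thesis unfolding F_def by (simp add: l2_inner_wderiv_zero wl)
    qed
    have ph: "l2_inner L (phi P (u, v) i) (phi P F i) = of_real (inverse (hE P i) * matB i j) * l2_inner L (phi P (u, v) i) f" for i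
    proof -
      have "AE x in lebI L. phi P F i x = of_real (inverse (hE P i) * matB i j) * f x"
        using wderiv_zero(2)
      proof eventually_elim
        fix x assume "wderiv L (\<lambda>x. 0) x = 0"
        moreover have "(\<Sum>k\<in>stiff. of_real (matB i k) * (if k = j then f else (\<lambda>x. 0)) x) = (\<Sum>k\<in>stiff. if k = j then of_real (matB i j) * f x else 0)"
          by (rule sum.cong) auto
        moreover have "(\<Sum>k\<in>stiff. if k = j then of_real (matB i j) * f x else 0) = of_real (matB i j) * f x"
          using j by (simp only: sum.delta finite_atLeastAtMost if_True)
        ultimately show "phi P F i x = of_real (inverse (hE P i) * matB i j) * f x"
          unfolding F_def by simp
      qed
      moreover have "phi P F i \<in> l2 L"
      proof -
        have "(F, (w, z)) \<in> spaceH P" using FX wz(3) by (simp add: in_H_iff)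
        from linear_AE_l2[OF linear_AE_c_phi this, of i] show ?thesis by (simp add: c_phi_def)
      qed
      ultimately have "l2_inner L (phi P (u, v) i) (phi P F i) = l2_inner L (phi P (u, v) i) (\<lambda>x. of_real (inverse (hE P i) * matB i j) * f x)"
        by (intro l2_inner_cong_right phil l2_scale fl)
      then show ?thesis by (simp add: l2_inner_scale_right)
    qed
    have aa: "a_form P (u, v) F = of_real cc * l2_inner L (c_v1 j Y) g + (\<Sum>i\<in>soft. of_real (co i) * l2_inner L (phi P (u, v) i) f)"
    proof -
      have "(\<Sum>k\<in>stiff. of_real (hO P k * EO P k) * l2_inner L (wderiv L (v k)) (wderiv L (if k = j then f else (\<lambda>x. 0))))
          = (\<Sum>k\<in>stiff. if k = j then of_real cc * l2_inner L (c_v1 j Y) g else 0)"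
      proof (rule sum.cong)
        fix k assume k: "k \<in> stiff"
        have "l2_inner L (wderiv L (v j)) (wderiv L f) = l2_inner L (c_v1 j Y) g"
          using l2_inner_cong_right[OF hf(2) vl[OF j] wderiv_l2[OF hf(1)] g] by (simp add: c_v1_def Ye)
        then show "of_real (hO P k * EO P k) * l2_inner L (wderiv L (v k)) (wderiv L (if k = j then f else (\<lambda>x. 0)))
          = (if k = j then of_real cc * l2_inner L (c_v1 j Y) g else 0)"
          using k by (auto simp: l2_inner_wderiv_zero vl cc_def)
      qed simp
      also have "\<dots> = of_real cc * l2_inner L (c_v1 j Y) g" using j by (simp only: sum.delta finite_atLeastAtMost if_True)
      finally have 1: "(\<Sum>k\<in>stiff. of_real (hO P k * EO P k) * l2_inner L (wderiv L (v k)) (wderiv L (snd F k))) = of_real cc * l2_inner L (c_v1 j Y) g"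
        by (simp add: F_def)
      have "a_form P (u, v) F = of_real K * l2_inner L (wderiv L (wderiv L u)) (wderiv L (wderiv L (fst F))) + (\<Sum>k\<in>stiff. of_real (hO P k * EO P k) * l2_inner L (wderiv L (v k)) (wderiv L (snd F k)))
        + (\<Sum>i\<in>soft. of_real (GE P i * hE P i) * l2_inner L (phi P (u, v) i) (phi P F i))"
        by (cases F) (simp only: a_form.simps fst_conv snd_conv)
      also have "l2_inner L (wderiv L (wderiv L u)) (wderiv L (wderiv L (fst F))) = 0"
        by (simp add: F_def l2_inner_wderiv_zero ul)
      finally show ?thesis unfolding 1 ph by (simp add: co_def mult.assoc)
    qed
    have b: "bdry_form P (p, y) F = - of_real (cc * gO P j) * pt_val L (y j) L * cnj (f L)"
    proof -
      have "(\<Sum>k\<in>stiff. of_real (hO P k * EO P k * gO P k) * pt_val L (y k) L * cnj (pt_val L (if k = j then f else (\<lambda>x. 0)) L))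
          = (\<Sum>k\<in>stiff. if k = j then of_real (cc * gO P j) * pt_val L (y j) L * cnj (f L) else 0)"
        by (rule sum.cong) (use hf(3)[of L] L_nonneg wderiv_zero in \<open>auto simp: cc_def\<close>)
      also have "\<dots> = of_real (cc * gO P j) * pt_val L (y j) L * cnj (f L)" using j by (simp only: sum.delta finite_atLeastAtMost if_True)
      finally show ?thesis unfolding F_def by (simp add: wderiv_zero)
    qed
    have "l2_inner L r f = of_real (hO P j * pO P j) * l2_inner L (z j) f + (\<Sum>i\<in>soft. of_real (co i) * l2_inner L (phi P (u, v) i) f)"
      unfolding r_def using zl[OF j] fl phil by (simp add: l2_inner_add l2_scale l2_sum l2_inner_sum l2_inner_scale)
    moreover have "l2_inner L a g = of_real cc * l2_inner L (c_v1 j Y) g" unfolding a_def by (rule l2_inner_scale)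
    ultimately have "l2_inner L a g + l2_inner L r f = c_form P (w, z) F + a_form P (u, v) F"
      unfolding c aa by (simp only: add_ac)
    then have "l2_inner L a g + l2_inner L r f = - of_real (cc * gO P j) * pt_val L (y j) L * cnj (f L)"
      using var[OF FX] unfolding b by (simp only:)
    then show "l2_inner L a g + l2_inner L r (\<lambda>x. 0 + integral {0..x} g) = (- of_real (cc * gO P j) * pt_val L (y j) L) * cnj (0 + integral {0..L} g)"
      unfolding f_def[abs_def] .
  qed
  then have "(\<lambda>x. inverse (of_real cc) * a x) \<in> h1 L" by (rule h1_scale(1)[OF L_pos])
  moreover have "cc \<noteq> 0" using hO_pos[OF j] EO_pos[OF j] by (simp add: cc_def)
  ultimately show ?thesis unfolding a_def by (simp add: mult.assoc[symmetric])
qed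

text \<open>
  Test displacements that bend the beam only. Here \<open>g = f''\<close>, and \<open>f(L) = 0\<close> means that \<open>f''\<close> is
  orthogonal to \<open>L - x\<close>. The inertial term \<open>\<langle>w, f\<rangle>\<close> is rewritten with the primitive \<open>W\<close> of \<open>w\<close> as
  \<open>- \<langle>W, f'\<rangle>\<close>.
\<close>

lemma dom_A_bending_regularity:
  assumes Y: "Y \<in> dom_A P"
  shows "c_u2 Y \<in> h1 L"
proof -
  obtain u v p y where Ye: "Y = ((u, v), (p, y))" by (metis prod.exhaust)
  obtain w z where wz: "(u, v) \<in> spaceX P" "(p, y) \<in> spaceX P" "(w, z) \<in> spaceY P"
    and var: "\<And>F. F \<in> spaceX P \<Longrightarrow> c_form P (w, z) F + a_form P (u, v) F = bdry_form P (p, y) F"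
    and S: "Y \<in> spaceH P" "((p, y), (w, z)) \<in> spaceH P"
    using dom_A_components[OF Y[unfolded Ye]] Ye by metis
  have zl: "z k \<in> l2 L" if "k \<in> stiff" for k using wz(3) that by (auto simp: in_Y_iff)
  have wl: "w \<in> l2 L" "wderiv L w \<in> l2 L" using wz(3) by (auto simp: in_Y_iff h1_l2 wderiv_l2)
  have vl: "wderiv L (v k) \<in> l2 L" if "k \<in> stiff" for k using wz(1) that by (auto simp: in_X_iff wderiv_l2)
  have ul: "c_u2 Y \<in> l2 L" by (rule linear_AE_l2[OF linear_AE_c_u2 S(1)])
  have phil: "phi P (u, v) i \<in> l2 L" for i using linear_AE_l2[OF linear_AE_c_phi S(1), of i] by (simp add: c_phi_def Ye)
  define co where "co i = GE P i * hE P i * vecN P i" for i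
  define W where "W x = 0 + integral {0..x} w" for x
  have W: "ac L W w" "W 0 = 0" unfolding W_def[abs_def] by (rule ac_integral[OF wl(1)], simp)
  define a where "a x = of_real K * c_u2 Y x" for x
  define r where "r x = of_real (par_\<alpha> P) * wderiv L w x + (\<Sum>i\<in>soft. of_real (co i) * phi P (u, v) i x) - W x" for x
  have al: "a \<in> l2 L" unfolding a_def by (intro l2_scale ul)
  have Wl: "W \<in> l2 L" by (rule ac_l2[OF W(1)])
  have rl: "r \<in> l2 L" unfolding r_def by (intro l2_diff l2_add l2_scale l2_sum wl phil Wl)
  \<comment> \<open>the direction to which \<open>f''\<close> must be orthogonal\<close>
  have lac: "ac L (\<lambda>x. of_real (L - x)) (\<lambda>x. - 1)"
    using ac_diff[OF ac_const[of L "of_real L"] ac_ident] by simp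
  have "a \<in> h1 L"
  proof (rule h1_of_weak_identity[OF L_pos al rl lac])
    fix g assume g: "g \<in> l2 L" and gl: "l2_inner L g (\<lambda>x. of_real (L - x)) = 0"
    define f1 where "f1 x = 0 + integral {0..x} g" for x
    have f1: "ac L f1 g" "f1 0 = 0" unfolding f1_def[abs_def] by (rule ac_integral[OF g], simp)
    have f1l: "f1 \<in> l2 L" by (rule ac_l2[OF f1(1)])
    define f where "f x = 0 + integral {0..x} f1" for x
    have f: "ac L f f1" "f 0 = 0" unfolding f_def[abs_def] by (rule ac_integral[OF f1l], simp)
    have fl: "f \<in> l2 L" by (rule ac_l2[OF f(1)])
    have fL: "f L = 0"
    proof -
      have "(LINT x|lebI L. g x * of_real (L - x) + f1 x * - 1) = 0"
        using ac_integration_by_parts[OF f1(1) lac L_pos] f1(2) by simp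
      moreover have "(LINT x|lebI L. g x * of_real (L - x) + f1 x * - 1) = l2_inner L g (\<lambda>x. of_real (L - x)) - (LINT x|lebI L. f1 x)"
        unfolding l2_inner_def using l2_inner_integrable[OF g ac_l2[OF lac]] l2_integrable[OF f1l] by (simp del: of_real_diff)
      ultimately have "(LINT x|lebI L. f1 x) = 0" using gl by simp
      then show ?thesis using LINT_eq_integral[OF l2_integrable[OF f1l]] by (simp add: f_def)
    qed
    note hf = h1I[OF L_pos f(1)] and hf1 = h1I[OF L_pos f1(1)]
    note hf' = h1_cong_AE[OF L_pos hf1(1) wderiv_l2[OF hf(1)] hf(2)]
    define F where "F = (f, (\<lambda>k::nat. (\<lambda>x. 0) :: real \<Rightarrow> complex))"
    have FX: "F \<in> spaceX P" unfolding F_def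
      using hf hf' hf1 f(2) f1(2) fL wderiv_zero h1_zero(1)[OF L_pos] L_nonneg by (auto simp: in_X_iff)
    have d2: "AE x in lebI L. wderiv L (wderiv L f) x = g x" using hf'(2) hf1(2) by eventually_elim simp
    have c: "c_form P (w, z) F = - l2_inner L W f1 + of_real (par_\<alpha> P) * l2_inner L (wderiv L w) f1"
    proof -
      have "(LINT x|lebI L. w x * cnj (f x) + W x * cnj (f1 x)) = 0"
        using ac_integration_by_parts[OF W(1) ac_cnj[OF f(1)] L_pos] W(2) fL by simp
      then have "l2_inner L w f + l2_inner L W f1 = 0"
        unfolding l2_inner_def using l2_inner_integrable[OF wl(1) fl] l2_inner_integrable[OF Wl f1l] by simp
      then have "l2_inner L w f = - l2_inner L W f1" by (simp add: eq_neg_iff_add_eq_0)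
      then show ?thesis unfolding F_def
        using l2_inner_cong_right[OF hf(2) wl(2) wderiv_l2[OF hf(1)] f1l] by (simp add: l2_inner_wderiv_zero)
    qed
    have ph: "l2_inner L (phi P (u, v) i) (phi P F i) = of_real (vecN P i) * l2_inner L (phi P (u, v) i) f1" for i
    proof -
      have "AE x in lebI L. phi P F i x = of_real (vecN P i) * f1 x"
        using hf(2) by eventually_elim (simp add: F_def)
      moreover have "phi P F i \<in> l2 L"
      proof -
        have "(F, (w, z)) \<in> spaceH P" using FX wz(3) by (simp add: in_H_iff)
        from linear_AE_l2[OF linear_AE_c_phi this, of i] show ?thesis by (simp add: c_phi_def)
      qed
      ultimately have "l2_inner L (phi P (u, v) i) (phi P F i) = l2_inner L (phi P (u, v) i) (\<lambda>x. of_real (vecN P i) * f1 x)"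
        by (intro l2_inner_cong_right phil l2_scale f1l)
      then show ?thesis by (simp add: l2_inner_scale_right)
    qed
    have aa: "a_form P (u, v) F = of_real K * l2_inner L (c_u2 Y) g + (\<Sum>i\<in>soft. of_real (co i) * l2_inner L (phi P (u, v) i) f1)"
    proof -
      have "a_form P (u, v) F = of_real K * l2_inner L (wderiv L (wderiv L u)) (wderiv L (wderiv L (fst F))) + (\<Sum>k\<in>stiff. of_real (hO P k * EO P k) * l2_inner L (wderiv L (v k)) (wderiv L (snd F k)))
        + (\<Sum>i\<in>soft. of_real (GE P i * hE P i) * l2_inner L (phi P (u, v) i) (phi P F i))"
        by (cases F) (simp only: a_form.simps fst_conv snd_conv)
      also have "(\<Sum>k\<in>stiff. of_real (hO P k * EO P k) * l2_inner L (wderiv L (v k)) (wderiv L (snd F k))) = 0"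
        by (rule sum.neutral) (simp add: F_def l2_inner_wderiv_zero vl del: atLeastAtMost_iff)
      also have "l2_inner L (wderiv L (wderiv L u)) (wderiv L (wderiv L (fst F))) = l2_inner L (c_u2 Y) g"
        using l2_inner_cong_right[OF d2 ul wderiv_l2[OF hf'(1)] g] by (simp add: F_def c_u2_def Ye)
      finally show ?thesis unfolding ph by (simp add: co_def mult.assoc)
    qed
    have b: "bdry_form P (p, y) F = - of_real (K * par_\<gamma> P 0) * pt_val L (wderiv L p) L * cnj (f1 L)"
      unfolding F_def using hf'(3)[of L] hf1(3)[of L] L_nonneg by (simp add: wderiv_zero)
    have "l2_inner L r f1 = of_real (par_\<alpha> P) * l2_inner L (wderiv L w) f1 + (\<Sum>i\<in>soft. of_real (co i) * l2_inner L (phi P (u, v) i) f1) - l2_inner L W f1"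
      unfolding r_def using wl f1l phil Wl by (simp add: l2_inner_diff l2_add l2_inner_add l2_scale l2_sum l2_inner_sum l2_inner_scale)
    moreover have "l2_inner L a g = of_real K * l2_inner L (c_u2 Y) g" unfolding a_def by (rule l2_inner_scale)
    ultimately have "l2_inner L a g + l2_inner L r f1 = c_form P (w, z) F + a_form P (u, v) F"
      unfolding c aa by (simp only: diff_conv_add_uminus add_ac)
    then have "l2_inner L a g + l2_inner L r f1 = - of_real (K * par_\<gamma> P 0) * pt_val L (wderiv L p) L * cnj (f1 L)"
      using var[OF FX] unfolding b by (simp only:)
    then show "l2_inner L a g + l2_inner L r (\<lambda>x. 0 + integral {0..x} g) = (- of_real (K * par_\<gamma> P 0) * pt_val L (wderiv L p) L) * cnj (0 + integral {0..L} g)"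
      unfolding f1_def[abs_def] .
  qed
  then have "(\<lambda>x. inverse (of_real K) * a x) \<in> h1 L" by (rule h1_scale(1)[OF L_pos])
  then show ?thesis unfolding a_def using K_pos by (simp add: mult.assoc[symmetric])
qed

end

section \<open>The multiplier\<close>

text \<open>
  The multiplier has the end value \<open>c t + l s\<close>, where \<open>s\<close> is an end value of \<open>u''\<close> or \<open>v\<^sub>j'\<close>,
  which is not controlled by the energy. The coefficient \<open>l/2\<close> of \<open>|s|\<^sup>2\<close> is exactly the one with
  which Rellich's identity provides \<open>|s|\<^sup>2\<close> in the potential energy.
\<close>

lemma Re_boundary_product_le:
  assumes "g \<ge> 0" "l \<ge> 0"
  shows "Re (- of_real g * th * cnj (of_real c * t + of_real l * s)) \<le>
    l / 2 * (cmod s)\<^sup>2 + l / 2 * g\<^sup>2 * (cmod th)\<^sup>2 + g * \<bar>c\<bar> * (cmod th * cmod t)"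
proof -
  have "Re (- of_real g * th * cnj (of_real c * t + of_real l * s)) \<le> cmod (- of_real g * th * cnj (of_real c * t + of_real l * s))"
    by (rule complex_Re_le_cmod)
  also have "\<dots> = g * cmod th * cmod (of_real c * t + of_real l * s)"
    using assms by (simp add: norm_mult complex_mod_cnj del: complex_cnj_add)
  also have "\<dots> \<le> g * cmod th * (\<bar>c\<bar> * cmod t + l * cmod s)"
    using assms by (intro mult_left_mono order_trans[OF norm_triangle_ineq]) (auto simp: norm_mult)
  also have "\<dots> = g * \<bar>c\<bar> * (cmod th * cmod t) + l * (cmod s * (g * cmod th))" by (simp add: algebra_simps)
  also have "\<dots> \<le> g * \<bar>c\<bar> * (cmod th * cmod t) + l * (((cmod s)\<^sup>2 + (g * cmod th)\<^sup>2) / 2)"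
    using sum_squares_bound[of "cmod s" "g * cmod th"] assms(2) by (intro add_left_mono mult_left_mono) auto
  also have "\<dots> = l / 2 * (cmod s)\<^sup>2 + l / 2 * g\<^sup>2 * (cmod th)\<^sup>2 + g * \<bar>c\<bar> * (cmod th * cmod t)"
    by (simp add: power_mult_distrib algebra_simps)
  finally show ?thesis .
qed

lemma absorb_product:
  fixes a b c d :: real
  assumes "d > 0"
  shows "c * (a * b) \<le> d * b\<^sup>2 + c\<^sup>2 / (4 * d) * a\<^sup>2"
proof -
  have "0 \<le> (c * a / (2 * sqrt d) - sqrt d * b)\<^sup>2" by simp
  also have "\<dots> = (c * a)\<^sup>2 / (4 * d) - c * a * b + d * b\<^sup>2"
    using assms by (simp add: power2_diff power_divide power_mult_distrib)
  finally show ?thesis by (simp add: power_mult_distrib algebra_simps)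
qed

context semi_hilbert
begin

lemma bounded_form_zero: "bounded_form (\<lambda>x y. 0)"
  unfolding bounded_form_def by (auto intro!: exI[of _ 0])

lemma bounded_form_add: "bounded_form A \<Longrightarrow> bounded_form B \<Longrightarrow> bounded_form (\<lambda>x y. A x y + B x y)"
  using bounded_form_lincomb[of A B 1] by simp

lemma bounded_form_cmult: "bounded_form A \<Longrightarrow> bounded_form (\<lambda>x y. c * A x y)"
  using bounded_form_lincomb[OF _ bounded_form_zero, of A c] by simp

lemma bounded_form_sum: "(\<And>i. i \<in> I \<Longrightarrow> bounded_form (A i)) \<Longrightarrow> bounded_form (\<lambda>x y. \<Sum>i\<in>I. A i x y)"
proof (induction I rule: infinite_finite_induct)
  case (insert i I)
  then show ?case using bounded_form_add[of "A i" "\<lambda>x y. \<Sum>i\<in>I. A i x y"] by simp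
qed (simp_all add: bounded_form_zero)

lemma bounded_form_rank_one:
  assumes a: "a \<in> S" and b: "b \<in> S"
  shows "bounded_form (\<lambda>x y. ip x a * ip y b)"
proof -
  have "\<bar>ip x a * ip y b\<bar> \<le> (nrm a * nrm b) * nrm x * nrm y" if x: "x \<in> S" and y: "y \<in> S" for x y
  proof -
    have "\<bar>ip x a * ip y b\<bar> \<le> (nrm x * nrm a) * (nrm y * nrm b)"
      unfolding abs_mult by (intro mult_mono Cauchy_Schwarz a b x y mult_nonneg_nonneg nrm_nonneg abs_ge_zero)
    then show ?thesis by (simp add: mult_ac)
  qed
  then have "\<exists>C. \<forall>x\<in>S. \<forall>y\<in>S. \<bar>ip x a * ip y b\<bar> \<le> C * nrm x * nrm y" by blast
  then show ?thesis unfolding bounded_form_def using a b by (auto simp: ip_simps algebra_simps)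
qed

end

context rao_nakra_beam
begin

text \<open>
  A single size for all end values; the estimates below need no finer information.
\<close>

definition "tr_norm Y = L2_set (\<lambda>k. cmod (tr k Y)) dampers" for Y :: state

lemma tr_le_tr_norm: "k \<in> dampers \<Longrightarrow> cmod (tr k Y) \<le> tr_norm Y"
  unfolding tr_norm_def by (rule member_le_L2_set) auto

lemma tr_norm_nonneg: "0 \<le> tr_norm Y" unfolding tr_norm_def by (rule L2_set_nonneg)

lemma tr_norm_sq: "(tr_norm Y)\<^sup>2 = (\<Sum>k\<in>dampers. (cmod (tr k Y))\<^sup>2)"
  unfolding tr_norm_def L2_set_def by (simp add: sum_nonneg del: sum.atLeast0_atMost_Suc)

lemma bounded_by_family:
  assumes "finite I" "\<And>i. i \<in> I \<Longrightarrow> bounded_by n (A i)" "\<And>Y. Y \<in> spaceH P \<Longrightarrow> 0 \<le> n Y"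
  shows "\<exists>C\<ge>0. \<forall>i\<in>I. \<forall>Y\<in>spaceH P. l2_norm L (A i Y) \<le> C * n Y"
  using assms(1,2)
proof (induction I)
  case (insert i I)
  then obtain C where C: "C \<ge> 0" "\<And>i Y. i \<in> I \<Longrightarrow> Y \<in> spaceH P \<Longrightarrow> l2_norm L (A i Y) \<le> C * n Y" by blast
  obtain D where D: "D \<ge> 0" "\<And>Y. Y \<in> spaceH P \<Longrightarrow> l2_norm L (A i Y) \<le> D * n Y" using bounded_byE[OF insert(4)[of i]] by blast
  have "l2_norm L (A k Y) \<le> (C + D) * n Y" if "k \<in> insert i I" "Y \<in> spaceH P" for k Y
  proof -
    have "0 \<le> C * n Y" "0 \<le> D * n Y" using C(1) D(1) assms(3)[OF that(2)] by auto
    then show ?thesis using C(2)[of k Y] D(2)[of Y] that by (auto simp: distrib_right)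
  qed
  then show ?case using C(1) D(1) by (intro exI[of _ "C + D"]) auto
qed auto

lemma H_norm_controls:
  obtains C where "C \<ge> 0" "\<And>Y. Y \<in> spaceH P \<Longrightarrow> l2_norm L (c_u2 Y) \<le> C * H_norm P Y"
    "\<And>Y. Y \<in> spaceH P \<Longrightarrow> l2_norm L (c_p Y) \<le> C * H_norm P Y"
    "\<And>Y. Y \<in> spaceH P \<Longrightarrow> l2_norm L (c_p1 Y) \<le> C * H_norm P Y"
    "\<And>Y i. Y \<in> spaceH P \<Longrightarrow> i \<in> soft \<Longrightarrow> l2_norm L (c_phi i Y) \<le> C * H_norm P Y"
    "\<And>Y. Y \<in> spaceH P \<Longrightarrow> tr_norm Y \<le> C * H_norm P Y"
proof -
  obtain C1 where C1: "C1 \<ge> 0" "\<And>Y. Y \<in> spaceH P \<Longrightarrow> l2_norm L (c_u2 Y) \<le> C1 * H_norm P Y" using bounded_byE[OF bounded_by_H(1)] by blast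
  obtain C2 where C2: "C2 \<ge> 0" "\<And>Y. Y \<in> spaceH P \<Longrightarrow> l2_norm L (c_p Y) \<le> C2 * H_norm P Y" using bounded_byE[OF bounded_by_c_p[OF bounded_by_H(3)]] by blast
  obtain C3 where C3: "C3 \<ge> 0" "\<And>Y. Y \<in> spaceH P \<Longrightarrow> l2_norm L (c_p1 Y) \<le> C3 * H_norm P Y" using bounded_byE[OF bounded_by_H(3)] by blast
  obtain C4 where C4: "C4 \<ge> 0" "\<And>i Y. i \<in> soft \<Longrightarrow> Y \<in> spaceH P \<Longrightarrow> l2_norm L (c_phi i Y) \<le> C4 * H_norm P Y"
    using bounded_by_family[OF _ bounded_by_c_phi[OF bounded_by_H(1,2)] H_norm_nonneg, of soft "\<lambda>i. i"] by auto
  obtain C5 where C5: "C5 \<ge> 0" "\<And>k Y. k \<in> dampers \<Longrightarrow> Y \<in> spaceH P \<Longrightarrow> l2_norm L (\<lambda>x. tr k Y) \<le> C5 * H_norm P Y"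
    using bounded_by_family[OF _ bounded_by_tr[OF bounded_by_H(1,2)] H_norm_nonneg, of "dampers" "\<lambda>k. k"] by blast
  define C6 where "C6 = real (card dampers) * (C5 / sqrt L)"
  have C6: "C6 \<ge> 0" using C5(1) L_nonneg by (simp add: C6_def)
  have tr_norm: "tr_norm Y \<le> C6 * H_norm P Y" if Y: "Y \<in> spaceH P" for Y
  proof -
    have "tr_norm Y \<le> (\<Sum>k\<in>dampers. cmod (tr k Y))" unfolding tr_norm_def by (rule L2_set_le_sum) auto
    also have "\<dots> \<le> (\<Sum>k\<in>dampers. C5 / sqrt L * H_norm P Y)"
    proof (rule sum_mono)
      fix k assume "k \<in> dampers"
      then have "sqrt L * cmod (tr k Y) \<le> C5 * H_norm P Y" using C5(2)[of k Y] Y by (simp add: l2_norm_const[OF L_pos] del: atLeastAtMost_iff)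
      then show "cmod (tr k Y) \<le> C5 / sqrt L * H_norm P Y" using L_pos by (simp add: field_simps)
    qed
    also have "\<dots> = C6 * H_norm P Y" unfolding C6_def sum_constant by simp
    finally show ?thesis .
  qed
  define C where "C = C1 + C2 + C3 + C4 + C6"
  have le: "C' * H_norm P Y \<le> C * H_norm P Y" if "Y \<in> spaceH P" "C' \<le> C" for C' Y
    using H_norm_nonneg[OF that(1)] that(2) by (rule mult_right_mono[rotated])
  have c: "C \<ge> 0" "C1 \<le> C" "C2 \<le> C" "C3 \<le> C" "C4 \<le> C" "C6 \<le> C" using C1(1) C2(1) C3(1) C4(1) C6 by (auto simp: C_def)
  show ?thesis
    by (rule that[OF c(1)]; (rule order_trans[OF _ le], rule C1 C2 C3 C4 tr_norm; use c in blast))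
qed

text \<open>
  Bending and stretching alone control the shear, by Poincare's inequality. The constant decides
  how small \<open>e\<close> has to be in the multiplier.
\<close>

lemma soft_strain_bound:
  obtains C where "C \<ge> 0" "\<And>Y. Y \<in> spaceH P \<Longrightarrow> shearing Y \<le>
     C * (K * (l2_norm L (c_u2 Y))\<^sup>2 + stretching Y)"
proof -
  define q where "q Y = K * (l2_norm L (c_u2 Y))\<^sup>2 + stretching Y" for Y
  have q: "q Y \<ge> 0" for Y unfolding q_def using ip_parts_nonneg(1,2)[of Y] by linarith
  have *: "bounded_by (\<lambda>Y. sqrt (q Y)) A" if "linear_AE A" "c > 0" "\<And>Y. c * (l2_norm L (A Y))\<^sup>2 \<le> q Y" for A c
    by (rule bounded_byI[OF that(1), of "1 / sqrt c"])
      (use that(2,3) le_of_weighted_square_le[of c "l2_norm L (A Y)" "sqrt (q Y)" for Y] q in auto)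
  have u: "bounded_by (\<lambda>Y. sqrt (q Y)) c_u2"
    by (rule *[OF linear_AE_c_u2 K_pos]) (use ip_parts_nonneg(2) in \<open>auto simp: q_def\<close>)
  have v: "bounded_by (\<lambda>Y. sqrt (q Y)) (c_v1 j)" if j: "j \<in> stiff" for j
  proof (rule *[OF linear_AE_c_v1[OF j], of "hO P j * EO P j"])
    show "hO P j * EO P j > 0" by (intro mult_pos_pos hO_pos EO_pos j)
    fix Y
    have "hO P j * EO P j * (l2_norm L (c_v1 j Y))\<^sup>2 \<le> stretching Y"
      by (rule single_le_sum_sq[OF j finite_atLeastAtMost mult_pos_pos[OF hO_pos EO_pos]])
    then show "hO P j * EO P j * (l2_norm L (c_v1 j Y))\<^sup>2 \<le> q Y" unfolding q_def using ip_parts_nonneg(1)[of Y] by linarith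
  qed
  have "\<exists>C\<ge>0. \<forall>i\<in>soft. \<forall>Y\<in>spaceH P. l2_norm L (c_phi i Y) \<le> C * sqrt (q Y)"
    by (rule bounded_by_family[OF finite_atLeastAtMost bounded_by_c_phi[OF u v]]) (auto simp: q)
  then obtain C where C: "C \<ge> 0" "\<And>i Y. i \<in> soft \<Longrightarrow> Y \<in> spaceH P \<Longrightarrow> l2_norm L (c_phi i Y) \<le> C * sqrt (q Y)" by blast
  define D where "D = (\<Sum>i\<in>soft. GE P i * hE P i * C\<^sup>2)"
  have D: "D \<ge> 0" unfolding D_def by (intro sum_nonneg mult_nonneg_nonneg zero_le_power2; blast intro: less_imp_le GE_pos hE_pos)
  show ?thesis
  proof (rule that[OF D])
    fix Y assume Y: "Y \<in> spaceH P"
    have "shearing Y \<le> (\<Sum>i\<in>soft. (GE P i * hE P i) * (C\<^sup>2 * q Y))"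
    proof (rule sum_mono)
      fix i assume i: "i \<in> soft"
      have "(l2_norm L (c_phi i Y))\<^sup>2 \<le> (C * sqrt (q Y))\<^sup>2" by (intro power_mono C i Y l2_norm_nonneg)
      also have "\<dots> = C\<^sup>2 * q Y" using q[of Y] by (simp add: power_mult_distrib)
      finally show "(GE P i * hE P i) * (l2_norm L (c_phi i Y))\<^sup>2 \<le> (GE P i * hE P i) * (C\<^sup>2 * q Y)"
        using GE_pos[OF i] hE_pos[OF i] by (intro mult_left_mono) auto
    qed
    also have "\<dots> = D * q Y" by (simp add: D_def sum_distrib_right mult.assoc)
    finally show "shearing Y \<le>
     D * (K * (l2_norm L (c_u2 Y))\<^sup>2 + stretching Y)" unfolding q_def .
  qed
qed

text \<open>
  The multiplier \<open>Mu\<close>, its first two derivatives, \<open>Mv\<^sub>j\<close> and its derivative. The summands \<open>0 * 0\<close>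
  bring the longitudinal ones into the form of lemma \<open>Rellich_multiplier\<close>, with vanishing
  correction.
\<close>

definition "mul_u e Y = (\<lambda>x. of_real (- (1/2 + e)) * c_u Y x + of_real x * c_u1 Y x + of_real (- (x\<^sup>2 / L)) * tr 0 Y)" for e :: real and Y :: state
definition "mul_u1 e Y = (\<lambda>x. of_real (1/2 - e) * c_u1 Y x + of_real x * c_u2 Y x + of_real (- (2 * x / L)) * tr 0 Y)" for e :: real and Y :: state
definition "mul_v e j Y = (\<lambda>x. of_real (1/2 - e) * c_v j Y x + of_real x * c_v1 j Y x + 0 * 0)" for e :: real and j and Y :: state
definition "mul_u2 e Y = (\<lambda>x. of_real (3/2 - e) * c_u2 Y x + of_real x * wderiv L (c_u2 Y) x + of_real (- (2 / L)) * tr 0 Y)" for e :: real and Y :: state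
definition "mul_v1 e j Y = (\<lambda>x. of_real (3/2 - e) * c_v1 j Y x + of_real x * wderiv L (c_v1 j Y) x + 0 * 0)" for e :: real and j and Y :: state

text \<open>
  \<open>Re c(V; MU)\<close> with the velocity \<open>V\<close> of \<open>Y\<close> and the displacement \<open>U\<close> of \<open>Z\<close>. Its derivative along
  an orbit consists of the kinetic part \<open>Re c(V; MV)\<close> and of \<open>Re c(\<A>\<^sub>1U; MU)\<close>, which the
  variational identity expresses by the elastic energy form and the boundary form.
\<close>

definition "mul_form e Y Z = Re (l2_inner L (c_p Y) (mul_u e Z)) + par_\<alpha> P * Re (l2_inner L (c_p1 Y) (mul_u1 e Z))
   + (\<Sum>j\<in>stiff. (hO P j * pO P j) * Re (l2_inner L (c_y j Y) (mul_v e j Z)))" for e :: real and Y Z :: state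

lemma bounded_form_mul_form: "H.bounded_form (mul_form e)"
proof -
  have t: "bounded_by (H_norm P) (\<lambda>Y x. tr 0 Y)" by (rule bounded_by_tr[OF bounded_by_H(1,2)]) auto
  have "bounded_by (H_norm P) (mul_u e)" unfolding mul_u_def
    by (intro bounded_by_add bounded_by_cmult bounded_by_c_u bounded_by_c_u1 bounded_by_H t continuous_intros) (use L_pos in auto)
  moreover have "bounded_by (H_norm P) (mul_u1 e)" unfolding mul_u1_def
    by (intro bounded_by_add bounded_by_cmult bounded_by_c_u1 bounded_by_H t continuous_intros) (use L_pos in auto)
  moreover have "bounded_by (H_norm P) (mul_v e j)" if "j \<in> stiff" for j unfolding mul_v_def
    by (intro bounded_by_add bounded_by_cmult bounded_by_c_v bounded_by_H that bounded_by_zero continuous_intros)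
  ultimately show ?thesis unfolding mul_form_def[abs_def]
    by (intro H.bounded_form_add H.bounded_form_cmult H.bounded_form_sum bounded_form_l2_inner bounded_by_c_p bounded_by_H)
qed

lemma mul_coefficient_bounds:
  assumes "x \<in> {0..L}"
  shows "cmod (of_real (- (x\<^sup>2 / L))) \<le> L" "cmod (of_real (- (2 * x / L))) \<le> 2" "cmod (of_real (- (2 / L))) \<le> 2 / L"
proof -
  have "x\<^sup>2 \<le> L\<^sup>2" using assms by (intro power_mono) auto
  then show "cmod (of_real (- (x\<^sup>2 / L))) \<le> L"
    unfolding norm_of_real using L_pos by (simp add: divide_le_eq power2_eq_square)
  show "cmod (of_real (- (2 * x / L))) \<le> 2"
    unfolding norm_of_real using L_pos assms by (simp add: divide_le_eq)
  show "cmod (of_real (- (2 / L))) \<le> 2 / L" unfolding norm_of_real using L_pos by simp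
qed

text \<open>
  \<open>Z = \<A>Y\<close> in the application. Rellich's identity contributes the factors \<open>- (1/2 + e) - 1/2\<close> for
  \<open>p\<close> and \<open>(1/2 - e) - 1/2\<close> for \<open>p'\<close> and \<open>y\<^sub>j\<close>. The end values in it are damped, and \<open>p(L) = 0\<close>.
\<close>

lemma kinetic_part:
  assumes Y: "Y \<in> spaceH P" and Z: "Z \<in> spaceH P" and e: "e \<ge> 0"
    and uZ: "c_u Z = c_p Y" and vZ: "\<And>j. j \<in> stiff \<Longrightarrow> c_v j Z = c_y j Y"
  shows "mul_form e Y Z \<le> - (1 + e) * (l2_norm L (c_p Y))\<^sup>2 - e * (par_\<alpha> P * (l2_norm L (c_p1 Y))\<^sup>2)
      - e * sliding Y
      + (par_\<alpha> P * (L / 2) + (\<Sum>j\<in>stiff. (hO P j * pO P j) * (L / 2))) * (tr_norm Z)\<^sup>2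
      + tr_norm Z * (sqrt L * L * l2_norm L (c_p Y) + par_\<alpha> P * (sqrt L * 2 * l2_norm L (c_p1 Y)))"
proof -
  have t0: "cmod (tr 0 Z) \<le> tr_norm Z" by (rule tr_le_tr_norm) auto
  have u1Z: "c_u1 Z = c_p1 Y" by (simp add: c_derivs uZ)
  have L2: "L / 2 \<ge> 0" using L_nonneg by simp
  have 1: "Re (l2_inner L (c_p Y) (mul_u e Z)) \<le> - (1 + e) * (l2_norm L (c_p Y))\<^sup>2 + sqrt L * L * (tr_norm Z * l2_norm L (c_p Y))"
  proof -
    note r = h1_representative[OF L_pos H_memD(1)[OF Z]]
    have "\<bar>Re (l2_inner L (c_u Z) (mul_u e Z)) - ((- (1/2 + e) - 1/2) * (l2_norm L (c_u Z))\<^sup>2 + L / 2 * (cmod (pt_val L (c_u Z) L))\<^sup>2)\<bar>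
       \<le> sqrt L * L * (cmod (tr 0 Z) * l2_norm L (c_u Z))"
      unfolding mul_u_def c_derivs(1)
      by (rule Rellich_multiplier[OF L_pos r(1) h1_l2[OF H_memD(1)[OF Z]] r(2) _ mul_coefficient_bounds(1)])
        (use L_pos in \<open>auto intro!: continuous_intros\<close>)
    then have "Re (l2_inner L (c_u Z) (mul_u e Z)) \<le> - (1 + e) * (l2_norm L (c_u Z))\<^sup>2 + sqrt L * L * (cmod (tr 0 Z) * l2_norm L (c_u Z))"
      using H_memD(4)[OF Z] by (simp add: abs_le_iff algebra_simps)
    also have "sqrt L * L * (cmod (tr 0 Z) * l2_norm L (c_u Z)) \<le> sqrt L * L * (tr_norm Z * l2_norm L (c_u Z))"
      using t0 L_nonneg by (intro mult_left_mono mult_right_mono l2_norm_nonneg) auto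
    finally show ?thesis by (simp add: uZ)
  qed
  have 2: "Re (l2_inner L (c_p1 Y) (mul_u1 e Z)) \<le> - e * (l2_norm L (c_p1 Y))\<^sup>2 + L / 2 * (tr_norm Z)\<^sup>2 + sqrt L * 2 * (tr_norm Z * l2_norm L (c_p1 Y))"
  proof -
    note r = h1_representative[OF L_pos H_memD(2)[OF Z]]
    have trz: "pt_val L (c_u1 Z) L = tr 0 Z" by (simp add: tr_def c_u1_def)
    have "\<bar>Re (l2_inner L (c_u1 Z) (mul_u1 e Z)) - ((1/2 - e - 1/2) * (l2_norm L (c_u1 Z))\<^sup>2 + L / 2 * (cmod (pt_val L (c_u1 Z) L))\<^sup>2)\<bar>
       \<le> sqrt L * 2 * (cmod (tr 0 Z) * l2_norm L (c_u1 Z))"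
      unfolding mul_u1_def c_derivs(2) c_derivs(1)[symmetric]
      by (rule Rellich_multiplier[OF L_pos r(1) h1_l2[OF H_memD(2)[OF Z]] r(2) _ mul_coefficient_bounds(2)])
        (use L_pos in \<open>auto intro!: continuous_intros\<close>)
    then have "Re (l2_inner L (c_u1 Z) (mul_u1 e Z)) \<le> - e * (l2_norm L (c_u1 Z))\<^sup>2 + L / 2 * (cmod (tr 0 Z))\<^sup>2 + sqrt L * 2 * (cmod (tr 0 Z) * l2_norm L (c_u1 Z))"
      unfolding trz by (simp add: abs_le_iff algebra_simps)
    also have "sqrt L * 2 * (cmod (tr 0 Z) * l2_norm L (c_u1 Z)) \<le> sqrt L * 2 * (tr_norm Z * l2_norm L (c_u1 Z))"
      using t0 L_nonneg by (intro mult_left_mono mult_right_mono l2_norm_nonneg) auto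
    also have "L / 2 * (cmod (tr 0 Z))\<^sup>2 \<le> L / 2 * (tr_norm Z)\<^sup>2" using t0 L2 by (intro mult_left_mono power_mono) auto
    finally show ?thesis by (simp add: u1Z)
  qed
  have 3: "Re (l2_inner L (c_y j Y) (mul_v e j Z)) \<le> - e * (l2_norm L (c_y j Y))\<^sup>2 + L / 2 * (tr_norm Z)\<^sup>2" if j: "j \<in> stiff" for j
  proof -
    note r = h1_representative[OF L_pos H_memD(6)[OF Z j]]
    have trz: "pt_val L (c_v j Z) L = tr j Z" using j by (simp add: tr_def c_v_def)
    have "\<bar>Re (l2_inner L (c_v j Z) (mul_v e j Z)) - ((1/2 - e - 1/2) * (l2_norm L (c_v j Z))\<^sup>2 + L / 2 * (cmod (pt_val L (c_v j Z) L))\<^sup>2)\<bar>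
       \<le> sqrt L * 0 * (cmod 0 * l2_norm L (c_v j Z))"
      unfolding mul_v_def c_derivs(3)
      by (rule Rellich_multiplier[OF L_pos r(1) h1_l2[OF H_memD(6)[OF Z j]] r(2)]) auto
    then have "Re (l2_inner L (c_v j Z) (mul_v e j Z)) = - e * (l2_norm L (c_v j Z))\<^sup>2 + L / 2 * (cmod (tr j Z))\<^sup>2"
      unfolding trz by simp
    also have "L / 2 * (cmod (tr j Z))\<^sup>2 \<le> L / 2 * (tr_norm Z)\<^sup>2"
      using tr_le_tr_norm[of j Z] j L2 by (intro mult_left_mono power_mono) auto
    finally show ?thesis by (simp add: vZ[OF j])
  qed
  have "mul_form e Y Z \<le> (- (1 + e) * (l2_norm L (c_p Y))\<^sup>2 + sqrt L * L * (tr_norm Z * l2_norm L (c_p Y)))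
     + par_\<alpha> P * (- e * (l2_norm L (c_p1 Y))\<^sup>2 + L / 2 * (tr_norm Z)\<^sup>2 + sqrt L * 2 * (tr_norm Z * l2_norm L (c_p1 Y)))
     + (\<Sum>j\<in>stiff. (hO P j * pO P j) * (- e * (l2_norm L (c_y j Y))\<^sup>2 + L / 2 * (tr_norm Z)\<^sup>2))"
    unfolding mul_form_def
    by (intro add_mono sum_mono mult_left_mono 1 2 3 less_imp_le alpha_pos mult_pos_pos hO_pos pO_pos)
  also have "(\<Sum>j\<in>stiff. (hO P j * pO P j) * (- e * (l2_norm L (c_y j Y))\<^sup>2 + L / 2 * (tr_norm Z)\<^sup>2)) =
      - e * sliding Y + (\<Sum>j\<in>stiff. (hO P j * pO P j) * (L / 2)) * (tr_norm Z)\<^sup>2"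
    unfolding sum_distrib_left sum_distrib_right sum.distrib[symmetric] by (intro sum.cong) (auto simp: algebra_simps)
  finally show ?thesis by (simp add: algebra_simps)
qed

end

lemma Re_of_real_mult: "Re (complex_of_real r * z) = r * Re z"
  by simp

context rao_nakra_beam
begin

text \<open>
  Membership of \<open>Mu\<close> in the displacement space requires a third derivative of \<open>u\<close>, hence the
  regularity of the domain.
\<close>

lemma multiplier_bending:
  assumes Y: "Y \<in> spaceH P" and r2: "c_u2 Y \<in> h1 L"
  shows "mul_u e Y \<in> h1 L" "wderiv L (mul_u e Y) \<in> h1 L"
    "AE x in lebI L. wderiv L (mul_u e Y) x = mul_u1 e Y x" "AE x in lebI L. wderiv L (wderiv L (mul_u e Y)) x = mul_u2 e Y x"
    "pt_val L (mul_u e Y) 0 = 0" "pt_val L (mul_u e Y) L = 0" "pt_val L (wderiv L (mul_u e Y)) 0 = 0"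
    "pt_val L (wderiv L (mul_u e Y)) L = of_real (- (3/2 + e)) * tr 0 Y + of_real L * pt_val L (c_u2 Y) L"
    "mul_u1 e Y \<in> l2 L" "mul_u2 e Y \<in> l2 L"
proof -
  define t where "t = tr 0 Y"
  note h = H_memD[OF Y]
  have a: "ac L (pt_val L (c_u Y)) (c_u1 Y)" "AE x in lebI L. c_u Y x = pt_val L (c_u Y) x"
    using h1_representative[OF L_pos h(1)] by (simp_all add: c_derivs)
  have b: "ac L (pt_val L (c_u1 Y)) (c_u2 Y)" "AE x in lebI L. c_u1 Y x = pt_val L (c_u1 Y) x"
    using h1_representative[OF L_pos h(2)] by (simp_all add: c_derivs)
  have c: "ac L (pt_val L (c_u2 Y)) (wderiv L (c_u2 Y))" "AE x in lebI L. c_u2 Y x = pt_val L (c_u2 Y) x"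
    using h1_representative[OF L_pos r2] by simp_all
  have l: "c_u Y \<in> l2 L" "c_u1 Y \<in> l2 L" "c_u2 Y \<in> l2 L" "wderiv L (c_u2 Y) \<in> l2 L"
    by (intro linear_AE_l2[OF linear_AE_c_u Y] linear_AE_l2[OF linear_AE_c_u1 Y] linear_AE_l2[OF linear_AE_c_u2 Y] wderiv_l2[OF r2])+
  have cont: "continuous_on {0..L} (\<lambda>x. complex_of_real x)" "continuous_on {0..L} (\<lambda>x. complex_of_real (- (x\<^sup>2 / L)))"
     "continuous_on {0..L} (\<lambda>x. complex_of_real (- (2 * x / L)))"
    by (intro continuous_intros; use L_pos in auto)+
  have q: "ac L (\<lambda>x. of_real (- (x\<^sup>2 / L)) * t) (\<lambda>x. of_real (- (2 * x / L)) * t)" for t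
    using ac_poly[of L "[:0, 0, - t / of_real L:]"] L_pos
    by (simp add: pderiv_pCons power2_eq_square algebra_simps)
  have q': "ac L (\<lambda>x. of_real (- (2 * x / L)) * t) (\<lambda>x. of_real (- (2 / L)) * t)" for t
    using ac_poly[of L "[:0, - 2 * t / of_real L:]"] L_pos
    by (simp add: pderiv_pCons algebra_simps)
  define f where "f x = of_real (- (1/2 + e)) * pt_val L (c_u Y) x + of_real x * pt_val L (c_u1 Y) x + of_real (- (x\<^sup>2 / L)) * t" for x
  have f: "ac L f (\<lambda>x. of_real (- (1/2 + e)) * c_u1 Y x + (1 * pt_val L (c_u1 Y) x + of_real x * c_u2 Y x) + of_real (- (2 * x / L)) * t)"
    unfolding f_def by (intro ac_add ac_scale a ac_mult[OF ac_ident b(1) L_pos] q)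
  define f1 where "f1 x = of_real (1/2 - e) * pt_val L (c_u1 Y) x + of_real x * pt_val L (c_u2 Y) x + of_real (- (2 * x / L)) * t" for x
  have f1: "ac L f1 (\<lambda>x. of_real (1/2 - e) * c_u2 Y x + (1 * pt_val L (c_u2 Y) x + of_real x * wderiv L (c_u2 Y) x) + of_real (- (2 / L)) * t)"
    unfolding f1_def by (intro ac_add ac_scale b ac_mult[OF ac_ident c(1) L_pos] q')
  have m0l: "mul_u e Y \<in> l2 L" unfolding mul_u_def
    by (intro l2_add l2_scale l l2_continuous_mult[OF l2_const] l2_continuous_mult[OF l(2)] cont)
  show m1l: "mul_u1 e Y \<in> l2 L" unfolding mul_u1_def
    by (intro l2_add l2_scale l l2_continuous_mult[OF l2_const] l2_continuous_mult[OF l(3)] cont)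
  show m3l: "mul_u2 e Y \<in> l2 L" unfolding mul_u2_def
    by (intro l2_add l2_scale l l2_const l2_continuous_mult[OF l(4)] cont)
  have "AE x in lebI L. mul_u e Y x = f x" using a(2) b(2)
    by eventually_elim (simp add: mul_u_def f_def t_def)
  note r = h1I_representative[OF L_pos m0l f this]
  show "mul_u e Y \<in> h1 L" by (rule r)
  have d: "AE x in lebI L. wderiv L (mul_u e Y) x = f1 x" using r(2) b(2) c(2)
    by eventually_elim (simp add: f1_def algebra_simps)
  show "AE x in lebI L. wderiv L (mul_u e Y) x = mul_u1 e Y x" using r(2) b(2)
    by eventually_elim (simp add: mul_u1_def t_def algebra_simps)
  note r1 = h1I_representative[OF L_pos wderiv_l2[OF r(1)] f1 d]
  show "wderiv L (mul_u e Y) \<in> h1 L" by (rule r1)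
  show "AE x in lebI L. wderiv L (wderiv L (mul_u e Y)) x = mul_u2 e Y x" using r1(2) c(2)
    by eventually_elim (simp add: mul_u2_def t_def algebra_simps)
  have t: "t = pt_val L (c_u1 Y) L" by (simp add: t_def tr_def c_u1_def)
  show "pt_val L (mul_u e Y) 0 = 0" using r(3)[of 0] h(3) L_pos by (simp add: f_def)
  show "pt_val L (mul_u e Y) L = 0" using r(3)[of L] h(4) L_pos by (simp add: f_def t power2_eq_square)
  show "pt_val L (wderiv L (mul_u e Y)) 0 = 0" using r1(3)[of 0] h(5) L_pos by (simp add: f1_def)
  show "pt_val L (wderiv L (mul_u e Y)) L = of_real (- (3/2 + e)) * tr 0 Y + of_real L * pt_val L (c_u2 Y) L"
    using r1(3)[of L] L_pos by (simp add: f1_def t[symmetric]) (simp add: t_def algebra_simps)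
qed

lemma multiplier_longitudinal:
  assumes Y: "Y \<in> spaceH P" and j: "j \<in> stiff" and r1: "c_v1 j Y \<in> h1 L"
  shows "mul_v e j Y \<in> h1 L" "AE x in lebI L. wderiv L (mul_v e j Y) x = mul_v1 e j Y x" "pt_val L (mul_v e j Y) 0 = 0"
    "pt_val L (mul_v e j Y) L = of_real (1/2 - e) * tr j Y + of_real L * pt_val L (c_v1 j Y) L" "mul_v1 e j Y \<in> l2 L"
proof -
  note h = H_memD(6,7)[OF Y j]
  have a: "ac L (pt_val L (c_v j Y)) (c_v1 j Y)" "AE x in lebI L. c_v j Y x = pt_val L (c_v j Y) x"
    using h1_representative[OF L_pos h(1)] by (simp_all add: c_derivs)
  have b: "ac L (pt_val L (c_v1 j Y)) (wderiv L (c_v1 j Y))" "AE x in lebI L. c_v1 j Y x = pt_val L (c_v1 j Y) x"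
    using h1_representative[OF L_pos r1] by simp_all
  have l: "c_v j Y \<in> l2 L" "c_v1 j Y \<in> l2 L" "wderiv L (c_v1 j Y) \<in> l2 L"
    by (intro linear_AE_l2[OF linear_AE_c_v[OF j] Y] linear_AE_l2[OF linear_AE_c_v1[OF j] Y] wderiv_l2[OF r1])+
  have cont: "continuous_on {0..L} (\<lambda>x. complex_of_real x)" by (intro continuous_intros)
  define f where "f x = of_real (1/2 - e) * pt_val L (c_v j Y) x + of_real x * pt_val L (c_v1 j Y) x" for x
  have f: "ac L f (\<lambda>x. of_real (1/2 - e) * c_v1 j Y x + (1 * pt_val L (c_v1 j Y) x + of_real x * wderiv L (c_v1 j Y) x))"
    unfolding f_def by (intro ac_add ac_scale a ac_mult[OF ac_ident b(1) L_pos])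
  have m2l: "mul_v e j Y \<in> l2 L" unfolding mul_v_def
    by (intro l2_add l2_scale l l2_const l2_continuous_mult[OF l(2)] cont)
  show "mul_v1 e j Y \<in> l2 L" unfolding mul_v1_def
    by (intro l2_add l2_scale l l2_const l2_continuous_mult[OF l(3)] cont)
  have "AE x in lebI L. mul_v e j Y x = f x" using a(2) b(2)
    by eventually_elim (simp add: mul_v_def f_def)
  note r = h1I_representative[OF L_pos m2l f this]
  show "mul_v e j Y \<in> h1 L" by (rule r)
  show "AE x in lebI L. wderiv L (mul_v e j Y) x = mul_v1 e j Y x" using r(2) b(2)
    by eventually_elim (simp add: mul_v1_def algebra_simps)
  show "pt_val L (mul_v e j Y) 0 = 0" using r(3)[of 0] h(2) L_pos by (simp add: f_def)
  show "pt_val L (mul_v e j Y) L = of_real (1/2 - e) * tr j Y + of_real L * pt_val L (c_v1 j Y) L"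
    using r(3)[of L] L_pos j by (simp add: f_def tr_def c_v_def)
qed

text \<open>
  The coefficients fit: differentiating \<open>Mu = x u' - (1/2 + e) u - \<dots>\<close> raises the coefficient
  \<open>- (1/2 + e)\<close> by 1 to the coefficient \<open>1/2 - e\<close> in \<open>Mv\<^sub>j\<close>, so the two contributions to the shear
  combine to \<open>x \<phi>' + (1/2 - e) \<phi>\<close>.
\<close>

lemma phi_multiplier:
  assumes Y: "Y \<in> spaceH P" and r2: "c_u2 Y \<in> h1 L"
  obtains p p' where "ac L p p'" "AE x in lebI L. c_phi i Y x = p x"
    "AE x in lebI L. phi P (mul_u e Y, \<lambda>j. mul_v e j Y) i x =
      of_real (1/2 - e) * c_phi i Y x + of_real x * p' x + of_real (- (2 * x / L)) * (of_real (vecN P i) * tr 0 Y)"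
proof -
  define p where "p x = of_real (inverse (hE P i)) * (\<Sum>j\<in>stiff. of_real (matB i j) * pt_val L (c_v j Y) x) + of_real (vecN P i) * pt_val L (c_u1 Y) x" for x
  define p' where "p' x = of_real (inverse (hE P i)) * (\<Sum>j\<in>stiff. of_real (matB i j) * c_v1 j Y x) + of_real (vecN P i) * c_u2 Y x" for x
  note h = H_memD[OF Y]
  have av: "ac L (pt_val L (c_v j Y)) (c_v1 j Y)" "AE x in lebI L. c_v j Y x = pt_val L (c_v j Y) x" if "j \<in> stiff" for j
    using h1_representative[OF L_pos h(6)[OF that]] by (simp_all add: c_derivs)
  have b: "ac L (pt_val L (c_u1 Y)) (c_u2 Y)" "AE x in lebI L. c_u1 Y x = pt_val L (c_u1 Y) x"
    using h1_representative[OF L_pos h(2)] by (simp_all add: c_derivs)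
  have "ac L p p'" unfolding p_def p'_def by (intro ac_add ac_scale ac_sum av b)
  moreover have "AE x in lebI L. \<forall>j\<in>stiff. c_v j Y x = pt_val L (c_v j Y) x"
    using av(2) by (intro AE_finite_allI) auto
  then have "AE x in lebI L. c_phi i Y x = p x" using b(2)
  proof eventually_elim
    fix x assume 1: "\<forall>j\<in>stiff. c_v j Y x = pt_val L (c_v j Y) x" and 2: "c_u1 Y x = pt_val L (c_u1 Y) x"
    have "(\<Sum>j\<in>stiff. of_real (matB i j) * c_v j Y x) = (\<Sum>j\<in>stiff. of_real (matB i j) * pt_val L (c_v j Y) x)"
      using 1 by (intro sum.cong) auto
    then show "c_phi i Y x = p x" unfolding c_phi_eq p_def 2 by (simp only:)
  qed
  moreover have "AE x in lebI L. phi P (mul_u e Y, \<lambda>j. mul_v e j Y) i x =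
      of_real (1/2 - e) * c_phi i Y x + of_real x * p' x + of_real (- (2 * x / L)) * (of_real (vecN P i) * tr 0 Y)"
    using multiplier_bending(3)[OF Y r2, of e]
  proof eventually_elim
    fix x assume 1: "wderiv L (mul_u e Y) x = mul_u1 e Y x"
    have s: "(\<Sum>j\<in>stiff. of_real (matB i j) * mul_v e j Y x) = of_real (1/2 - e) * (\<Sum>j\<in>stiff. of_real (matB i j) * c_v j Y x)
       + of_real x * (\<Sum>j\<in>stiff. of_real (matB i j) * c_v1 j Y x)"
      unfolding sum_distrib_left sum.distrib[symmetric] by (intro sum.cong) (auto simp: mul_v_def algebra_simps)
    have "phi P (mul_u e Y, \<lambda>j. mul_v e j Y) i x = of_real (inverse (hE P i)) * (\<Sum>j\<in>stiff. of_real (matB i j) * mul_v e j Y x) + of_real (vecN P i) * mul_u1 e Y x"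
      using 1 by (simp only: phi.simps)
    also have "\<dots> = of_real (1/2 - e) * c_phi i Y x + of_real x * p' x + of_real (- (2 * x / L)) * (of_real (vecN P i) * tr 0 Y)"
      unfolding s mul_u1_def c_phi_eq p'_def by (simp only: distrib_left distrib_right mult_ac add_ac)
    finally show "phi P (mul_u e Y, \<lambda>j. mul_v e j Y) i x =
      of_real (1/2 - e) * c_phi i Y x + of_real x * p' x + of_real (- (2 * x / L)) * (of_real (vecN P i) * tr 0 Y)" .
  qed
  ultimately show ?thesis by (rule that)
qed

lemma multiplier_in_X:
  assumes Y: "Y \<in> spaceH P" and r2: "c_u2 Y \<in> h1 L" and r1: "\<And>j. j \<in> stiff \<Longrightarrow> c_v1 j Y \<in> h1 L"
  shows "(mul_u e Y, \<lambda>j. mul_v e j Y) \<in> spaceX P"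
  unfolding in_X_iff using multiplier_bending[OF Y r2] multiplier_longitudinal[OF Y _ r1] by blast

text \<open>
  After the second differentiation of \<open>Mu\<close> and the first one of \<open>Mv\<^sub>j\<close> the coefficient is
  \<open>3/2 - e\<close>, which leaves the factor \<open>1 - e\<close> for bending and stretching, but only \<open>- e\<close> for the
  shear. The end value \<open>|\<phi>(L)|\<^sup>2\<close> has a good sign and is dropped; those of \<open>u''\<close> and \<open>v\<^sub>j'\<close> are
  kept for the boundary form.
\<close>

lemma potential_part:
  assumes Y: "Y \<in> spaceH P" and r2: "c_u2 Y \<in> h1 L" and r1: "\<And>j. j \<in> stiff \<Longrightarrow> c_v1 j Y \<in> h1 L"
  shows "Re (a_form P (fst Y) (mul_u e Y, \<lambda>j. mul_v e j Y)) \<ge>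
     (1 - e) * (K * (l2_norm L (c_u2 Y))\<^sup>2 + stretching Y)
     - e * shearing Y
     + L / 2 * (K * (cmod (pt_val L (c_u2 Y) L))\<^sup>2 + (\<Sum>j\<in>stiff. (hO P j * EO P j) * (cmod (pt_val L (c_v1 j Y) L))\<^sup>2))
     - tr_norm Y * (K * (sqrt L * (2 / L) * l2_norm L (c_u2 Y)) + (\<Sum>i\<in>soft. (GE P i * hE P i) * (sqrt L * 2 * (\<bar>vecN P i\<bar> * l2_norm L (c_phi i Y)))))"
proof -
  let ?F = "(mul_u e Y, \<lambda>j. mul_v e j Y)"
  note mb = multiplier_bending[OF Y r2, of e]
  have t0: "cmod (tr 0 Y) \<le> tr_norm Y" by (rule tr_le_tr_norm) auto
  have FX: "?F \<in> spaceX P" by (rule multiplier_in_X[OF Y r2 r1])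
  have 1: "Re (l2_inner L (c_u2 Y) (wderiv L (wderiv L (mul_u e Y)))) \<ge> (1 - e) * (l2_norm L (c_u2 Y))\<^sup>2 + L / 2 * (cmod (pt_val L (c_u2 Y) L))\<^sup>2
      - tr_norm Y * (sqrt L * (2 / L) * l2_norm L (c_u2 Y))"
  proof -
    note r = h1_representative[OF L_pos r2]
    have "l2_inner L (c_u2 Y) (wderiv L (wderiv L (mul_u e Y))) = l2_inner L (c_u2 Y) (mul_u2 e Y)"
      by (rule l2_inner_cong_right[OF mb(4) h1_l2[OF r2] wderiv_l2[OF mb(2)] mb(10)])
    moreover have "\<bar>Re (l2_inner L (c_u2 Y) (mul_u2 e Y)) - ((3/2 - e - 1/2) * (l2_norm L (c_u2 Y))\<^sup>2 + L / 2 * (cmod (pt_val L (c_u2 Y) L))\<^sup>2)\<bar>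
        \<le> sqrt L * (2 / L) * (cmod (tr 0 Y) * l2_norm L (c_u2 Y))"
      unfolding mul_u2_def
      by (rule Rellich_multiplier[OF L_pos r(1) h1_l2[OF r2] r(2) _ mul_coefficient_bounds(3)]) (auto intro!: continuous_intros)
    moreover have "sqrt L * (2 / L) * (cmod (tr 0 Y) * l2_norm L (c_u2 Y)) \<le> sqrt L * (2 / L) * (tr_norm Y * l2_norm L (c_u2 Y))"
      using t0 L_nonneg by (intro mult_left_mono mult_right_mono l2_norm_nonneg) auto
    moreover have "sqrt L * (2 / L) * (tr_norm Y * l2_norm L (c_u2 Y)) = tr_norm Y * (sqrt L * (2 / L) * l2_norm L (c_u2 Y))" by (simp only: mult_ac)
    moreover have "3/2 - e - 1/2 = 1 - e" by simp
    ultimately show ?thesis unfolding abs_le_iff by (simp only:) linarith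
  qed
  have 2: "Re (l2_inner L (c_v1 j Y) (wderiv L (mul_v e j Y))) \<ge> (1 - e) * (l2_norm L (c_v1 j Y))\<^sup>2 + L / 2 * (cmod (pt_val L (c_v1 j Y) L))\<^sup>2"
    if j: "j \<in> stiff" for j
  proof -
    note ml = multiplier_longitudinal[OF Y j r1[OF j], of e]
    note r = h1_representative[OF L_pos r1[OF j]]
    have "l2_inner L (c_v1 j Y) (wderiv L (mul_v e j Y)) = l2_inner L (c_v1 j Y) (mul_v1 e j Y)"
      by (rule l2_inner_cong_right[OF ml(2) h1_l2[OF r1[OF j]] wderiv_l2[OF ml(1)] ml(5)])
    moreover have "\<bar>Re (l2_inner L (c_v1 j Y) (mul_v1 e j Y)) - ((3/2 - e - 1/2) * (l2_norm L (c_v1 j Y))\<^sup>2 + L / 2 * (cmod (pt_val L (c_v1 j Y) L))\<^sup>2)\<bar>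
        \<le> sqrt L * 0 * (cmod 0 * l2_norm L (c_v1 j Y))"
      unfolding mul_v1_def by (rule Rellich_multiplier[OF L_pos r(1) h1_l2[OF r1[OF j]] r(2)]) auto
    ultimately show ?thesis by simp
  qed
  have 3: "Re (l2_inner L (c_phi i Y) (phi P ?F i)) \<ge> - e * (l2_norm L (c_phi i Y))\<^sup>2 - tr_norm Y * (sqrt L * 2 * (\<bar>vecN P i\<bar> * l2_norm L (c_phi i Y)))" for i
  proof -
    obtain p p' where p: "ac L p p'" "AE x in lebI L. c_phi i Y x = p x"
      "AE x in lebI L. phi P ?F i x = of_real (1/2 - e) * c_phi i Y x + of_real x * p' x + of_real (- (2 * x / L)) * (of_real (vecN P i) * tr 0 Y)"
      by (rule phi_multiplier[OF Y r2])
    have pl: "c_phi i Y \<in> l2 L" by (rule linear_AE_l2[OF linear_AE_c_phi Y])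
    have Fl: "phi P ?F i \<in> l2 L"
    proof -
      have "(?F, snd Y) \<in> spaceH P" using FX Y by (cases Y) (simp add: in_H_iff)
      from linear_AE_l2[OF linear_AE_c_phi this, of i] show ?thesis by (simp only: c_phi_def fst_conv)
    qed
    have ml: "(\<lambda>x. of_real (1/2 - e) * c_phi i Y x + of_real x * p' x + of_real (- (2 * x / L)) * (of_real (vecN P i) * tr 0 Y)) \<in> l2 L"
      by (intro l2_add l2_scale pl l2_continuous_mult[OF l2_const] l2_continuous_mult[OF ac_deriv_l2[OF p(1)]] continuous_intros) (use L_pos in auto)
    note cong = l2_inner_cong_right[OF p(3) pl Fl ml]
    have "\<bar>Re (l2_inner L (c_phi i Y) (phi P ?F i)) - ((1/2 - e - 1/2) * (l2_norm L (c_phi i Y))\<^sup>2 + L / 2 * (cmod (p L))\<^sup>2)\<bar>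
        \<le> sqrt L * 2 * (cmod (of_real (vecN P i) * tr 0 Y) * l2_norm L (c_phi i Y))"
      unfolding cong by (rule Rellich_multiplier[OF L_pos p(1) pl p(2) _ mul_coefficient_bounds(2)]) (use L_pos in \<open>auto intro!: continuous_intros\<close>)
    moreover have "sqrt L * 2 * (cmod (of_real (vecN P i) * tr 0 Y) * l2_norm L (c_phi i Y)) \<le> sqrt L * 2 * ((\<bar>vecN P i\<bar> * tr_norm Y) * l2_norm L (c_phi i Y))"
      using t0 L_nonneg unfolding norm_mult norm_of_real by (intro mult_left_mono mult_right_mono l2_norm_nonneg) auto
    moreover have "sqrt L * 2 * ((\<bar>vecN P i\<bar> * tr_norm Y) * l2_norm L (c_phi i Y)) = tr_norm Y * (sqrt L * 2 * (\<bar>vecN P i\<bar> * l2_norm L (c_phi i Y)))" by (simp only: mult_ac)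
    moreover have "1/2 - e - 1/2 = - e" by simp
    moreover have "0 \<le> L / 2 * (cmod (p L))\<^sup>2" using L_nonneg by simp
    ultimately show ?thesis unfolding abs_le_iff by (simp only:) linarith
  qed
  obtain u v p y where Ye: "Y = ((u, v), (p, y))" by (metis prod.exhaust)
  have "Re (a_form P (fst Y) ?F) = K * Re (l2_inner L (c_u2 Y) (wderiv L (wderiv L (mul_u e Y))))
     + (\<Sum>j\<in>stiff. (hO P j * EO P j) * Re (l2_inner L (c_v1 j Y) (wderiv L (mul_v e j Y))))
     + (\<Sum>i\<in>soft. (GE P i * hE P i) * Re (l2_inner L (c_phi i Y) (phi P ?F i)))"
  proof -
    have "a_form P (fst Y) ?F = of_real K * l2_inner L (c_u2 Y) (wderiv L (wderiv L (mul_u e Y)))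
     + (\<Sum>j\<in>stiff. of_real (hO P j * EO P j) * l2_inner L (c_v1 j Y) (wderiv L (mul_v e j Y)))
     + (\<Sum>i\<in>soft. of_real (GE P i * hE P i) * l2_inner L (c_phi i Y) (phi P ?F i))"
      unfolding Ye by (simp only: fst_conv a_form.simps c_defs snd_conv)
    then show ?thesis by (simp only: plus_complex.simps Re_sum Re_of_real_mult)
  qed
  also have "\<dots> \<ge> K * ((1 - e) * (l2_norm L (c_u2 Y))\<^sup>2 + L / 2 * (cmod (pt_val L (c_u2 Y) L))\<^sup>2 - tr_norm Y * (sqrt L * (2 / L) * l2_norm L (c_u2 Y)))
     + (\<Sum>j\<in>stiff. (hO P j * EO P j) * ((1 - e) * (l2_norm L (c_v1 j Y))\<^sup>2 + L / 2 * (cmod (pt_val L (c_v1 j Y) L))\<^sup>2))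
     + (\<Sum>i\<in>soft. (GE P i * hE P i) * (- e * (l2_norm L (c_phi i Y))\<^sup>2 - tr_norm Y * (sqrt L * 2 * (\<bar>vecN P i\<bar> * l2_norm L (c_phi i Y)))))"
    by (intro add_mono sum_mono mult_left_mono 1 2 3 less_imp_le K_pos mult_pos_pos hO_pos EO_pos GE_pos hE_pos)
  also have "(\<Sum>j\<in>stiff. (hO P j * EO P j) * ((1 - e) * (l2_norm L (c_v1 j Y))\<^sup>2 + L / 2 * (cmod (pt_val L (c_v1 j Y) L))\<^sup>2)) =
     (1 - e) * stretching Y + L / 2 * (\<Sum>j\<in>stiff. (hO P j * EO P j) * (cmod (pt_val L (c_v1 j Y) L))\<^sup>2)"
    unfolding sum_distrib_left sum.distrib[symmetric] by (intro sum.cong) (auto simp: algebra_simps)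
  also have "(\<Sum>i\<in>soft. (GE P i * hE P i) * (- e * (l2_norm L (c_phi i Y))\<^sup>2 - tr_norm Y * (sqrt L * 2 * (\<bar>vecN P i\<bar> * l2_norm L (c_phi i Y))))) =
     - e * shearing Y - tr_norm Y * (\<Sum>i\<in>soft. (GE P i * hE P i) * (sqrt L * 2 * (\<bar>vecN P i\<bar> * l2_norm L (c_phi i Y))))"
    unfolding sum_distrib_left sum_subtractf[symmetric] by (intro sum.cong) (auto simp: algebra_simps)
  finally show ?thesis by (simp add: algebra_simps)
qed

lemma boundary_part:
  assumes Y: "Y \<in> spaceH P" and r2: "c_u2 Y \<in> h1 L" and r1: "\<And>j. j \<in> stiff \<Longrightarrow> c_v1 j Y \<in> h1 L"
  shows "Re (bdry_form P (fst Z) (mul_u e Y, \<lambda>j. mul_v e j Y)) \<le>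
      L / 2 * (K * (cmod (pt_val L (c_u2 Y) L))\<^sup>2 + (\<Sum>j\<in>stiff. (hO P j * EO P j) * (cmod (pt_val L (c_v1 j Y) L))\<^sup>2))
      + (K * (L / 2 * (par_\<gamma> P 0)\<^sup>2) + (\<Sum>j\<in>stiff. (hO P j * EO P j) * (L / 2 * (gO P j)\<^sup>2))) * (tr_norm Z)\<^sup>2
      + (K * (par_\<gamma> P 0 * \<bar>- (3/2 + e)\<bar>) + (\<Sum>j\<in>stiff. (hO P j * EO P j) * (gO P j * \<bar>1/2 - e\<bar>))) * (tr_norm Z * tr_norm Y)"
proof -
  let ?F = "(mul_u e Y, \<lambda>j. mul_v e j Y)"
  have step: "Re (- of_real g * tr k Z * cnj (of_real c * tr k Y + of_real L * s)) \<le> L / 2 * (cmod s)\<^sup>2 + L / 2 * g\<^sup>2 * (tr_norm Z)\<^sup>2 + g * \<bar>c\<bar> * (tr_norm Z * tr_norm Y)"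
    if g: "g \<ge> 0" and k: "k \<in> dampers" for g c s k
  proof -
    have "Re (- of_real g * tr k Z * cnj (of_real c * tr k Y + of_real L * s)) \<le> L / 2 * (cmod s)\<^sup>2 + L / 2 * g\<^sup>2 * (cmod (tr k Z))\<^sup>2 + g * \<bar>c\<bar> * (cmod (tr k Z) * cmod (tr k Y))"
      by (rule Re_boundary_product_le[OF g L_nonneg])
    also have "\<dots> \<le> L / 2 * (cmod s)\<^sup>2 + L / 2 * g\<^sup>2 * (tr_norm Z)\<^sup>2 + g * \<bar>c\<bar> * (tr_norm Z * tr_norm Y)"
      using g L_nonneg tr_le_tr_norm[OF k, of Z] tr_le_tr_norm[OF k, of Y] tr_norm_nonneg[of Z]
      by (intro add_mono mult_left_mono power_mono mult_mono) auto
    finally show ?thesis .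
  qed
  obtain p y w z where Z: "Z = ((p, y), (w, z))" by (metis prod.exhaust)
  have "bdry_form P (fst Z) ?F = of_real K * (- of_real (par_\<gamma> P 0) * tr 0 Z * cnj (of_real (- (3/2 + e)) * tr 0 Y + of_real L * pt_val L (c_u2 Y) L))
    + (\<Sum>j\<in>stiff. of_real (hO P j * EO P j) * (- of_real (gO P j) * tr j Z * cnj (of_real (1/2 - e) * tr j Y + of_real L * pt_val L (c_v1 j Y) L)))"
  proof -
    have "(\<Sum>j\<in>stiff. of_real (hO P j * EO P j) * (- of_real (gO P j) * tr j Z * cnj (of_real (1/2 - e) * tr j Y + of_real L * pt_val L (c_v1 j Y) L)))
       = (\<Sum>j\<in>stiff. - (of_real (hO P j * EO P j * gO P j) * pt_val L (y j) L * cnj (pt_val L (mul_v e j Y) L)))"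
    proof (rule sum.cong)
      fix j assume j: "j \<in> stiff"
      then have "j \<noteq> 0" by auto
      then have "tr j Z = pt_val L (y j) L" by (simp add: tr_def Z)
      then show "of_real (hO P j * EO P j) * (- of_real (gO P j) * tr j Z * cnj (of_real (1/2 - e) * tr j Y + of_real L * pt_val L (c_v1 j Y) L))
        = - (of_real (hO P j * EO P j * gO P j) * pt_val L (y j) L * cnj (pt_val L (mul_v e j Y) L))"
        unfolding multiplier_longitudinal(4)[OF Y j r1[OF j]] by simp
    qed simp
    moreover have "tr 0 Z = pt_val L (wderiv L p) L" by (simp add: tr_def Z)
    ultimately show ?thesis unfolding multiplier_bending(8)[OF Y r2, of e, symmetric]
      unfolding Z fst_conv bdry_form.simps sum_negf by simp
  qed
  then have "Re (bdry_form P (fst Z) ?F) = K * Re (- of_real (par_\<gamma> P 0) * tr 0 Z * cnj (of_real (- (3/2 + e)) * tr 0 Y + of_real L * pt_val L (c_u2 Y) L))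
    + (\<Sum>j\<in>stiff. (hO P j * EO P j) * Re (- of_real (gO P j) * tr j Z * cnj (of_real (1/2 - e) * tr j Y + of_real L * pt_val L (c_v1 j Y) L)))"
    by (simp only: plus_complex.simps Re_sum Re_of_real_mult)
  also have "\<dots> \<le> K * (L / 2 * (cmod (pt_val L (c_u2 Y) L))\<^sup>2 + L / 2 * (par_\<gamma> P 0)\<^sup>2 * (tr_norm Z)\<^sup>2 + par_\<gamma> P 0 * \<bar>- (3/2 + e)\<bar> * (tr_norm Z * tr_norm Y))
    + (\<Sum>j\<in>stiff. (hO P j * EO P j) * (L / 2 * (cmod (pt_val L (c_v1 j Y) L))\<^sup>2 + L / 2 * (gO P j)\<^sup>2 * (tr_norm Z)\<^sup>2 + gO P j * \<bar>1/2 - e\<bar> * (tr_norm Z * tr_norm Y)))"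
    by (intro add_mono sum_mono mult_left_mono step less_imp_le K_pos mult_pos_pos hO_pos EO_pos gamma_pos gO_pos) auto
  also have "(\<Sum>j\<in>stiff. (hO P j * EO P j) * (L / 2 * (cmod (pt_val L (c_v1 j Y) L))\<^sup>2 + L / 2 * (gO P j)\<^sup>2 * (tr_norm Z)\<^sup>2 + gO P j * \<bar>1/2 - e\<bar> * (tr_norm Z * tr_norm Y)))
    = L / 2 * (\<Sum>j\<in>stiff. (hO P j * EO P j) * (cmod (pt_val L (c_v1 j Y) L))\<^sup>2) + (\<Sum>j\<in>stiff. (hO P j * EO P j) * (L / 2 * (gO P j)\<^sup>2)) * (tr_norm Z)\<^sup>2
      + (\<Sum>j\<in>stiff. (hO P j * EO P j) * (gO P j * \<bar>1/2 - e\<bar>)) * (tr_norm Z * tr_norm Y)"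
    unfolding sum_distrib_left sum_distrib_right sum.distrib[symmetric] by (intro sum.cong) (auto simp: algebra_simps)
  finally show ?thesis by (simp add: algebra_simps)
qed

end

section \<open>The Lyapunov form\<close>

lemma weighted_sum_le:
  fixes a s p r q e :: real
  assumes "2 * e * s \<le> (1 - 2 * e) * a" "0 \<le> p"
  shows "- (1 - e) * a + e * s - (1 + e) * p - e * r - e * q \<le> - e * (a + s + (p + r + q))"
  using assms by (simp add: algebra_simps)

context rao_nakra_beam
begin

text \<open>
  Pairing with a state without displacement or without velocity isolates one of the two energy
  forms.
\<close>

lemma ip_velocity_part:
  assumes "U \<in> spaceX P" "V \<in> spaceY P" "W \<in> spaceY P"
  shows "ip (U, V) (0, W) = Re (c_form P V W)"
proof -
  obtain u v where U: "U = (u, v)" by (metis prod.exhaust)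
  have z: "(0::disp) = ((\<lambda>x. 0), (\<lambda>k x. 0))" by (simp add: zero_prod_def zero_fun_def)
  have S: "(U, V) \<in> spaceH P" using assms by (simp add: in_H_iff)
  have "(0, W) \<in> spaceH P" using X_zero assms by (simp add: in_H_iff)
  then have pz: "phi P 0 i \<in> l2 L" for i using linear_AE_l2[OF linear_AE_c_phi, of "(0, W)" i] by (simp add: c_phi_def)
  have "l2_inner L (phi P (u, v) i) (phi P 0 i) = 0" for i
  proof -
    have "AE x in lebI L. phi P 0 i x = 0" using wderiv_zero(2) by eventually_elim (simp add: z)
    then show ?thesis using l2_inner_zero[OF _ _ pz] linear_AE_l2[OF linear_AE_c_phi S, of i] by (simp add: c_phi_def U del: phi.simps)
  qed
  then have "(\<Sum>i\<in>soft. of_real (GE P i * hE P i) * l2_inner L (phi P (u, v) i) (phi P 0 i)) = 0" by simp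
  moreover have "(\<Sum>j\<in>stiff. of_real (hO P j * EO P j) * l2_inner L (wderiv L (v j)) (wderiv L (\<lambda>x. 0))) = 0"
  proof (rule sum.neutral, rule ballI)
    fix j assume j: "j \<in> stiff"
    have "wderiv L (v j) \<in> l2 L" using linear_AE_l2[OF linear_AE_c_v1[OF j] S] by (simp add: c_v1_def U)
    then show "of_real (hO P j * EO P j) * l2_inner L (wderiv L (v j)) (wderiv L (\<lambda>x. 0)) = 0" by (simp add: l2_inner_wderiv_zero)
  qed
  moreover have "l2_inner L (wderiv L (wderiv L u)) (wderiv L (wderiv L (\<lambda>x. 0))) = 0"
    using linear_AE_l2[OF linear_AE_c_u2 S] by (simp add: c_u2_def U l2_inner_wderiv_zero)
  ultimately have "a_form P U 0 = 0" unfolding U z a_form.simps by (simp only: mult_zero_right add_0)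
  then show ?thesis by (simp add: ip_def)
qed

lemma ip_displacement_part:
  assumes "U \<in> spaceX P" "Q \<in> spaceH P"
  shows "ip (U, 0) Q = Re (a_form P U (fst Q))"
proof -
  obtain Q1 f ff where Q: "Q = (Q1, (f, ff))" by (metis prod.exhaust)
  have z: "(0::disp) = ((\<lambda>x. 0), (\<lambda>k x. 0))" by (simp add: zero_prod_def zero_fun_def)
  have "wderiv L f \<in> l2 L" using linear_AE_l2[OF linear_AE_c_p1 assms(2)] by (simp add: c_p1_def Q)
  then have "c_form P 0 (f, ff) = 0" unfolding z by (simp add: l2_inner_wderiv_zero)
  then show ?thesis by (simp add: ip_def Q)
qed

lemma tr_bounded: obtains C where "C \<ge> 0" "\<And>k Y. k \<in> dampers \<Longrightarrow> Y \<in> spaceH P \<Longrightarrow> cmod (tr k Y) \<le> C * H_norm P Y"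
  using H_norm_controls tr_le_tr_norm by (metis order_trans)

lemma trace_representer:
  assumes k: "k \<in> dampers"
  shows "\<exists>G\<in>spaceH P. \<forall>Y\<in>spaceH P. ip Y G = Re (c * tr k Y)"
proof -
  obtain C where C: "C \<ge> 0" "\<And>k Y. k \<in> dampers \<Longrightarrow> Y \<in> spaceH P \<Longrightarrow> cmod (tr k Y) \<le> C * H_norm P Y"
    using tr_bounded by blast
  have b: "\<bar>Re (c * tr k Y)\<bar> \<le> (cmod c * C) * H.nrm Y" if Y: "Y \<in> spaceH P" for Y
  proof -
    have "\<bar>Re (c * tr k Y)\<bar> \<le> cmod c * cmod (tr k Y)" using abs_Re_le_cmod[of "c * tr k Y"] by (simp only: norm_mult)
    also have "\<dots> \<le> cmod c * (C * H_norm P Y)" by (intro mult_left_mono C k Y) simp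
    finally show ?thesis by (simp only: H_nrm mult.assoc)
  qed
  have add: "Re (c * tr k (x + y)) = Re (c * tr k x) + Re (c * tr k y)" if "x \<in> spaceH P" "y \<in> spaceH P" for x y
    unfolding tr_plus[OF that k] by (simp only: distrib_left plus_complex.simps)
  have hom: "Re (c * tr k (state_scale (complex_of_real r) x)) = r * Re (c * tr k x)" if "x \<in> spaceH P" for x r
    unfolding tr_scale[OF that k] mult.left_commute[of c "complex_of_real r"] by (rule Re_of_real_mult)
  show ?thesis using H.riesz[of "\<lambda>Y. Re (c * tr k Y)", OF add hom b] by metis
qed

lemma boundary_form_bounded:
  obtains C where "C \<ge> 0" "\<And>Z :: state. \<bar>Re (bdry_form P (fst Z) F)\<bar> \<le> C * tr_norm Z"
proof -
  obtain f ff where F: "F = (f, ff)" by (metis prod.exhaust)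
  define C where "C = \<bar>K * par_\<gamma> P 0\<bar> * cmod (pt_val L (wderiv L f) L) + (\<Sum>j\<in>stiff. \<bar>hO P j * EO P j * gO P j\<bar> * cmod (pt_val L (ff j) L))"
  show ?thesis
  proof (rule that[of C])
    show "C \<ge> 0" unfolding C_def by (intro add_nonneg_nonneg sum_nonneg mult_nonneg_nonneg) auto
    fix Z :: state
    obtain p y w z where Z: "Z = ((p, y), (w, z))" by (metis prod.exhaust)
    have t0: "cmod (pt_val L (wderiv L p) L) \<le> tr_norm Z" using tr_le_tr_norm[of 0 Z] by (simp add: tr_def Z)
    have tj: "cmod (pt_val L (y j) L) \<le> tr_norm Z" if "j \<in> stiff" for j using tr_le_tr_norm[of j Z] that by (simp add: tr_def Z)
    have "\<bar>Re (bdry_form P (fst Z) F)\<bar> \<le> cmod (bdry_form P (fst Z) F)" by (rule abs_Re_le_cmod)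
    also have "\<dots> \<le> cmod (- of_real (K * par_\<gamma> P 0) * pt_val L (wderiv L p) L * cnj (pt_val L (wderiv L f) L))
        + cmod (\<Sum>j\<in>stiff. of_real (hO P j * EO P j * gO P j) * pt_val L (y j) L * cnj (pt_val L (ff j) L))"
      unfolding Z F fst_conv bdry_form.simps by (rule norm_triangle_ineq4)
    also have "\<dots> \<le> \<bar>K * par_\<gamma> P 0\<bar> * tr_norm Z * cmod (pt_val L (wderiv L f) L) + (\<Sum>j\<in>stiff. \<bar>hO P j * EO P j * gO P j\<bar> * tr_norm Z * cmod (pt_val L (ff j) L))"
      by (intro add_mono order_trans[OF norm_sum] sum_mono; unfold norm_mult norm_minus_cancel norm_of_real complex_mod_cnj)
        (intro mult_right_mono mult_left_mono t0 tj; simp)+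
    also have "\<dots> = C * tr_norm Z" unfolding C_def distrib_right sum_distrib_right by (simp only: mult_ac)
    finally show "\<bar>Re (bdry_form P (fst Z) F)\<bar> \<le> C * tr_norm Z" .
  qed
qed

lemma dom_A_variational:
  assumes Y: "Y \<in> dom_A P"
  shows "Y \<in> spaceH P" "op_A P Y \<in> spaceH P" "fst (op_A P Y) = snd Y" "snd Y \<in> spaceX P"
    "F \<in> spaceX P \<Longrightarrow> c_form P (snd (op_A P Y)) F + a_form P (fst Y) F = bdry_form P (snd Y) F"
proof -
  obtain u v p y where Ye: "Y = ((u, v), (p, y))" by (metis prod.exhaust)
  show "Y \<in> spaceH P" "op_A P Y \<in> spaceH P" "fst (op_A P Y) = snd Y" "snd Y \<in> spaceX P"
    "F \<in> spaceX P \<Longrightarrow> c_form P (snd (op_A P Y)) F + a_form P (fst Y) F = bdry_form P (snd Y) F"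
    using dom_A_components[OF Y[unfolded Ye]] unfolding Ye by (metis op_A.simps fst_conv snd_conv)+
qed

lemma dissipation:
  assumes Y: "Y \<in> dom_A P"
  shows "ip (op_A P Y) Y = - (K * par_\<gamma> P 0 * (cmod (tr 0 (op_A P Y)))\<^sup>2
      + (\<Sum>j\<in>stiff. (hO P j * EO P j * gO P j) * (cmod (tr j (op_A P Y)))\<^sup>2))"
proof -
  note d = dom_A_variational[OF Y]
  obtain U p y where Ye: "Y = (U, (p, y))" by (metis prod.exhaust)
  have UX: "U \<in> spaceX P" "(p, y) \<in> spaceX P" using d(1,4) by (auto simp: Ye in_H_iff)
  obtain W where AY: "op_A P Y = ((p, y), W)" using d(3) by (cases "op_A P Y") (auto simp: Ye)
  have z: "((p, y), 0) \<in> spaceH P" "(U, 0) \<in> spaceH P" using UX X_zero X_subset_Y by (auto simp: in_H_iff)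
  have sym: "Re (a_form P (p, y) U) = Re (a_form P U (p, y))"
    using ip_commute[OF z] ip_displacement_part[OF UX(2) z(2)] ip_displacement_part[OF UX(1) z(1)] by simp
  have "ip (op_A P Y) Y = Re (a_form P (p, y) U) + Re (c_form P W (p, y))"
    unfolding AY unfolding Ye ip_def H_inner.simps by (rule plus_complex.simps)
  also have "\<dots> = Re (c_form P W (p, y) + a_form P U (p, y))" unfolding sym by simp
  also have "\<dots> = Re (bdry_form P (p, y) (p, y))" using d(5)[OF UX(2)] AY Ye by simp
  also have "\<dots> = - (K * par_\<gamma> P 0 * (cmod (pt_val L (wderiv L p) L))\<^sup>2
      + (\<Sum>j\<in>stiff. (hO P j * EO P j * gO P j) * (cmod (pt_val L (y j) L))\<^sup>2))"
  proof -
    have c: "Re (of_real r * s * cnj s) = r * (cmod s)\<^sup>2" for r s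
      unfolding mult.assoc Re_of_real_mult complex_norm_square[symmetric] by simp
    have "bdry_form P (p, y) (p, y) = - (of_real (K * par_\<gamma> P 0) * pt_val L (wderiv L p) L * cnj (pt_val L (wderiv L p) L)
        + (\<Sum>j\<in>stiff. of_real (hO P j * EO P j * gO P j) * pt_val L (y j) L * cnj (pt_val L (y j) L)))"
      unfolding bdry_form.simps by simp
    then show ?thesis by (simp only: uminus_complex.simps plus_complex.simps Re_sum c)
  qed
  also have "(\<Sum>j\<in>stiff. (hO P j * EO P j * gO P j) * (cmod (pt_val L (y j) L))\<^sup>2) = (\<Sum>j\<in>stiff. (hO P j * EO P j * gO P j) * (cmod (tr j (op_A P Y)))\<^sup>2)"
    by (intro sum.cong) (auto simp: AY tr_def)
  also have "pt_val L (wderiv L p) L = tr 0 (op_A P Y)" by (simp add: AY tr_def)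
  finally show ?thesis .
qed

lemma dissipation_controls_traces:
  obtains C where "C \<ge> 0" "\<And>Y. Y \<in> dom_A P \<Longrightarrow> (tr_norm (op_A P Y))\<^sup>2 \<le> - C * ip (op_A P Y) Y"
proof -
  define c where "c k = (if k = 0 then K * par_\<gamma> P 0 else hO P k * EO P k * gO P k)" for k
  have c: "c k > 0" if "k \<in> dampers" for k
  proof (cases "k = 0")
    case True then show ?thesis using K_pos gamma_pos by (simp add: c_def)
  next
    case False
    then have "k \<in> stiff" using that by auto
    then show ?thesis using False by (simp add: c_def hO_pos EO_pos gO_pos del: atLeastAtMost_iff)
  qed
  define C where "C = (\<Sum>k\<in>dampers. 1 / c k)"
  have C: "1 / c k \<le> C" if "k \<in> dampers" for k
    unfolding C_def by (rule member_le_sum) (use that c in \<open>auto intro: less_imp_le\<close>)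
  have C0: "C \<ge> 0" using C[of 0] c[of 0] by (smt (verit) atLeastAtMost_iff zero_le divide_pos_pos)
  show ?thesis
  proof (rule that[OF C0])
    fix Y assume Y: "Y \<in> dom_A P"
    let ?t = "\<lambda>k. (cmod (tr k (op_A P Y)))\<^sup>2"
    have split: "dampers = insert 0 stiff" by auto
    have "(\<Sum>k\<in>dampers. c k * ?t k) = c 0 * ?t 0 + (\<Sum>k\<in>stiff. c k * ?t k)"
      unfolding split by (rule sum.insert) auto
    also have "(\<Sum>k\<in>stiff. c k * ?t k) = (\<Sum>j\<in>stiff. (hO P j * EO P j * gO P j) * ?t j)"
      by (intro sum.cong) (auto simp: c_def)
    finally have s: "(\<Sum>k\<in>dampers. c k * ?t k) = - ip (op_A P Y) Y"
      unfolding dissipation[OF Y] by (simp add: c_def)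
    have "(tr_norm (op_A P Y))\<^sup>2 \<le> (\<Sum>k\<in>dampers. C * (c k * ?t k))"
      unfolding tr_norm_sq
    proof (rule sum_mono)
      fix k assume k: "k \<in> dampers"
      have "1 \<le> C * c k" using C[OF k] c[OF k] by (simp add: divide_le_eq)
      then have "1 * ?t k \<le> (C * c k) * ?t k" by (intro mult_right_mono) auto
      then show "?t k \<le> C * (c k * ?t k)" by (simp add: mult.assoc)
    qed
    also have "\<dots> = - C * ip (op_A P Y) Y" unfolding sum_distrib_left[symmetric] s by simp
    finally show "(tr_norm (op_A P Y))\<^sup>2 \<le> - C * ip (op_A P Y) Y" .
  qed
qed

text \<open>
  Let \<open>G\<^sub>k\<close> represent the functional \<open>tr k\<close>, and let \<open>F\<^sub>k\<close> be its displacement: the static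
  response to a load at the end. For \<open>Y = (U, V)\<close> in the domain the variational identity gives
  \<open>\<langle>\<A>Y, (0, F\<^sub>k)\<rangle> = - a(U; F\<^sub>k)\<close> plus damped terms, and \<open>a(U; F\<^sub>k)\<close> is the end value \<open>tr k Y\<close>. So
  the form \<open>\<langle>Y, (0, F\<^sub>k)\<rangle> \<langle>Z, G\<^sub>k\<rangle>\<close> has derivative \<open>- |tr k Y|\<^sup>2\<close> up to terms that contain a
  damped end velocity. Real and imaginary parts of the end values are treated as separate
  functionals.
\<close>

lemma trace_form:
  obtains b C where "H.bounded_form b" "C \<ge> 0"
    "\<And>Y. Y \<in> dom_A P \<Longrightarrow> b (op_A P Y) Y + b Y (op_A P Y) \<le> - (tr_norm Y)\<^sup>2 + C * (tr_norm (op_A P Y) * H_norm P Y)"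
proof -
  \<comment> \<open>\<open>Re (1 * z)\<close> and \<open>Re (\<i> * z)\<close> are the real and minus the imaginary part of \<open>z\<close>\<close>
  define I where "I = dampers \<times> {1, \<i>}"
  have fin: "finite I" by (simp add: I_def)
  have "\<forall>q\<in>I. \<exists>G. G \<in> spaceH P \<and> (\<forall>Y\<in>spaceH P. ip Y G = Re (snd q * tr (fst q) Y))"
  proof
    fix q assume "q \<in> I"
    then have "fst q \<in> dampers" unfolding I_def by (simp add: mem_Times_iff del: atLeastAtMost_iff)
    then show "\<exists>G. G \<in> spaceH P \<and> (\<forall>Y\<in>spaceH P. ip Y G = Re (snd q * tr (fst q) Y))"
      using trace_representer[of "fst q" "snd q"] by blast
  qed
  from bchoice[OF this] obtain G where G: "\<And>q. q \<in> I \<Longrightarrow> G q \<in> spaceH P"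
    "\<And>q Y. q \<in> I \<Longrightarrow> Y \<in> spaceH P \<Longrightarrow> ip Y (G q) = Re (snd q * tr (fst q) Y)" by blast
  have GX: "fst (G q) \<in> spaceX P" if "q \<in> I" for q using G(1)[OF that] by (cases "G q") (auto simp: in_H_iff)
  \<comment> \<open>the static displacement, used as a velocity\<close>
  define E where "E q = (0 :: disp, fst (G q))" for q
  have E: "E q \<in> spaceH P" if "q \<in> I" for q using GX[OF that] X_zero X_subset_Y by (auto simp: E_def in_H_iff)
  define b where "b Y Z = (\<Sum>q\<in>I. ip Y (E q) * ip Z (G q))" for Y Z
  have bb: "H.bounded_form b" unfolding b_def[abs_def]
    by (intro H.bounded_form_sum H.bounded_form_rank_one E G)
  obtain C0 where C0: "C0 \<ge> 0" "\<And>Y. Y \<in> spaceH P \<Longrightarrow> tr_norm Y \<le> C0 * H_norm P Y" using H_norm_controls by metis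
  have "\<forall>q\<in>I. \<exists>C. C \<ge> 0 \<and> (\<forall>Z. \<bar>Re (bdry_form P (fst Z) (fst (G q)))\<bar> \<le> C * tr_norm Z)"
    using boundary_form_bounded by metis
  from bchoice[OF this] obtain B where B: "\<And>q. q \<in> I \<Longrightarrow> B q \<ge> 0"
    "\<And>q Z. q \<in> I \<Longrightarrow> \<bar>Re (bdry_form P (fst Z) (fst (G q)))\<bar> \<le> B q * tr_norm Z" by blast
  define C where "C = (\<Sum>q\<in>I. B q * C0 + H_norm P (E q))"
  have C: "C \<ge> 0" unfolding C_def using B(1) C0(1) H_norm_nonneg[OF E] by (intro sum_nonneg add_nonneg_nonneg mult_nonneg_nonneg) auto
  have Gle: "\<bar>ip Y (G q)\<bar> \<le> tr_norm Y" if q: "q \<in> I" and Y: "Y \<in> spaceH P" for q Y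
  proof -
    have "\<bar>Re (snd q * tr (fst q) Y)\<bar> \<le> cmod (snd q) * cmod (tr (fst q) Y)" using abs_Re_le_cmod[of "snd q * tr (fst q) Y"] by (simp only: norm_mult)
    also have "\<dots> = cmod (tr (fst q) Y)" using q by (auto simp: I_def)
    also have "\<dots> \<le> tr_norm Y" using q by (intro tr_le_tr_norm) (auto simp: I_def)
    finally show ?thesis using G(2)[OF q Y] by simp
  qed
  have sq: "(\<Sum>q\<in>I. (ip Y (G q))\<^sup>2) = (tr_norm Y)\<^sup>2" if Y: "Y \<in> spaceH P" for Y
  proof -
    have "(\<Sum>q\<in>I. (ip Y (G q))\<^sup>2) = (\<Sum>q\<in>I. (Re (snd q * tr (fst q) Y))\<^sup>2)" using G(2) Y by (intro sum.cong) auto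
    also have "\<dots> = (\<Sum>k\<in>dampers. \<Sum>c\<in>{1, \<i>}. (Re (c * tr k Y))\<^sup>2)"
      unfolding I_def sum.cartesian_product by (intro sum.cong) auto
    also have "\<dots> = (\<Sum>k\<in>dampers. (cmod (tr k Y))\<^sup>2)"
      by (intro sum.cong) (auto simp: cmod_power2 complex_eq_iff)
    finally show ?thesis by (simp only: tr_norm_sq)
  qed
  show ?thesis
  proof (rule that[OF bb C])
    fix Y assume Y: "Y \<in> dom_A P"
    note d = dom_A_variational[OF Y]
    let ?A = "op_A P Y"
    have UX: "fst Y \<in> spaceX P" using d(1) by (cases Y) (simp add: in_H_iff)
    have WY: "snd ?A \<in> spaceY P" using d(2) by (cases ?A) (simp add: in_H_iff)
    have h: "H_norm P Y \<ge> 0" by (rule H_norm_nonneg[OF d(1)])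
    have q1: "ip ?A (E q) = - ip Y (G q) + Re (bdry_form P (fst ?A) (fst (G q)))" if q: "q \<in> I" for q
    proof -
      have "ip ?A (E q) = Re (c_form P (snd ?A) (fst (G q)))"
      proof -
        have "ip (fst ?A, snd ?A) (0, fst (G q)) = Re (c_form P (snd ?A) (fst (G q)))"
          by (rule ip_velocity_part) (use d(3,4) WY GX[OF q] X_subset_Y in auto)
        then show ?thesis by (simp add: E_def)
      qed
      also have "\<dots> = - Re (a_form P (fst Y) (fst (G q))) + Re (bdry_form P (fst ?A) (fst (G q)))"
        using arg_cong[OF d(5)[OF GX[OF q]], of Re] d(3) by simp
      also have "Re (a_form P (fst Y) (fst (G q))) = ip (fst Y, 0) (G q)" by (rule ip_displacement_part[OF UX G(1)[OF q], symmetric])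
      also have "\<dots> = Re (snd q * tr (fst q) (fst Y, 0))"
        by (rule G(2)[OF q]) (use UX X_zero X_subset_Y in \<open>auto simp: in_H_iff\<close>)
      also have "tr (fst q) (fst Y, 0) = tr (fst q) Y" by (simp add: tr_def)
      also have "Re (snd q * tr (fst q) Y) = ip Y (G q)" by (rule G(2)[OF q d(1), symmetric])
      finally show ?thesis .
    qed
    have "b ?A Y \<le> (\<Sum>q\<in>I. - (ip Y (G q))\<^sup>2 + B q * C0 * (tr_norm ?A * H_norm P Y))"
      unfolding b_def
    proof (rule sum_mono)
      fix q assume q: "q \<in> I"
      have "Re (bdry_form P (fst ?A) (fst (G q))) * ip Y (G q) \<le> \<bar>Re (bdry_form P (fst ?A) (fst (G q)))\<bar> * \<bar>ip Y (G q)\<bar>"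
        by (metis abs_ge_self abs_mult)
      also have "\<dots> \<le> (B q * tr_norm ?A) * (C0 * H_norm P Y)"
        using B(1)[OF q] tr_norm_nonneg by (intro mult_mono B(2)[OF q] order_trans[OF Gle[OF q d(1)] C0(2)[OF d(1)]]) auto
      finally show "ip ?A (E q) * ip Y (G q) \<le> - (ip Y (G q))\<^sup>2 + B q * C0 * (tr_norm ?A * H_norm P Y)"
        unfolding q1[OF q] by (simp add: algebra_simps power2_eq_square)
    qed
    also have "\<dots> = - (tr_norm Y)\<^sup>2 + (\<Sum>q\<in>I. B q * C0) * (tr_norm ?A * H_norm P Y)"
      unfolding sum.distrib sum_negf sq[OF d(1)] sum_distrib_right[symmetric] by simp
    finally have 1: "b ?A Y \<le> - (tr_norm Y)\<^sup>2 + (\<Sum>q\<in>I. B q * C0) * (tr_norm ?A * H_norm P Y)" .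
    have "b Y ?A \<le> (\<Sum>q\<in>I. H_norm P (E q) * (tr_norm ?A * H_norm P Y))"
      unfolding b_def
    proof (rule sum_mono)
      fix q assume q: "q \<in> I"
      have "ip Y (E q) * ip ?A (G q) \<le> \<bar>ip Y (E q)\<bar> * \<bar>ip ?A (G q)\<bar>" by (metis abs_ge_self abs_mult)
      also have "\<dots> \<le> (H_norm P Y * H_norm P (E q)) * tr_norm ?A"
        using H.Cauchy_Schwarz[OF d(1) E[OF q]] Gle[OF q d(2)] h H_norm_nonneg[OF E[OF q]]
        unfolding H_nrm by (intro mult_mono) auto
      finally show "ip Y (E q) * ip ?A (G q) \<le> H_norm P (E q) * (tr_norm ?A * H_norm P Y)" by (simp only: mult_ac)
    qed
    also have "\<dots> = (\<Sum>q\<in>I. H_norm P (E q)) * (tr_norm ?A * H_norm P Y)" by (rule sum_distrib_right[symmetric])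
    finally show "b ?A Y + b Y ?A \<le> - (tr_norm Y)\<^sup>2 + C * (tr_norm ?A * H_norm P Y)"
      using 1 unfolding C_def sum.distrib distrib_right by linarith
  qed
qed

text \<open>
  The multiplier estimates put together. The value of \<open>e\<close> solves \<open>2 e Cs = 1 - 2 e\<close>, where \<open>Cs\<close>
  bounds shear by bending and stretching: then \<open>- (1 - e) a + e s \<le> - e (a + s)\<close> for the energies
  \<open>a\<close> of bending and stretching and \<open>s\<close> of shear.
\<close>

lemma multiplier_form:
  obtains b c C where "H.bounded_form b" "c > 0" "C \<ge> 0"
    "\<And>Y. Y \<in> dom_A P \<Longrightarrow> b (op_A P Y) Y + b Y (op_A P Y) \<le>
      - c * ip Y Y + C * (tr_norm Y * H_norm P Y) + C * (tr_norm (op_A P Y) * H_norm P Y) + C * (tr_norm (op_A P Y))\<^sup>2"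
proof -
  obtain Cs where Cs: "Cs \<ge> 0" "\<And>Y. Y \<in> spaceH P \<Longrightarrow> shearing Y \<le>
     Cs * (K * (l2_norm L (c_u2 Y))\<^sup>2 + stretching Y)"
    using soft_strain_bound by blast
  define e where "e = 1 / (2 * (1 + Cs))"
  have e: "e > 0" "e \<le> 1 / 2" "2 * e * Cs = 1 - 2 * e" using Cs(1) by (auto simp: e_def field_simps)
  obtain N where N: "N \<ge> 0" "\<And>Y. Y \<in> spaceH P \<Longrightarrow> l2_norm L (c_u2 Y) \<le> N * H_norm P Y"
    "\<And>Y. Y \<in> spaceH P \<Longrightarrow> l2_norm L (c_p Y) \<le> N * H_norm P Y"
    "\<And>Y. Y \<in> spaceH P \<Longrightarrow> l2_norm L (c_p1 Y) \<le> N * H_norm P Y"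
    "\<And>Y i. Y \<in> spaceH P \<Longrightarrow> i \<in> soft \<Longrightarrow> l2_norm L (c_phi i Y) \<le> N * H_norm P Y"
    "\<And>Y. Y \<in> spaceH P \<Longrightarrow> tr_norm Y \<le> N * H_norm P Y" using H_norm_controls by blast
  define C1 where "C1 = par_\<alpha> P * (L / 2) + (\<Sum>j\<in>stiff. (hO P j * pO P j) * (L / 2))"
  define C2 where "C2 = sqrt L * L * N + par_\<alpha> P * (sqrt L * 2 * N)"
  define C3 where "C3 = K * (sqrt L * (2 / L) * N) + (\<Sum>i\<in>soft. (GE P i * hE P i) * (sqrt L * 2 * (\<bar>vecN P i\<bar> * N)))"
  define C4 where "C4 = K * (L / 2 * (par_\<gamma> P 0)\<^sup>2) + (\<Sum>j\<in>stiff. (hO P j * EO P j) * (L / 2 * (gO P j)\<^sup>2))"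
  define C5 where "C5 = K * (par_\<gamma> P 0 * \<bar>- (3/2 + e)\<bar>) + (\<Sum>j\<in>stiff. (hO P j * EO P j) * (gO P j * \<bar>1/2 - e\<bar>))"
  have pos: "hO P j \<ge> 0" "pO P j \<ge> 0" "EO P j \<ge> 0" "gO P j \<ge> 0" if "j \<in> stiff" for j
    using hO_pos[OF that] pO_pos[OF that] EO_pos[OF that] gO_pos[OF that] by auto
  have pos': "hE P i \<ge> 0" "GE P i \<ge> 0" if "i \<in> soft" for i using hE_pos[OF that] GE_pos[OF that] by auto
  have pos0: "K \<ge> 0" "par_\<alpha> P \<ge> 0" "par_\<gamma> P 0 \<ge> 0" using K_pos alpha_pos gamma_pos by auto
  have CC: "C1 \<ge> 0" "C2 \<ge> 0" "C3 \<ge> 0" "C4 \<ge> 0" "C5 \<ge> 0"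
    unfolding C1_def C2_def C3_def C4_def C5_def using L_nonneg N(1) pos0
    by (auto intro!: add_nonneg_nonneg sum_nonneg mult_nonneg_nonneg divide_nonneg_nonneg pos pos' simp del: sum.cl_ivl_Suc)
  define C where "C = C1 + C2 + C3 + C4 + C5 * N"
  have C: "C \<ge> 0" using CC N(1) by (simp add: C_def)
  show ?thesis
  proof (rule that[OF bounded_form_mul_form[of e] e(1) C])
    fix Y assume Y: "Y \<in> dom_A P"
    note d = dom_A_variational[OF Y]
    let ?A = "op_A P Y"
    let ?F = "(mul_u e Y, \<lambda>j. mul_v e j Y)"
    define h where "h = H_norm P Y"
    have h: "h \<ge> 0" unfolding h_def by (rule H_norm_nonneg[OF d(1)])
    note r2 = dom_A_bending_regularity[OF Y] and r1 = dom_A_longitudinal_regularity[OF Y]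
    note mb = multiplier_bending[OF d(1) r2, of e]
    define a where "a = K * (l2_norm L (c_u2 Y))\<^sup>2 + stretching Y"
    define s where "s = shearing Y"
    define q where "q = sliding Y"
    define g where "g = L / 2 * (K * (cmod (pt_val L (c_u2 Y) L))\<^sup>2 + (\<Sum>j\<in>stiff. (hO P j * EO P j) * (cmod (pt_val L (c_v1 j Y) L))\<^sup>2))"
    have kin: "mul_form e Y ?A \<le> - (1 + e) * (l2_norm L (c_p Y))\<^sup>2 - e * (par_\<alpha> P * (l2_norm L (c_p1 Y))\<^sup>2) - e * q
        + C1 * (tr_norm ?A)\<^sup>2 + tr_norm ?A * (C2 * h)"
    proof -
      have "mul_form e Y ?A \<le> - (1 + e) * (l2_norm L (c_p Y))\<^sup>2 - e * (par_\<alpha> P * (l2_norm L (c_p1 Y))\<^sup>2) - e * q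
        + C1 * (tr_norm ?A)\<^sup>2 + tr_norm ?A * (sqrt L * L * l2_norm L (c_p Y) + par_\<alpha> P * (sqrt L * 2 * l2_norm L (c_p1 Y)))"
        unfolding q_def C1_def
        by (rule kinetic_part[OF d(1,2) less_imp_le[OF e(1)]]) (simp_all add: c_defs d(3))
      moreover have "sqrt L * L * l2_norm L (c_p Y) + par_\<alpha> P * (sqrt L * 2 * l2_norm L (c_p1 Y)) \<le> sqrt L * L * (N * h) + par_\<alpha> P * (sqrt L * 2 * (N * h))"
        unfolding h_def using L_nonneg pos0 by (intro add_mono mult_left_mono N d(1)) auto
      then have "tr_norm ?A * (sqrt L * L * l2_norm L (c_p Y) + par_\<alpha> P * (sqrt L * 2 * l2_norm L (c_p1 Y))) \<le> tr_norm ?A * (C2 * h)"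
        unfolding C2_def by (intro mult_left_mono tr_norm_nonneg) (simp add: algebra_simps)
      ultimately show ?thesis by linarith
    qed
    have pot: "Re (a_form P (fst Y) ?F) \<ge> (1 - e) * a - e * s + g - tr_norm Y * (C3 * h)"
    proof -
      have "(\<Sum>i\<in>soft. (GE P i * hE P i) * (sqrt L * 2 * (\<bar>vecN P i\<bar> * l2_norm L (c_phi i Y)))) \<le> (\<Sum>i\<in>soft. (GE P i * hE P i) * (sqrt L * 2 * (\<bar>vecN P i\<bar> * (N * h))))"
        unfolding h_def using L_nonneg pos' by (intro sum_mono mult_left_mono N d(1) mult_nonneg_nonneg) auto
      moreover have "K * (sqrt L * (2 / L) * l2_norm L (c_u2 Y)) \<le> K * (sqrt L * (2 / L) * (N * h))"
        unfolding h_def using L_nonneg pos0 by (intro mult_left_mono N d(1)) auto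
      ultimately have "K * (sqrt L * (2 / L) * l2_norm L (c_u2 Y)) + (\<Sum>i\<in>soft. (GE P i * hE P i) * (sqrt L * 2 * (\<bar>vecN P i\<bar> * l2_norm L (c_phi i Y)))) \<le>
         K * (sqrt L * (2 / L) * (N * h)) + (\<Sum>i\<in>soft. (GE P i * hE P i) * (sqrt L * 2 * (\<bar>vecN P i\<bar> * (N * h))))" by linarith
      also have "\<dots> = C3 * h" unfolding C3_def distrib_right sum_distrib_right by (simp only: mult_ac)
      finally have "tr_norm Y * (K * (sqrt L * (2 / L) * l2_norm L (c_u2 Y)) + (\<Sum>i\<in>soft. (GE P i * hE P i) * (sqrt L * 2 * (\<bar>vecN P i\<bar> * l2_norm L (c_phi i Y))))) \<le> tr_norm Y * (C3 * h)"
        by (intro mult_left_mono tr_norm_nonneg)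
      then show ?thesis using potential_part[OF d(1) r2 r1, of e] unfolding a_def s_def g_def by linarith
    qed
    have bd: "Re (bdry_form P (snd Y) ?F) \<le> g + C4 * (tr_norm ?A)\<^sup>2 + C5 * (tr_norm ?A * (N * h))"
    proof -
      have "Re (bdry_form P (fst ?A) ?F) \<le> g + C4 * (tr_norm ?A)\<^sup>2 + C5 * (tr_norm ?A * tr_norm Y)"
        unfolding g_def C4_def C5_def by (rule boundary_part[OF d(1) r2 r1])
      moreover have "C5 * (tr_norm ?A * tr_norm Y) \<le> C5 * (tr_norm ?A * (N * h))"
        unfolding h_def using CC by (intro mult_left_mono N d(1) tr_norm_nonneg) auto
      ultimately show ?thesis unfolding d(3) by linarith
    qed
    have "mul_form e ?A Y = Re (c_form P (snd ?A) ?F)"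
    proof -
      obtain V w z where AY: "?A = (V, (w, z))" by (metis prod.exhaust)
      have l: "wderiv L w \<in> l2 L" using linear_AE_l2[OF linear_AE_c_p1 d(2)] by (simp add: c_p1_def AY)
      have "l2_inner L (wderiv L w) (wderiv L (mul_u e Y)) = l2_inner L (wderiv L w) (mul_u1 e Y)"
        by (rule l2_inner_cong_right[OF mb(3) l wderiv_l2[OF mb(1)] mb(9)])
      then show ?thesis unfolding AY snd_conv c_form.simps mul_form_def c_defs fst_conv
        by (simp only: plus_complex.simps Re_sum Re_of_real_mult)
    qed
    also have "\<dots> = - Re (a_form P (fst Y) ?F) + Re (bdry_form P (snd Y) ?F)"
      using arg_cong[OF d(5)[OF multiplier_in_X[OF d(1) r2 r1, of e]], of Re] by simp
    finally have 1: "mul_form e ?A Y \<le> - (1 - e) * a + e * s + tr_norm Y * (C3 * h) + C4 * (tr_norm ?A)\<^sup>2 + C5 * (tr_norm ?A * (N * h))"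
      using pot bd by (simp add: algebra_simps)
    have main: "- (1 - e) * a + e * s - (1 + e) * (l2_norm L (c_p Y))\<^sup>2 - e * (par_\<alpha> P * (l2_norm L (c_p1 Y))\<^sup>2) - e * q \<le> - e * ip Y Y"
    proof -
      have "2 * e * s \<le> 2 * e * (Cs * a)" using Cs(2)[OF d(1)] e(1) unfolding s_def a_def by (intro mult_left_mono) auto
      also have "\<dots> = (1 - 2 * e) * a" using e(3) by (metis mult.assoc)
      finally have "2 * e * s \<le> (1 - 2 * e) * a" .
      moreover have "ip Y Y = a + s + ((l2_norm L (c_p Y))\<^sup>2 + par_\<alpha> P * (l2_norm L (c_p1 Y))\<^sup>2 + q)"
        unfolding ip_self[OF d(1)] a_def s_def q_def by simp
      ultimately show ?thesis using weighted_sum_le[of e s a "(l2_norm L (c_p Y))\<^sup>2" "par_\<alpha> P * (l2_norm L (c_p1 Y))\<^sup>2" q] by simp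
    qed
    have prods: "0 \<le> tr_norm Y * h" "0 \<le> tr_norm ?A * h" "0 \<le> (tr_norm ?A)\<^sup>2" using h tr_norm_nonneg by auto
    have "tr_norm Y * (C3 * h) \<le> C * (tr_norm Y * h)" "tr_norm ?A * (C2 * h) + C5 * (tr_norm ?A * (N * h)) \<le> C * (tr_norm ?A * h)" "C1 * (tr_norm ?A)\<^sup>2 + C4 * (tr_norm ?A)\<^sup>2 \<le> C * (tr_norm ?A)\<^sup>2"
    proof -
      have "C3 * (tr_norm Y * h) \<le> C * (tr_norm Y * h)" using CC N(1) by (intro mult_right_mono prods) (auto simp: C_def)
      then show "tr_norm Y * (C3 * h) \<le> C * (tr_norm Y * h)" by (simp only: mult_ac)
      have "(C2 + C5 * N) * (tr_norm ?A * h) \<le> C * (tr_norm ?A * h)" using CC by (intro mult_right_mono prods) (auto simp: C_def)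
      then show "tr_norm ?A * (C2 * h) + C5 * (tr_norm ?A * (N * h)) \<le> C * (tr_norm ?A * h)" by (simp add: algebra_simps)
      have "(C1 + C4) * (tr_norm ?A)\<^sup>2 \<le> C * (tr_norm ?A)\<^sup>2" using CC N(1) by (intro mult_right_mono prods) (auto simp: C_def)
      then show "C1 * (tr_norm ?A)\<^sup>2 + C4 * (tr_norm ?A)\<^sup>2 \<le> C * (tr_norm ?A)\<^sup>2" by (simp add: algebra_simps)
    qed
    then show "mul_form e ?A Y + mul_form e Y ?A \<le> - e * ip Y Y + C * (tr_norm Y * H_norm P Y) + C * (tr_norm ?A * H_norm P Y) + C * (tr_norm ?A)\<^sup>2"
      unfolding h_def[symmetric] using 1 kin main by linarith
  qed
qed

text \<open>
  The mixed product of the displacement end values with the norm is the only term of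
  \<open>multiplier_form\<close> that the damping does not control; the multiple \<open>M\<close> of the trace form absorbs
  it.
\<close>

theorem Lyapunov_form:
  obtains b c C where "H.bounded_form b" "c > 0" "C \<ge> 0"
    "\<And>Y. Y \<in> dom_A P \<Longrightarrow> b (op_A P Y) Y + b Y (op_A P Y) \<le> - c * ip Y Y - C * ip (op_A P Y) Y"
proof -
  obtain b1 c C1 where b1: "H.bounded_form b1" "c > 0" "C1 \<ge> 0"
    "\<And>Y. Y \<in> dom_A P \<Longrightarrow> b1 (op_A P Y) Y + b1 Y (op_A P Y) \<le>
      - c * ip Y Y + C1 * (tr_norm Y * H_norm P Y) + C1 * (tr_norm (op_A P Y) * H_norm P Y) + C1 * (tr_norm (op_A P Y))\<^sup>2"
    using multiplier_form by blast
  obtain b2 C2 where b2: "H.bounded_form b2" "C2 \<ge> 0"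
    "\<And>Y. Y \<in> dom_A P \<Longrightarrow> b2 (op_A P Y) Y + b2 Y (op_A P Y) \<le> - (tr_norm Y)\<^sup>2 + C2 * (tr_norm (op_A P Y) * H_norm P Y)"
    using trace_form by blast
  obtain C3 where C3: "C3 \<ge> 0" "\<And>Y. Y \<in> dom_A P \<Longrightarrow> (tr_norm (op_A P Y))\<^sup>2 \<le> - C3 * ip (op_A P Y) Y"
    using dissipation_controls_traces by blast
  \<comment> \<open>\<open>M\<close> makes \<open>C1 t h \<le> (c/4) h\<^sup>2 + M t\<^sup>2\<close>; a second quarter of \<open>c\<close> absorbs the mixed products with damped end velocities\<close>
  define M where "M = C1\<^sup>2 / c"
  have M: "M \<ge> 0" using b1(2) by (simp add: M_def)
  define D where "D = C1 + M * C2"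
  define E where "E = C1 + D\<^sup>2 / c"
  have E: "E \<ge> 0" using b1(2,3) by (simp add: E_def)
  have c4: "c / 4 > 0" using b1(2) by simp
  show ?thesis
  proof (rule that[of "\<lambda>Y Z. M * b2 Y Z + b1 Y Z" "c / 2" "E * C3"])
    show "H.bounded_form (\<lambda>Y Z. M * b2 Y Z + b1 Y Z)" by (rule H.bounded_form_lincomb[OF b2(1) b1(1)])
    show "c / 2 > 0" "E * C3 \<ge> 0" using b1(2) E C3(1) by auto
    fix Y assume Y: "Y \<in> dom_A P"
    have YS: "Y \<in> spaceH P" by (rule dom_A_variational[OF Y])
    define h where "h = H_norm P Y"
    define t where "t = tr_norm Y"
    define r where "r = tr_norm (op_A P Y)"
    have hh: "ip Y Y = h\<^sup>2" unfolding h_def by (rule H_norm_sq[OF YS, symmetric])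
    have 1: "b1 (op_A P Y) Y + b1 Y (op_A P Y) \<le> - c * h\<^sup>2 + C1 * (t * h) + C1 * (r * h) + C1 * r\<^sup>2"
      using b1(4)[OF Y] unfolding hh h_def[symmetric] t_def[symmetric] r_def[symmetric] .
    have "M * (b2 (op_A P Y) Y + b2 Y (op_A P Y)) \<le> M * (- t\<^sup>2 + C2 * (r * h))"
      using b2(3)[OF Y] M unfolding h_def[symmetric] t_def[symmetric] r_def[symmetric] by (intro mult_left_mono)
    then have 2: "M * b2 (op_A P Y) Y + M * b2 Y (op_A P Y) \<le> - M * t\<^sup>2 + M * C2 * (r * h)" by (simp add: algebra_simps)
    have 3: "C1 * (t * h) \<le> c / 4 * h\<^sup>2 + M * t\<^sup>2"
      using absorb_product[OF c4, of C1 t h] by (simp add: M_def)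
    have 4: "D * (r * h) \<le> c / 4 * h\<^sup>2 + D\<^sup>2 / c * r\<^sup>2"
      using absorb_product[OF c4, of D r h] by simp
    have 5: "D * (r * h) = C1 * (r * h) + M * C2 * (r * h)" by (simp add: D_def distrib_right)
    have 6: "E * r\<^sup>2 = C1 * r\<^sup>2 + D\<^sup>2 / c * r\<^sup>2" by (simp add: E_def distrib_right)
    have 7: "E * r\<^sup>2 \<le> - (E * C3) * ip (op_A P Y) Y"
      using mult_left_mono[OF C3(2)[OF Y] E] unfolding r_def by (simp add: mult.assoc)
    have "(M * b2 (op_A P Y) Y + b1 (op_A P Y) Y) + (M * b2 Y (op_A P Y) + b1 Y (op_A P Y)) \<le> - (c / 2) * h\<^sup>2 + E * r\<^sup>2"
      using 1 2 3 4 5 6 by (simp add: field_simps)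
    then show "(M * b2 (op_A P Y) Y + b1 (op_A P Y) Y) + (M * b2 Y (op_A P Y) + b1 Y (op_A P Y))
        \<le> - (c / 2) * ip Y Y - (E * C3) * ip (op_A P Y) Y"
      unfolding hh using 7 by simp
  qed
qed

theorem strongly_stable:
  assumes C0: "C0_semigroup (spaceH P) (H_norm P) state_scale T"
    and gen: "is_generator (spaceH P) (H_norm P) state_scale T (dom_A P) (op_A P)"
    and Y: "Y \<in> spaceH P"
  shows "((\<lambda>t. H_norm P (T t Y)) \<longlongrightarrow> 0) at_top"
proof -
  interpret hilbert_semigroup "spaceH P" state_scale ip T
    by unfold_locales (use C0 in \<open>simp add: H_nrm\<close>)
  obtain b c C where b: "H.bounded_form b" "c > 0" "C \<ge> 0"
    "\<And>Y. Y \<in> dom_A P \<Longrightarrow> b (op_A P Y) Y + b Y (op_A P Y) \<le> - c * ip Y Y - C * ip (op_A P Y) Y"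
    using Lyapunov_form by blast
  have d: "ip (op_A P Z) Z \<le> 0" if Z: "Z \<in> dom_A P" for Z
    unfolding dissipation[OF Z] neg_le_0_iff_le using K_pos gamma_pos
    by (intro add_nonneg_nonneg sum_nonneg mult_nonneg_nonneg zero_le_power2; blast intro: less_imp_le hO_pos EO_pos gO_pos)
  have "((\<lambda>t. H.nrm (T t Y)) \<longlongrightarrow> 0) at_top"
    by (rule stable_of_Lyapunov_form[OF _ b(1-3) d b(4) Y]) (use gen in \<open>simp_all add: H_nrm\<close>)
  then show ?thesis by (simp add: H_nrm)
qed

end

theorem theorem4p2:
  fixes P :: beam and T :: "real \<Rightarrow> state \<Rightarrow> state"
  assumes "par_m P \<ge> 1" and "par_L P > 0" and "par_\<alpha> P > 0" and "par_K P > 0"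
    and "\<And>i. 1 \<le> i \<Longrightarrow> i \<le> 2 * par_m P + 1 \<Longrightarrow> par_h P i > 0"
    and "\<And>i. odd i \<Longrightarrow> i \<le> 2 * par_m P + 1 \<Longrightarrow> par_\<rho> P i > 0"
    and "\<And>i. odd i \<Longrightarrow> i \<le> 2 * par_m P + 1 \<Longrightarrow> par_E P i > 0"
    and "\<And>i. even i \<Longrightarrow> 1 \<le> i \<Longrightarrow> i \<le> 2 * par_m P + 1 \<Longrightarrow> par_G P i > 0"
    and "par_\<gamma> P 0 > 0"
    and "\<And>i. odd i \<Longrightarrow> i \<le> 2 * par_m P + 1 \<Longrightarrow> par_\<gamma> P i > 0"
    and "C0_semigroup (spaceH P) (H_norm P) state_scale T"
    and "is_generator (spaceH P) (H_norm P) state_scale T (dom_A P) (op_A P)"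
    and "par_\<gamma> P 0 \<noteq> sqrt (par_\<alpha> P / par_K P)"
    and "\<And>k. odd k \<Longrightarrow> k \<le> 2 * par_m P + 1 \<Longrightarrow> par_\<gamma> P k \<noteq> sqrt (par_\<rho> P k / par_E P k)"
  shows "\<forall>Y\<^sub>0\<in>spaceH P. ((\<lambda>t. H_norm P (T t Y\<^sub>0)) \<longlongrightarrow> 0) at_top"
proof -
  have odd: "odd (2 * j - 1)" "1 \<le> 2 * j - 1" "2 * j - 1 \<le> 2 * par_m P + 1" if "j \<in> {1..par_m P + 1}" for j :: nat
    using that by (cases j; auto)+
  have even: "even (2 * i)" "1 \<le> 2 * i" "2 * i \<le> 2 * par_m P + 1" if "i \<in> {1..par_m P}" for i :: nat
    using that by auto
  interpret rao_nakra_beam P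
  proof
    show "hO P j > 0" "pO P j > 0" "EO P j > 0" "gO P j > 0" if "j \<in> {1..par_m P + 1}" for j
      unfolding hO_def pO_def EO_def gO_def using odd[OF that] assms by blast+
    show "hE P i > 0" "GE P i > 0" if "i \<in> {1..par_m P}" for i
      unfolding hE_def GE_def using even[OF that] assms by blast+
  qed (use assms in auto)
  show ?thesis using strongly_stable assms by blast
qed

end
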